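(* Let $\mathcal{C}$ be a permutation class. The simple permutations in $\mathcal{C}$ are monotone griddable if and only if $\mathcal{C}$ does not contain any of the following structures, or their symmetries: arbitrarily long parallel sawtooth alternations; arbitrarily long sliced wedge sawtooth alternations; proper pin sequences with arbitrarily many turns; spiral proper pin sequences with arbitrarily many extensions. Explicitly: the simple permutations in $\mathcal{C}$ are monotone griddable if and only if there is a positive integer $N$ such that $\mathcal{C}$ contains no permutation which is, up to one of the eight symmetries of the square, one of the following: (1) a parallel sawtooth alternation of length $3n$ with $n\ge N$; (2) a sliced wedge sawtooth alternation (of type 1, 2 or 3) of length $3n$ with $n\ge N$; (3) a permutation whose points, in some order, form a proper pin sequence with at least $N$ turns; (4) a spiral pin sequence with at least $N$ extensions.
   Context: **Basics.** A permutation $\pi$ of length $n$ is identified with its plot, the set of points $(i,\pi(i))$, $1\le i\le n$. Containment is classical pattern containment; a permutation class is a set of permutations closed downwards under containment. Any finite point set in the plane with no two points sharing a coordinate is identified with the permutation order isomorphic to it. The symmetries are those of the dihedral group of order 8 acting on plots (generated by reflections in vertical, horizontal and diagonal axes). An interval of $\pi$ is a nonempty set of points $\{(i,\pi(i)):i\in I\}$ with both $I$ and $\pi(I)$ sets of consecutive integers. $\pi$ is simple if $\pi\ne 1$ and its only intervals are the singletons and the whole of $\pi$. A set $X$ of permutations is monotone griddable if there are integers $h,v$ such that for every $\pi\in X$ the plot of $\pi$ can be divided into cells by at most $h$ horizontal and $v$ vertical lines so that the points in each cell form a monotone increasing or decreasing sequence (or the cell is empty). **Slicing.** $\mathrm{rect}(p_1,\dots,p_k)$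 is the smallest axes-parallel rectangle containing the points. A point $(x,y)$ slices a rectangle $[a,b]\times[c,d]$ if either $x\in(a,b)$ and $y\notin[c,d]$ (vertically), or $x\notin[a,b]$ and $y\in(c,d)$ (horizontally). A point slices a set of points if it slices its rectangular hull. Relative to a rectangle, NE, NW, SE, SW denote the four corner regions (e.g. NE: strictly above and to the right of the rectangle). Two points form a copy of 21 if one is above and to the left of the other. **Sawtooth alternations.** A sawtooth alternation of length $3n$ is a permutation consisting of a sum $21\,43\cdots(2n)(2n-1)$ of $n$ copies of 21 placed alongside (i.e. entirely above, below, to the left or to the right of) a monotone sequence of $n$ points, such that each copy of 21 is sliced by a single entry of the monotone sequence. It is parallel if the monotone sequence is increasing and wedge if it is decreasing. When the monotone sequence lies below, these are: $\pi(3j-2)=n+2j$, $\pi(3j)=n+2j-1$, and $\pi(3j-1)=j$ (parallel) or $\pi(3j-1)=n+1-j$ (wedge), $1\le j\le n$. Sliced wedge sawtooth alternations of length $3n$ are obtained from the wedge sawtooth alternation with the monotone sequence below, whose leftmost three points form an interval order isomorphic to 312, in one of three ways: type 1: move the `1' of this 312 vertically below all other points of the monotone sequence; type 2: move the `2' of this 312 horizontally to the right of all other points of the permutation; type 3: replace the `1' of this 312 by a new maximum element in the same horizontal position. (For $n=4$: type 1 is $6,1,5,8,4,7,10,3,9,12,2,11$; type 2 is $6,4,8,3,7,10,2,9,12,1,11,5$; type 3 is $5,12,4,7,3,6,9,2,8,11,1,10$.) For wedge sawtooth alternations with the monotone sequence on another side the definitions are made by symmetry. **Pin sequences.** A pin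 sequence in a permutation is a sequence of its points $p_1,p_2,\dots,p_m$ such that for each $i\ge3$, $p_i$ slices $\mathrm{rect}(p_1,\dots,p_{i-1})$. For $i\ge 3$ the pin $p_i$ has a direction (left, right, up or down) according to its position relative to this rectangle; $p_1,p_2$ have no direction. It is proper if (maximality) each pin is maximal in its direction, e.g. if $p_i$ is a right pin then no point of the permutation further right than $p_i$ slices $\mathrm{rect}(p_1,\dots,p_{i-1})$, and similarly for the other directions; and (separation) each $p_{i+1}$ lies horizontally or vertically between $\mathrm{rect}(p_1,\dots,p_{i-1})$ and $p_i$. In (3) and (4), properness of the pin sequence is with respect to the permutation formed by the pins alone. A pin $p_i$ ($i\ge5$) is a turn if its direction is the same as that of $p_{i-2}$. A spiral is a proper pin sequence with no turns; its directions then cyclically follow `left, up, right, down' or `left, down, right, up'. **Extensions.** Let $p_1,\dots,p_m$ be a spiral and let $i\ge4$. Suppose first that $p_{i-1}$ is an up pin and $p_i$ is a right pin; for other directions, apply the unique symmetry of the square carrying the directions of $p_{i-1},p_i$ to up, right (so the pattern 21 and the corners below are replaced by their images). Conditions requiring the presence of a pin that does not exist are regarded as not satisfied. - Type 1: an additional point $q$ is a type 1 extension of $p_i$ if $\mathrm{rect}(p_i,q)$ is sliced by $p_{i-1}$ and/or $p_{i+1}$, and by no other points, and $p_i,q$ form a copy of 21. - Type 2: three additional points $q,r,s$ form a type 2 extension of $p_i$ if: (i) either $p_{i-1},s$ form a copy of 21 and the only pin slicing $\mathrm{rect}(p_{i-1},s)$ is $p_i$, or $s,p_{i+1}$ form a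 copy of 21 and the only pin slicing $\mathrm{rect}(p_{i+1},s)$ is $p_{i+2}$; (ii) $q$ and $r$ form a copy of 21 that is SW of $p_i$, NE of $\mathrm{rect}(p_1,\dots,p_{i-2})$, and is sliced only by $s$; (iii) $p_{i+1}$ separates $p_i$ from $q$ and $r$, and, apart from $s$, no pin other than $p_{i+1}$ slices $\mathrm{rect}(p_i,q,r)$. A spiral pin sequence with $k$ extensions is a permutation formed by the points of a spiral pin sequence together with additional points such that there are $k$ distinct pins to which extensions (of either type) have been added. *)

theory Defs
  imports Complex_Main "HOL-Combinatorics.Multiset_Permutations"
begin

section \<open>Permutations, plots and classes\<close>

type_synonym point = "real \<times> real"

text \<open>One-line notation; the entry at position \<open>i\<close> (counted from 1) is \<open>\<pi> ! (i - 1)\<close>.\<close>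

definition permutation :: "nat list \<Rightarrow> bool" where
  "permutation \<pi> \<longleftrightarrow> \<pi> \<in> permutations_of_set {1..length \<pi>}"

definition plot :: "nat list \<Rightarrow> point set" where
  "plot \<pi> = {(real i, real (\<pi> ! (i - 1))) |i. 1 \<le> i \<and> i \<le> length \<pi>}"

text \<open>Since the orders are preserved in both directions, a point set that is order isomorphic to
  a plot has no two points sharing a coordinate.\<close>

definition order_isomorphic :: "point set \<Rightarrow> point set \<Rightarrow> bool" where
  "order_isomorphic A B \<longleftrightarrow> (\<exists>g. bij_betw g A B \<and>
     (\<forall>p\<in>A. \<forall>q\<in>A. (fst p < fst q \<longleftrightarrow> fst (g p) < fst (g q)) \<and>
                   (snd p < snd q \<longleftrightarrow> snd (g p) < snd (g q))))"

definition contained_in :: "nat list \<Rightarrow> nat list \<Rightarrow> bool" where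
  "contained_in \<sigma> \<pi> \<longleftrightarrow> (\<exists>S\<subseteq>plot \<pi>. order_isomorphic (plot \<sigma>) S)"

definition permutation_class :: "nat list set \<Rightarrow> bool" where
  "permutation_class C \<longleftrightarrow> (\<forall>\<pi>\<in>C. permutation \<pi>) \<and>
     (\<forall>\<pi>\<in>C. \<forall>\<sigma>. permutation \<sigma> \<and> contained_in \<sigma> \<pi> \<longrightarrow> \<sigma> \<in> C)"

definition square_symmetries :: "(point \<Rightarrow> point) set" where
  "square_symmetries =
     {\<lambda>(x, y). (s * x, t * y) |s t. s \<in> {-1, 1} \<and> t \<in> {-1, 1}} \<union>
     {\<lambda>(x, y). (s * y, t * x) |s t. s \<in> {-1, 1} \<and> t \<in> {-1, 1}}"

definition is_up_to_symmetry :: "nat list \<Rightarrow> point set \<Rightarrow> bool" where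
  "is_up_to_symmetry \<pi> A \<longleftrightarrow> (\<exists>f\<in>square_symmetries. order_isomorphic (plot \<pi>) (f ` A))"

section \<open>Simple permutations and monotone griddability\<close>

text \<open>An interval is represented by its set \<open>I\<close> of positions.\<close>

definition interval :: "nat list \<Rightarrow> nat set \<Rightarrow> bool" where
  "interval \<pi> I \<longleftrightarrow> I \<noteq> {} \<and> I \<subseteq> {1..length \<pi>} \<and>
     (\<exists>a b. I = {a..b}) \<and> (\<exists>c d. (\<lambda>i. \<pi> ! (i - 1)) ` I = {c..d})"

text \<open>The length condition excludes the permutation 1, and also the empty permutation.\<close>

definition simple :: "nat list \<Rightarrow> bool" where
  "simple \<pi> \<longleftrightarrow> permutation \<pi> \<and> 1 < length \<pi> \<and>
     (\<forall>I. interval \<pi> I \<longrightarrow> card I = 1 \<or> I = {1..length \<pi>})"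

definition increasing_points :: "point set \<Rightarrow> bool" where
  "increasing_points S \<longleftrightarrow> (\<forall>p\<in>S. \<forall>q\<in>S. fst p < fst q \<longrightarrow> snd p < snd q)"

definition decreasing_points :: "point set \<Rightarrow> bool" where
  "decreasing_points S \<longleftrightarrow> (\<forall>p\<in>S. \<forall>q\<in>S. fst p < fst q \<longrightarrow> snd q < snd p)"

text \<open>\<open>H\<close> holds the heights of the horizontal lines, \<open>V\<close> the abscissae of the vertical ones.
  The points of \<open>P\<close> in the cell of \<open>p\<close> are those that no line separates from \<open>p\<close>.\<close>

definition cell :: "real set \<Rightarrow> real set \<Rightarrow> point set \<Rightarrow> point \<Rightarrow> point set" where
  "cell H V P p = {q\<in>P. (\<forall>c\<in>V. c < fst p \<longleftrightarrow> c < fst q) \<and> (\<forall>c\<in>H. c < snd p \<longleftrightarrow> c < snd q)}"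

text \<open>Grid lines do not pass through points.\<close>

definition gridding :: "real set \<Rightarrow> real set \<Rightarrow> point set \<Rightarrow> bool" where
  "gridding H V P \<longleftrightarrow> finite H \<and> finite V \<and> fst ` P \<inter> V = {} \<and> snd ` P \<inter> H = {} \<and>
     (\<forall>p\<in>P. increasing_points (cell H V P p) \<or> decreasing_points (cell H V P p))"

definition monotone_griddable :: "nat list set \<Rightarrow> bool" where
  "monotone_griddable X \<longleftrightarrow> (\<exists>h v. \<forall>\<pi>\<in>X. \<exists>H V.
     gridding H V (plot \<pi>) \<and> card H \<le> h \<and> card V \<le> v)"

section \<open>Relative position and slicing\<close>

datatype direction = Left | Right | Up | Down

fun further :: "direction \<Rightarrow> point \<Rightarrow> point \<Rightarrow> bool" where
  "further Left q p \<longleftrightarrow> fst q < fst p"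
| "further Right q p \<longleftrightarrow> fst p < fst q"
| "further Up q p \<longleftrightarrow> snd p < snd q"
| "further Down q p \<longleftrightarrow> snd q < snd p"

text \<open>The rectangular hull of a finite nonempty set \<open>S\<close> is
  \<open>{Min (fst ` S)..Max (fst ` S)} \<times> {Min (snd ` S)..Max (snd ` S)}\<close>.
  Below, rectangles are always given by such a set \<open>S\<close>.\<close>

definition slices :: "point \<Rightarrow> point set \<Rightarrow> bool" where
  "slices p S \<longleftrightarrow>
     fst p \<in> {Min (fst ` S)<..<Max (fst ` S)} \<and> snd p \<notin> {Min (snd ` S)..Max (snd ` S)} \<or>
     fst p \<notin> {Min (fst ` S)..Max (fst ` S)} \<and> snd p \<in> {Min (snd ` S)<..<Max (snd ` S)}"

text \<open>\<open>p\<close> lies horizontally or vertically between the rectangle of \<open>S\<close> and \<open>q\<close>.\<close>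

definition separates :: "point \<Rightarrow> point set \<Rightarrow> point \<Rightarrow> bool" where
  "separates p S q \<longleftrightarrow> (\<exists>d. (\<forall>s\<in>S. further d p s) \<and> further d q p)"

definition NE_of :: "point \<Rightarrow> point set \<Rightarrow> bool" where
  "NE_of p S \<longleftrightarrow> (\<forall>s\<in>S. fst s < fst p \<and> snd s < snd p)"

definition SW_of :: "point \<Rightarrow> point set \<Rightarrow> bool" where
  "SW_of p S \<longleftrightarrow> (\<forall>s\<in>S. fst p < fst s \<and> snd p < snd s)"

definition copy_of_21 :: "point \<Rightarrow> point \<Rightarrow> bool" where
  "copy_of_21 p q \<longleftrightarrow> fst p < fst q \<and> snd q < snd p \<or> fst q < fst p \<and> snd p < snd q"

section \<open>Sawtooth alternations\<close>

text \<open>Only the orientation with the monotone sequence below is defined: the other three positions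
  arise from it by symmetries of the square (the inverse and the rotation by 180 degrees map
  sums of copies of 21 to such sums and keep increasing and decreasing sequences so).\<close>

definition teeth :: "nat \<Rightarrow> point set" where
  "teeth n = (\<Union>j\<in>{1..n}. {(3 * real j - 2, real n + 2 * real j), (3 * real j, real n + 2 * real j - 1)})"

definition parallel_sawtooth :: "nat \<Rightarrow> point set" where
  "parallel_sawtooth n = teeth n \<union> (\<lambda>j. (3 * real j - 1, real j)) ` {1..n}"

definition wedge_sawtooth :: "nat \<Rightarrow> point set" where
  "wedge_sawtooth n = teeth n \<union> (\<lambda>j. (3 * real j - 1, real n + 1 - real j)) ` {1..n}"

text \<open>The leftmost three points of the wedge sawtooth alternation are \<open>(1, n + 2)\<close>, \<open>(2, n)\<close>
  and \<open>(3, n + 1)\<close>.  The moved or new point gets a coordinate 0 or \<open>3 n + 1\<close>, beyond all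
  others, so the resulting set is a permutation up to order isomorphism.\<close>

definition sliced_wedge1 :: "nat \<Rightarrow> point set" where
  "sliced_wedge1 n = insert (2, 0) (wedge_sawtooth n - {(2, real n)})"

definition sliced_wedge2 :: "nat \<Rightarrow> point set" where
  "sliced_wedge2 n = insert (3 * real n + 1, real n + 1) (wedge_sawtooth n - {(3, real n + 1)})"

definition sliced_wedge3 :: "nat \<Rightarrow> point set" where
  "sliced_wedge3 n = insert (2, 3 * real n + 1) (wedge_sawtooth n - {(2, real n)})"

section \<open>Pin sequences\<close>

text \<open>A sequence \<open>p\<^sub>1, \<dots>, p\<^sub>m\<close> is given by \<open>m\<close> and a function \<open>p\<close>, of which
  only the values on \<open>{1..m}\<close> matter; \<open>P\<close> is the ambient permutation.\<close>

definition pin_sequence :: "point set \<Rightarrow> nat \<Rightarrow> (nat \<Rightarrow> point) \<Rightarrow> bool" where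
  "pin_sequence P m p \<longleftrightarrow> inj_on p {1..m} \<and> p ` {1..m} \<subseteq> P \<and>
     (\<forall>i\<in>{3..m}. slices (p i) (p ` {1..<i}))"

definition pin_direction :: "(nat \<Rightarrow> point) \<Rightarrow> nat \<Rightarrow> direction \<Rightarrow> bool" where
  "pin_direction p i d \<longleftrightarrow> 3 \<le> i \<and> (\<forall>j\<in>{1..<i}. further d (p i) (p j))"

definition proper_pin_sequence :: "point set \<Rightarrow> nat \<Rightarrow> (nat \<Rightarrow> point) \<Rightarrow> bool" where
  "proper_pin_sequence P m p \<longleftrightarrow> pin_sequence P m p \<and>
     (\<forall>i\<in>{3..m}. \<forall>d. pin_direction p i d \<longrightarrow>
        \<not> (\<exists>q\<in>P. further d q (p i) \<and> slices q (p ` {1..<i}))) \<and>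
     (\<forall>i\<in>{2..<m}. separates (p (i + 1)) (p ` {1..<i}) (p i))"

definition turns :: "nat \<Rightarrow> (nat \<Rightarrow> point) \<Rightarrow> nat set" where
  "turns m p = {i\<in>{5..m}. \<exists>d. pin_direction p i d \<and> pin_direction p (i - 2) d}"

definition pin_sequence_with_turns :: "nat \<Rightarrow> point set \<Rightarrow> bool" where
  "pin_sequence_with_turns k A \<longleftrightarrow>
     (\<exists>m p. A = p ` {1..m} \<and> proper_pin_sequence A m p \<and> card (turns m p) = k)"

definition spiral :: "nat \<Rightarrow> (nat \<Rightarrow> point) \<Rightarrow> bool" where
  "spiral m p \<longleftrightarrow> proper_pin_sequence (p ` {1..m}) m p \<and> turns m p = {}"

section \<open>Extensions of spirals\<close>

text \<open>First the case that \<open>p (i - 1)\<close> is an up pin and \<open>p i\<close> is a right pin.  \<open>A\<close> is the set of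
  all points, pins and additional ones.\<close>

definition type1_ext_up_right ::
  "point set \<Rightarrow> nat \<Rightarrow> (nat \<Rightarrow> point) \<Rightarrow> nat \<Rightarrow> point \<Rightarrow> bool" where
  "type1_ext_up_right A m p i q \<longleftrightarrow> copy_of_21 (p i) q \<and>
     (slices (p (i - 1)) {p i, q} \<or> i + 1 \<le> m \<and> slices (p (i + 1)) {p i, q}) \<and>
     (\<forall>x\<in>A. slices x {p i, q} \<longrightarrow> x = p (i - 1) \<or> i + 1 \<le> m \<and> x = p (i + 1))"

definition only_pin_slicing ::
  "nat \<Rightarrow> (nat \<Rightarrow> point) \<Rightarrow> nat \<Rightarrow> point set \<Rightarrow> bool" where
  "only_pin_slicing m p j S \<longleftrightarrow> (\<forall>l\<in>{1..m}. slices (p l) S \<longleftrightarrow> l = j)"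

definition type2_ext_up_right ::
  "point set \<Rightarrow> nat \<Rightarrow> (nat \<Rightarrow> point) \<Rightarrow> nat \<Rightarrow> point \<Rightarrow> point \<Rightarrow> point \<Rightarrow> bool" where
  "type2_ext_up_right A m p i q r s \<longleftrightarrow>
     (copy_of_21 (p (i - 1)) s \<and> only_pin_slicing m p i {p (i - 1), s} \<or>
      i + 2 \<le> m \<and> copy_of_21 s (p (i + 1)) \<and> only_pin_slicing m p (i + 2) {p (i + 1), s}) \<and>
     copy_of_21 q r \<and>
     SW_of q {p i} \<and> SW_of r {p i} \<and>
     NE_of q (p ` {1..i - 2}) \<and> NE_of r (p ` {1..i - 2}) \<and>
     (\<forall>x\<in>A. slices x {q, r} \<longleftrightarrow> x = s) \<and>
     i + 1 \<le> m \<and> separates (p (i + 1)) {q, r} (p i) \<and>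
     (\<forall>l\<in>{1..m}. slices (p l) {p i, q, r} \<longrightarrow> l = i + 1)"

text \<open>For other directions, everything is carried to the above case by a symmetry.\<close>

definition type1_extension ::
  "point set \<Rightarrow> nat \<Rightarrow> (nat \<Rightarrow> point) \<Rightarrow> nat \<Rightarrow> point \<Rightarrow> bool" where
  "type1_extension A m p i q \<longleftrightarrow> (\<exists>f\<in>square_symmetries.
     pin_direction (f \<circ> p) (i - 1) Up \<and> pin_direction (f \<circ> p) i Right \<and>
     type1_ext_up_right (f ` A) m (f \<circ> p) i (f q))"

definition type2_extension ::
  "point set \<Rightarrow> nat \<Rightarrow> (nat \<Rightarrow> point) \<Rightarrow> nat \<Rightarrow> point \<Rightarrow> point \<Rightarrow> point \<Rightarrow> bool" where
  "type2_extension A m p i q r s \<longleftrightarrow> (\<exists>f\<in>square_symmetries.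
     pin_direction (f \<circ> p) (i - 1) Up \<and> pin_direction (f \<circ> p) i Right \<and>
     type2_ext_up_right (f ` A) m (f \<circ> p) i (f q) (f r) (f s))"

text \<open>\<open>X\<close> is the set of points added to extend \<open>p i\<close>.\<close>

definition extension_of ::
  "point set \<Rightarrow> nat \<Rightarrow> (nat \<Rightarrow> point) \<Rightarrow> nat \<Rightarrow> point set \<Rightarrow> bool" where
  "extension_of A m p i X \<longleftrightarrow>
     (\<exists>q. X = {q} \<and> type1_extension A m p i q) \<or>
     (\<exists>q r s. X = {q, r, s} \<and> type2_extension A m p i q r s)"

text \<open>\<open>K\<close> is the set of extended pins.  The pins are distinct, but extensions of different
  pins are not required to be disjoint.\<close>

definition spiral_with_extensions :: "nat \<Rightarrow> point set \<Rightarrow> bool" where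
  "spiral_with_extensions k A \<longleftrightarrow> (\<exists>m p K X.
     spiral m p \<and> K \<subseteq> {4..m} \<and> card K = k \<and>
     A = p ` {1..m} \<union> (\<Union>i\<in>K. X i) \<and>
     p ` {1..m} \<inter> (\<Union>i\<in>K. X i) = {} \<and>
     (\<forall>i\<in>K. extension_of A m p i (X i)))"

end

theory Submission
  imports Defs "HOL-Library.Ramsey"
begin

text \<open>A simple permutation without a gridding by few lines contains many non-monotone sets that are
  pairwise separated in both coordinates, hence by Ramsey's theorem, up to symmetry, a long sum of
  copies of 21.  The box around a few consecutive copies is not an interval, so some point slices a
  copy of 21 inside it from outside; Ramsey's theorem applied to these slicing points leaves an
  increasing oscillation, which is a pin sequence full of turns, or a long sawtooth alternation.

  A wedge sawtooth alternation is not an obstruction by itself.  Starting from its narrow end, grow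
  rectangular layers, each extending the previous one by the points in the horizontal and vertical strips
  through it.  If one layer swallows many teeth, the point responsible completes a sliced wedge
  sawtooth alternation.  Otherwise there are many layers, and going back from the last one gives a
  proper pin sequence with one pin per layer.  If it has few turns, a long stretch of it is a
  spiral, and every tooth it passes yields an extension of a nearby pin, after exchanging at
  most two pins for points of the tooth.

  Conversely, each of the structures contains many copies of 21 in a row such that every interval
  containing one of them is large; thinning them out inside a minimal hull leaves a simple
  permutation that still contains many separated copies, and no few lines can grid it.\<close>

section \<open>Directions and symmetries\<close>

text \<open>Lines and cells disappear early: for simple members of a class, griddability by
  boundedly many lines is the same as a bound on the \<open>k\<close> for which their plots are
  \<open>scattered k\<close>, and both implications are proved for that parameter. The obstacle is
  the wedge. In a wedge sawtooth alternation the narrow-end teeth with their slicing points form an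
  interval, for every number of them. So it forces no large simple permutation, and a simple
  permutation containing it has to break this nest of intervals by further points. The layers
  measure how fast that happens: one point may break many of the intervals at once, or the breaking
  takes many short steps, each witnessed by a pin. A spiral by itself consists of four monotone arms
  and is harmless as well; only the teeth that it passes on its way make it an obstruction. All
  inequalities are stated with the signed coordinate \<open>sg d\<close>. A symmetry then merely
  permutes the directions \<open>d\<close>, and one of up to eight congruent cases suffices.\<close>

fun sg :: "direction \<Rightarrow> point \<Rightarrow> real" where
  "sg Left z = - fst z" | "sg Right z = fst z" | "sg Up z = snd z" | "sg Down z = - snd z"

fun opp :: "direction \<Rightarrow> direction" where
  "opp Left = Right" | "opp Right = Left" | "opp Up = Down" | "opp Down = Up"

fun vertical :: "direction \<Rightarrow> bool" where
  "vertical Left = False" | "vertical Right = False" | "vertical Up = True" | "vertical Down = True"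

definition perp :: "direction \<Rightarrow> direction \<Rightarrow> bool" where
  "perp d e \<longleftrightarrow> vertical d \<noteq> vertical e"

lemma further_sg: "further d q p \<longleftrightarrow> sg d p < sg d q"
  by (cases d) auto

lemma sg_opp [simp]: "sg (opp d) z = - sg d z"
  by (cases d) auto

lemma vertical_opp [simp]: "vertical (opp d) = vertical d"
  by (cases d) auto

lemma opp_opp [simp]: "opp (opp d) = d"
  by (cases d) auto

lemma opp_neq [simp]: "opp d \<noteq> d" "d \<noteq> opp d"
  by (cases d; simp)+

lemma perp_opp [simp]: "perp (opp d) e = perp d e" "perp d (opp e) = perp d e"
  by (cases d; cases e; simp add: perp_def)+

lemma perp_sym: "perp d e \<Longrightarrow> perp e d"
  by (auto simp: perp_def)

lemma perp_irrefl [simp]: "\<not> perp d d"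
  by (simp add: perp_def)

lemma not_perp: "\<not> perp d e \<Longrightarrow> e = d \<or> e = opp d"
  by (cases d; cases e; simp add: perp_def)

lemma perp_perp: "perp d e \<Longrightarrow> perp e c \<Longrightarrow> c = d \<or> c = opp d"
  by (cases d; cases e; cases c; simp add: perp_def)

lemma direction_cases_perp: "perp d e \<Longrightarrow> c = d \<or> c = opp d \<or> c = e \<or> c = opp e"
  by (cases d; cases e; cases c; simp add: perp_def)

lemma ex_perp: "\<exists>e. perp d e"
  by (metis perp_def vertical.simps)

lemma point_eq_sg: "perp d e \<Longrightarrow> sg d u = sg d v \<Longrightarrow> sg e u = sg e v \<Longrightarrow> u = v"
  by (cases d; cases e; simp add: perp_def prod_eq_iff)

text \<open>In these coordinates \<open>d\<close> becomes the rightward and \<open>e\<close> the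
  upward direction. For perpendicular \<open>d\<close> and \<open>e\<close> they are exactly the
  eight symmetries, so choosing a symmetry amounts to choosing two directions.\<close>

definition tf :: "direction \<Rightarrow> direction \<Rightarrow> point \<Rightarrow> point" where
  "tf d e z = (sg d z, sg e z)"

lemma square_symmetries_iff: "f \<in> square_symmetries \<longleftrightarrow> (\<exists>d e. perp d e \<and> f = tf d e)"
proof
  assume "f \<in> square_symmetries"
  then obtain s t :: real where st: "s \<in> {-1, 1}" "t \<in> {-1, 1}"
    and f: "f = (\<lambda>(x, y). (s * x, t * y)) \<or> f = (\<lambda>(x, y). (s * y, t * x))"
    unfolding square_symmetries_def by auto
  define dx where "dx = (\<lambda>s::real. if s = 1 then Right else Left)"
  define dy where "dy = (\<lambda>s::real. if s = 1 then Up else Down)"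
  from f show "\<exists>d e. perp d e \<and> f = tf d e"
  proof
    assume "f = (\<lambda>(x, y). (s * x, t * y))"
    then have "f = tf (dx s) (dy t)" using st by (auto simp: tf_def dx_def dy_def fun_eq_iff)
    then show ?thesis by (metis perp_def vertical.simps dx_def dy_def)
  next
    assume "f = (\<lambda>(x, y). (s * y, t * x))"
    then have "f = tf (dy s) (dx t)" using st by (auto simp: tf_def dx_def dy_def fun_eq_iff)
    then show ?thesis by (metis perp_def vertical.simps dx_def dy_def)
  qed
next
  assume "\<exists>d e. perp d e \<and> f = tf d e"
  then obtain d e where de: "perp d e" "f = tf d e" by blast
  define s where "s = (\<lambda>d. case d of Left \<Rightarrow> -1 | Right \<Rightarrow> 1 | Up \<Rightarrow> 1 | Down \<Rightarrow> (-1::real))"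
  have s: "s c \<in> {-1, 1}" for c by (cases c) (auto simp: s_def)
  show "f \<in> square_symmetries"
  proof (cases "vertical d")
    case True
    then have "f = (\<lambda>(x, y). (s d * y, s e * x))"
      using de by (cases d; cases e; auto simp: perp_def tf_def s_def fun_eq_iff)
    then show ?thesis unfolding square_symmetries_def using s by blast
  next
    case False
    then have "f = (\<lambda>(x, y). (s d * x, s e * y))"
      using de by (cases d; cases e; auto simp: perp_def tf_def s_def fun_eq_iff)
    then show ?thesis unfolding square_symmetries_def using s by blast
  qed
qed

text \<open>\<open>turn_of \<kappa>\<close>: \<open>\<kappa>\<close> is the action of a symmetry of the square on the four directions.\<close>

definition turn_of :: "(direction \<Rightarrow> direction) \<Rightarrow> bool" where
  "turn_of \<kappa> \<longleftrightarrow> perp (\<kappa> Right) (\<kappa> Up) \<and> (\<forall>g. \<kappa> (opp g) = opp (\<kappa> g))"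

lemma turn_ofD:
  assumes "turn_of \<kappa>"
  shows "\<kappa> (opp g) = opp (\<kappa> g)" and "perp (\<kappa> g) (\<kappa> h) \<longleftrightarrow> perp g h" and "\<exists>g. \<kappa> g = d"
proof -
  note a = assms[unfolded turn_of_def]
  have L: "\<kappa> Left = opp (\<kappa> Right)" and D: "\<kappa> Down = opp (\<kappa> Up)"
    using a by (metis opp.simps)+
  show "\<kappa> (opp g) = opp (\<kappa> g)" using a by blast
  show "perp (\<kappa> g) (\<kappa> h) \<longleftrightarrow> perp g h"
    using L D conjunct1[OF a] by (cases g; cases h) (simp_all add: perp_def)
  show "\<exists>g. \<kappa> g = d" using a L D direction_cases_perp by metis
qed

lemma turn_of_id: "turn_of (\<lambda>d. d)" by (simp add: turn_of_def perp_def)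

lemma turn_of_comp: "turn_of \<kappa> \<Longrightarrow> turn_of \<mu> \<Longrightarrow> turn_of (\<lambda>d. \<kappa> (\<mu> d))"
  by (simp add: turn_of_def[of "\<lambda>d. \<kappa> (\<mu> d)"] turn_ofD(1) turn_ofD(2)) (simp add: perp_def)

lemma symmetry_turn:
  assumes "f \<in> square_symmetries"
  shows "\<exists>\<kappa>. turn_of \<kappa> \<and> (\<forall>g z. sg g (f z) = sg (\<kappa> g) z)"
proof -
  obtain d e where de: "perp d e" "f = tf d e" using assms square_symmetries_iff by blast
  define \<kappa> where "\<kappa> g = (case g of Left \<Rightarrow> opp d | Right \<Rightarrow> d | Up \<Rightarrow> e | Down \<Rightarrow> opp e)" for g
  have "turn_of \<kappa>" unfolding turn_of_def
  proof (intro conjI allI)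
    fix g show "\<kappa> (opp g) = opp (\<kappa> g)" by (cases g) (auto simp: \<kappa>_def)
  qed (use de in \<open>auto simp: \<kappa>_def\<close>)
  moreover have "sg g (f z) = sg (\<kappa> g) z" for g z
    using de by (cases g) (auto simp: \<kappa>_def tf_def)
  ultimately show ?thesis by blast
qed

lemma turn_symmetry:
  assumes "turn_of \<kappa>"
  shows "\<exists>f\<in>square_symmetries. \<forall>g z. sg g (f z) = sg (\<kappa> g) z"
proof
  have \<kappa>: "\<kappa> Left = opp (\<kappa> Right)" "\<kappa> Down = opp (\<kappa> Up)"
    using turn_ofD(1)[OF assms] by (metis opp.simps)+
  show "tf (\<kappa> Right) (\<kappa> Up) \<in> square_symmetries"
    using assms square_symmetries_iff turn_of_def by blast
  show "\<forall>g z. sg g (tf (\<kappa> Right) (\<kappa> Up) z) = sg (\<kappa> g) z"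
  proof (intro allI)
    fix g z show "sg g (tf (\<kappa> Right) (\<kappa> Up) z) = sg (\<kappa> g) z"
      using \<kappa> by (cases g) (auto simp: tf_def)
  qed
qed

lemma sg_ext: "(\<And>d. sg d u = sg d v) \<Longrightarrow> u = v"
  using ex_perp point_eq_sg by blast

lemma turn_of_inv:
  assumes "turn_of \<kappa>"
  shows "\<exists>\<mu>. turn_of \<mu> \<and> (\<forall>d. \<mu> (\<kappa> d) = d) \<and> (\<forall>d. \<kappa> (\<mu> d) = d)"
proof -
  have inj: "\<kappa> a = \<kappa> b \<Longrightarrow> a = b" for a b
    using turn_ofD[OF assms] by (metis direction_cases_perp ex_perp opp_neq(1) not_perp perp_irrefl)
  obtain \<mu> where \<mu>: "\<And>d. \<kappa> (\<mu> d) = d" using turn_ofD(3)[OF assms] by metis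
  have \<mu>': "\<mu> (\<kappa> d) = d" for d using inj \<mu> by blast
  have "turn_of \<mu>" unfolding turn_of_def
    by (metis \<mu> \<mu>' turn_ofD(1,2)[OF assms] perp_def vertical.simps)
  then show ?thesis using \<mu> \<mu>' by blast
qed

section \<open>Point sets in general position: intervals, simplicity, scattered families\<close>

definition gp :: "point set \<Rightarrow> bool" where
  "gp A \<longleftrightarrow> finite A \<and> inj_on fst A \<and> inj_on snd A"

lemma gp_sg: "gp A \<Longrightarrow> u \<in> A \<Longrightarrow> v \<in> A \<Longrightarrow> sg d u = sg d v \<Longrightarrow> u = v"
  by (cases d) (auto simp: gp_def dest: inj_onD)

lemma gpI: "finite A \<Longrightarrow> (\<And>u v d. u \<in> A \<Longrightarrow> v \<in> A \<Longrightarrow> sg d u = sg d v \<Longrightarrow> u = v) \<Longrightarrow> gp A"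
  unfolding gp_def inj_on_def by (metis sg.simps(2,3))

lemma gp_subset: "gp A \<Longrightarrow> B \<subseteq> A \<Longrightarrow> gp B"
  unfolding gp_def using finite_subset inj_on_subset by blast

text \<open>Intervals as sets closed under betweenness in either coordinate. In this form no
  rectangular hull is computed and intersections of intervals are evidently intervals.\<close>

definition ivl :: "point set \<Rightarrow> point set \<Rightarrow> bool" where
  "ivl A I \<longleftrightarrow> I \<subseteq> A \<and> (\<forall>z\<in>A - I. \<forall>u\<in>I. \<forall>v\<in>I. \<forall>d. \<not> (sg d u < sg d z \<and> sg d z < sg d v))"

lemma ivlD: "ivl A I \<Longrightarrow> u \<in> I \<Longrightarrow> v \<in> I \<Longrightarrow> z \<in> A \<Longrightarrow> sg d u < sg d z \<Longrightarrow> sg d z < sg d v \<Longrightarrow> z \<in> I"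
  unfolding ivl_def by blast

definition simple_set :: "point set \<Rightarrow> bool" where
  "simple_set A \<longleftrightarrow> gp A \<and> (\<exists>u\<in>A. \<exists>v\<in>A. u \<noteq> v) \<and>
     (\<forall>I u v. ivl A I \<longrightarrow> u \<in> I \<longrightarrow> v \<in> I \<longrightarrow> u \<noteq> v \<longrightarrow> I = A)"

lemma simple_setD: "simple_set A \<Longrightarrow> ivl A I \<Longrightarrow> u \<in> I \<Longrightarrow> v \<in> I \<Longrightarrow> u \<noteq> v \<Longrightarrow> I = A"
  unfolding simple_set_def by blast

text \<open>Quantifying over all perpendicular pairs makes invariance under symmetries immediate;
  the pairs right-up and right-down alone already say that there is an ascent and a descent.\<close>

definition nonmono :: "point set \<Rightarrow> bool" where
  "nonmono F \<longleftrightarrow> (\<forall>d e. perp d e \<longrightarrow> (\<exists>p\<in>F. \<exists>q\<in>F. sg d p < sg d q \<and> sg e p < sg e q))"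

lemma nonmono_iff:
  "nonmono F \<longleftrightarrow> (\<exists>p\<in>F. \<exists>q\<in>F. fst p < fst q \<and> snd p < snd q) \<and>
                 (\<exists>p\<in>F. \<exists>q\<in>F. fst p < fst q \<and> snd q < snd p)"
proof
  assume a: "nonmono F"
  have "perp Right Up" "perp Right Down" by (auto simp: perp_def)
  then show "(\<exists>p\<in>F. \<exists>q\<in>F. fst p < fst q \<and> snd p < snd q) \<and>
                 (\<exists>p\<in>F. \<exists>q\<in>F. fst p < fst q \<and> snd q < snd p)"
    using a[unfolded nonmono_def, rule_format, of Right Up] a[unfolded nonmono_def, rule_format, of Right Down]
    by auto
next
  assume a: "(\<exists>p\<in>F. \<exists>q\<in>F. fst p < fst q \<and> snd p < snd q) \<and>
                 (\<exists>p\<in>F. \<exists>q\<in>F. fst p < fst q \<and> snd q < snd p)"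
  show "nonmono F" unfolding nonmono_def
  proof (intro allI impI)
    fix d e assume "perp d e"
    then show "\<exists>p\<in>F. \<exists>q\<in>F. sg d p < sg d q \<and> sg e p < sg e q"
      using a by (cases d; cases e; auto simp: perp_def)
  qed
qed

definition apart :: "direction \<Rightarrow> point set \<Rightarrow> point set \<Rightarrow> bool" where
  "apart d F G \<longleftrightarrow> (\<forall>p\<in>F. \<forall>q\<in>G. sg d p < sg d q) \<or> (\<forall>p\<in>F. \<forall>q\<in>G. sg d q < sg d p)"

definition scattered :: "nat \<Rightarrow> point set \<Rightarrow> bool" where
  "scattered k A \<longleftrightarrow> (\<exists>F::nat \<Rightarrow> point set. (\<forall>i<k. F i \<subseteq> A \<and> nonmono (F i)) \<and>
     (\<forall>i<k. \<forall>j<k. i \<noteq> j \<longrightarrow> (\<forall>d. apart d (F i) (F j))))"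

text \<open>Order isomorphism up to the symmetry acting as \<open>\<kappa>\<close>.\<close>

definition sim :: "(direction \<Rightarrow> direction) \<Rightarrow> (point \<Rightarrow> point) \<Rightarrow> point set \<Rightarrow> point set \<Rightarrow> bool" where
  "sim \<kappa> g A B \<longleftrightarrow> turn_of \<kappa> \<and> bij_betw g A B \<and>
     (\<forall>p\<in>A. \<forall>q\<in>A. \<forall>d. sg d (g p) < sg d (g q) \<longleftrightarrow> sg (\<kappa> d) p < sg (\<kappa> d) q)"

lemma order_isomorphic_sg: "order_isomorphic A B \<longleftrightarrow> (\<exists>g. sim (\<lambda>d. d) g A B)"
proof -
  show ?thesis
  proof
    assume "order_isomorphic A B"
    then obtain g where g: "bij_betw g A B"
      "\<forall>p\<in>A. \<forall>q\<in>A. (fst p < fst q \<longleftrightarrow> fst (g p) < fst (g q)) \<and> (snd p < snd q \<longleftrightarrow> snd (g p) < snd (g q))"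
      unfolding order_isomorphic_def by auto
    then have "sg d (g p) < sg d (g q) \<longleftrightarrow> sg d p < sg d q" if "p \<in> A" "q \<in> A" for p q d
      using that by (cases d) auto
    then have "sim (\<lambda>d. d) g A B" using g(1) by (simp add: sim_def turn_of_id)
    then show "\<exists>g. sim (\<lambda>d. d) g A B" by blast
  next
    assume "\<exists>g. sim (\<lambda>d. d) g A B"
    then obtain g where g: "bij_betw g A B"
      "\<And>p q d. p \<in> A \<Longrightarrow> q \<in> A \<Longrightarrow> sg d (g p) < sg d (g q) \<longleftrightarrow> sg d p < sg d q"
      unfolding sim_def by blast
    have "(fst p < fst q \<longleftrightarrow> fst (g p) < fst (g q)) \<and> (snd p < snd q \<longleftrightarrow> snd (g p) < snd (g q))"
      if "p \<in> A" "q \<in> A" for p q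
      using g(2)[OF that, of Right] g(2)[OF that, of Up] by simp
    then show "order_isomorphic A B" unfolding order_isomorphic_def using g(1) by blast
  qed
qed

lemma sim_subset: "sim \<kappa> g A B \<Longrightarrow> A' \<subseteq> A \<Longrightarrow> sim \<kappa> g A' (g ` A')"
  unfolding sim_def by (meson bij_betw_subset subsetD)

lemma sim_image_subset: "sim \<kappa> g A B \<Longrightarrow> A' \<subseteq> A \<Longrightarrow> g ` A' \<subseteq> B"
  unfolding sim_def bij_betw_def by blast

lemma sim_refl: "sim (\<lambda>d. d) (\<lambda>z. z) A A"
  by (simp add: sim_def turn_of_id bij_betw_def)

lemma sim_trans:
  assumes "sim \<kappa> g A B" "sim \<mu> h B C"
  shows "sim (\<lambda>d. \<kappa> (\<mu> d)) (h \<circ> g) A C"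
proof -
  have "bij_betw g A B" using assms by (simp add: sim_def)
  then have "g p \<in> B" if "p \<in> A" for p using that bij_betwE by blast
  moreover have "bij_betw (h \<circ> g) A C" using assms bij_betw_trans unfolding sim_def by blast
  ultimately show ?thesis using assms turn_of_comp unfolding sim_def by simp
qed

lemma sim_inv:
  assumes "sim \<kappa> g A B"
  shows "\<exists>\<mu> h. sim \<mu> h B A \<and> (\<forall>d. \<mu> (\<kappa> d) = d) \<and> (\<forall>d. \<kappa> (\<mu> d) = d)"
proof -
  obtain \<mu> where \<mu>: "turn_of \<mu>" "\<And>d. \<mu> (\<kappa> d) = d" "\<And>d. \<kappa> (\<mu> d) = d" using turn_of_inv assms sim_def by blast
  define h where "h = the_inv_into A g"
  have b: "bij_betw h B A" using assms unfolding sim_def h_def by (simp add: bij_betw_the_inv_into)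
  have gh: "g (h z) = z" if "z \<in> B" for z
    using assms that unfolding sim_def h_def bij_betw_def by (metis f_the_inv_into_f)
  have hA: "h z \<in> A" if "z \<in> B" for z using b that bij_betwE by blast
  have "sg d (h p) < sg d (h q) \<longleftrightarrow> sg (\<mu> d) p < sg (\<mu> d) q" if "p \<in> B" "q \<in> B" for p q d
  proof -
    have "sg (\<mu> d) (g (h p)) < sg (\<mu> d) (g (h q)) \<longleftrightarrow> sg (\<kappa> (\<mu> d)) (h p) < sg (\<kappa> (\<mu> d)) (h q)"
      using assms hA that unfolding sim_def by blast
    then show ?thesis using gh that \<mu> by simp
  qed
  then have "sim \<mu> h B A" using \<mu> b unfolding sim_def by blast
  then show ?thesis using \<mu> by blast
qed

lemma sim_symmetry:
  assumes "f \<in> square_symmetries"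
  shows "\<exists>\<kappa>. sim \<kappa> f A (f ` A) \<and> (\<forall>g z. sg g (f z) = sg (\<kappa> g) z)"
proof -
  obtain \<kappa> where \<kappa>: "turn_of \<kappa>" "\<forall>g z. sg g (f z) = sg (\<kappa> g) z" using symmetry_turn assms by blast
  have "inj_on f A"
  proof (rule inj_onI)
    fix x y assume "f x = f y"
    then have "sg (\<kappa> d) x = sg (\<kappa> d) y" for d using \<kappa> by metis
    then show "x = y" using sg_ext turn_ofD(3)[OF \<kappa>(1)] by metis
  qed
  then show ?thesis using \<kappa> by (auto simp: sim_def bij_betw_def)
qed

text \<open>The action \<kappa> on directions is realised by an actual symmetry \<open>f\<close>.
  Undoing \<open>g\<close> and then applying \<open>f\<close> preserves every comparison.\<close>

lemma sim_factor:
  assumes "sim \<kappa> g A B"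
  shows "\<exists>f\<in>square_symmetries. order_isomorphic B (f ` A)"
proof -
  obtain f where f: "f \<in> square_symmetries" "\<forall>g z. sg g (f z) = sg (\<kappa> g) z"
    using turn_symmetry assms sim_def by blast
  obtain \<mu> h where h: "sim \<mu> h B A" "\<And>d. \<mu> (\<kappa> d) = d" using sim_inv[OF assms] by blast
  obtain \<kappa>' where k: "sim \<kappa>' f A (f ` A)" "\<forall>g z. sg g (f z) = sg (\<kappa>' g) z" using sim_symmetry[OF f(1)] by blast
  have "sim \<kappa> f A (f ` A)" using k(1) assms f(2) unfolding sim_def by (auto simp del: split_paired_All)
  then have "sim (\<lambda>d. \<mu> (\<kappa> d)) (f \<circ> h) B (f ` A)" using sim_trans h by blast
  then show ?thesis using f(1) h(2) order_isomorphic_sg by auto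
qed

lemma is_up_to_symmetry_sim: "is_up_to_symmetry \<pi> A \<longleftrightarrow> (\<exists>\<kappa> g. sim \<kappa> g A (plot \<pi>))"
proof
  assume "is_up_to_symmetry \<pi> A"
  then obtain f g where f: "f \<in> square_symmetries" "sim (\<lambda>d. d) g (plot \<pi>) (f ` A)"
    unfolding is_up_to_symmetry_def order_isomorphic_sg by blast
  show "\<exists>\<kappa> g. sim \<kappa> g A (plot \<pi>)"
    using sim_symmetry[OF f(1), of A] sim_inv[OF f(2)] sim_trans by metis
next
  assume "\<exists>\<kappa> g. sim \<kappa> g A (plot \<pi>)"
  then show "is_up_to_symmetry \<pi> A" using sim_factor unfolding is_up_to_symmetry_def by blast
qed

lemma sim_gp: assumes "sim \<kappa> g A B" "gp A" shows "gp B"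
proof (rule gpI)
  have b: "bij_betw g A B" using assms sim_def by blast
  show "finite B" using b assms(2) bij_betw_finite gp_def by blast
  fix u v d assume uv: "u \<in> B" "v \<in> B" "sg d u = sg d v"
  then obtain p q where pq: "p \<in> A" "q \<in> A" "u = g p" "v = g q" using b unfolding bij_betw_def by blast
  then have "sg (\<kappa> d) p = sg (\<kappa> d) q" using assms(1) uv unfolding sim_def
    by (metis linorder_neqE_linordered_idom order_less_irrefl)
  then show "u = v" using pq gp_sg[OF assms(2)] by blast
qed

lemma sim_ivl: assumes s: "sim \<kappa> g A B" and "ivl B I" shows "ivl A {z\<in>A. g z \<in> I}"
  unfolding ivl_def
proof (intro conjI ballI allI notI)
  fix z u v d
  assume z: "z \<in> A - {z \<in> A. g z \<in> I}" and uv: "u \<in> {z \<in> A. g z \<in> I}" "v \<in> {z \<in> A. g z \<in> I}"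
   and l: "sg d u < sg d z \<and> sg d z < sg d v"
  obtain c where c: "\<kappa> c = d" using s turn_ofD(3) sim_def by blast
  have "sg c (g u) < sg c (g z)" "sg c (g z) < sg c (g v)" using s z uv l c unfolding sim_def by auto
  moreover have "g z \<in> B" using s z unfolding sim_def bij_betw_def by blast
  ultimately have "g z \<in> I" using ivlD[OF assms(2)] uv by blast
  then show False using z by blast
qed auto

lemma sim_simple_set: assumes s: "sim \<kappa> g A B" and "simple_set A" shows "simple_set B"
  unfolding simple_set_def
proof (intro conjI allI impI)
  have b: "bij_betw g A B" using s sim_def by blast
  have "gp A" and "\<exists>u\<in>A. \<exists>v\<in>A. u \<noteq> v" using assms(2) by (simp_all add: simple_set_def)
  then show "gp B" using sim_gp s by blast
  obtain u v where uv: "u \<in> A" "v \<in> A" "u \<noteq> v" using \<open>\<exists>u\<in>A. \<exists>v\<in>A. u \<noteq> v\<close> by blast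
  have "g u \<in> B" "g v \<in> B" "g u \<noteq> g v"
    using b uv unfolding bij_betw_def by (auto dest: inj_onD)
  then show "\<exists>u\<in>B. \<exists>v\<in>B. u \<noteq> v" by blast
  fix I u v assume I: "ivl B I" "u \<in> I" "v \<in> I" "u \<noteq> v"
  then have "I \<subseteq> B" by (simp add: ivl_def)
  then obtain p q where "p \<in> A" "q \<in> A" "u = g p" "v = g q" using I b unfolding bij_betw_def by blast
  then have "{z\<in>A. g z \<in> I} = A" using simple_setD[OF assms(2) sim_ivl[OF s I(1)], of p q] I by blast
  then show "I = B" using b \<open>I \<subseteq> B\<close> unfolding bij_betw_def by blast
qed

lemma sim_scattered: assumes s: "sim \<kappa> g A B" and "scattered k A" shows "scattered k B"
proof -
  from assms(2)[unfolded scattered_def] obtain F where F0: "\<forall>i<k. F i \<subseteq> A \<and> nonmono (F i)"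
    "\<forall>i<k. \<forall>j<k. i \<noteq> j \<longrightarrow> (\<forall>d. apart d (F i) (F j))"
    by (elim exE conjE)
  have F: "\<And>i. i < k \<Longrightarrow> F i \<subseteq> A \<and> nonmono (F i)"
    "\<And>i j d. i < k \<Longrightarrow> j < k \<Longrightarrow> i \<noteq> j \<Longrightarrow> apart d (F i) (F j)"
    using F0 by simp_all
  have g: "sg d (g p) < sg d (g q) \<longleftrightarrow> sg (\<kappa> d) p < sg (\<kappa> d) q" if "p \<in> A" "q \<in> A" for p q d
    using s that unfolding sim_def by blast
  have "g ` F i \<subseteq> B \<and> nonmono (g ` F i)" if i: "i < k" for i
  proof
    show "g ` F i \<subseteq> B" using sim_image_subset s F i by blast
    show "nonmono (g ` F i)" unfolding nonmono_def
    proof (intro allI impI)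
      fix d e assume "perp d e"
      then have "perp (\<kappa> d) (\<kappa> e)" using turn_ofD s sim_def by blast
      then obtain p q where "p \<in> F i" "q \<in> F i" "sg (\<kappa> d) p < sg (\<kappa> d) q \<and> sg (\<kappa> e) p < sg (\<kappa> e) q"
        using F i unfolding nonmono_def by blast
      then show "\<exists>p\<in>g ` F i. \<exists>q\<in>g ` F i. sg d p < sg d q \<and> sg e p < sg e q" using g F i by blast
    qed
  qed
  moreover have "apart d (g ` F i) (g ` F j)" if "i < k" "j < k" "i \<noteq> j" for i j d
    using F(2)[OF that, of "\<kappa> d"] F(1) that(1,2) g unfolding apart_def by blast
  ultimately have "(\<forall>i<k. g ` F i \<subseteq> B \<and> nonmono (g ` F i)) \<and>
     (\<forall>i<k. \<forall>j<k. i \<noteq> j \<longrightarrow> (\<forall>d. apart d (g ` F i) (g ` F j)))" by simp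
  then show ?thesis unfolding scattered_def by (rule exI[of _ "\<lambda>i. g ` F i"])
qed

section \<open>Permutations and classes\<close>

lemma permutation_iff: "permutation \<pi> \<longleftrightarrow> distinct \<pi> \<and> set \<pi> = {1..length \<pi>}"
  unfolding permutation_def permutations_of_set_def by auto

definition pt :: "nat list \<Rightarrow> nat \<Rightarrow> point" where
  "pt \<pi> i = (real i, real (\<pi> ! (i - 1)))"

lemma plot_pt: "plot \<pi> = pt \<pi> ` {1..length \<pi>}"
  unfolding plot_def pt_def by auto

lemma permutation_value_inj:
  assumes "permutation \<pi>" "i \<in> {1..length \<pi>}" "j \<in> {1..length \<pi>}" "\<pi> ! (i - 1) = \<pi> ! (j - 1)"
  shows "i = j"
proof -
  have "i - 1 = j - 1"
    using assms nth_eq_iff_index_eq[of \<pi> "i - 1" "j - 1"] by (auto simp: permutation_iff)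
  then show ?thesis using assms by auto
qed

lemma permutation_value_surj:
  assumes "permutation \<pi>" "y \<in> {1..length \<pi>}"
  shows "\<exists>i\<in>{1..length \<pi>}. \<pi> ! (i - 1) = y"
proof -
  have "y \<in> set \<pi>" using assms by (simp add: permutation_iff)
  then obtain k where k: "k < length \<pi>" "\<pi> ! k = y" by (auto simp: in_set_conv_nth)
  then show ?thesis by (intro bexI[of _ "Suc k"]) auto
qed

lemma permutation_value_range:
  assumes "permutation \<pi>" "i \<in> {1..length \<pi>}"
  shows "\<pi> ! (i - 1) \<in> {1..length \<pi>}"
proof -
  have "\<pi> ! (i - 1) \<in> set \<pi>" using assms(2) by (intro nth_mem) auto
  then show ?thesis using assms by (simp add: permutation_iff)
qed

lemma plot_gp: assumes "permutation \<pi>" shows "gp (plot \<pi>)"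
  unfolding gp_def plot_pt inj_on_def
  using permutation_value_inj[OF assms] by (auto simp: pt_def)

text \<open>Let \<open>J\<close> be the positions of the points of \<open>I\<close>. Horizontal
  betweenness makes \<open>J\<close> a block of positions; vertical betweenness makes its values a
  block, because every value of a permutation is attained.\<close>

lemma simple_imp_simple_set:
  assumes "simple \<pi>"
  shows "simple_set (plot \<pi>)"
  unfolding simple_set_def
proof (intro conjI allI impI)
  let ?n = "length \<pi>"
  have perm: "permutation \<pi>" and n: "1 < ?n"
    and s: "\<And>J. interval \<pi> J \<Longrightarrow> card J = 1 \<or> J = {1..?n}"
    using assms by (auto simp: simple_def)
  show "gp (plot \<pi>)" using plot_gp perm by blast
  have "pt \<pi> 1 \<noteq> pt \<pi> 2" "pt \<pi> 1 \<in> plot \<pi>" "pt \<pi> 2 \<in> plot \<pi>" using n by (auto simp: pt_def plot_pt)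
  then show "\<exists>u\<in>plot \<pi>. \<exists>v\<in>plot \<pi>. u \<noteq> v" by blast
  fix I u v assume I: "ivl (plot \<pi>) I" and uv: "u \<in> I" "v \<in> I" "u \<noteq> v"
  define J where "J = {i\<in>{1..?n}. pt \<pi> i \<in> I}"
  let ?val = "\<lambda>i. \<pi> ! (i - 1)"
  have sub: "I \<subseteq> plot \<pi>" using I by (simp add: ivl_def)
  have IJ: "I = pt \<pi> ` J" using sub by (auto simp: J_def plot_pt)
  have fin: "finite J" by (simp add: J_def)
  have ne: "J \<noteq> {}" using IJ uv by auto
  have "J = {Min J..Max J}"
  proof
    show "J \<subseteq> {Min J..Max J}" using fin by auto
    show "{Min J..Max J} \<subseteq> J"
    proof
      fix i assume i: "i \<in> {Min J..Max J}"
      have mm: "Min J \<in> J" "Max J \<in> J" using fin ne by simp_all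
      show "i \<in> J"
      proof (cases "i = Min J \<or> i = Max J")
        case False
        then have l: "Min J < i" "i < Max J" using i by auto
        have "i \<in> {1..?n}" using mm i by (auto simp: J_def)
        moreover have "pt \<pi> i \<in> I"
          using ivlD[OF I, of "pt \<pi> (Min J)" "pt \<pi> (Max J)" "pt \<pi> i" Right] mm l calculation
          by (auto simp: J_def pt_def plot_pt)
        ultimately show ?thesis by (simp add: J_def)
      qed (use mm in auto)
    qed
  qed
  moreover have "?val ` J = {Min (?val ` J)..Max (?val ` J)}" (is "?V = _")
  proof
    show "?V \<subseteq> {Min ?V..Max ?V}" using fin by auto
    show "{Min ?V..Max ?V} \<subseteq> ?V"
    proof
      fix y assume y: "y \<in> {Min ?V..Max ?V}"
      have mm: "Min ?V \<in> ?V" "Max ?V \<in> ?V" using fin ne by (simp_all del: Min_in Max_in add: Min_in Max_in)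
      then obtain i j where ij: "i \<in> J" "?val i = Min ?V" "j \<in> J" "?val j = Max ?V" by auto
      have "y \<in> {1..?n}" using y ij permutation_value_range[OF perm, of i] permutation_value_range[OF perm, of j]
        by (auto simp: J_def)
      then obtain k where k: "k \<in> {1..?n}" "?val k = y" using permutation_value_surj perm by blast
      show "y \<in> ?V"
      proof (cases "y = Min ?V \<or> y = Max ?V")
        case False
        then have "?val i < ?val k" "?val k < ?val j" using y k ij by auto
        then have "pt \<pi> k \<in> I"
          using ivlD[OF I, of "pt \<pi> i" "pt \<pi> j" "pt \<pi> k" Up] ij k by (auto simp: J_def pt_def plot_pt)
        then have "k \<in> J" using k by (simp add: J_def)
        then show ?thesis using k by blast
      qed (use mm in auto)
    qed
  qed
  moreover have "J \<subseteq> {1..?n}" by (auto simp: J_def)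
  ultimately have "interval \<pi> J" unfolding interval_def using ne by blast
  then have "card J = 1 \<or> J = {1..?n}" using s by blast
  moreover have "card J \<noteq> 1" using IJ uv by (auto simp: card_1_singleton_iff)
  ultimately show "I = plot \<pi>" using IJ plot_pt by simp
qed

text \<open>By injectivity of the values, a point whose value falls into the block of values of
  \<open>K\<close> has its position in \<open>K\<close>. Hence a block of positions with a block of
  values spans a set closed under betweenness.\<close>

lemma simple_set_imp_simple:
  assumes perm: "permutation \<pi>" and P: "simple_set (plot \<pi>)"
  shows "simple \<pi>"
  unfolding simple_def
proof (intro conjI allI impI)
  let ?n = "length \<pi>"
  let ?val = "\<lambda>i. \<pi> ! (i - 1)"
  show "permutation \<pi>" by (rule perm)
  have "\<exists>u\<in>plot \<pi>. \<exists>v\<in>plot \<pi>. u \<noteq> v" using P by (simp add: simple_set_def)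
  then obtain u v where uv: "u \<in> plot \<pi>" "v \<in> plot \<pi>" "u \<noteq> v" by blast
  then obtain i j where "i \<in> {1..?n}" "j \<in> {1..?n}" "u = pt \<pi> i" "v = pt \<pi> j" unfolding plot_pt by blast
  then have "i \<in> {1..?n}" "j \<in> {1..?n}" "i \<noteq> j" using uv by auto
  then show "1 < ?n" by auto
  fix K assume K: "interval \<pi> K"
  then obtain a b c d where K': "K \<noteq> {}" "K \<subseteq> {1..?n}" "K = {a..b}" "?val ` K = {c..d}"
    unfolding interval_def by blast
  have valK: "i \<in> K" if "i \<in> {1..?n}" "?val i \<in> {c..d}" for i
  proof -
    have "?val i \<in> ?val ` K" using that K'(4) by simp
    then obtain k where "k \<in> K" "?val i = ?val k" by auto
    then show ?thesis using permutation_value_inj[OF perm that(1), of k] K'(2) by auto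
  qed
  have valK': "?val i \<in> {c..d}" if "i \<in> K" for i using that K'(4) by blast
  have "ivl (plot \<pi>) (pt \<pi> ` K)"
    unfolding ivl_def
  proof (intro conjI ballI allI notI)
    show "pt \<pi> ` K \<subseteq> plot \<pi>" using K' by (auto simp: plot_pt)
    fix z u v e assume z: "z \<in> plot \<pi> - pt \<pi> ` K" and uv: "u \<in> pt \<pi> ` K" "v \<in> pt \<pi> ` K"
      and l: "sg e u < sg e z \<and> sg e z < sg e v"
    obtain i j k where i: "i \<in> {1..?n}" "z = pt \<pi> i" "i \<notin> K" and jk: "j \<in> K" "u = pt \<pi> j" "k \<in> K" "v = pt \<pi> k"
      using z uv unfolding plot_pt by blast
    have "i \<in> {a..b} \<or> ?val i \<in> {c..d}"
      using l i jk K'(3) valK'[of j] valK'[of k] by (cases e) (auto simp: pt_def)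
    then show False using i K'(3) valK by blast
  qed
  then have all: "pt \<pi> ` K = plot \<pi>" if "u \<in> K" "v \<in> K" "u \<noteq> v" for u v
    using simple_setD[OF P, of "pt \<pi> ` K" "pt \<pi> u" "pt \<pi> v"] that by (auto simp: pt_def)
  have inj: "inj (pt \<pi>)" by (auto simp: inj_on_def pt_def)
  show "card K = 1 \<or> K = {1..?n}"
  proof (cases "card K = 1")
    case False
    obtain u where u: "u \<in> K" using K' by blast
    have "K \<noteq> {u}" using False by auto
    then obtain v where "v \<in> K" "u \<noteq> v" using u by blast
    then have "pt \<pi> ` K = pt \<pi> ` {1..?n}" using all u by (simp add: plot_pt)
    then show ?thesis using inj by (simp add: inj_image_eq_iff)
  qed simp
qed

section \<open>Standardisation of point sets and closure of classes\<close>

definition rank :: "('a \<Rightarrow> real) \<Rightarrow> 'a set \<Rightarrow> 'a \<Rightarrow> nat" where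
  "rank f A z = card {w\<in>A. f w \<le> f z}"

lemma rank_less:
  assumes "finite A" "u \<in> A" "v \<in> A"
  shows "rank f A u < rank f A v \<longleftrightarrow> f u < f v"
proof -
  have *: "rank f A u < rank f A v" if "f u < f v" "v \<in> A" for u v
    unfolding rank_def using that assms(1) by (intro psubset_card_mono psubsetI) (auto, force)
  have **: "rank f A v \<le> rank f A u" if "f v \<le> f u" for u v
    unfolding rank_def using that assms(1) by (intro card_mono) auto
  show ?thesis using *[OF _ assms(3)] **[of v u] by (metis linorder_not_less)
qed

lemma rank_bij:
  assumes "finite A" "inj_on f A"
  shows "bij_betw (rank f A) A {1..card A}"
proof -
  have inj: "inj_on (rank f A) A"
  proof (rule inj_onI)
    fix u v assume uv: "u \<in> A" "v \<in> A" "rank f A u = rank f A v"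
    then have "f u = f v" using rank_less[OF assms(1), of u v f] rank_less[OF assms(1), of v u f]
      by (metis linorder_neqE_linordered_idom nat_neq_iff)
    then show "u = v" using assms(2) uv by (meson inj_onD)
  qed
  have "rank f A ` A \<subseteq> {1..card A}"
  proof
    fix y assume "y \<in> rank f A ` A"
    then obtain z where z: "z \<in> A" "y = rank f A z" by blast
    have "{w\<in>A. f w \<le> f z} \<noteq> {}" using z by auto
    then have "0 < y" using z assms(1) by (simp add: rank_def card_gt_0_iff)
    moreover have "y \<le> card A" using z assms(1) by (auto simp: rank_def intro!: card_mono)
    ultimately show "y \<in> {1..card A}" by simp
  qed
  moreover have "card (rank f A ` A) = card {1..card A}" using inj by (simp add: card_image)
  ultimately have "rank f A ` A = {1..card A}" by (simp add: card_subset_eq)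
  then show ?thesis using inj by (simp add: bij_betw_def)
qed

text \<open>Sorting \<open>A\<close> by abscissa and writing down the ranks of the ordinates gives
  the one-line notation.\<close>

lemma ex_permutation:
  assumes "gp A"
  shows "\<exists>\<pi>. permutation \<pi> \<and> order_isomorphic (plot \<pi>) A"
proof -
  let ?n = "card A"
  let ?rx = "rank fst A" and ?ry = "rank snd A"
  have fin: "finite A" using assms by (simp add: gp_def)
  have bx: "bij_betw ?rx A {1..?n}" and by': "bij_betw ?ry A {1..?n}"
    using assms rank_bij by (auto simp: gp_def)
  define h where "h = the_inv_into A ?rx"
  have bh: "bij_betw h {1..?n} A" unfolding h_def using bx by (rule bij_betw_the_inv_into)
  have rxh: "?rx (h i) = i" if "i \<in> {1..?n}" for i
    using bx that unfolding h_def bij_betw_def by (metis f_the_inv_into_f)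
  define \<pi> where "\<pi> = map (\<lambda>i. ?ry (h i)) [1..<Suc ?n]"
  have len: "length \<pi> = ?n" by (simp add: \<pi>_def)
  have val: "\<pi> ! (i - 1) = ?ry (h i)" if "i \<in> {1..?n}" for i
    using that by (auto simp: \<pi>_def nth_upt simp del: upt_Suc)
  have bb: "bij_betw (\<lambda>i. ?ry (h i)) {1..?n} {1..?n}"
    using bij_betw_trans[OF bh by'] by (simp add: o_def)
  have "set [1..<Suc ?n] = {1..?n}" by auto
  then have "distinct \<pi> \<and> set \<pi> = {1..?n}"
    using bb unfolding \<pi>_def bij_betw_def by (simp add: distinct_map del: upt_Suc set_upt)
  then have perm: "permutation \<pi>" using len permutation_iff by simp
  \<comment> \<open>The abscissa of a point of a plot is its position, so rounding down recovers the
    index.\<close>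
  define g :: "point \<Rightarrow> point" where "g = (\<lambda>z. h (nat \<lfloor>fst z\<rfloor>))"
  have gpt: "g (pt \<pi> i) = h i" for i by (simp add: g_def pt_def)
  have hA: "h i \<in> A" if "i \<in> {1..?n}" for i using bh that bij_betwE by blast
  have ord: "(fst p < fst q \<longleftrightarrow> fst (g p) < fst (g q)) \<and> (snd p < snd q \<longleftrightarrow> snd (g p) < snd (g q))"
    if pq: "p \<in> plot \<pi>" "q \<in> plot \<pi>" for p q
  proof -
    obtain i j where ij: "i \<in> {1..?n}" "j \<in> {1..?n}" "p = pt \<pi> i" "q = pt \<pi> j"
      using pq unfolding plot_pt len by blast
    have "fst p < fst q \<longleftrightarrow> i < j" using ij by (simp add: pt_def)
    moreover have "i < j \<longleftrightarrow> fst (h i) < fst (h j)"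
      using rank_less[OF fin, of "h i" "h j" fst] hA ij rxh by simp
    moreover have "snd p < snd q \<longleftrightarrow> ?ry (h i) < ?ry (h j)" using ij by (simp add: pt_def val del: One_nat_def)
    moreover have "?ry (h i) < ?ry (h j) \<longleftrightarrow> snd (h i) < snd (h j)"
      using rank_less[OF fin, of "h i" "h j" snd] hA ij by simp
    ultimately show ?thesis using ij gpt by simp
  qed
  have "bij_betw g (plot \<pi>) A"
  proof -
    have "bij_betw (g \<circ> pt \<pi>) {1..?n} A" using bh gpt by (simp add: o_def)
    moreover have "bij_betw (pt \<pi>) {1..?n} (plot \<pi>)"
      unfolding bij_betw_def plot_pt len by (auto simp: inj_on_def pt_def)
    ultimately show ?thesis using bij_betw_comp_iff by blast
  qed
  then have "order_isomorphic (plot \<pi>) A" unfolding order_isomorphic_def using ord by blast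
  then show ?thesis using perm by blast
qed

lemma class_subset:
  assumes "permutation_class C" "\<rho> \<in> C" "S \<subseteq> plot \<rho>"
  shows "\<exists>\<pi>\<in>C. order_isomorphic (plot \<pi>) S"
proof -
  have "permutation \<rho>" using assms by (simp add: permutation_class_def)
  then have "gp S" using plot_gp gp_subset assms(3) by blast
  then obtain \<pi> where "permutation \<pi>" "order_isomorphic (plot \<pi>) S" using ex_permutation by blast
  then show ?thesis using assms unfolding permutation_class_def contained_in_def by blast
qed

text \<open>A class need not be closed under symmetries. The symmetry therefore stays in the
  relation between \<open>A\<close> and \<open>S\<close>, and the member of \<open>C\<close> is the
  standardisation of \<open>S\<close> itself.\<close>

lemma class_symmetry:
  assumes "permutation_class C" "\<rho> \<in> C" "sim \<kappa> g A S" "S \<subseteq> plot \<rho>"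
  shows "\<exists>\<pi>\<in>C. is_up_to_symmetry \<pi> A"
proof -
  obtain \<pi> h where "\<pi> \<in> C" "sim (\<lambda>d. d) h (plot \<pi>) S"
    using class_subset[OF assms(1,2,4)] order_isomorphic_sg by blast
  then show ?thesis using sim_inv sim_trans[OF assms(3)] is_up_to_symmetry_sim by blast
qed

text \<open>A single line meets at most one of \<open>k\<close> pairwise scattered sets, so a set missed by all
  lines would lie in one cell.\<close>

lemma gridding_scattered:
  assumes "gridding H V P" "scattered k P"
  shows "k \<le> card H + card V"
proof -
  have fin: "finite H" "finite V" and mono: "\<And>p. p \<in> P \<Longrightarrow> increasing_points (cell H V P p) \<or> decreasing_points (cell H V P p)"
    and avoid: "fst ` P \<inter> V = {}" "snd ` P \<inter> H = {}"
    using assms by (auto simp: gridding_def)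
  from assms(2)[unfolded scattered_def] obtain F where F0: "\<forall>i<k. F i \<subseteq> P \<and> nonmono (F i)"
    "\<forall>i<k. \<forall>j<k. i \<noteq> j \<longrightarrow> (\<forall>d. apart d (F i) (F j))"
    by (elim exE conjE)
  \<comment> \<open>Each set is labelled by a line that splits it, \<open>Inl\<close> for a vertical
    and \<open>Inr\<close> for a horizontal one; the bound then follows from injectivity of the
    labels.\<close>
  have "\<exists>l. (\<exists>c\<in>V. l = Inl c \<and> (\<exists>p\<in>F i. \<exists>q\<in>F i. fst p < c \<and> c < fst q)) \<or>
            (\<exists>c\<in>H. l = Inr c \<and> (\<exists>p\<in>F i. \<exists>q\<in>F i. snd p < c \<and> c < snd q))" (is "\<exists>l. ?L i l")
    if i: "i < k" for i
  proof (rule ccontr)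
    assume no: "\<nexists>l. ?L i l"
    have noV: "\<not> (fst p < c \<and> c < fst q)" if "p \<in> F i" "q \<in> F i" "c \<in> V" for p q c
      using no spec[of "\<lambda>l. \<not> ?L i l" "Inl c"] that by auto
    have noH: "\<not> (snd p < c \<and> c < snd q)" if "p \<in> F i" "q \<in> F i" "c \<in> H" for p q c
    proof
      assume "snd p < c \<and> c < snd q"
      then have "?L i (Inr c)" using that
        by (intro disjI2 bexI[of _ c] conjI refl bexI[of _ p] bexI[of _ q]) auto
      then show False using no by (metis (no_types))
    qed
    have sub: "F i \<subseteq> P" and nm: "nonmono (F i)" using F0 i by auto
    then obtain p where p: "p \<in> F i" unfolding nonmono_iff by blast
    have "F i \<subseteq> cell H V P p"
    proof
      fix q assume q: "q \<in> F i"
      have "c < fst p \<longleftrightarrow> c < fst q" if "c \<in> V" for c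
      proof -
        have "c \<noteq> fst p" "c \<noteq> fst q" using avoid(1) sub p q that by auto
        moreover have "\<not> (fst p < c \<and> c < fst q)" "\<not> (fst q < c \<and> c < fst p)" using noV p q that by auto
        ultimately show ?thesis by linarith
      qed
      moreover have "c < snd p \<longleftrightarrow> c < snd q" if "c \<in> H" for c
      proof -
        have "c \<noteq> snd p" "c \<noteq> snd q" using avoid(2) sub p q that by auto
        moreover have "\<not> (snd p < c \<and> c < snd q)" "\<not> (snd q < c \<and> c < snd p)" using noH p q that by auto
        ultimately show ?thesis by linarith
      qed
      ultimately show "q \<in> cell H V P p" using q sub by (auto simp: cell_def)
    qed
    moreover have "increasing_points (cell H V P p) \<or> decreasing_points (cell H V P p)" using mono p sub by blast
    ultimately show False using nm unfolding nonmono_iff increasing_points_def decreasing_points_def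
      by (meson order_less_asym subsetD)
  qed
  then obtain L where L: "\<And>i. i < k \<Longrightarrow> ?L i (L i)" by metis
  have "L ` {..<k} \<subseteq> V <+> H"
  proof (rule image_subsetI)
    fix i assume "i \<in> {..<k}"
    then have "?L i (L i)" using L by simp
    then show "L i \<in> V <+> H" by (elim disjE bexE conjE) auto
  qed
  moreover have "inj_on L {..<k}"
  proof (rule inj_onI, rule ccontr)
    fix i j assume ij: "i \<in> {..<k}" "j \<in> {..<k}" "L i = L j" "i \<noteq> j"
    have ap: "apart d (F i) (F j)" for d using F0(2) ij by auto
    \<comment> \<open>Two sets split by the same line would both straddle it, yet one of them lies
      wholly before the other.\<close>
    have no: False if "p \<in> F i" "q \<in> F i" "sg d p < c" "c < sg d q" "p' \<in> F j" "q' \<in> F j"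
      "sg d p' < c" "c < sg d q'" for p q p' q' c d
    proof -
      have "sg d q < sg d p' \<or> sg d q' < sg d p" using ap[of d] that(1,2,5,6) unfolding apart_def by auto
      then show False using that(3,4,7,8) by linarith
    qed
    have Li: "?L i (L i)" by (rule L) (use ij in simp)
    have Lj: "?L j (L i)" unfolding ij(3) by (rule L) (use ij in simp)
    show False
    proof (cases "L i")
      case (Inl c)
      obtain p q where "p \<in> F i" "q \<in> F i" "fst p < c" "c < fst q" using Li Inl by auto
      moreover obtain p' q' where "p' \<in> F j" "q' \<in> F j" "fst p' < c" "c < fst q'" using Lj Inl by auto
      ultimately show False using no[of p q Right c p' q'] by simp
    next
      case (Inr c)
      obtain p q where "p \<in> F i" "q \<in> F i" "snd p < c" "c < snd q" using Li Inr by auto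
      moreover obtain p' q' where "p' \<in> F j" "q' \<in> F j" "snd p' < c" "c < snd q'" using Lj Inr by auto
      ultimately show False using no[of p q Up c p' q'] by simp
    qed
  qed
  moreover have "finite (V <+> H)" using fin by simp
  ultimately have "card {..<k} \<le> card (V <+> H)" by (meson card_inj_on_le)
  then show ?thesis using fin by (simp add: card_Plus)
qed

section \<open>Griddings and scattered sets\<close>

text \<open>Colouring increasing lists instead of sets lets the colour refer to the smallest, the
  second smallest entry and so on; \<open>h\<close> enumerates the homogeneous set in increasing
  order.\<close>

lemma ramsey_increasing:
  "\<exists>n::nat. \<forall>c::nat list \<Rightarrow> nat. (\<forall>xs. c xs < q) \<longrightarrow> (\<exists>h::nat \<Rightarrow> nat. \<exists>i. (\<forall>x<m. \<forall>y<m. x < y \<longrightarrow> h x < h y) \<and>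
     (\<forall>x<m::nat. h x < n) \<and> (\<forall>xs. length xs = r \<and> sorted_wrt (<) xs \<and> set xs \<subseteq> {..<m} \<longrightarrow> c (map h xs) = i))"
proof -
  obtain N :: nat where N: "partn_lst {..<N} (replicate q m) r" using ramsey_full by blast
  show ?thesis
  proof (intro exI[of _ N] allI impI)
    fix c :: "nat list \<Rightarrow> nat" assume c: "\<forall>xs. c xs < q"
    define f where "f X = c (sorted_list_of_set X)" for X
    have "f \<in> nsets {..<N} r \<rightarrow> {..<length (replicate q m)}" using c by (auto simp: f_def)
    then obtain i where i: "i < length (replicate q m)" "monochromatic {..<N} (replicate q m ! i) r f i"
      using N unfolding partn_lst_def by blast
    then obtain H where H: "H \<in> nsets {..<N} m" "f ` nsets H r \<subseteq> {i}"
      unfolding monochromatic_def by auto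
    then have fin: "finite H" and card: "card H = m" and sub: "H \<subseteq> {..<N}" by (auto simp: nsets_def)
    define L where "L = sorted_list_of_set H"
    have L: "sorted_wrt (<) L" "length L = m" "set L = H"
      using fin card by (auto simp: L_def)
    define h where "h x = L ! x" for x
    have mono: "h x < h y" if "x < y" "y < m" for x y
      using L that unfolding h_def by (metis sorted_wrt_nth_less)
    have hH: "h x \<in> H" if "x < m" for x using that L by (metis h_def nth_mem)
    have "c (map h xs) = i" if xs: "length xs = r" "sorted_wrt (<) xs" "set xs \<subseteq> {..<m}" for xs
    proof -
      have s: "sorted_wrt (<) (map h xs)"
        unfolding sorted_wrt_map
        by (rule sorted_wrt_mono_rel[OF _ xs(2)]) (use xs(3) mono in auto)
      then have "sorted (map h xs)" "distinct (map h xs)" by (simp_all only: strict_sorted_iff)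
      then have "sorted_list_of_set (set (map h xs)) = map h xs"
        by (rule sorted_list_of_set.idem_if_sorted_distinct)
      moreover
      have "set (map h xs) \<in> nsets H r"
      proof -
        have "distinct (map h xs)" using s by (simp add: strict_sorted_iff)
        then have "card (set (map h xs)) = r" using xs(1) distinct_card by fastforce
        then show ?thesis using hH xs(3) by (auto simp: nsets_def)
      qed
      then have "f (set (map h xs)) \<in> {i}" using H(2) by blast
      ultimately show ?thesis unfolding f_def by simp
    qed
    moreover have "h x < N" if "x < m" for x using hH[OF that] sub by auto
    ultimately have "(\<forall>x<m. \<forall>y<m. x < y \<longrightarrow> h x < h y) \<and>
     (\<forall>x<m. h x < N) \<and> (\<forall>xs. length xs = r \<and> sorted_wrt (<) xs \<and> set xs \<subseteq> {..<m} \<longrightarrow> c (map h xs) = i)"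
      using mono by simp
    then show "\<exists>h i. (\<forall>x<m. \<forall>y<m. x < y \<longrightarrow> h x < h y) \<and>
     (\<forall>x<m. h x < N) \<and> (\<forall>xs. length xs = r \<and> sorted_wrt (<) xs \<and> set xs \<subseteq> {..<m} \<longrightarrow> c (map h xs) = i)"
      by (intro exI)
  qed
qed

lemma ramsey_pairs:
  "\<exists>n::nat. \<forall>c::nat \<Rightarrow> nat \<Rightarrow> nat. (\<forall>x y. c x y < q) \<longrightarrow> (\<exists>h::nat \<Rightarrow> nat. \<exists>i. (\<forall>x<m. \<forall>y<m. x < y \<longrightarrow> h x < h y) \<and>
     (\<forall>x<m::nat. h x < n) \<and> (\<forall>x y. x < y \<longrightarrow> y < m \<longrightarrow> c (h x) (h y) = i))"
proof -
  obtain n where n: "\<And>c::nat list \<Rightarrow> nat. (\<forall>xs. c xs < q) \<Longrightarrow> (\<exists>h i. (\<forall>x<m. \<forall>y<m. x < y \<longrightarrow> h x < h y) \<and>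
     (\<forall>x<m. h x < n) \<and> (\<forall>xs. length xs = 2 \<and> sorted_wrt (<) xs \<and> set xs \<subseteq> {..<m} \<longrightarrow> c (map h xs) = i))"
    using ramsey_increasing[of q m 2] by blast
  show ?thesis
  proof (intro exI[of _ n] allI impI)
    fix c :: "nat \<Rightarrow> nat \<Rightarrow> nat" assume "\<forall>x y. c x y < q"
    then have "\<forall>xs. c (xs ! 0) (xs ! 1) < q" by blast
    from n[OF this] obtain h i where h: "\<forall>x<m. \<forall>y<m. x < y \<longrightarrow> h x < h y" "\<forall>x<m. h x < n"
      "\<forall>xs. length xs = 2 \<and> sorted_wrt (<) xs \<and> set xs \<subseteq> {..<m} \<longrightarrow> c (map h xs ! 0) (map h xs ! 1) = i"
      by (elim exE conjE)
    have "c (h x) (h y) = i" if "x < y" "y < m" for x y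
      using h(3)[rule_format, of "[x, y]"] that by simp
    then show "\<exists>h i. (\<forall>x<m. \<forall>y<m. x < y \<longrightarrow> h x < h y) \<and>
     (\<forall>x<m. h x < n) \<and> (\<forall>x y. x < y \<longrightarrow> y < m \<longrightarrow> c (h x) (h y) = i)" using h by blast
  qed
qed

definition pairwise_apart :: "direction \<Rightarrow> nat \<Rightarrow> (nat \<Rightarrow> point set) \<Rightarrow> bool" where
  "pairwise_apart d k G \<longleftrightarrow> (\<forall>i<k. \<forall>j<k. i \<noteq> j \<longrightarrow> apart d (G i) (G j))"

lemma apart_opp: "apart (opp d) F G \<longleftrightarrow> apart d F G"
  unfolding apart_def by auto

lemma apart_sym: "apart d F G \<Longrightarrow> apart d G F"
  unfolding apart_def by auto

text \<open>Grid lines must avoid the points, whose coordinates are integers, so half-integers are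
  used. A set that reaches \<open>h\<close> from both sides and is not flat has a point at distance
  at least 1 from \<open>h\<close>, and the half-integer next to \<open>h\<close> on that side
  splits it.\<close>

lemma half_integer_separates:
  fixes F :: "point set" and h :: real
  assumes int: "\<And>z. z \<in> F \<Longrightarrow> sg d z \<in> \<int>" and h: "h \<in> \<int>"
    and p: "p \<in> F" "sg d p \<le> h" and q: "q \<in> F" "h \<le> sg d q"
    and rs: "r \<in> F" "s \<in> F" "sg d r < sg d s"
  shows "\<exists>c\<in>{h - 1/2, h + 1/2}. \<exists>u\<in>F. \<exists>v\<in>F. sg d u < c \<and> c < sg d v"
proof -
  have int_less: "x + 1 \<le> y" if xy: "x \<in> \<int>" "y \<in> \<int>" "x < y" for x y :: real
  proof -
    obtain k l where "x = real_of_int k" "y = real_of_int l" using xy(1,2) by (elim Ints_cases) auto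
    moreover from this have "k + 1 \<le> l" using xy(3) by simp
    then have "real_of_int (k + 1) \<le> real_of_int l" by (simp only: of_int_le_iff)
    ultimately show ?thesis by simp
  qed
  have lt: "sg d z \<le> h - 1" if "z \<in> F" "sg d z < h" for z
    using int_less[OF int[OF that(1)] h that(2)] by simp
  have gt: "h + 1 \<le> sg d z" if "z \<in> F" "h < sg d z" for z
    using int_less[OF h int[OF that(1)] that(2)] .
  have "(\<exists>u\<in>F. \<exists>v\<in>F. sg d u < h \<and> h \<le> sg d v) \<or> (\<exists>u\<in>F. \<exists>v\<in>F. sg d u \<le> h \<and> h < sg d v)"
    using p q rs by (metis linorder_not_less order_le_less_trans)
  then show ?thesis
  proof
    assume "\<exists>u\<in>F. \<exists>v\<in>F. sg d u < h \<and> h \<le> sg d v"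
    then obtain u v where uv: "u \<in> F" "v \<in> F" "sg d u < h" "h \<le> sg d v" by blast
    then have "sg d u < h - 1/2 \<and> h - 1/2 < sg d v" using lt[of u] by simp
    then show ?thesis using uv by blast
  next
    assume "\<exists>u\<in>F. \<exists>v\<in>F. sg d u \<le> h \<and> h < sg d v"
    then obtain u v where uv: "u \<in> F" "v \<in> F" "sg d u \<le> h" "h < sg d v" by blast
    then have "sg d u < h + 1/2 \<and> h + 1/2 < sg d v" using gt[of v] by simp
    then show ?thesis using uv by blast
  qed
qed

lemma half_not_int: "(h::real) \<in> \<int> \<Longrightarrow> h - 1/2 \<notin> \<int> \<and> h + 1/2 \<notin> \<int>"
proof -
  assume h: "h \<in> \<int>"
  have half: "(1/2::real) \<notin> \<int>"
  proof
    assume "(1/2::real) \<in> \<int>"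
    then obtain k where "1/2 = real_of_int k" by (auto elim: Ints_cases)
    then have "1 = 2 * k" by linarith
    then show False by presburger
  qed
  have "h - (h - 1/2) = 1/2" "(h + 1/2) - h = 1/2" by simp_all
  then show ?thesis using h half Ints_diff by metis
qed

context
  fixes P :: "point set"
  assumes finP: "finite P" and intP: "\<And>z d. z \<in> P \<Longrightarrow> sg d z \<in> \<int>"
begin

lemma nonmono_pair:
  assumes "nonmono F" shows "\<exists>r\<in>F. \<exists>s\<in>F. sg d r < sg d s"
  using assms ex_perp unfolding nonmono_def by blast

text \<open>Greedy piercing of intervals: a family without \<open>m + 1\<close> pairwise disjoint members is pierced
  by \<open>m\<close> points, taken at the lowest upper end.\<close>

lemma pierce_vertical:
  assumes "\<F> \<subseteq> {F. F \<subseteq> P \<and> nonmono F}"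
    and "\<nexists>G. (\<forall>i<Suc m. G i \<in> \<F> \<and> (\<forall>p\<in>G i. y0 < snd p)) \<and> pairwise_apart Up (Suc m) G"
  shows "\<exists>H. finite H \<and> card H \<le> 2 * m \<and> H \<inter> \<int> = {} \<and>
     (\<forall>F\<in>\<F>. (\<forall>p\<in>F. y0 < snd p) \<longrightarrow> (\<exists>c\<in>H. \<exists>p\<in>F. \<exists>q\<in>F. snd p < c \<and> c < snd q))"
  using assms(2)
proof (induction m arbitrary: y0)
  case 0
  have "\<not> (F \<in> \<F> \<and> (\<forall>p\<in>F. y0 < snd p))" for F
  proof
    assume "F \<in> \<F> \<and> (\<forall>p\<in>F. y0 < snd p)"
    then have "(\<forall>i<Suc 0. F \<in> \<F> \<and> (\<forall>p\<in>F. y0 < snd p)) \<and> pairwise_apart Up (Suc 0) (\<lambda>i. F)"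
      by (simp add: pairwise_apart_def)
    then show False using 0 by (elim notE) (rule exI[of _ "\<lambda>i. F"])
  qed
  then show ?case by (intro exI[of _ "{}"]) auto
next
  case (Suc m)
  define \<F>1 where "\<F>1 = {F\<in>\<F>. \<forall>p\<in>F. y0 < snd p}"
  show ?case
  proof (cases "\<F>1 = {}")
    case True
    then show ?thesis by (intro exI[of _ "{}"]) (auto simp: \<F>1_def)
  next
    case False
    have fin1: "finite \<F>1" using assms(1) finP by (auto simp: \<F>1_def intro: finite_subset[of _ "Pow P"])
    have props: "finite F" "F \<noteq> {}" "F \<subseteq> P" "nonmono F" if "F \<in> \<F>1" for F
    proof -
      show F: "F \<subseteq> P" "nonmono F" using that assms(1) unfolding \<F>1_def by auto
      show "finite F" using F(1) finP finite_subset by blast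
      show "F \<noteq> {}" using nonmono_pair[OF F(2)] by blast
    qed
    define F0 where "F0 = arg_min_on (\<lambda>F. Max (snd ` F)) \<F>1"
    have F0: "F0 \<in> \<F>1" and min: "\<And>F. F \<in> \<F>1 \<Longrightarrow> Max (snd ` F0) \<le> Max (snd ` F)"
      using arg_min_if_finite[OF fin1 False, of "\<lambda>F. Max (snd ` F)"] unfolding F0_def by (auto simp: linorder_not_less)
    define h where "h = Max (snd ` F0)"
    have hub: "snd p \<le> h" if "p \<in> F0" for p using that props[OF F0] by (simp add: h_def)
    have y0h: "y0 < h"
    proof -
      obtain p where "p \<in> F0" using props[OF F0] by blast
      then show ?thesis using F0 hub[of p] by (force simp: \<F>1_def)
    qed
    have "h \<in> snd ` F0" unfolding h_def using props[OF F0] by (intro Max_in) auto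
    then obtain p0 where p0: "p0 \<in> F0" "h = snd p0" by (elim imageE)
    have hint: "h \<in> \<int>" using p0 props[OF F0] intP[of p0 Up] by auto
    have "\<nexists>G. (\<forall>i<Suc m. G i \<in> \<F> \<and> (\<forall>p\<in>G i. h < snd p)) \<and> pairwise_apart Up (Suc m) G"
    proof
      assume "\<exists>G. (\<forall>i<Suc m. G i \<in> \<F> \<and> (\<forall>p\<in>G i. h < snd p)) \<and> pairwise_apart Up (Suc m) G"
      then obtain G where G: "\<And>i. i < Suc m \<Longrightarrow> G i \<in> \<F> \<and> (\<forall>p\<in>G i. h < snd p)" "pairwise_apart Up (Suc m) G" by blast
      \<comment> \<open>\<open>F0\<close> ends at \<open>h\<close>, so it would enlarge any family
        lying above \<open>h\<close>.\<close>
      define G' where "G' i = (if i < Suc m then G i else F0)" for i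
      have "apart Up F0 (G i)" if "i < Suc m" for i
        using G(1)[OF that] hub unfolding apart_def by fastforce
      then have "pairwise_apart Up (Suc (Suc m)) G'"
        using G(2) apart_sym[of Up F0] unfolding pairwise_apart_def G'_def by (simp add: less_Suc_eq)
      moreover have "G' i \<in> \<F> \<and> (\<forall>p\<in>G' i. y0 < snd p)" for i
        using G(1)[of i] F0 y0h unfolding G'_def \<F>1_def by force
      ultimately have "(\<forall>i<Suc (Suc m). G' i \<in> \<F> \<and> (\<forall>p\<in>G' i. y0 < snd p)) \<and> pairwise_apart Up (Suc (Suc m)) G'"
        by (intro conjI allI impI) (assumption | blast)+
      then have "\<exists>G. (\<forall>i<Suc (Suc m). G i \<in> \<F> \<and> (\<forall>p\<in>G i. y0 < snd p)) \<and> pairwise_apart Up (Suc (Suc m)) G"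
        by (rule exI[where x = G'])
      with Suc.prems show False by (rule notE)
    qed
    from Suc.IH[OF this] obtain H where H: "finite H" "card H \<le> 2 * m" "H \<inter> \<int> = {}"
      "\<forall>F\<in>\<F>. (\<forall>p\<in>F. h < snd p) \<longrightarrow> (\<exists>c\<in>H. \<exists>p\<in>F. \<exists>q\<in>F. snd p < c \<and> c < snd q)" by (elim exE conjE)
    \<comment> \<open>A member that is not wholly above \<open>h\<close> still reaches up to
      \<open>h\<close> by the choice of \<open>F0\<close>, so one of the two lines next to
      \<open>h\<close> splits it.\<close>
    let ?H = "H \<union> {h - 1/2, h + 1/2}"
    have "\<exists>c\<in>?H. \<exists>p\<in>F. \<exists>q\<in>F. snd p < c \<and> c < snd q" if F: "F \<in> \<F>" "\<forall>p\<in>F. y0 < snd p" for F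
    proof (cases "\<forall>p\<in>F. h < snd p")
      case True
      then show ?thesis using H(4)[rule_format, OF F(1)] by blast
    next
      case False
      have F1: "F \<in> \<F>1" using F by (simp add: \<F>1_def)
      obtain p where p: "p \<in> F" "snd p \<le> h" using False by auto
      have "Max (snd ` F) \<in> snd ` F" using props[OF F1] by (intro Max_in) auto
      then obtain q where q: "q \<in> F" "h \<le> snd q"
        using min[OF F1] unfolding h_def by (metis imageE)
      obtain r s where rs: "r \<in> F" "s \<in> F" "sg Up r < sg Up s" using nonmono_pair props[OF F1] by blast
      have "\<exists>c\<in>{h - 1/2, h + 1/2}. \<exists>u\<in>F. \<exists>v\<in>F. sg Up u < c \<and> c < sg Up v"
      proof (rule half_integer_separates[of F Up h p q r s])
        show "sg Up z \<in> \<int>" if "z \<in> F" for z using intP props(3)[OF F1] that by blast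
      qed (use hint p q rs in simp_all)
      then show ?thesis by auto
    qed
    moreover have "card ?H \<le> 2 * Suc m"
    proof -
      have "card ?H \<le> card H + card {h - 1/2, h + 1/2}" by (rule card_Un_le)
      also have "\<dots> \<le> 2 * m + 2" using H(2) by (intro add_mono) (auto simp: card_insert_if)
      finally show ?thesis by simp
    qed
    moreover have "?H \<inter> \<int> = {}" using H(3) half_not_int[OF hint] by blast
    ultimately show ?thesis using H(1) by (intro exI[of _ ?H]) auto
  qed
qed

text \<open>The families occupy consecutive vertical strips from left to right, and inside a strip
  the sets are apart only vertically. Representatives from different strips are thus apart
  horizontally for free.\<close>

definition strips :: "nat \<Rightarrow> nat \<Rightarrow> real \<Rightarrow> (nat \<Rightarrow> nat \<Rightarrow> point set) \<Rightarrow> bool" where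
  "strips k K x0 G \<longleftrightarrow> (\<forall>i<k. \<forall>j<K. G i j \<subseteq> P \<and> nonmono (G i j) \<and> (\<forall>p\<in>G i j. x0 < fst p)) \<and>
     (\<forall>i<k. pairwise_apart Up K (G i)) \<and>
     (\<forall>i<k. \<forall>i'<k. i < i' \<longrightarrow> (\<forall>j<K. \<forall>j'<K. \<forall>p\<in>G i j. \<forall>q\<in>G i' j'. fst p < fst q))"

definition pierced :: "nat \<Rightarrow> nat \<Rightarrow> real \<Rightarrow> bool" where
  "pierced v h x0 \<longleftrightarrow>
   (\<exists>V H. finite V \<and> finite H \<and> card V \<le> v \<and> card H \<le> h \<and> V \<inter> \<int> = {} \<and> H \<inter> \<int> = {} \<and>
     (\<forall>F. F \<subseteq> P \<longrightarrow> nonmono F \<longrightarrow> (\<forall>p\<in>F. x0 < fst p) \<longrightarrow>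
        (\<exists>c\<in>V. \<exists>p\<in>F. \<exists>q\<in>F. fst p < c \<and> c < fst q) \<or> (\<exists>c\<in>H. \<exists>p\<in>F. \<exists>q\<in>F. snd p < c \<and> c < snd q)))"

text \<open>Sweep a vertical line rightwards from \<open>x0\<close> and stop at the first
  \<open>n\<close> for which the strip behind it holds \<open>m + 1\<close> vertically apart sets.
  Sets ending before \<open>n\<close> are pierced by \<open>2 * m\<close> horizontal lines, sets
  meeting abscissa \<open>n\<close> by the two vertical lines next to it, and induction treats the
  sets beyond \<open>n\<close>.\<close>

lemma strips_or_pierce:
  assumes nonneg: "\<And>z. z \<in> P \<Longrightarrow> 0 \<le> fst z"
  shows "(\<exists>G. strips k (Suc m) x0 G) \<or> pierced (2 * k) (2 * m * k) x0"
proof (induction k arbitrary: x0)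
  case 0
  then show ?case by (auto simp: strips_def)
next
  case (Suc k)
  define \<F> where "\<F> Q = {F. F \<subseteq> P \<and> nonmono F \<and> (\<forall>p\<in>F. x0 < fst p \<and> Q (fst p))}" for Q
  define dis where "dis Q \<longleftrightarrow> (\<exists>G. (\<forall>i<Suc m. G i \<in> \<F> Q) \<and> pairwise_apart Up (Suc m) G)" for Q
  have pierce: "\<exists>H. finite H \<and> card H \<le> 2 * m \<and> H \<inter> \<int> = {} \<and>
     (\<forall>F\<in>\<F> Q. \<exists>c\<in>H. \<exists>p\<in>F. \<exists>q\<in>F. snd p < c \<and> c < snd q)" if "\<not> dis Q" for Q
  proof -
    \<comment> \<open>A height below all of \<open>P\<close>, from which the vertical piercing sees
      every set.\<close>
    define y0 where "y0 = Min (insert 0 (snd ` P)) - 1"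
    have y0: "y0 < snd p" if "p \<in> P" for p
    proof -
      have "Min (insert 0 (snd ` P)) \<le> snd p" using that finP by (intro Min_le) auto
      then show ?thesis by (simp add: y0_def)
    qed
    have "\<nexists>G. (\<forall>i<Suc m. G i \<in> \<F> Q \<and> (\<forall>p\<in>G i. y0 < snd p)) \<and> pairwise_apart Up (Suc m) G"
      using that unfolding dis_def by blast
    moreover have "\<F> Q \<subseteq> {F. F \<subseteq> P \<and> nonmono F}" by (auto simp: \<F>_def)
    ultimately have H: "\<exists>H. finite H \<and> card H \<le> 2 * m \<and> H \<inter> \<int> = {} \<and>
       (\<forall>F\<in>\<F> Q. (\<forall>p\<in>F. y0 < snd p) \<longrightarrow> (\<exists>c\<in>H. \<exists>p\<in>F. \<exists>q\<in>F. snd p < c \<and> c < snd q))"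
      by (intro pierce_vertical)
    have "\<forall>p\<in>F. y0 < snd p" if "F \<in> \<F> Q" for F using that y0 by (auto simp: \<F>_def)
    then show ?thesis using H by simp
  qed
  show ?case
  proof (cases "dis (\<lambda>x. True)")
    case False
    from pierce[OF this] obtain H where H: "finite H" "card H \<le> 2 * m" "H \<inter> \<int> = {}"
       "\<forall>F\<in>\<F> (\<lambda>x. True). \<exists>c\<in>H. \<exists>p\<in>F. \<exists>q\<in>F. snd p < c \<and> c < snd q" by (elim exE conjE)
    have "pierced (2 * Suc k) (2 * m * Suc k) x0"
      unfolding pierced_def
    proof (intro exI conjI allI impI)
      show "finite ({}::real set)" "card ({}::real set) \<le> 2 * Suc k" "{} \<inter> \<int> = ({}::real set)" by simp_all
      show "finite H" "H \<inter> \<int> = {}" "card H \<le> 2 * m * Suc k" using H by auto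
      fix F assume "F \<subseteq> P" "nonmono F" "\<forall>p\<in>F. x0 < fst p"
      then have "F \<in> \<F> (\<lambda>x. True)" by (simp add: \<F>_def)
      then show "(\<exists>c\<in>{}. \<exists>p\<in>F. \<exists>q\<in>F. fst p < c \<and> c < fst q) \<or> (\<exists>c\<in>H. \<exists>p\<in>F. \<exists>q\<in>F. snd p < c \<and> c < snd q)"
        using H(4) by simp
    qed
    then show ?thesis ..
  next
    case True
    have "\<exists>n::nat. dis (\<lambda>x. x \<le> real n)"
    proof -
      obtain n :: nat where n: "Max (insert 0 (fst ` P)) \<le> real n" using real_arch_simple by blast
      have "fst p \<le> real n" if "p \<in> P" for p
        using n that finP by (meson Max_ge finite_imageI finite_insert imageI insertCI order_trans)
      then have "\<F> (\<lambda>x. True) \<subseteq> \<F> (\<lambda>x. x \<le> real n)" by (auto simp: \<F>_def)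
      then show ?thesis using True unfolding dis_def by (meson subsetD)
    qed
    then obtain n :: nat where n: "dis (\<lambda>x. x \<le> real n)" "\<And>n'. n' < n \<Longrightarrow> \<not> dis (\<lambda>x. x \<le> real n')"
      using exists_least_iff[of "\<lambda>n. dis (\<lambda>x. x \<le> real n)"] by blast
    \<comment> \<open>By integrality, being left of \<open>n\<close> means being at most
      \<open>n - 1\<close>, so minimality of \<open>n\<close> applies; for \<open>n = 0\<close>
      there is no point on the left at all.\<close>
    have nd: "\<not> dis (\<lambda>x. x < real n)"
    proof
      assume d: "dis (\<lambda>x. x < real n)"
      have "n \<noteq> 0"
      proof
        assume "n = 0"
        then obtain F where F: "F \<in> \<F> (\<lambda>x. x < 0)" using d unfolding dis_def by auto
        then obtain p where "p \<in> F" using nonmono_pair unfolding \<F>_def by blast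
        moreover from this have "p \<in> P" "fst p < 0" using F by (auto simp: \<F>_def)
        ultimately show False using nonneg[of p] by simp
      qed
      have less: "x \<le> real (n - 1)" if "x \<in> \<int>" "x < real n" for x
      proof -
        obtain k where k: "x = real_of_int k" using \<open>x \<in> \<int>\<close> by (auto elim: Ints_cases)
        then have "k < int n" using that by linarith
        then show ?thesis using k \<open>n \<noteq> 0\<close> by linarith
      qed
      have "\<F> (\<lambda>x. x < real n) \<subseteq> \<F> (\<lambda>x. x \<le> real (n - 1))"
      proof (intro subsetI)
        fix F assume F: "F \<in> \<F> (\<lambda>x. x < real n)"
        have "fst p \<in> \<int>" if "p \<in> F" for p using intP[of p Right] F that by (auto simp: \<F>_def)
        then show "F \<in> \<F> (\<lambda>x. x \<le> real (n - 1))"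
          using F less unfolding \<F>_def by blast
      qed
      then have "dis (\<lambda>x. x \<le> real (n - 1))" using d unfolding dis_def by (meson subsetD)
      then show False using n(2)[of "n - 1"] \<open>n \<noteq> 0\<close> by simp
    qed
    from pierce[OF nd] obtain H1 where H1: "finite H1" "card H1 \<le> 2 * m" "H1 \<inter> \<int> = {}"
       "\<forall>F\<in>\<F> (\<lambda>x. x < real n). \<exists>c\<in>H1. \<exists>p\<in>F. \<exists>q\<in>F. snd p < c \<and> c < snd q" by (elim exE conjE)
    obtain G0 where G0: "\<And>i. i < Suc m \<Longrightarrow> G0 i \<in> \<F> (\<lambda>x. x \<le> real n)" "pairwise_apart Up (Suc m) G0"
      using n(1) unfolding dis_def by blast
    have x0n: "x0 < real n"
    proof -
      have F: "G0 0 \<in> \<F> (\<lambda>x. x \<le> real n)" using G0 by blast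
      then obtain p where "p \<in> G0 0" using nonmono_pair unfolding \<F>_def by blast
      then show ?thesis using F by (force simp: \<F>_def)
    qed
    consider (s) G where "strips k (Suc m) (real n) G" | (pp) "pierced (2 * k) (2 * m * k) (real n)"
      using Suc.IH[of "real n"] by blast
    then show ?thesis
    proof cases
      case s
      define G' where "G' i = (case i of 0 \<Rightarrow> G0 | Suc i \<Rightarrow> G i)" for i
      have G0': "G0 j \<subseteq> P \<and> nonmono (G0 j) \<and> (\<forall>p\<in>G0 j. x0 < fst p \<and> fst p \<le> real n)" if "j < Suc m" for j
        using G0(1)[OF that] by (auto simp: \<F>_def)
      have G: "G i j \<subseteq> P \<and> nonmono (G i j) \<and> (\<forall>p\<in>G i j. real n < fst p)" if "i < k" "j < Suc m" for i j
        using s that by (simp add: strips_def)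
      have "strips (Suc k) (Suc m) x0 G'"
        unfolding strips_def
      proof (intro conjI allI impI ballI)
        fix i j assume ij: "i < Suc k" "j < Suc m"
        show "G' i j \<subseteq> P" "nonmono (G' i j)" using G0'[OF ij(2)] G[of "i - 1" j] ij by (auto simp: G'_def split: nat.split)
        show "x0 < fst p" if "p \<in> G' i j" for p
          using that G0'[OF ij(2)] G[of "i - 1" j] ij x0n by (force simp: G'_def split: nat.splits)
      next
        fix i assume "i < Suc k"
        then show "pairwise_apart Up (Suc m) (G' i)" using G0(2) s by (auto simp: G'_def strips_def split: nat.split)
      next
        fix i i' j j' p q assume a: "i < Suc k" "i' < Suc k" "i < i'" "j < Suc m" "j' < Suc m" "p \<in> G' i j" "q \<in> G' i' j'"
        then obtain l' where l': "i' = Suc l'" "l' < k" by (cases i') auto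
        show "fst p < fst q"
        proof (cases i)
          case 0
          then have "p \<in> G0 j" "q \<in> G l' j'" using a l' by (auto simp: G'_def)
          then show ?thesis using G0'[OF a(4)] G[OF l'(2) a(5)] by force
        next
          case (Suc l)
          then have "p \<in> G l j" "q \<in> G l' j'" using a l' by (auto simp: G'_def)
          moreover have "l < k" "l < l'" using a l' Suc by auto
          ultimately show ?thesis
            using s[unfolded strips_def, THEN conjunct2, THEN conjunct2, rule_format, of l l' j j' p q] l'(2) a(4,5) by blast
        qed
      qed
      then show ?thesis by blast
    next
      case pp
      then obtain V H where p: "finite V" "finite H" "card V \<le> 2 * k" "card H \<le> 2 * m * k" "V \<inter> \<int> = {}" "H \<inter> \<int> = {}"
      "\<forall>F. F \<subseteq> P \<longrightarrow> nonmono F \<longrightarrow> (\<forall>p\<in>F. real n < fst p) \<longrightarrow>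
        (\<exists>c\<in>V. \<exists>p\<in>F. \<exists>q\<in>F. fst p < c \<and> c < fst q) \<or> (\<exists>c\<in>H. \<exists>p\<in>F. \<exists>q\<in>F. snd p < c \<and> c < snd q)"
        unfolding pierced_def by (elim exE conjE)
      let ?V = "V \<union> {real n - 1/2, real n + 1/2}" and ?H = "H \<union> H1"
      have "(\<exists>c\<in>?V. \<exists>p\<in>F. \<exists>q\<in>F. fst p < c \<and> c < fst q) \<or> (\<exists>c\<in>?H. \<exists>p\<in>F. \<exists>q\<in>F. snd p < c \<and> c < snd q)"
        if F: "F \<subseteq> P" "nonmono F" "\<forall>p\<in>F. x0 < fst p" for F
      proof -
        consider "\<forall>p\<in>F. real n < fst p" | "\<forall>p\<in>F. fst p < real n" |
          u v where "u \<in> F" "fst u \<le> real n" "v \<in> F" "real n \<le> fst v" by force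
        then show ?thesis
        proof cases
          case 1
          then show ?thesis using p(7)[rule_format, OF F(1,2)] by blast
        next
          case 2
          then have "F \<in> \<F> (\<lambda>x. x < real n)" using F by (auto simp: \<F>_def)
          then show ?thesis using H1(4)[rule_format, of F] by blast
        next
          case 3
          obtain r s where rs: "r \<in> F" "s \<in> F" "sg Right r < sg Right s" using nonmono_pair F by blast
          have "\<exists>c\<in>{real n - 1/2, real n + 1/2}. \<exists>u\<in>F. \<exists>v\<in>F. sg Right u < c \<and> c < sg Right v"
          proof (rule half_integer_separates[of F Right "real n" u v r s])
            show "sg Right z \<in> \<int>" if "z \<in> F" for z using intP F(1) that by blast
          qed (use 3 rs in simp_all)
          then show ?thesis by auto
        qed
      qed
      moreover have "card ?V \<le> 2 * Suc k"
      proof -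
        have "card ?V \<le> card V + card {real n - 1/2, real n + 1/2}" by (rule card_Un_le)
        also have "\<dots> \<le> 2 * k + 2" using p(3) by (intro add_mono) (auto simp: card_insert_if)
        finally show ?thesis by simp
      qed
      moreover have "card ?H \<le> 2 * m * Suc k"
      proof -
        have "card ?H \<le> card H + card H1" by (rule card_Un_le)
        then show ?thesis using p(4) H1(2) by simp
      qed
      moreover have "?V \<inter> \<int> = {}" "?H \<inter> \<int> = {}" using p(5,6) H1(3) half_not_int[of "real n"] by auto
      ultimately have "pierced (2 * Suc k) (2 * m * Suc k) x0"
        using p(1,2) H1(1) unfolding pierced_def
        by (intro exI[of _ ?V] exI[of _ ?H] conjI allI impI) (simp_all only: finite_Un finite.emptyI finite.insertI simp_thms)
      then show ?thesis ..
    qed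
  qed
qed

text \<open>One representative per family: repeatedly take the interval with the lowest upper end; it
  meets at most one member of each remaining family.\<close>

lemma choose_apart:
  assumes "finite I" and "\<And>i. i \<in> I \<Longrightarrow> finite (J i) \<and> card I \<le> card (J i)"
    and "\<And>i j. i \<in> I \<Longrightarrow> j \<in> J i \<Longrightarrow> G i j \<subseteq> P \<and> G i j \<noteq> {}"
    and "\<And>i j j'. i \<in> I \<Longrightarrow> j \<in> J i \<Longrightarrow> j' \<in> J i \<Longrightarrow> j \<noteq> j' \<Longrightarrow> apart Up (G i j) (G i j')"
  shows "\<exists>\<phi>. (\<forall>i\<in>I. \<phi> i \<in> J i) \<and> (\<forall>i\<in>I. \<forall>i'\<in>I. i \<noteq> i' \<longrightarrow> apart Up (G i (\<phi> i)) (G i' (\<phi> i')))"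
  using assms
proof (induction "card I" arbitrary: I J)
  case 0
  then show ?case by auto
next
  case (Suc n)
  define T where "T = (\<lambda>(i, j). Max (snd ` G i j))"
  define S where "S = Sigma I J"
  have S: "finite S" "S \<noteq> {}"
  proof -
    show "finite S" unfolding S_def using Suc.prems by (intro finite_SigmaI) auto
    obtain i where "i \<in> I" using Suc.hyps(2) by force
    moreover have "J i \<noteq> {}" using Suc.prems(2)[OF \<open>i \<in> I\<close>] Suc.hyps(2) by force
    ultimately show "S \<noteq> {}" by (auto simp: S_def)
  qed
  define s0 where "s0 = arg_min_on T S"
  have "s0 \<in> S" and min: "\<And>s. s \<in> S \<Longrightarrow> T s0 \<le> T s"
    using arg_min_if_finite[OF S, of T] unfolding s0_def by (auto simp: linorder_not_less)
  obtain i0 j0 where s0: "s0 = (i0, j0)" by fastforce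
  then have i0: "i0 \<in> I" "j0 \<in> J i0" using \<open>s0 \<in> S\<close> by (auto simp: S_def)
  define h where "h = T s0"
  have finG: "finite (G i j)" if "i \<in> I" "j \<in> J i" for i j using Suc.prems(3)[OF that] finP finite_subset by blast
  have top: "\<exists>p\<in>G i j. h \<le> snd p" if "i \<in> I" "j \<in> J i" for i j
  proof -
    have "h \<le> Max (snd ` G i j)" using min[of "(i, j)"] that by (auto simp: S_def T_def h_def)
    moreover have "Max (snd ` G i j) \<in> snd ` G i j" using finG[OF that] Suc.prems(3)[OF that] by (intro Max_in) auto
    ultimately obtain p where "p \<in> G i j" "h \<le> snd p" by (metis imageE)
    then show ?thesis by blast
  qed
  have ub: "snd p \<le> h" if "p \<in> G i0 j0" for p
    using that finG[OF i0] by (simp add: h_def s0 T_def)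
  define J' where "J' i = {j\<in>J i. \<forall>p\<in>G i j. h < snd p}" for i
  define I' where "I' = I - {i0}"
  have cI: "n = card I'" using Suc.hyps(2) i0 Suc.prems(1) by (simp add: I'_def)
  have J'1: "finite (J' i) \<and> card I' \<le> card (J' i)" if i: "i \<in> I'" for i
  proof
    have iI: "i \<in> I" using i by (simp add: I'_def)
    have fJ: "finite (J i)" "card I \<le> card (J i)" using Suc.prems(2)[OF iI] by auto
    then show "finite (J' i)" by (simp add: J'_def)
    \<comment> \<open>Two members that reach both down and up to \<open>h\<close> would overlap, so
      each family loses at most one member.\<close>
    have "x = y" if xy: "x \<in> J i - J' i" "y \<in> J i - J' i" for x y
    proof (rule ccontr)
      assume ne: "x \<noteq> y"
      have x: "x \<in> J i" "y \<in> J i" using xy by auto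
      have "\<not> (\<forall>p\<in>G i x. h < snd p)" "\<not> (\<forall>p\<in>G i y. h < snd p)" using xy by (auto simp: J'_def)
      then obtain p q where pq: "p \<in> G i x" "snd p \<le> h" "q \<in> G i y" "snd q \<le> h" by (meson linorder_not_less)
      obtain p' q' where pq': "p' \<in> G i x" "h \<le> snd p'" "q' \<in> G i y" "h \<le> snd q'" using top iI x by meson
      have "apart Up (G i x) (G i y)" using Suc.prems(4)[OF iI x ne] .
      then have "snd p' < snd q \<or> snd q' < snd p" using pq(1,3) pq'(1,3) unfolding apart_def
        by (metis sg.simps(3))
      then show False using pq pq' by linarith
    qed
    then have "card (J i - J' i) \<le> 1" by (metis card_le_Suc0_iff_eq One_nat_def fJ(1) finite_Diff)
    moreover have "card (J i - J' i) = card (J i) - card (J' i)"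
      by (intro card_Diff_subset) (use fJ in \<open>auto simp: J'_def\<close>)
    ultimately show "card I' \<le> card (J' i)" using fJ(2) cI Suc.hyps(2) by linarith
  qed
  have sub: "i \<in> I" "J' i \<subseteq> J i" if "i \<in> I'" for i using that by (auto simp: I'_def J'_def)
  have "\<exists>\<phi>. (\<forall>i\<in>I'. \<phi> i \<in> J' i) \<and> (\<forall>i\<in>I'. \<forall>i'\<in>I'. i \<noteq> i' \<longrightarrow> apart Up (G i (\<phi> i)) (G i' (\<phi> i')))"
  proof (rule Suc.hyps(1)[OF cI])
    show "finite I'" using Suc.prems(1) by (simp add: I'_def)
    fix i assume i: "i \<in> I'"
    show "finite (J' i) \<and> card I' \<le> card (J' i)" using J'1[OF i] .
    fix j assume j: "j \<in> J' i"
    then have j': "j \<in> J i" using sub(2)[OF i] by blast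
    show "G i j \<subseteq> P \<and> G i j \<noteq> {}" using Suc.prems(3)[OF sub(1)[OF i] j'] .
    fix j2 assume "j2 \<in> J' i" "j \<noteq> j2"
    then show "apart Up (G i j) (G i j2)" using Suc.prems(4)[OF sub(1)[OF i] j'] sub(2)[OF i] by blast
  qed
  then obtain \<phi> where \<phi>: "\<And>i. i\<in>I' \<Longrightarrow> \<phi> i \<in> J' i"
    "\<And>i i'. i\<in>I' \<Longrightarrow> i'\<in>I' \<Longrightarrow> i \<noteq> i' \<Longrightarrow> apart Up (G i (\<phi> i)) (G i' (\<phi> i'))" by blast
  have *: "apart Up (G i0 j0) (G i (\<phi> i))" if "i \<in> I'" for i
    using \<phi>(1)[OF that] ub unfolding apart_def J'_def by fastforce
  show ?case
  proof (intro exI[of _ "\<phi>(i0 := j0)"] conjI ballI impI)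
    fix i assume "i \<in> I"
    then show "(\<phi>(i0 := j0)) i \<in> J i" using i0 \<phi>(1)[of i] sub(2)[of i] by (auto simp: I'_def)
  next
    fix i i' assume a: "i \<in> I" "i' \<in> I" "i \<noteq> i'"
    then show "apart Up (G i ((\<phi>(i0 := j0)) i)) (G i' ((\<phi>(i0 := j0)) i'))"
      using *[of i] *[of i'] \<phi>(2)[of i i'] apart_sym by (auto simp: I'_def)
  qed
qed

text \<open>From \<open>m + 1\<close> strips with \<open>m + 1\<close> sets each, vertically apart
  representatives could be chosen, and these would be scattered. So the sweep ends with few piercing
  lines, and no cell can contain a non-monotone set because some line would split it.\<close>

lemma gridding_of_not_scattered:
  assumes gp: "gp P" and nonneg: "\<And>z. z \<in> P \<Longrightarrow> 0 \<le> fst z" and ns: "\<not> scattered (Suc m) P"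
  shows "\<exists>H V. gridding H V P \<and> card H \<le> 2 * m * Suc m \<and> card V \<le> 2 * Suc m"
proof -
  have "\<not> strips (Suc m) (Suc m) (-1) G" for G
  proof
    assume s: "strips (Suc m) (Suc m) (-1) G"
    have "\<exists>\<phi>. (\<forall>i\<in>{..<Suc m}. \<phi> i \<in> {..<Suc m}) \<and>
      (\<forall>i\<in>{..<Suc m}. \<forall>i'\<in>{..<Suc m}. i \<noteq> i' \<longrightarrow> apart Up (G i (\<phi> i)) (G i' (\<phi> i')))"
    proof (rule choose_apart)
      fix i j assume ij: "i \<in> {..<Suc m}" "j \<in> {..<Suc m}"
      then have "G i j \<subseteq> P" "nonmono (G i j)" using s by (auto simp: strips_def)
      then show "G i j \<subseteq> P \<and> G i j \<noteq> {}" using nonmono_pair by blast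
    next
      fix i j j' assume ij: "i \<in> {..<Suc m}" "j \<in> {..<Suc m}" "j' \<in> {..<Suc m}" "j \<noteq> j'"
      then show "apart Up (G i j) (G i j')" using s by (auto simp: strips_def pairwise_apart_def)
    qed auto
    then obtain \<phi> where \<phi>: "\<And>i. i < Suc m \<Longrightarrow> \<phi> i < Suc m"
      "\<And>i i'. i < Suc m \<Longrightarrow> i' < Suc m \<Longrightarrow> i \<noteq> i' \<Longrightarrow> apart Up (G i (\<phi> i)) (G i' (\<phi> i'))" by auto
    define F where "F i = G i (\<phi> i)" for i
    have "F i \<subseteq> P \<and> nonmono (F i)" if "i < Suc m" for i using s \<phi>(1)[OF that] that by (auto simp: strips_def F_def)
    moreover have "apart d (F i) (F j)" if ij: "i < Suc m" "j < Suc m" "i \<noteq> j" for i j d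
    proof -
      have lt: "apart Right (F i) (F j)" if "i < j" "j < Suc m" for i j
      proof -
        have "i < Suc m" using that by simp
        then have "\<forall>p\<in>F i. \<forall>q\<in>F j. fst p < fst q"
          using s \<phi>(1)[of i] \<phi>(1)[of j] that unfolding strips_def F_def by blast
        then show ?thesis by (simp add: apart_def)
      qed
      have R: "apart Right (F i) (F j)" using lt[of i j] lt[of j i] ij apart_sym by (metis linorder_neqE_nat)
      have U: "apart Up (F i) (F j)" using \<phi>(2)[OF ij] by (simp add: F_def)
      show ?thesis using R U apart_opp[of Right] apart_opp[of Up] by (cases d) auto
    qed
    ultimately have "(\<forall>i<Suc m. F i \<subseteq> P \<and> nonmono (F i)) \<and>
     (\<forall>i<Suc m. \<forall>j<Suc m. i \<noteq> j \<longrightarrow> (\<forall>d. apart d (F i) (F j)))" by simp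
    then show False using ns unfolding scattered_def by blast
  qed
  then have "pierced (2 * Suc m) (2 * m * Suc m) (-1)"
    using strips_or_pierce[OF nonneg, of "Suc m" m "-1"] by blast
  then obtain V H where VH: "finite V" "finite H" "card V \<le> 2 * Suc m" "card H \<le> 2 * m * Suc m"
    "V \<inter> \<int> = {}" "H \<inter> \<int> = {}"
    "\<forall>F. F \<subseteq> P \<longrightarrow> nonmono F \<longrightarrow> (\<forall>p\<in>F. -1 < fst p) \<longrightarrow>
        (\<exists>c\<in>V. \<exists>p\<in>F. \<exists>q\<in>F. fst p < c \<and> c < fst q) \<or> (\<exists>c\<in>H. \<exists>p\<in>F. \<exists>q\<in>F. snd p < c \<and> c < snd q)"
    unfolding pierced_def by (elim exE conjE)
  have "increasing_points (cell H V P p) \<or> decreasing_points (cell H V P p)" for p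
  proof (rule ccontr)
    assume no: "\<not> ?thesis"
    let ?F = "cell H V P p"
    have sub: "?F \<subseteq> P" by (auto simp: cell_def)
    have tot: "u = v" if "u \<in> ?F" "v \<in> ?F" "snd u = snd v" for u v
      using gp_sg[OF gp, of u v Up] that sub by auto
    have "nonmono ?F" unfolding nonmono_iff
    proof
      show "\<exists>p\<in>?F. \<exists>q\<in>?F. fst p < fst q \<and> snd p < snd q"
        using no tot unfolding decreasing_points_def by (metis linorder_neqE_linordered_idom order_less_irrefl)
      show "\<exists>p\<in>?F. \<exists>q\<in>?F. fst p < fst q \<and> snd q < snd p"
        using no tot unfolding increasing_points_def by (metis linorder_neqE_linordered_idom order_less_irrefl)
    qed
    moreover have "\<forall>p\<in>?F. -1 < fst p" using nonneg sub by force
    ultimately have "(\<exists>c\<in>V. \<exists>p\<in>?F. \<exists>q\<in>?F. fst p < c \<and> c < fst q) \<or> (\<exists>c\<in>H. \<exists>p\<in>?F. \<exists>q\<in>?F. snd p < c \<and> c < snd q)"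
      using VH(7)[rule_format, OF sub] by simp
    then show False unfolding cell_def by (auto dest: order_less_asym)
  qed
  moreover have "fst ` P \<inter> V = {}" "snd ` P \<inter> H = {}"
    using VH(5,6) intP[of _ Right] intP[of _ Up] by auto
  ultimately have "gridding H V P" using VH(1,2) by (simp add: gridding_def)
  then show ?thesis using VH(3,4) by blast
qed

end

section \<open>Long sums of copies of 21\<close>

definition sum21 :: "nat \<Rightarrow> point set \<Rightarrow> bool" where
  "sum21 n A \<longleftrightarrow> (\<exists>a b. (\<forall>i<n. a i \<in> A \<and> b i \<in> A \<and> fst (a i) < fst (b i) \<and> snd (b i) < snd (a i)) \<and>
     (\<forall>i j. i < j \<longrightarrow> j < n \<longrightarrow> fst (b i) < fst (a j) \<and> snd (a i) < snd (b j)))"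

lemma sum21_of_increasing:
  assumes "\<And>i. i < m \<Longrightarrow> F i \<subseteq> A \<and> (\<exists>p\<in>F i. \<exists>q\<in>F i. fst p < fst q \<and> snd q < snd p)"
    and "\<And>i j p q. i < j \<Longrightarrow> j < m \<Longrightarrow> p \<in> F i \<Longrightarrow> q \<in> F j \<Longrightarrow> fst p < fst q \<and> snd p < snd q"
  shows "sum21 m A"
proof -
  have "\<forall>i. \<exists>p q. i < m \<longrightarrow> p \<in> F i \<and> q \<in> F i \<and> fst p < fst q \<and> snd q < snd p" using assms(1) by meson
  then obtain a b where ab: "\<And>i. i < m \<Longrightarrow> a i \<in> F i \<and> b i \<in> F i \<and> fst (a i) < fst (b i) \<and> snd (b i) < snd (a i)"
    by metis
  have "\<forall>i<m. a i \<in> A \<and> b i \<in> A \<and> fst (a i) < fst (b i) \<and> snd (b i) < snd (a i)" using ab assms(1) by blast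
  moreover have "fst (b i) < fst (a j) \<and> snd (a i) < snd (b j)" if "i < j" "j < m" for i j
    using assms(2)[OF that] ab[of i] ab[of j] that by auto
  ultimately show ?thesis unfolding sum21_def by blast
qed

text \<open>Pairs of sets are coloured by whether the second lies to the right of the first and
  whether it lies above. A homogeneous subfamily is a monotone sequence of sets. Each set contains
  both a 12 and a 21, so if the sequence descends it can be turned upside down.\<close>

lemma sum21_of_scattered:
  "\<exists>n. \<forall>A. scattered n A \<longrightarrow> sum21 m A \<or> sum21 m (tf Right Down ` A)"
proof -
  obtain n where n: "\<And>c::nat \<Rightarrow> nat \<Rightarrow> nat. (\<forall>x y. c x y < 4) \<Longrightarrow> (\<exists>h i. (\<forall>x<m. \<forall>y<m. x < y \<longrightarrow> h x < h y) \<and>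
     (\<forall>x<m. h x < n) \<and> (\<forall>x y. x < y \<longrightarrow> y < m \<longrightarrow> c (h x) (h y) = i))" using ramsey_pairs[of 4 m] by blast
  show ?thesis
  proof (intro exI[of _ n] allI impI)
    fix A assume "scattered n A"
    from this[unfolded scattered_def] obtain F where F0: "\<forall>i<n. F i \<subseteq> A \<and> nonmono (F i)"
      "\<forall>i<n. \<forall>j<n. i \<noteq> j \<longrightarrow> (\<forall>d. apart d (F i) (F j))"
      by (elim exE conjE)
    define lt where "lt d i j \<longleftrightarrow> (\<forall>p\<in>F i. \<forall>q\<in>F j. sg d p < sg d q)" for d i j
    define c :: "nat \<Rightarrow> nat \<Rightarrow> nat" where "c i j = (if lt Right i j then 0 else 1) + (if lt Up i j then 0 else 2)" for i j
    have "\<forall>x y. c x y < 4" by (simp add: c_def)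
    then obtain h col where h: "\<And>x y. x < y \<Longrightarrow> y < m \<Longrightarrow> h x < h y" "\<And>x. x < m \<Longrightarrow> h x < n"
      "\<And>x y. x < y \<Longrightarrow> y < m \<Longrightarrow> c (h x) (h y) = col" using n[of c] by (metis order.strict_trans)
    define K where "K x = F (h x)" for x
    have nm: "K i \<subseteq> A" "nonmono (K i)" if "i < m" for i using F0 h(2)[OF that] by (auto simp: K_def)
    have ap: "apart d (K i) (K j)" if "i < j" "j < m" for i j d
      using F0(2) h(1)[OF that] h(2)[OF that(2)] h(2)[of i] that by (simp add: K_def)
    obtain \<alpha> \<beta> where ab: "\<And>i j. i < j \<Longrightarrow> j < m \<Longrightarrow> lt Right (h i) (h j) \<longleftrightarrow> \<alpha>"
       "\<And>i j. i < j \<Longrightarrow> j < m \<Longrightarrow> lt Up (h i) (h j) \<longleftrightarrow> \<beta>"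
    proof (rule that[of "col = 0 \<or> col = 2" "col = 0 \<or> col = 1"])
      fix i j :: nat assume "i < j" "j < m"
      then have "c (h i) (h j) = col" using h(3) by blast
      then show "lt Right (h i) (h j) \<longleftrightarrow> (col = 0 \<or> col = 2)" "lt Up (h i) (h j) \<longleftrightarrow> (col = 0 \<or> col = 1)"
        by (auto simp: c_def split: if_splits)
    qed
    have R: "if \<alpha> then fst p < fst q else fst q < fst p" if "i < j" "j < m" "p \<in> K i" "q \<in> K j" for i j p q
      using ab(1)[OF that(1,2)] ap[OF that(1,2), of Right] that(3,4) unfolding lt_def apart_def K_def by auto
    have U: "if \<beta> then snd p < snd q else snd q < snd p" if "i < j" "j < m" "p \<in> K i" "q \<in> K j" for i j p q
      using ab(2)[OF that(1,2)] ap[OF that(1,2), of Up] that(3,4) unfolding lt_def apart_def K_def by auto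
    have nm': "(\<exists>p\<in>K i. \<exists>q\<in>K i. fst p < fst q \<and> snd q < snd p)" "(\<exists>p\<in>K i. \<exists>q\<in>K i. fst p < fst q \<and> snd p < snd q)"
      if "i < m" for i using nm(2)[OF that] unfolding nonmono_iff by blast+
    \<comment> \<open>The sets are renumbered so that they run from left to right.\<close>
    define K' where "K' x = (if \<alpha> then K x else K (m - 1 - x))" for x
    have K'i: "K' i \<subseteq> A \<and> (\<exists>p\<in>K' i. \<exists>q\<in>K' i. fst p < fst q \<and> snd q < snd p) \<and> (\<exists>p\<in>K' i. \<exists>q\<in>K' i. fst p < fst q \<and> snd p < snd q)"
      if "i < m" for i
    proof -
      have "m - 1 - i < m" using that by simp
      then show ?thesis unfolding K'_def using nm(1)[OF that] nm'[OF that] nm(1)[of "m - 1 - i"] nm'[of "m - 1 - i"] by simp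
    qed
    have K': "fst p < fst q \<and> (if \<alpha> = \<beta> then snd p < snd q else snd q < snd p)"
      if "i < j" "j < m" "p \<in> K' i" "q \<in> K' j" for i j p q
    proof (cases \<alpha>)
      case True
      then show ?thesis using R[OF that(1,2), of p q] U[OF that(1,2), of p q] that(3,4) by (simp add: K'_def)
    next
      case False
      have "m - 1 - j < m - 1 - i" "m - 1 - i < m" using that by auto
      then show ?thesis using False R[of "m - 1 - j" "m - 1 - i" q p] U[of "m - 1 - j" "m - 1 - i" q p] that(3,4)
        by (simp add: K'_def)
    qed
    show "sum21 m A \<or> sum21 m (tf Right Down ` A)"
    proof (cases "\<alpha> = \<beta>")
      case True
      have "sum21 m A" by (rule sum21_of_increasing[of m K']) (use K'i K' True in auto)
      then show ?thesis ..
    next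
      case False
      have "sum21 m (tf Right Down ` A)"
      proof (rule sum21_of_increasing[of m "\<lambda>i. tf Right Down ` K' i"])
        fix i
        show "i < m \<Longrightarrow> tf Right Down ` K' i \<subseteq> tf Right Down ` A \<and>
           (\<exists>p\<in>tf Right Down ` K' i. \<exists>q\<in>tf Right Down ` K' i. fst p < fst q \<and> snd q < snd p)"
        proof -
          assume im: "i < m"
          obtain p q where pq: "p \<in> K' i" "q \<in> K' i" "fst p < fst q" "snd p < snd q" using K'i[OF im] by blast
          have "fst (tf Right Down p) < fst (tf Right Down q) \<and> snd (tf Right Down q) < snd (tf Right Down p)"
            using pq by (simp add: tf_def)
          then have "\<exists>p\<in>tf Right Down ` K' i. \<exists>q\<in>tf Right Down ` K' i. fst p < fst q \<and> snd q < snd p"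
            using pq by blast
          then show ?thesis using K'i[OF im] by blast
        qed
      next
        fix i j p q assume "i < j" "j < m" "p \<in> tf Right Down ` K' i" "q \<in> tf Right Down ` K' j"
        then show "fst p < fst q \<and> snd p < snd q" using K'[of i j] False by (auto simp: tf_def)
      qed
      then show ?thesis ..
    qed
  qed
qed

section \<open>Simple subsets and pin sequences\<close>

text \<open>Collapsing a proper interval that contains at most one point of \<open>U\<close> to a single point keeps
  the hypothesis, so minimal counterexamples do not exist.\<close>

lemma simple_subset:
  assumes "gp A" "U \<subseteq> A" "\<exists>u\<in>U. \<exists>v\<in>U. u \<noteq> v"
    and "\<And>I u v. ivl A I \<Longrightarrow> u \<in> U \<Longrightarrow> v \<in> U \<Longrightarrow> u \<noteq> v \<Longrightarrow> u \<in> I \<Longrightarrow> v \<in> I \<Longrightarrow> I = A"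
  shows "\<exists>B. U \<subseteq> B \<and> B \<subseteq> A \<and> simple_set B"
  using assms
proof (induction "card A" arbitrary: A rule: less_induct)
  case less
  show ?case
  proof (cases "simple_set A")
    case True
    then show ?thesis using less.prems(2) by blast
  next
    case False
    then obtain I x y where I: "ivl A I" "x \<in> I" "y \<in> I" "x \<noteq> y" "I \<noteq> A"
      using less.prems(1-3) unfolding simple_set_def by blast
    have one: "u = v" if "u \<in> U" "v \<in> U" "u \<in> I" "v \<in> I" for u v
      using less.prems(4)[OF I(1) that(1,2) _ that(3,4)] I(5) by blast
    have sub: "I \<subseteq> A" using I(1) by (simp add: ivl_def)
    obtain z where z: "z \<in> I" "\<And>u. u \<in> U \<Longrightarrow> u \<in> I \<Longrightarrow> u = z" using one I(2) by blast
    define B where "B = A - (I - {z})"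
    have fin: "finite A" using less.prems(1) by (simp add: gp_def)
    have BA: "B \<subseteq> A" by (auto simp: B_def)
    have "B \<noteq> A" using I(2-4) sub z(1) unfolding B_def by blast
    then have card: "card B < card A" using BA fin by (simp add: psubset_card_mono psubsetI)
    have UB: "U \<subseteq> B" using less.prems(2) z(2) by (auto simp: B_def)
    have BI: "B \<inter> I = {z}" using z(1) sub by (auto simp: B_def)
    have "J = B" if J: "ivl B J" "u \<in> U" "v \<in> U" "u \<noteq> v" "u \<in> J" "v \<in> J" for J u v
    proof -
      have JB: "J \<subseteq> B" using J(1) by (simp add: ivl_def)
      \<comment> \<open>\<open>r\<close> collapses \<open>A\<close> onto \<open>B\<close> by sending
        all of \<open>I\<close> to \<open>z\<close>, and \<open>J'\<close> is the preimage of
        \<open>J\<close> under it.\<close>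
      define J' where "J' = (if z \<in> J then J \<union> I else J)"
      define r where "r w = (if w \<in> I then z else w)" for w
      have rB: "r w \<in> B" if "w \<in> A" for w using that BI by (auto simp: r_def B_def)
      have rJ: "r w \<in> J" if "w \<in> J'" for w using that BI JB by (auto simp: r_def J'_def split: if_splits)
      have rJ': "w \<in> J'" if "w \<in> A" "r w \<in> J" for w using that by (auto simp: r_def J'_def split: if_splits)
      have cmp: "sg d w < sg d (r t)" if "w \<in> A" "t \<in> A" "w \<notin> I" "sg d w < sg d t" for w t d
      proof (rule ccontr)
        assume n: "\<not> sg d w < sg d (r t)"
        then have t: "t \<in> I" "r t = z" using that(4) by (auto simp: r_def split: if_splits)
        have "sg d w \<noteq> sg d z" using gp_sg[OF less.prems(1) that(1), of z d] z(1) sub that(3) by auto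
        then have "sg d z < sg d w" using n t by simp
        then show False using ivlD[OF I(1) z(1) t(1) that(1) _ that(4)] that(3) by blast
      qed
      have cmp': "sg d (r t) < sg d w" if "w \<in> A" "t \<in> A" "w \<notin> I" "sg d t < sg d w" for w t d
        using cmp[of w t "opp d"] that by simp
      have "ivl A J'"
        unfolding ivl_def
      proof (intro conjI ballI allI notI)
        show "J' \<subseteq> A" using JB BA sub by (auto simp: J'_def)
        fix w p q d
        assume w: "w \<in> A - J'" and pq: "p \<in> J'" "q \<in> J'" and l: "sg d p < sg d w \<and> sg d w < sg d q"
        have pqA: "p \<in> A" "q \<in> A" using pq \<open>J' \<subseteq> A\<close> by auto
        show False
        proof (cases "w \<in> I")
          case False
          have "sg d (r p) < sg d w" "sg d w < sg d (r q)" using cmp cmp' w pqA False l by blast+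
          then have "w \<in> J" using ivlD[OF J(1) rJ[OF pq(1)] rJ[OF pq(2)]] rB[of w] w False by (simp add: r_def)
          then show False using w by (auto simp: J'_def split: if_splits)
        next
          case True
          then have zJ: "z \<notin> J" using w by (auto simp: J'_def)
          then have "p \<in> J" "q \<in> J" using pq by (auto simp: J'_def)
          moreover from this have "p \<notin> I" "q \<notin> I" using BI JB zJ by auto
          ultimately have "sg d p < sg d z" "sg d z < sg d q"
            using cmp[of p w d] cmp'[of q w d] w pqA l True by (auto simp: r_def)
          then show False using ivlD[OF J(1) \<open>p \<in> J\<close> \<open>q \<in> J\<close>, of z d] zJ BI by blast
        qed
      qed
      moreover have "u \<in> J'" "v \<in> J'" using J by (auto simp: J'_def)
      ultimately have "J' = A" using less.prems(4) J(2-4) by blast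
      then show "J = B"
      proof -
        have "w \<in> J" if "w \<in> B" for w
        proof -
          have "w \<in> J'" using that BA \<open>J' = A\<close> by blast
          moreover have "r w = w" using that BI by (auto simp: r_def)
          ultimately show ?thesis using rJ[of w] by simp
        qed
        then show ?thesis using JB by blast
      qed
    qed
    then obtain B' where "U \<subseteq> B'" "B' \<subseteq> B" "simple_set B'"
      using less.hyps[OF card gp_subset[OF less.prems(1) BA] UB less.prems(3)] by blast
    then show ?thesis using BA by blast
  qed
qed

text \<open>The hull of everything replaces \<open>A\<close>, since an interval of an interval is an interval; dropping
  every other pair makes two points of different pairs enclose a dropped pair.\<close>

lemma simple_of_sum21:
  fixes a b :: "nat \<Rightarrow> point"
  assumes gp: "gp A" and k: "0 < k"
    and ab: "\<And>i. i < 2 * k + 2 \<Longrightarrow> a i \<in> A \<and> b i \<in> A \<and> fst (a i) < fst (b i) \<and> snd (b i) < snd (a i)"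
    and inc: "\<And>i j. i < j \<Longrightarrow> j < 2 * k + 2 \<Longrightarrow> fst (b i) < fst (a j) \<and> snd (a i) < snd (b j)"
    and closed: "\<And>I i j. ivl A I \<Longrightarrow> i < 2 * k + 2 \<Longrightarrow> j < 2 * k + 2 \<Longrightarrow> a i \<in> I \<Longrightarrow> b i \<in> I \<Longrightarrow> a j \<in> I \<and> b j \<in> I"
  shows "\<exists>B\<subseteq>A. simple_set B \<and> scattered (k div 2) B"
proof -
  let ?n = "2 * k + 2"
  have lt: "fst u < fst v \<and> snd u < snd v" if "i < j" "j < ?n" "u \<in> {a i, b i}" "v \<in> {a j, b j}" for i j u v
    using inc[OF that(1,2)] ab[of i] ab[of j] that by auto
  define J where "J = \<Inter>{I. ivl A I \<and> a 0 \<in> I \<and> b 0 \<in> I}"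
  have ivlA: "ivl A A" by (simp add: ivl_def)
  have JA: "J \<subseteq> A" using ivlA ab[of 0] by (auto simp: J_def)
  have Jivl: "ivl A J"
    unfolding ivl_def
  proof (intro conjI ballI allI notI)
    fix z u v d assume z: "z \<in> A - J" and uv: "u \<in> J" "v \<in> J" and l: "sg d u < sg d z \<and> sg d z < sg d v"
    obtain I where I: "ivl A I" "a 0 \<in> I" "b 0 \<in> I" "z \<notin> I" using z by (auto simp: J_def)
    have "u \<in> I" "v \<in> I" using uv I by (auto simp: J_def)
    then show False using ivlD[OF I(1)] z l I(4) by blast
  qed (use JA in auto)
  have ab0: "a 0 \<in> J" "b 0 \<in> J" by (auto simp: J_def)
  have abJ: "a j \<in> J \<and> b j \<in> J" if "j < ?n" for j using closed[OF Jivl _ that, of 0] ab0 by simp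
  have full: "I = J" if I: "ivl J I" "i < ?n" "a i \<in> I" "b i \<in> I" for I i
  proof -
    have IJ: "I \<subseteq> J" using I(1) by (simp add: ivl_def)
    have "ivl A I"
      unfolding ivl_def
    proof (intro conjI ballI allI notI)
      show "I \<subseteq> A" using IJ JA by blast
      fix z u v d assume z: "z \<in> A - I" and uv: "u \<in> I" "v \<in> I" and l: "sg d u < sg d z \<and> sg d z < sg d v"
      have "z \<in> J" using ivlD[OF Jivl, of u v z d] uv IJ z l by blast
      then show False using ivlD[OF I(1) uv] z l by blast
    qed
    then have "a 0 \<in> I" "b 0 \<in> I" using closed[of I i 0] I by simp_all
    then have "J \<subseteq> I" using \<open>ivl A I\<close> by (auto simp: J_def)
    then show ?thesis using IJ by blast
  qed
  define U where "U = (\<Union>i<k. {a (2 * i), b (2 * i)})"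
  have full2: "I = J" if I: "ivl J I" and uv: "u \<in> U" "v \<in> U" "u \<noteq> v" "u \<in> I" "v \<in> I" for I u v
  proof -
    obtain i j where ij: "i < k" "j < k" "u \<in> {a (2 * i), b (2 * i)}" "v \<in> {a (2 * j), b (2 * j)}"
      using uv unfolding U_def by blast
    have btw: "I = J" if "i < j" "j < k" "u \<in> {a (2 * i), b (2 * i)}" "v \<in> {a (2 * j), b (2 * j)}" "u \<in> I" "v \<in> I" for i j u v
    proof -
      let ?l = "2 * i + 1"
      have l: "?l < ?n" "2 * i < ?l" "?l < 2 * j" "2 * j < ?n" using that by auto
      have "w \<in> I" if w: "w \<in> {a ?l, b ?l}" for w
      proof -
        have "fst u < fst w" using lt[OF l(2,1) \<open>u \<in> {a (2 * i), b (2 * i)}\<close> w] by blast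
        moreover have "fst w < fst v" using lt[OF l(3,4) w \<open>v \<in> {a (2 * j), b (2 * j)}\<close>] by blast
        moreover have "w \<in> J" using abJ[OF l(1)] w by auto
        ultimately show ?thesis using ivlD[OF I \<open>u \<in> I\<close> \<open>v \<in> I\<close>, of w Right] by simp
      qed
      then show ?thesis using full[OF I l(1)] by blast
    qed
    consider "i < j" | "j < i" | "i = j" by linarith
    then show ?thesis
    proof cases
      case 1 then show ?thesis using btw[of i j u v] ij uv by blast
    next
      case 2 then show ?thesis using btw[of j i v u] ij uv by blast
    next
      case 3
      then have "a (2 * i) \<in> I" "b (2 * i) \<in> I" using ij uv by auto
      then show ?thesis using full[OF I, of "2 * i"] ij by simp
    qed
  qed
  have "a 0 \<in> U" "b 0 \<in> U" "a 0 \<noteq> b 0" using k ab[of 0] by (force simp: U_def)+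
  then have ex: "\<exists>u\<in>U. \<exists>v\<in>U. u \<noteq> v" by blast
  have UJ: "U \<subseteq> J" using abJ by (auto simp: U_def)
  have "\<exists>B. U \<subseteq> B \<and> B \<subseteq> J \<and> simple_set B"
    by (rule simple_subset[OF gp_subset[OF gp JA] UJ ex full2])
  then obtain B where B: "U \<subseteq> B" "B \<subseteq> J" "simple_set B" by blast
  \<comment> \<open>One copy of 21 is monotone. Two consecutive kept copies together are not, which
    costs a factor of two.\<close>
  define F where "F i = {a (4 * i), b (4 * i), a (4 * i + 2), b (4 * i + 2)}" for i
  have F1: "F i \<subseteq> U \<and> nonmono (F i)" if i: "i < k div 2" for i
  proof
    have "2 * i < k" "2 * i + 1 < k" using i by auto
    moreover have "4 * i = 2 * (2 * i)" "4 * i + 2 = 2 * (2 * i + 1)" by auto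
    moreover have "a (2 * j) \<in> U" "b (2 * j) \<in> U" if "j < k" for j using that by (auto simp: U_def)
    ultimately show "F i \<subseteq> U" unfolding F_def by (metis empty_subsetI insert_subset)
    have n: "4 * i + 2 < ?n" "4 * i < ?n" using i by auto
    have "fst (a (4 * i)) < fst (a (4 * i + 2)) \<and> snd (a (4 * i)) < snd (a (4 * i + 2))"
      by (rule lt[of "4 * i" "4 * i + 2" "a (4 * i)" "a (4 * i + 2)"]) (use n in simp_all)
    then show "nonmono (F i)" unfolding nonmono_iff F_def using ab[OF n(2)] by (auto simp del: split_paired_All split_paired_Ex)
  qed
  have F2: "apart d (F i) (F j)" if ij: "i < j" "j < k div 2" for i j d
  proof -
    have "fst u < fst v \<and> snd u < snd v" if uv: "u \<in> F i" "v \<in> F j" for u v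
    proof -
      obtain i' where i': "i' = 4 * i \<or> i' = 4 * i + 2" "u \<in> {a i', b i'}" using uv(1) unfolding F_def by blast
      obtain j' where j': "j' = 4 * j \<or> j' = 4 * j + 2" "v \<in> {a j', b j'}" using uv(2) unfolding F_def by blast
      have "i' < j'" "j' < ?n" using i' j' ij by auto
      then show ?thesis using lt i'(2) j'(2) by blast
    qed
    then show ?thesis unfolding apart_def by (cases d) auto
  qed
  have "scattered (k div 2) B"
    unfolding scattered_def
  proof (intro exI[of _ F] conjI allI impI)
    show "F i \<subseteq> B" "nonmono (F i)" if "i < k div 2" for i using F1[OF that] B(1) by auto
    show "apart d (F i) (F j)" if "i < k div 2" "j < k div 2" "i \<noteq> j" for i j d
      using F2[of i j d] F2[of j i d] that unfolding apart_def by (metis linorder_neqE_nat)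
  qed
  then show ?thesis using B JA by blast
qed

text \<open>\<open>p 2\<close> gets a direction as well, namely the one in which \<open>p 3\<close> separates it from \<open>p 1\<close>.\<close>

definition pins :: "nat \<Rightarrow> (nat \<Rightarrow> point) \<Rightarrow> (nat \<Rightarrow> direction) \<Rightarrow> bool" where
  "pins m p D \<longleftrightarrow> (\<forall>i\<in>{3..m}. perp (D i) (D (i - 1)) \<and>
     (\<forall>j\<in>{1..<i}. sg (D i) (p j) < sg (D i) (p i)) \<and>
     (\<forall>j\<in>{1..<i - 1}. sg (D (i - 1)) (p j) < sg (D (i - 1)) (p i)) \<and>
     sg (D (i - 1)) (p i) < sg (D (i - 1)) (p (i - 1)))"

lemma pinsD:
  assumes "pins m p D" "3 \<le> i" "i \<le> m"
  shows "perp (D i) (D (i - 1))"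
    and "1 \<le> j \<Longrightarrow> j < i \<Longrightarrow> sg (D i) (p j) < sg (D i) (p i)"
    and "1 \<le> j \<Longrightarrow> j < i - 1 \<Longrightarrow> sg (D (i - 1)) (p j) < sg (D (i - 1)) (p i)"
    and "sg (D (i - 1)) (p i) < sg (D (i - 1)) (p (i - 1))"
  using assms unfolding pins_def by auto

lemma slices_iff:
  assumes "finite S" "S \<noteq> {}"
  shows "slices z S \<longleftrightarrow> (\<exists>d e. perp d e \<and> (\<exists>s\<in>S. \<exists>t\<in>S. sg d s < sg d z \<and> sg d z < sg d t) \<and> (\<forall>s\<in>S. sg e s < sg e z))"
proof -
  have L: "fst z \<in> {Min (fst ` S)<..<Max (fst ` S)} \<longleftrightarrow> (\<exists>s\<in>S. \<exists>t\<in>S. fst s < fst z \<and> fst z < fst t)"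
    "fst z \<notin> {Min (fst ` S)..Max (fst ` S)} \<longleftrightarrow> (\<forall>s\<in>S. fst s < fst z) \<or> (\<forall>s\<in>S. fst z < fst s)"
    "snd z \<in> {Min (snd ` S)<..<Max (snd ` S)} \<longleftrightarrow> (\<exists>s\<in>S. \<exists>t\<in>S. snd s < snd z \<and> snd z < snd t)"
    "snd z \<notin> {Min (snd ` S)..Max (snd ` S)} \<longleftrightarrow> (\<forall>s\<in>S. snd s < snd z) \<or> (\<forall>s\<in>S. snd z < snd s)"
    using assms by (auto simp: Min_less_iff Max_gr_iff Max_less_iff Min_gr_iff not_le)
  show ?thesis
  proof
    assume "slices z S"
    then consider "\<exists>s\<in>S. \<exists>t\<in>S. fst s < fst z \<and> fst z < fst t" "(\<forall>s\<in>S. snd s < snd z) \<or> (\<forall>s\<in>S. snd z < snd s)" |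
      "\<exists>s\<in>S. \<exists>t\<in>S. snd s < snd z \<and> snd z < snd t" "(\<forall>s\<in>S. fst s < fst z) \<or> (\<forall>s\<in>S. fst z < fst s)"
      unfolding slices_def L by blast
    then show "\<exists>d e. perp d e \<and> (\<exists>s\<in>S. \<exists>t\<in>S. sg d s < sg d z \<and> sg d z < sg d t) \<and> (\<forall>s\<in>S. sg e s < sg e z)"
    proof cases
      case 1
      have pp: "perp Right Up" "perp Right Down" by (auto simp: perp_def)
      from 1(2) show ?thesis
      proof
        assume "\<forall>s\<in>S. snd s < snd z"
        then show ?thesis using 1(1) pp by (intro exI[of _ Right] exI[of _ Up]) simp
      next
        assume "\<forall>s\<in>S. snd z < snd s"
        then show ?thesis using 1(1) pp by (intro exI[of _ Right] exI[of _ Down]) simp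
      qed
    next
      case 2
      have pp: "perp Up Right" "perp Up Left" by (auto simp: perp_def)
      from 2(2) show ?thesis
      proof
        assume "\<forall>s\<in>S. fst s < fst z"
        then show ?thesis using 2(1) pp by (intro exI[of _ Up] exI[of _ Right]) simp
      next
        assume "\<forall>s\<in>S. fst z < fst s"
        then show ?thesis using 2(1) pp by (intro exI[of _ Up] exI[of _ Left]) simp
      qed
    qed
  next
    assume "\<exists>d e. perp d e \<and> (\<exists>s\<in>S. \<exists>t\<in>S. sg d s < sg d z \<and> sg d z < sg d t) \<and> (\<forall>s\<in>S. sg e s < sg e z)"
    then obtain d e s t where de: "perp d e" and st: "s \<in> S" "t \<in> S" "sg d s < sg d z" "sg d z < sg d t"
      and e: "\<forall>s\<in>S. sg e s < sg e z" by blast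
    show "slices z S"
    proof (cases "vertical d")
      case True
      then have "\<exists>s\<in>S. \<exists>t\<in>S. snd s < snd z \<and> snd z < snd t"
        using st by (cases d) auto
      moreover have "(\<forall>s\<in>S. fst s < fst z) \<or> (\<forall>s\<in>S. fst z < fst s)"
        using True de e by (cases e) (auto simp: perp_def)
      ultimately show ?thesis unfolding slices_def L by blast
    next
      case False
      then have "\<exists>s\<in>S. \<exists>t\<in>S. fst s < fst z \<and> fst z < fst t"
        using st by (cases d) auto
      moreover have "(\<forall>s\<in>S. snd s < snd z) \<or> (\<forall>s\<in>S. snd z < snd s)"
        using False de e by (cases e) (auto simp: perp_def)
      ultimately show ?thesis unfolding slices_def L by blast
    qed
  qed
qed

lemma slices_between:
  assumes "finite S" "S \<noteq> {}" "slices z S"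
  shows "\<exists>d. \<exists>s\<in>S. \<exists>t\<in>S. sg d s < sg d z \<and> sg d z < sg d t"
  using assms(3) unfolding slices_iff[OF assms(1,2)] by (elim exE conjE) (rule exI)

lemma separates_iff: "separates z S w \<longleftrightarrow> (\<exists>d. (\<forall>s\<in>S. sg d s < sg d z) \<and> sg d z < sg d w)"
  unfolding separates_def further_sg by blast

lemma pin_direction_iff: "pin_direction p i d \<longleftrightarrow> 3 \<le> i \<and> (\<forall>j\<in>{1..<i}. sg d (p j) < sg d (p i))"
  unfolding pin_direction_def further_sg by blast

text \<open>Along the axis of \<open>D (i - 1)\<close> the pin lies between \<open>p 1\<close> and
  \<open>p (i - 1)\<close>, which excludes both directions of that axis; and
  \<open>opp (D i)\<close> is excluded because the pin is beyond \<open>p 1\<close> in direction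
  \<open>D i\<close>.\<close>

lemma pins_direction:
  assumes "pins m p D" "3 \<le> i" "i \<le> m"
  shows "pin_direction p i d \<longleftrightarrow> d = D i"
proof
  assume "d = D i"
  then show "pin_direction p i d" using pinsD(2)[OF assms] assms(2) by (simp add: pin_direction_iff)
next
  assume d: "pin_direction p i d"
  have j: "sg d (p j) < sg d (p i)" if "1 \<le> j" "j < i" for j using d that by (simp add: pin_direction_iff)
  have o1: "sg (D (i - 1)) (p 1) < sg (D (i - 1)) (p i)" "sg (D (i - 1)) (p i) < sg (D (i - 1)) (p (i - 1))"
    using pinsD(3)[OF assms, of 1] pinsD(4)[OF assms] assms(2) by auto
  have o2: "sg (D i) (p 1) < sg (D i) (p i)" using pinsD(2)[OF assms, of 1] assms(2) by auto
  have "d = D i \<or> d = opp (D i) \<or> d = D (i - 1) \<or> d = opp (D (i - 1))"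
    using pinsD(1)[OF assms] direction_cases_perp by blast
  moreover have "1 \<le> i - 1" "i - 1 < i" "1 < i" using assms(2) by auto
  ultimately show "d = D i" using o1 o2 j[of 1] j[of "i - 1"] by auto
qed

text \<open>Maximality is automatic when the pins are the whole permutation: a later pin lies beyond
  all pins other than its immediate predecessor in two perpendicular directions. It therefore sits
  in a corner of the earlier rectangle and does not slice it.\<close>

lemma pins_proper:
  assumes P: "pins m p D" and ne: "p 1 \<noteq> p 2"
  shows "proper_pin_sequence (p ` {1..m}) m p"
proof -
  have inj: "inj_on p {1..m}"
  proof (rule inj_onI)
    have *: "p x \<noteq> p y" if xy: "1 \<le> x" "x < y" "y \<le> m" for x y
    proof (cases "y = 2")
      case True
      then have "x = 1" using xy by simp
      then show ?thesis using True ne by simp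
    next
      case False
      then show ?thesis using pinsD(2)[OF P, of y x] xy by fastforce
    qed
    fix x y assume "x \<in> {1..m}" "y \<in> {1..m}" "p x = p y"
    then show "x = y" using *[of x y] *[of y x] by (metis atLeastAtMost_iff linorder_neqE_nat)
  qed
  have sl: "slices (p i) (p ` {1..<i})" if i: "3 \<le> i" "i \<le> m" for i
  proof -
    have "perp (D (i - 1)) (D i)" using pinsD(1)[OF P i] perp_sym by blast
    moreover have "sg (D (i - 1)) (p 1) < sg (D (i - 1)) (p i)" "sg (D (i - 1)) (p i) < sg (D (i - 1)) (p (i - 1))"
      using pinsD(3)[OF P i, of 1] pinsD(4)[OF P i] i by auto
    moreover have "p 1 \<in> p ` {1..<i}" "p (i - 1) \<in> p ` {1..<i}" using i by auto
    moreover have "\<forall>s\<in>p ` {1..<i}. sg (D i) s < sg (D i) (p i)" using pinsD(2)[OF P i] by auto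
    moreover have "p ` {1..<i} \<noteq> {}" using i by auto
    ultimately show ?thesis using slices_iff[of "p ` {1..<i}" "p i"] by blast
  qed
  have mx: "\<not> (\<exists>q\<in>p ` {1..m}. further d q (p i) \<and> slices q (p ` {1..<i}))"
    if i: "3 \<le> i" "i \<le> m" and d: "pin_direction p i d" for i d
  proof
    assume "\<exists>q\<in>p ` {1..m}. further d q (p i) \<and> slices q (p ` {1..<i})"
    then obtain l where l: "1 \<le> l" "l \<le> m" "sg d (p i) < sg d (p l)" "slices (p l) (p ` {1..<i})"
      by (auto simp: further_sg)
    have dD: "d = D i" using pins_direction[OF P i] d by blast
    have "i < l" using l(1,3) pinsD(2)[OF P i, of l] dD by (metis linorder_neqE_nat order_less_asym order_less_irrefl)
    have l3: "3 \<le> l" using i \<open>i < l\<close> by simp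
    have A: "sg (D l) (p j) < sg (D l) (p l)" "sg (D (l - 1)) (p j) < sg (D (l - 1)) (p l)" if "1 \<le> j" "j < i" for j
      using pinsD(2,3)[OF P l3 l(2), of j] that \<open>i < l\<close> by auto
    have pp: "perp (D l) (D (l - 1))" using pinsD(1)[OF P l3 l(2)] .
    have "p ` {1..<i} \<noteq> {}" using i by auto
    from slices_between[OF _ this l(4)]
    obtain d' s t where st: "s \<in> p ` {1..<i}" "t \<in> p ` {1..<i}" "sg d' s < sg d' (p l)" "sg d' (p l) < sg d' t"
      by blast
    have "d' = D l \<or> d' = opp (D l) \<or> d' = D (l - 1) \<or> d' = opp (D (l - 1))"
      using pp direction_cases_perp by blast
    moreover have "sg (D l) t < sg (D l) (p l)" "sg (D (l - 1)) t < sg (D (l - 1)) (p l)"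
      "sg (D l) s < sg (D l) (p l)" "sg (D (l - 1)) s < sg (D (l - 1)) (p l)"
      using A st(1,2) by auto
    ultimately show False using st(3,4) by (elim disjE) simp_all
  qed
  have sep: "separates (p (i + 1)) (p ` {1..<i}) (p i)" if "2 \<le> i" "i < m" for i
    using pinsD(3,4)[OF P, of "i + 1"] that by (auto simp: separates_iff intro!: exI[of _ "D i"])
  show ?thesis unfolding proper_pin_sequence_def pin_sequence_def
    using inj sl mx sep by auto
qed

text \<open>For a pin with a successor, the direction is the one in which the successor separates it
  from the earlier rectangle; slicing forces the same direction. The last pin has no successor and
  takes the direction in which it slices.\<close>

lemma proper_pins:
  assumes pr: "proper_pin_sequence A m p" and gpA: "gp A"
  shows "\<exists>D. pins m p D"
proof -
  have inj: "inj_on p {1..m}" and pA: "p ` {1..m} \<subseteq> A"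
    and sl: "\<And>i. i \<in> {3..m} \<Longrightarrow> slices (p i) (p ` {1..<i})"
    and sep: "\<And>i. i \<in> {2..<m} \<Longrightarrow> separates (p (i + 1)) (p ` {1..<i}) (p i)"
    using pr unfolding proper_pin_sequence_def pin_sequence_def by auto
  have "\<exists>D. \<forall>i. i \<in> {2..<m} \<longrightarrow> (\<forall>j\<in>{1..<i}. sg (D i) (p j) < sg (D i) (p (i + 1))) \<and> sg (D i) (p (i + 1)) < sg (D i) (p i)"
  proof (rule choice, intro allI)
    fix i show "\<exists>y. i \<in> {2..<m} \<longrightarrow> (\<forall>j\<in>{1..<i}. sg y (p j) < sg y (p (i + 1))) \<and> sg y (p (i + 1)) < sg y (p i)"
      using sep[of i] by (auto simp: separates_iff)
  qed
  then obtain D' where D0: "\<forall>i. i \<in> {2..<m} \<longrightarrow> (\<forall>j\<in>{1..<i}. sg (D' i) (p j) < sg (D' i) (p (i + 1))) \<and> sg (D' i) (p (i + 1)) < sg (D' i) (p i)"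
    by (elim exE)
  have D': "\<And>i j. i \<in> {2..<m} \<Longrightarrow> 1 \<le> j \<Longrightarrow> j < i \<Longrightarrow> sg (D' i) (p j) < sg (D' i) (p (i + 1))"
    "\<And>i. i \<in> {2..<m} \<Longrightarrow> sg (D' i) (p (i + 1)) < sg (D' i) (p i)" using D0 by auto
  have main: "\<exists>e. perp e (D' (i - 1)) \<and> (\<forall>j\<in>{1..<i}. sg e (p j) < sg e (p i)) \<and> (i < m \<longrightarrow> e = D' i)"
    if i: "3 \<le> i" "i \<le> m" for i
  proof -
    have ne: "p ` {1..<i} \<noteq> {}" using i by auto
    have "slices (p i) (p ` {1..<i})" using sl i by simp
    then obtain d e where de: "perp d e" and "\<exists>s\<in>p ` {1..<i}. \<exists>t\<in>p ` {1..<i}. sg d s < sg d (p i) \<and> sg d (p i) < sg d t"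
        and e: "\<forall>s\<in>p ` {1..<i}. sg e s < sg e (p i)"
      using slices_iff[of "p ` {1..<i}" "p i"] ne by auto
    have e': "sg e (p j) < sg e (p i)" if "1 \<le> j" "j < i" for j using e that by auto
    have f: "sg (D' (i - 1)) (p 1) < sg (D' (i - 1)) (p i)" "sg (D' (i - 1)) (p i) < sg (D' (i - 1)) (p (i - 1))"
    proof -
      have "i - 1 \<in> {2..<m}" "1 < i - 1" "i - 1 + 1 = i" using i by auto
      then show "sg (D' (i - 1)) (p 1) < sg (D' (i - 1)) (p i)" "sg (D' (i - 1)) (p i) < sg (D' (i - 1)) (p (i - 1))"
        using D'(1)[of "i - 1" 1] D'(2)[of "i - 1"] by simp_all
    qed
    have pe: "perp e (D' (i - 1))"
    proof (rule ccontr)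
      assume "\<not> perp e (D' (i - 1))"
      then have "D' (i - 1) = e \<or> D' (i - 1) = opp e" using not_perp by blast
      moreover have "1 \<le> i - 1" "i - 1 < i" "1 < i" using i by auto
      ultimately show False using f e'[of 1] e'[of "i - 1"] by auto
    qed
    moreover have "e = D' i" if "i < m"
    proof (rule ccontr)
      assume ne: "e \<noteq> D' i"
      have g: "sg (D' i) (p j) < sg (D' i) (p i)" if "1 \<le> j" "j < i" for j
        using D'(1)[of i j] D'(2)[of i] that i \<open>i < m\<close> by auto
      have "D' i = opp e \<or> D' i = D' (i - 1) \<or> D' i = opp (D' (i - 1))"
        using direction_cases_perp[OF pe, of "D' i"] ne by auto
      moreover have "1 \<le> i - 1" "i - 1 < i" "1 < i" using i by auto
      ultimately show False using f e'[of 1] g[of 1] g[of "i - 1"] by auto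
    qed
    ultimately show ?thesis using e' by auto
  qed
  obtain e where e: "3 \<le> m \<Longrightarrow> perp e (D' (m - 1)) \<and> (\<forall>j\<in>{1..<m}. sg e (p j) < sg e (p m))"
    using main[of m] by (cases "3 \<le> m") auto
  define D where "D i = (if i < m then D' i else e)" for i
  have "pins m p D"
    unfolding pins_def
  proof (intro ballI conjI)
    fix i assume i: "i \<in> {3..m}"
    have D1: "D (i - 1) = D' (i - 1)" using i by (auto simp: D_def)
    have *: "perp (D i) (D (i - 1)) \<and> (\<forall>j\<in>{1..<i}. sg (D i) (p j) < sg (D i) (p i))"
    proof (cases "i < m")
      case True
      then show ?thesis using main[of i] i D1 by (auto simp: D_def)
    next
      case False
      then have "i = m" using i by simp
      then show ?thesis using e i D1 by (auto simp: D_def)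
    qed
    then show "perp (D i) (D (i - 1))" by blast
    show "sg (D i) (p j) < sg (D i) (p i)" if "j \<in> {1..<i}" for j using * that by blast
    show "sg (D (i - 1)) (p j) < sg (D (i - 1)) (p i)" if "j \<in> {1..<i - 1}" for j
      using D'(1)[of "i - 1" j] that i D1 by auto
    show "sg (D (i - 1)) (p i) < sg (D (i - 1)) (p (i - 1))"
    proof -
      have "i - 1 \<in> {2..<m}" "i - 1 + 1 = i" using i by auto
      then show ?thesis using D'(2)[of "i - 1"] D1 by simp
    qed
  qed
  then show ?thesis by blast
qed

lemma pins_turns:
  assumes "pins m p D"
  shows "turns m p = {i\<in>{5..m}. D i = D (i - 2)}"
  unfolding turns_def using pins_direction[OF assms] by auto

text \<open>An interval containing two consecutive pins contains all pins that have a direction: a pin lies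
  between its two predecessors, and conversely either between its two successors, or all earlier
  pins do.\<close>

lemma pins_ivl:
  assumes P: "pins m p D" and I: "ivl A I" and pA: "p ` {1..m} \<subseteq> A"
    and i: "3 \<le> i" "i + 1 \<le> m" "p i \<in> I" "p (i + 1) \<in> I" and j: "3 \<le> j" "j \<le> m"
  shows "p j \<in> I"
proof -
  have A: "p l \<in> A" if "1 \<le> l" "l \<le> m" for l using pA that by auto
  have fwd: "p (l + 2) \<in> I" if "1 \<le> l" "l + 2 \<le> m" "p l \<in> I" "p (l + 1) \<in> I" for l
  proof -
    have "sg (D (l + 1)) (p l) < sg (D (l + 1)) (p (l + 2))" "sg (D (l + 1)) (p (l + 2)) < sg (D (l + 1)) (p (l + 1))"
      using pinsD(3,4)[OF P, of "l + 2"] that by auto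
    then show ?thesis using ivlD[OF I that(3,4) A] that by simp
  qed
  have up: "l \<le> m \<Longrightarrow> p l \<in> I" if "i \<le> l" for l
    using that
  proof (induction l rule: less_induct)
    case (less l)
    show ?case
    proof (cases "l = i \<or> l = i + 1")
      case True
      then show ?thesis using i by auto
    next
      case False
      have "l = (l - 2) + 2" using False less.prems i(1) by simp
      then obtain k where k: "l = k + 2" by (rule that)
      then have "p k \<in> I" "p (k + 1) \<in> I" using less False by auto
      then show ?thesis using fwd[of k] k less.prems i False by auto
    qed
  qed
  have bwd: "p (l - 1) \<in> I" if l: "4 \<le> l" "l + 1 \<le> m" "p l \<in> I" "p (l + 1) \<in> I" for l
  proof -
    have d: "D (l + 1) = D (l - 1) \<or> D (l + 1) = opp (D (l - 1))"
      using perp_perp[of "D (l - 1)" "D l" "D (l + 1)"] pinsD(1)[OF P, of l] pinsD(1)[OF P, of "l + 1"] l perp_sym by auto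
    have s1: "sg (D (l - 1)) (p l) < sg (D (l - 1)) (p (l - 1))" using pinsD(4)[OF P, of l] l by auto
    from d show ?thesis
    proof
      assume eq: "D (l + 1) = D (l - 1)"
      have "sg (D (l - 1)) (p (l - 1)) < sg (D (l - 1)) (p (l + 1))"
        using pinsD(2)[OF P, of "l + 1" "l - 1"] l eq by auto
      then show ?thesis using ivlD[OF I l(3,4) A _ ] s1 l by simp
    next
      assume eq: "D (l + 1) = opp (D (l - 1))"
      \<comment> \<open>If the direction reverses, all pins before \<open>l - 1\<close> lie between
        the pins \<open>l\<close> and \<open>l + 1\<close>. Two consecutive ones among them lead
        forward again to \<open>p (l - 1)\<close>.\<close>
      have "p q \<in> I" if q: "1 \<le> q" "q < l - 1" for q
      proof -
        have "sg (D (l - 1)) (p q) < sg (D (l - 1)) (p l)" using pinsD(3)[OF P, of l q] l q by auto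
        moreover have "sg (D (l - 1)) (p (l + 1)) < sg (D (l - 1)) (p q)"
          using pinsD(2)[OF P, of "l + 1" q] l q eq by auto
        ultimately show ?thesis using ivlD[OF I l(4,3) A] q l by simp
      qed
      note pI = this
      have "l = (l - 3) + 3" using l by simp
      then obtain k where k: "l = k + 3" by (rule that)
      then have "p k \<in> I" "p (k + 1) \<in> I" using pI[of k] pI[of "k + 1"] l by auto
      then show ?thesis using fwd[of k] l k by simp
    qed
  qed
  have down: "3 \<le> i - k \<Longrightarrow> p (i - k) \<in> I \<and> p (i - k + 1) \<in> I" for k
  proof (induction k)
    case 0
    then show ?case using i by simp
  next
    case (Suc k)
    then have "p (i - k) \<in> I" "p (i - k + 1) \<in> I" by auto
    then have "p (i - k - 1) \<in> I" using bwd[of "i - k"] Suc.prems i by auto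
    moreover have "i - Suc k + 1 = i - k" using Suc.prems by auto
    ultimately show ?case using \<open>p (i - k) \<in> I\<close> by simp
  qed
  show ?thesis
  proof (cases "i \<le> j")
    case True
    then show ?thesis using up j by blast
  next
    case False
    then show ?thesis using down[of "i - j"] j by simp
  qed
qed

section \<open>Scattered simple sets inside the unavoidable structures\<close>

definition has_simple :: "nat \<Rightarrow> point set \<Rightarrow> bool" where
  "has_simple k A \<longleftrightarrow> (\<exists>B\<subseteq>A. simple_set B \<and> scattered k B)"

lemma has_simple_sim:
  assumes s: "sim \<kappa> g A A'" and "has_simple k A'"
  shows "has_simple k A"
proof -
  obtain B where B: "B \<subseteq> A'" "simple_set B" "scattered k B" using assms(2) unfolding has_simple_def by blast
  obtain \<mu> h where h: "sim \<mu> h A' A" using sim_inv[OF s] by blast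
  have "sim \<mu> h B (h ` B)" using sim_subset[OF h B(1)] .
  then have "simple_set (h ` B)" "scattered k (h ` B)" using sim_simple_set sim_scattered B by blast+
  moreover have "h ` B \<subseteq> A" using sim_image_subset[OF h B(1)] .
  ultimately show ?thesis unfolding has_simple_def by blast
qed

lemma ivlR: "ivl A I \<Longrightarrow> u \<in> I \<Longrightarrow> v \<in> I \<Longrightarrow> z \<in> A \<Longrightarrow> fst u < fst z \<Longrightarrow> fst z < fst v \<Longrightarrow> z \<in> I"
  using ivlD[of A I u v z Right] by simp

lemma ivlU: "ivl A I \<Longrightarrow> u \<in> I \<Longrightarrow> v \<in> I \<Longrightarrow> z \<in> A \<Longrightarrow> snd u < snd z \<Longrightarrow> snd z < snd v \<Longrightarrow> z \<in> I"
  using ivlD[of A I u v z Up] by simp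

text \<open>The upper left and the lower right point of the \<open>j\<close>-th tooth.\<close>

abbreviation "thl n j \<equiv> (3 * real j - 2, real n + 2 * real j)"
abbreviation "thr n j \<equiv> (3 * real j, real n + 2 * real j - 1)"

lemma teeth_mem: "1 \<le> j \<Longrightarrow> j \<le> n \<Longrightarrow> thl n j \<in> teeth n \<and> thr n j \<in> teeth n"
  unfolding teeth_def by auto

text \<open>Reduction to the closure property of \<open>simple_of_sum21\<close>; the first \<open>r\<close> teeth are ignored.\<close>

lemma teeth_has_simple:
  assumes gp: "gp A" and k: "0 < k" and n: "2 * k + 2 + r \<le> n"
    and mem: "\<And>j. r < j \<Longrightarrow> j \<le> n \<Longrightarrow> thl n j \<in> A \<and> thr n j \<in> A"
    and closed: "\<And>I j i. ivl A I \<Longrightarrow> r < j \<Longrightarrow> j \<le> n \<Longrightarrow> thl n j \<in> I \<Longrightarrow> thr n j \<in> I \<Longrightarrow> r < i \<Longrightarrow> i \<le> n \<Longrightarrow> thl n i \<in> I \<and> thr n i \<in> I"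
  shows "has_simple (k div 2) A"
  unfolding has_simple_def
proof (rule simple_of_sum21[OF gp k, of "\<lambda>i. thl n (i + r + 1)" "\<lambda>i. thr n (i + r + 1)"])
  fix i assume i: "i < 2 * k + 2"
  then show "thl n (i + r + 1) \<in> A \<and> thr n (i + r + 1) \<in> A \<and> fst (thl n (i + r + 1)) < fst (thr n (i + r + 1)) \<and>
    snd (thr n (i + r + 1)) < snd (thl n (i + r + 1))"
    using mem[of "i + r + 1"] n by simp
next
  fix i j :: nat assume "i < j" "j < 2 * k + 2"
  then show "fst (thr n (i + r + 1)) < fst (thl n (j + r + 1)) \<and> snd (thl n (i + r + 1)) < snd (thr n (j + r + 1))"
    by simp
next
  fix I i j assume "ivl A I" "i < 2 * k + 2" "j < 2 * k + 2" "thl n (i + r + 1) \<in> I" "thr n (i + r + 1) \<in> I"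
  then show "thl n (j + r + 1) \<in> I \<and> thr n (j + r + 1) \<in> I"
    using closed[of I "i + r + 1" "j + r + 1"] n by simp
qed

text \<open>An interval with a tooth gains the point slicing it, then by height all later slicing
  points, and through these the teeth on the right. The teeth on the left have heights between the
  slicing point and the tooth.\<close>

lemma parallel_has_simple:
  assumes gp: "gp (parallel_sawtooth n)" and k: "0 < k" and n: "2 * k + 2 \<le> n"
  shows "has_simple (k div 2) (parallel_sawtooth n)"
proof (rule teeth_has_simple[OF gp k, of 0])
  let ?A = "parallel_sawtooth n"
  let ?c = "\<lambda>j::nat. (3 * real j - 1, real j)"
  show mem: "thl n j \<in> ?A \<and> thr n j \<in> ?A" if "0 < j" "j \<le> n" for j
    using teeth_mem[of j n] that by (simp add: parallel_sawtooth_def)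
  have cm: "?c j \<in> ?A" if "0 < j" "j \<le> n" for j using that by (auto simp: parallel_sawtooth_def)
  fix I j i assume I: "ivl ?A I" and j: "0 < j" "j \<le> n" "thl n j \<in> I" "thr n j \<in> I" and i: "0 < i" "i \<le> n"
  have cj: "?c j \<in> I" using ivlR[OF I j(3,4) cm[OF j(1,2)]] by simp
  have ci: "?c l \<in> I" if "j < l" "l \<le> n" for l
    using ivlU[OF I cj j(4) cm[of l]] that j by simp
  have mid: "thl n l \<in> I \<and> thr n l \<in> I" if "j < l" "l < n" for l
    using ivlR[OF I cj ci[of n], of "thl n l"] ivlR[OF I cj ci[of n], of "thr n l"] mem[of l] that by simp
  have lastp: "thl n n \<in> I \<and> thr n n \<in> I" if "j < n"
  proof -
    have a: "thl n n \<in> I" using ivlR[OF I cj ci[of n], of "thl n n"] mem[of n] that by simp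
    then show ?thesis using ivlU[OF I ci[of n] a, of "thr n n"] mem[of n] that by simp
  qed
  have low: "thl n l \<in> I \<and> thr n l \<in> I" if "0 < l" "l < j" for l
    using ivlU[OF I cj j(4), of "thl n l"] ivlU[OF I cj j(4), of "thr n l"] mem[of l] that j by simp
  show "thl n i \<in> I \<and> thr n i \<in> I" using mid[of i] lastp low[of i] i j by (cases "i = j"; cases "i = n"; cases "i < j"; simp)
qed (use n in simp)

text \<open>The heights between a tooth and its slicing point cover the earlier teeth and lead to
  the displaced point, for type 2 directly and otherwise through the first tooth. The displaced
  point is beyond all later teeth or all later slicing points; a plain wedge has nothing to carry
  the interval there. Counting starts after the first tooth, which type 2 damages.\<close>

lemma sliced_wedge_has_simple:
  assumes gp: "gp A" and A: "A = sliced_wedge1 n \<or> A = sliced_wedge2 n \<or> A = sliced_wedge3 n"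
    and k: "0 < k" and n: "2 * k + 3 \<le> n"
  shows "has_simple (k div 2) A"
proof (rule teeth_has_simple[OF gp k, of 1])
  let ?c = "\<lambda>j::nat. (3 * real j - 1, real n + 1 - real j)"
  show mem: "thl n j \<in> A \<and> thr n j \<in> A" if "1 < j" "j \<le> n" for j
    using teeth_mem[of j n] that A by (auto simp: sliced_wedge1_def sliced_wedge2_def sliced_wedge3_def wedge_sawtooth_def)
  have cm: "?c j \<in> A" if "1 < j" "j \<le> n" for j
    using that A by (auto simp: sliced_wedge1_def sliced_wedge2_def sliced_wedge3_def wedge_sawtooth_def)
  fix I j i assume I: "ivl A I" and j: "1 < j" "j \<le> n" "thl n j \<in> I" "thr n j \<in> I" and i: "1 < i" "i \<le> n"
  have cj: "?c j \<in> I" using ivlR[OF I j(3,4) cm[OF j(1,2)]] by simp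
  have low: "thl n l \<in> I \<and> thr n l \<in> I" if "1 < l" "l < j" for l
    using ivlU[OF I cj j(4), of "thl n l"] ivlU[OF I cj j(4), of "thr n l"] mem[of l] that j by simp
  have high: "thl n l \<in> I \<and> thr n l \<in> I" if l: "j < l" "l \<le> n" for l
  proof -
    have one: "thl n 1 \<in> A" using teeth_mem[of 1 n] n A
      by (auto simp: sliced_wedge1_def sliced_wedge2_def sliced_wedge3_def wedge_sawtooth_def)
    have a1: "thl n 1 \<in> I" using ivlU[OF I cj j(4) one] j by simp
    from A consider (1) "A = sliced_wedge1 n" | (2) "A = sliced_wedge2 n" | (3) "A = sliced_wedge3 n" by blast
    then show ?thesis
    proof cases
      case 1
      have b1: "thr n 1 \<in> A" using teeth_mem[of 1 n] n unfolding 1 by (auto simp: sliced_wedge1_def wedge_sawtooth_def)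
      have b1I: "thr n 1 \<in> I" using ivlU[OF I cj j(4) b1] j by simp
      have "(2, 0) \<in> A" unfolding 1 by (simp add: sliced_wedge1_def)
      then have z: "(2, 0) \<in> I" using ivlR[OF I a1 b1I] by simp
      have cl: "?c l \<in> I" using ivlU[OF I z j(4) cm[of l]] l j by simp
      have "thl n l \<in> I" using ivlR[OF I cj cl, of "thl n l"] mem[of l] l j by simp
      then show ?thesis using ivlU[OF I cl, of "thl n l" "thr n l"] mem[of l] l j by simp
    next
      case 2
      have zA: "(3 * real n + 1, real n + 1) \<in> A" unfolding 2 by (simp add: sliced_wedge2_def)
      have z: "(3 * real n + 1, real n + 1) \<in> I" using ivlU[OF I cj j(4) zA] j by simp
      show ?thesis using ivlR[OF I cj z, of "thl n l"] ivlR[OF I cj z, of "thr n l"] mem[of l] l j by simp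
    next
      case 3
      have b1: "thr n 1 \<in> A" using teeth_mem[of 1 n] n unfolding 3 by (auto simp: sliced_wedge3_def wedge_sawtooth_def)
      have b1I: "thr n 1 \<in> I" using ivlU[OF I cj j(4) b1] j by simp
      have "(2, 3 * real n + 1) \<in> A" unfolding 3 by (simp add: sliced_wedge3_def)
      then have z: "(2, 3 * real n + 1) \<in> I" using ivlR[OF I a1 b1I] by simp
      show ?thesis using ivlU[OF I j(4) z, of "thl n l"] ivlU[OF I j(4) z, of "thr n l"] mem[of l] l j by simp
    qed
  qed
  show "thl n i \<in> I \<and> thr n i \<in> I" using low[of i] high[of i] i j by (cases "i = j"; cases "i < j"; simp)
qed (use n in simp)

section \<open>Selecting turns and extensions of equal orientation\<close>

lemma pigeonhole_class:
  assumes "finite U" "finite S" "f ` U \<subseteq> S" "card S * q < card U"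
  shows "\<exists>y\<in>S. q < card {x\<in>U. f x = y}"
proof (rule ccontr)
  assume "\<not> ?thesis"
  then have le: "card {x\<in>U. f x = y} \<le> q" if "y \<in> S" for y using that by force
  have "U = (\<Union>y\<in>S. {x\<in>U. f x = y})" using assms(3) by blast
  then have "card U \<le> (\<Sum>y\<in>S. card {x\<in>U. f x = y})" using card_UN_le[OF assms(2), of "\<lambda>y. {x\<in>U. f x = y}"] by simp
  also have "\<dots> \<le> (\<Sum>y\<in>S. q)" using le by (rule sum_mono)
  finally show False using assms(4) by simp
qed

lemma card_direction_pairs: "finite (UNIV :: (direction \<times> direction) set) \<and> card (UNIV :: (direction \<times> direction) set) \<le> 16"
proof -
  have U: "(UNIV :: direction set) = {Left, Right, Up, Down}"
  proof (rule UNIV_eq_I)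
    fix x show "x \<in> {Left, Right, Up, Down}" by (cases x) simp_all
  qed
  have "finite (UNIV :: direction set)" "card (UNIV :: direction set) \<le> 4" unfolding U by (simp_all add: card_insert_if)
  moreover have "(UNIV :: (direction \<times> direction) set) = UNIV \<times> UNIV" by simp
  moreover from calculation have "finite (UNIV :: (direction \<times> direction) set)"
    by (intro finite_Prod_UNIV)
  moreover have "card (UNIV :: (direction \<times> direction) set) = card (UNIV :: direction set) * card (UNIV :: direction set)"
    by (subst UNIV_Times_UNIV[symmetric]) (rule card_cartesian_product)
  ultimately show ?thesis using mult_le_mono[of "card (UNIV :: direction set)" 4 "card (UNIV :: direction set)" 4]
    by simp
qed

text \<open>Take every \<open>g\<close>-th element in increasing order.\<close>

lemma spaced_subsequence:
  fixes W :: "nat set"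
  assumes "finite W" "g * q \<le> card W" "0 < g"
  shows "\<exists>t. (\<forall>i<q. t i \<in> W) \<and> (\<forall>i j. i < j \<longrightarrow> j < q \<longrightarrow> t i + g \<le> t j)"
proof -
  define L where "L = sorted_list_of_set W"
  have L: "sorted_wrt (<) L" "length L = card W" "set L = W" using assms(1) by (auto simp: L_def)
  have step: "L ! x + y \<le> L ! (x + y)" if "x + y < length L" for x y
    using that
  proof (induction y)
    case (Suc y)
    have "L ! (x + y) < L ! (x + Suc y)" using sorted_wrt_nth_less[OF L(1), of "x + y" "x + Suc y"] Suc.prems by simp
    then show ?case using Suc by simp
  qed simp
  have lt: "g * i < length L" if "i < q" for i
  proof -
    have "g * i < g * q" using that assms(3) by simp
    then show ?thesis using assms(2) L(2) by linarith
  qed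
  show ?thesis
  proof (intro exI[of _ "\<lambda>i. L ! (g * i)"] conjI allI impI)
    fix i assume "i < q"
    then show "L ! (g * i) \<in> W" using lt L(3) nth_mem by blast
  next
    fix i j assume ij: "i < j" "j < q"
    have "g * i + g \<le> g * j" using ij(1) by (metis Suc_leI add.commute mult_Suc_right mult_le_mono2)
    then obtain y where y: "g * j = (g * i + g) + y" using le_Suc_ex by blast
    have "L ! (g * i) + (g + y) \<le> L ! (g * i + (g + y))" using step[of "g * i" "g + y"] lt[OF ij(2)] y by simp
    then show "L ! (g * i) + g \<le> L ! (g * j)" using y by (simp add: add.assoc)
  qed
qed

text \<open>In the coordinates given by \<open>D i\<close> and \<open>D (i - 1)\<close>, a turn
  \<open>i\<close> and its predecessor form a copy of 21 beyond all pins before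
  \<open>i - 2\<close>, so turns with equal directions give a sum of copies of 21. Two consecutive
  pins pull all directed pins into an interval. The factor 16 counts pairs of directions, 3 keeps
  the turns apart, and \<open>2 * k + 2\<close> copies are wanted.\<close>

lemma turns_has_simple:
  assumes pr: "proper_pin_sequence A m p" and A: "A = p ` {1..m}" and gp: "gp A" and k: "0 < k"
    and turns: "16 * (3 * (2 * k + 2)) < card (turns m p)"
  shows "has_simple (k div 2) A"
proof -
  obtain D where P: "pins m p D" using proper_pins[OF pr gp] by blast
  let ?U = "turns m p"
  have U: "?U = {i\<in>{5..m}. D i = D (i - 2)}" using pins_turns[OF P] .
  have "\<exists>y\<in>UNIV. 3 * (2 * k + 2) < card {x\<in>?U. (D (x - 1), D x) = y}"
  proof (rule pigeonhole_class)
    show "finite ?U" unfolding U by simp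
    show "card (UNIV :: (direction \<times> direction) set) * (3 * (2 * k + 2)) < card ?U"
      using card_direction_pairs turns by (meson le_less_trans mult_le_mono1)
  qed (use card_direction_pairs in auto)
  then obtain e d where W: "3 * (2 * k + 2) < card {x\<in>?U. D (x - 1) = e \<and> D x = d}" by (auto simp: prod_eq_iff)
  let ?W = "{x\<in>?U. D (x - 1) = e \<and> D x = d}"
  have "finite ?W" unfolding U by simp
  then obtain t where t: "\<And>i. i < 2 * k + 2 \<Longrightarrow> t i \<in> ?W" "\<And>i j. i < j \<Longrightarrow> j < 2 * k + 2 \<Longrightarrow> t i + 3 \<le> t j"
    using spaced_subsequence[of ?W 3 "2 * k + 2"] W by auto
  have t': "5 \<le> t i" "t i \<le> m" "D (t i) = d" "D (t i - 1) = e" "D (t i - 2) = d" if "i < 2 * k + 2" for i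
    using t(1)[OF that] unfolding U by auto
  have "perp d e" using pinsD(1)[OF P, of "t 0"] t'[of 0] by simp
  define f where "f = tf d e"
  have fs: "f \<in> square_symmetries" using \<open>perp d e\<close> square_symmetries_iff f_def by blast
  obtain \<kappa> where \<kappa>: "sim \<kappa> f A (f ` A)" using sim_symmetry[OF fs] by blast
  have [simp]: "fst (f z) = sg d z" "snd (f z) = sg e z" for z by (simp_all add: f_def tf_def)
  have pA: "p j \<in> A" if "1 \<le> j" "j \<le> m" for j using that A by auto
  have "\<exists>B\<subseteq>f ` A. simple_set B \<and> scattered (k div 2) B"
  proof (rule simple_of_sum21[OF _ k, of _ "\<lambda>i. f (p (t i - 1))" "\<lambda>i. f (p (t i))"])
    show "gp (f ` A)" using sim_gp \<kappa> gp by blast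
  next
    fix i assume i: "i < 2 * k + 2"
    have "sg d (p (t i - 1)) < sg d (p (t i))" using pinsD(2)[OF P, of "t i" "t i - 1"] t'[OF i] by auto
    moreover have "sg e (p (t i)) < sg e (p (t i - 1))" using pinsD(4)[OF P, of "t i"] t'[OF i] by auto
    ultimately show "f (p (t i - 1)) \<in> f ` A \<and> f (p (t i)) \<in> f ` A \<and> fst (f (p (t i - 1))) < fst (f (p (t i))) \<and> snd (f (p (t i))) < snd (f (p (t i - 1)))"
      using pA[of "t i"] pA[of "t i - 1"] t'[OF i] by auto
  next
    fix i j assume ij: "i < j" "j < 2 * k + 2"
    have i: "i < 2 * k + 2" using ij by simp
    have "t j - 1 - 1 = t j - 2" by simp
    then have "sg d (p (t i)) < sg d (p (t j - 1))"
      using pinsD(3)[OF P, of "t j - 1" "t i"] t'[OF ij(2)] t'[OF i] t(2)[OF ij] by auto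
    moreover have "sg e (p (t i - 1)) < sg e (p (t j))"
      using pinsD(3)[OF P, of "t j" "t i - 1"] t'[OF ij(2)] t'[OF i] t(2)[OF ij] by auto
    ultimately show "fst (f (p (t i))) < fst (f (p (t j - 1))) \<and> snd (f (p (t i - 1))) < snd (f (p (t j)))" by simp
  next
    fix I i j assume I: "ivl (f ` A) I" and i: "i < 2 * k + 2" and j: "j < 2 * k + 2"
      and m: "f (p (t i - 1)) \<in> I" "f (p (t i)) \<in> I"
    define I' where "I' = {z\<in>A. f z \<in> I}"
    have I': "ivl A I'" unfolding I'_def using sim_ivl[OF \<kappa> I] .
    have "p (t i - 1) \<in> I'" "p (t i - 1 + 1) \<in> I'" using m pA[of "t i - 1"] pA[of "t i"] t'[OF i] by (auto simp: I'_def)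
    then have "p l \<in> I'" if "3 \<le> l" "l \<le> m" for l
      using pins_ivl[OF P I', of "t i - 1" l] that t'[OF i] A by auto
    from this[of "t j"] this[of "t j - 1"] show "f (p (t j - 1)) \<in> I \<and> f (p (t j)) \<in> I"
      using t'[OF j] by (auto simp: I'_def)
  qed
  then have "has_simple (k div 2) (f ` A)" by (simp add: has_simple_def)
  then show ?thesis using has_simple_sim \<kappa> by blast
qed

section \<open>Copies of 21 at the extensions of a spiral\<close>

lemma slices_pair:
  "slices z {u, v} \<longleftrightarrow>
    ((fst u < fst z \<and> fst z < fst v \<or> fst v < fst z \<and> fst z < fst u) \<and> (snd z < snd u \<and> snd z < snd v \<or> snd u < snd z \<and> snd v < snd z)) \<or>
    ((snd u < snd z \<and> snd z < snd v \<or> snd v < snd z \<and> snd z < snd u) \<and> (fst z < fst u \<and> fst z < fst v \<or> fst u < fst z \<and> fst v < fst z))"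
proof -
  have mx: "Max {a, b} = max a b" "Min {a, b} = min a b" for a b :: real by simp_all
  have inside: "c \<in> {min a b<..<max a b} \<longleftrightarrow> a < c \<and> c < b \<or> b < c \<and> c < a" for a b c :: real by auto
  have outside: "c \<notin> {min a b..max a b} \<longleftrightarrow> c < a \<and> c < b \<or> a < c \<and> b < c" for a b c :: real by auto
  show ?thesis unfolding slices_def image_insert image_empty mx inside outside by (rule disj_cong[OF refl]) (rule conj_commute)
qed

text \<open>The copy of 21 is \<open>p i\<close> with \<open>q\<close> for type 1 and
  \<open>q\<close> with \<open>r\<close> for type 2. In the first case it is sliced by a neighbour
  of \<open>p i\<close>, which produces two consecutive pins. In the second it is sliced by
  \<open>s\<close>; as only one prescribed pin may slice the rectangle of \<open>s\<close> and a
  neighbour of \<open>p i\<close>, the point \<open>s\<close> is so far out that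
  \<open>p (i - 4)\<close> and \<open>p (i - 3)\<close> lie between it and the copy. The bounds by
  pins \<open>i - 4\<close> and \<open>i + 4\<close> put copies of distant extensions in increasing
  order.\<close>

lemma spiral_extension_closed:
  assumes gp: "gp A" and P: "pins m p D" and pA: "p ` {1..m} \<subseteq> A"
    and per: "\<And>j. 3 \<le> j \<Longrightarrow> j + 2 \<le> m \<Longrightarrow> D (j + 2) = opp (D j)"
    and i: "12 \<le> i" "i + 8 \<le> m" and D: "D i = Right" "D (i - 1) = Up"
    and ext: "(\<exists>q. q \<in> A - p ` {1..m} \<and> type1_ext_up_right A m p i q) \<or>
      (\<exists>q r s. {q, r, s} \<subseteq> A - p ` {1..m} \<and> type2_ext_up_right A m p i q r s)"
  shows "\<exists>a\<in>A. \<exists>b\<in>A. fst a < fst b \<and> snd b < snd a \<and> fst (p (i - 4)) < fst a \<and> snd (p (i - 4)) < snd b \<and>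
     fst b < fst (p (i + 4)) \<and> snd a < snd (p (i + 4)) \<and>
     (\<forall>I. ivl A I \<longrightarrow> a \<in> I \<longrightarrow> b \<in> I \<longrightarrow> (\<forall>j\<in>{3..m}. p j \<in> I))"
proof -
  \<comment> \<open>Indices written as \<open>k + 1\<close> to \<open>k + 9\<close> avoid truncated
    subtraction; pin \<open>i\<close> is pin \<open>k + 5\<close>.\<close>
  define k where "k = i - 5"
  have k: "i = k + 5" "7 \<le> k" using i by (auto simp: k_def)
  have "i - 1 = k + 4" using k by simp
  then have D': "D (k + 5) = Right" "D (k + 4) = Up" using D k(1) by metis+
  have Dk: "D (k + 6) = Down" "D (k + 7) = Left" "D (k + 8) = Up" "D (k + 9) = Right"
    "D (k + 3) = Left" "D (k + 2) = Down" "D (k + 1) = Right" "D k = Up"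
  proof -
    have per: "D a = opp (D b)" if "a = b + 2" "3 \<le> b" "a \<le> m" for a b using per[of b] that by simp
    show a: "D (k + 6) = Down" "D (k + 7) = Left" using per[of "k + 6" "k + 4"] per[of "k + 7" "k + 5"] D' i k by simp_all
    show "D (k + 8) = Up" "D (k + 9) = Right" using per[of "k + 8" "k + 6"] per[of "k + 9" "k + 7"] a i k by simp_all
    have "opp (D (k + 3)) = Right" "opp (D (k + 2)) = Up" using per[of "k + 5" "k + 3"] per[of "k + 4" "k + 2"] D' i k by simp_all
    then show b: "D (k + 3) = Left" "D (k + 2) = Down" by (metis opp.simps opp_opp)+
    have "opp (D (k + 1)) = Left" "opp (D k) = Down" using per[of "k + 3" "k + 1"] per[of "k + 2" "k"] b i k by simp_all
    then show "D (k + 1) = Right" "D k = Up" by (metis opp.simps opp_opp)+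
  qed
  have ik: "i - 1 = k + 4" "i - 2 = k + 3" "i + 1 = k + 6" "i + 2 = k + 7" using k by simp_all
  let ?x = "\<lambda>l. fst (p l)" and ?y = "\<lambda>l. snd (p l)"
  have far: "sg (D l) (p j) < sg (D l) (p l)" if "3 \<le> l" "l \<le> m" "1 \<le> j" "j < l" for l j
    using pinsD(2)[OF P that(1,2)] that by blast
  have crs: "sg (D l) (p j) < sg (D l) (p l')" if "l' = l + 1" "2 \<le> l" "l + 1 \<le> m" "1 \<le> j" "j < l" for l l' j
    using pinsD(3)[OF P, of "l + 1" j] that by simp
  have prv: "sg (D l) (p l') < sg (D l) (p l)" if "l' = l + 1" "2 \<le> l" "l + 1 \<le> m" for l l'
    using pinsD(4)[OF P, of "l + 1"] that by simp
  have c1: "?x (k + 2) < ?x (k + 1)" using prv[of "k + 2" "k + 1"] Dk i k by simp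
  have c2: "?y (k + 1) < ?y k" using prv[of "k + 1" "k"] Dk i k by simp
  have c3: "?x (k + 4) < ?x (k + 2)" "?x (k + 4) < ?x (k + 1)"
    using crs[of "k + 4" "k + 3" "k + 2"] crs[of "k + 4" "k + 3" "k + 1"] Dk i k by simp_all
  have c4: "?x (k + 3) < ?x (k + 4)" using prv[of "k + 4" "k + 3"] Dk i k by simp
  have c5: "?y (k + 2) < ?y (k + 3)" using prv[of "k + 3" "k + 2"] Dk i k by simp
  have c6: "?y l < ?y (k + 4)" if "1 \<le> l" "l < k + 4" for l using far[of "k + 4" l] D' i k that by simp
  have c7: "?y (k + 5) < ?y (k + 4)" using prv[of "k + 5" "k + 4"] D' i k by simp
  have c8: "?y (k + 6) < ?y l" if "1 \<le> l" "l < k + 6" for l using far[of "k + 6" l] Dk i k that by simp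
  have c9: "?y (k + 1) < ?y (k + 5)" "?x (k + 1) < ?x (k + 5)"
    using crs[of "k + 5" "k + 4" "k + 1"] far[of "k + 5" "k + 1"] D' i k by simp_all
  have c10: "?y (k + 5) < ?y (k + 9)" "?x (k + 5) < ?x (k + 9)"
    using crs[of "k + 9" "k + 8" "k + 5"] far[of "k + 9" "k + 5"] Dk i k by simp_all
  have c11: "?x (k + 6) < ?x (k + 5)" using prv[of "k + 6" "k + 5"] D' i k by simp
  have pm: "p l \<in> A" if "1 \<le> l" "l \<le> m" for l using pA that by auto
  have pp: "p l \<in> p ` {1..m}" if "1 \<le> l" "l \<le> m" for l using that by auto
  have pinj: "l = l'" if "p l = p l'" "1 \<le> l" "l \<le> m" "1 \<le> l'" "l' \<le> m" "3 \<le> l" "3 \<le> l'" for l l'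
    using far[of l l'] far[of l' l] that by (metis linorder_neqE_nat order_less_irrefl)
  have nq: "fst q \<noteq> ?x l \<and> snd q \<noteq> ?y l" if q: "q \<in> A - p ` {1..m}" "1 \<le> l" "l \<le> m" for q l
    using gp_sg[OF gp, of q "p l" Right] gp_sg[OF gp, of q "p l" Up] pm[of l] pp[of l] q by (metis Diff_iff sg.simps(2,3))
  have two: "\<forall>j\<in>{3..m}. p j \<in> I" if "ivl A I" "p l \<in> I" "p (l + 1) \<in> I" "3 \<le> l" "l + 1 \<le> m" for I l
    using pins_ivl[OF P that(1) pA that(4,5,2,3)] by simp
  have im: "k + 13 \<le> m" using i k by simp
  have ik4: "i - 4 = k + 1" "i + 4 = k + 9" using k by simp_all
  have res: ?thesis if "a \<in> A" "b \<in> A" "fst a < fst b" "snd b < snd a" "?x (k + 1) < fst a" "?y (k + 1) < snd b"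
    "fst b < ?x (k + 9)" "snd a < ?y (k + 9)" "\<And>I. ivl A I \<Longrightarrow> a \<in> I \<Longrightarrow> b \<in> I \<Longrightarrow> \<forall>j\<in>{3..m}. p j \<in> I" for a b
    unfolding ik4
  proof (rule bexI[where x = a], rule bexI[where x = b])
    show "fst a < fst b \<and> snd b < snd a \<and> ?x (k + 1) < fst a \<and> ?y (k + 1) < snd b \<and>
     fst b < ?x (k + 9) \<and> snd a < ?y (k + 9) \<and> (\<forall>I. ivl A I \<longrightarrow> a \<in> I \<longrightarrow> b \<in> I \<longrightarrow> (\<forall>j\<in>{3..m}. p j \<in> I))"
      using that(3-8) by (intro conjI allI impI) (assumption | rule that(9))+
  qed (rule that)+
  from ext show ?thesis
  proof
    assume "\<exists>q. q \<in> A - p ` {1..m} \<and> type1_ext_up_right A m p i q"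
    then obtain q where q: "q \<in> A - p ` {1..m}" and t1: "type1_ext_up_right A m p i q" by blast
    note t1' = t1[unfolded type1_ext_up_right_def ik, unfolded k(1)]
    have c21: "copy_of_21 (p (k + 5)) q" and sl: "slices (p (k + 4)) {p (k + 5), q} \<or> slices (p (k + 6)) {p (k + 5), q}"
      and only: "\<And>x. x \<in> A \<Longrightarrow> slices x {p (k + 5), q} \<Longrightarrow> x = p (k + 4) \<or> x = p (k + 6)"
      using t1' by auto
    \<comment> \<open>The pins four steps before and after \<open>p i\<close> must not slice its
      rectangle with \<open>q\<close>. This is what confines \<open>q\<close> between them.\<close>
    have n1: "\<not> slices (p (k + 1)) {p (k + 5), q}" using only[OF pm[of "k + 1"]] pinj[of "k + 1" "k + 4"] pinj[of "k + 1" "k + 6"] im k(2) by auto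
    have n2: "\<not> slices (p (k + 9)) {p (k + 5), q}" using only[OF pm[of "k + 9"]] pinj[of "k + 9" "k + 4"] pinj[of "k + 9" "k + 6"] im by auto
    have nq1: "fst q \<noteq> ?x (k + 1)" "snd q \<noteq> ?y (k + 1)" "fst q \<noteq> ?x (k + 9)" "snd q \<noteq> ?y (k + 9)"
      using nq[OF q, of "k + 1"] nq[OF q, of "k + 9"] im by auto
    have cl: "\<forall>j\<in>{3..m}. p j \<in> I" if I: "ivl A I" "p (k + 5) \<in> I" "q \<in> I" for I
    proof -
      have btw: "z \<in> I" if zs: "slices z {p (k + 5), q}" "z \<in> A" for z
      proof -
        have "\<exists>d. \<exists>s\<in>{p (k + 5), q}. \<exists>t\<in>{p (k + 5), q}. sg d s < sg d z \<and> sg d z < sg d t"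
          by (rule slices_between[OF _ _ zs(1)]) simp_all
        then obtain d s t where st: "s \<in> {p (k + 5), q}" "t \<in> {p (k + 5), q}" "sg d s < sg d z" "sg d z < sg d t"
          by (elim exE bexE conjE)
        have "s \<in> I" "t \<in> I" using st I(2,3) by auto
        then show ?thesis using ivlD[OF I(1) _ _ zs(2)] st by blast
      qed
      from sl show ?thesis
      proof
        assume "slices (p (k + 4)) {p (k + 5), q}"
        then have "p (k + 4) \<in> I" using btw pm[of "k + 4"] im by simp
        then show ?thesis using two[OF I(1), of "k + 4"] I(2) im k(2) by (simp add: algebra_simps)
      next
        assume "slices (p (k + 6)) {p (k + 5), q}"
        then have "p (k + 6) \<in> I" using btw pm[of "k + 6"] im by simp
        then show ?thesis using two[OF I(1), of "k + 5"] I(2) im k(2) by (simp add: algebra_simps)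
      qed
    qed
    show ?thesis
    proof (cases "fst q < ?x (k + 5)")
      case True
      then have y: "?y (k + 5) < snd q" using c21 by (auto simp: copy_of_21_def)
      have "?x (k + 1) < fst q" using n1 True y c9 nq1 by (auto simp: slices_pair)
      moreover have "snd q < ?y (k + 9)" using n2 True y c10 nq1 by (auto simp: slices_pair)
      ultimately have o: "fst q < ?x (k + 5)" "?y (k + 5) < snd q" "?x (k + 1) < fst q" "?y (k + 1) < ?y (k + 5)"
        "?x (k + 5) < ?x (k + 9)" "snd q < ?y (k + 9)" using True y c9 c10 by simp_all
      have "q \<in> A" "p (k + 5) \<in> A" using q pm[of "k + 5"] im by auto
      then show ?thesis using o cl by (rule res)
    next
      case False
      then have y: "snd q < ?y (k + 5)" "?x (k + 5) < fst q" using c21 by (auto simp: copy_of_21_def)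
      have "?y (k + 1) < snd q" using n1 y c9 nq1 by (auto simp: slices_pair)
      moreover have "fst q < ?x (k + 9)" using n2 y c10 nq1 by (auto simp: slices_pair)
      ultimately have o: "?x (k + 5) < fst q" "snd q < ?y (k + 5)" "?x (k + 1) < ?x (k + 5)" "?y (k + 1) < snd q"
        "fst q < ?x (k + 9)" "?y (k + 5) < ?y (k + 9)" using y c9 c10 by simp_all
      have "p (k + 5) \<in> A" "q \<in> A" using q pm[of "k + 5"] im by auto
      then show ?thesis using o cl by (rule res)
    qed
  next
    assume "\<exists>q r s. {q, r, s} \<subseteq> A - p ` {1..m} \<and> type2_ext_up_right A m p i q r s"
    then obtain q r s where sub: "{q, r, s} \<subseteq> A - p ` {1..m}" and t2: "type2_ext_up_right A m p i q r s"
      by (elim exE conjE)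
    have qrs: "q \<in> A - p ` {1..m}" "r \<in> A - p ` {1..m}" "s \<in> A - p ` {1..m}" using sub by simp_all
    note t2' = t2[unfolded type2_ext_up_right_def ik, unfolded k(1)]
    \<comment> \<open>\<open>q\<close> and \<open>r\<close> may come in either order;
      \<open>a\<close> is the left one of the two.\<close>
    define a where "a = (if fst q < fst r then q else r)"
    define b where "b = (if fst q < fst r then r else q)"
    have qr: "copy_of_21 q r" using t2' by simp
    have ab: "fst a < fst b" "snd b < snd a" using qr by (auto simp: a_def b_def copy_of_21_def)
    have abA: "a \<in> A - p ` {1..m}" "b \<in> A - p ` {1..m}" using qrs by (auto simp: a_def b_def)
    have sab: "slices s {a, b}"
    proof -
      have "slices s {q, r}" using t2' qrs by blast
      then show ?thesis by (auto simp: a_def b_def insert_commute)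
    qed
    have SW: "fst a < ?x (k + 5)" "snd a < ?y (k + 5)" "fst b < ?x (k + 5)" "snd b < ?y (k + 5)"
      using t2' by (auto simp: SW_of_def a_def b_def)
    have NE: "?x l < fst a" "?y l < snd a" "?x l < fst b" "?y l < snd b" if "1 \<le> l" "l \<le> k + 3" for l
      using t2' that by (auto simp: NE_of_def a_def b_def)
    have sep: "fst b < ?x (k + 6)"
    proof -
      have "separates (p (k + 6)) {q, r} (p (k + 5))" using t2' by blast
      then obtain d where d: "sg d q < sg d (p (k + 6))" "sg d r < sg d (p (k + 6))" "sg d (p (k + 6)) < sg d (p (k + 5))"
        unfolding separates_iff by auto
      have dd: "sg d a < sg d (p (k + 6))" "sg d b < sg d (p (k + 6))" using d by (auto simp: a_def b_def)
      show ?thesis using dd d(3) c8[of "k + 5"] c8[of "k + 3"] c11 NE[of "k + 3"] SW k(2) by (cases d) auto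
    qed
    have close: "\<forall>j\<in>{3..m}. p j \<in> I" if I: "ivl A I" "a \<in> I" "b \<in> I" for I
    proof -
      have sI: "s \<in> I"
      proof -
        have "\<exists>d. \<exists>v\<in>{a, b}. \<exists>w\<in>{a, b}. sg d v < sg d s \<and> sg d s < sg d w"
          by (rule slices_between[OF _ _ sab]) simp_all
        then obtain d v w where st: "v \<in> {a, b}" "w \<in> {a, b}" "sg d v < sg d s" "sg d s < sg d w"
          by (elim exE bexE conjE)
        have "v \<in> I" "w \<in> I" "s \<in> A" using st I(2,3) qrs by auto
        then show ?thesis using ivlD[OF I(1)] st by blast
      qed
      have ns: "fst s \<noteq> ?x l" "snd s \<noteq> ?y l" if "1 \<le> l" "l \<le> m" for l using nq[OF qrs(3) that] by auto
      have V: "fst a < fst s \<and> fst s < fst b \<or> snd b < snd s \<and> snd s < snd a" using sab ab by (auto simp: slices_pair)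
      have fin: "\<forall>j\<in>{3..m}. p j \<in> I" if "p (k + 1) \<in> I" "p (k + 2) \<in> I"
        using two[OF I(1), of "k + 1"] that im k(2) by (simp add: algebra_simps)
      have left: "\<forall>j\<in>{3..m}. p j \<in> I" if "fst s \<le> ?x (k + 1)" "fst s \<le> ?x (k + 2)"
      proof (rule fin)
        show "p (k + 1) \<in> I" using ivlR[OF I(1) sI I(2) pm[of "k + 1"]] ns[of "k + 1"] that NE[of "k + 1"] im by auto
        show "p (k + 2) \<in> I" using ivlR[OF I(1) sI I(2) pm[of "k + 2"]] ns[of "k + 2"] that NE[of "k + 2"] im by auto
      qed
      have low: "\<forall>j\<in>{3..m}. p j \<in> I" if "snd s \<le> ?y (k + 1)" "snd s \<le> ?y (k + 2)"
      proof (rule fin)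
        show "p (k + 1) \<in> I" using ivlU[OF I(1) sI I(2) pm[of "k + 1"]] ns[of "k + 1"] that NE[of "k + 1"] im by auto
        show "p (k + 2) \<in> I" using ivlU[OF I(1) sI I(2) pm[of "k + 2"]] ns[of "k + 2"] that NE[of "k + 2"] im by auto
      qed
      have alt: "(copy_of_21 (p (k + 4)) s \<and> only_pin_slicing m p (k + 5) {p (k + 4), s}) \<or>
         (copy_of_21 s (p (k + 6)) \<and> only_pin_slicing m p (k + 7) {p (k + 6), s})"
        using t2' by blast
      then show ?thesis
      proof
        assume "copy_of_21 (p (k + 4)) s \<and> only_pin_slicing m p (k + 5) {p (k + 4), s}"
        then have c21: "copy_of_21 (p (k + 4)) s" and only: "\<not> slices (p l) {p (k + 4), s}" if "1 \<le> l" "l \<le> m" "l \<noteq> k + 5" for l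
          using that by (auto simp: only_pin_slicing_def)
        have o1: "\<not> slices (p (k + 1)) {p (k + 4), s}" and o2: "\<not> slices (p (k + 2)) {p (k + 4), s}"
          and o3: "\<not> slices (p (k + 3)) {p (k + 4), s}" using only[of "k + 1"] only[of "k + 2"] only[of "k + 3"] im by auto
        have c: "copy_of_21 (p (k + 4)) s" using c21[of 1] im by auto
        from V show ?thesis
        proof
          \<comment> \<open>Impossible here: to keep pin \<open>k + 2\<close> from slicing,
            \<open>s\<close> has to be below it, and then pin \<open>k + 3\<close> slices.\<close>
          assume v: "fst a < fst s \<and> fst s < fst b"
          have s4: "?x (k + 4) < fst s" using v c3 NE[of "k + 2"] by auto
          then have y4: "snd s < ?y (k + 4)" using c by (auto simp: copy_of_21_def)
          have "snd s \<le> ?y (k + 2)" using o2 s4 y4 c3 c6[of "k + 2"] v NE[of "k + 2"] by (auto simp: slices_pair)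
          then have False using o3 c4 c5 c6[of "k + 3"] s4 by (auto simp: slices_pair)
          then show ?thesis ..
        next
          assume h: "snd b < snd s \<and> snd s < snd a"
          then have y4: "snd s < ?y (k + 4)" using SW c7 by auto
          then have s4: "?x (k + 4) < fst s" using c by (auto simp: copy_of_21_def)
          have "fst s \<le> ?x (k + 2)" using o2 s4 y4 c3 c6[of "k + 2"] h NE[of "k + 2"] by (auto simp: slices_pair)
          moreover have "fst s \<le> ?x (k + 1)" using o1 s4 y4 c3 c6[of "k + 1"] h NE[of "k + 1"] by (auto simp: slices_pair)
          ultimately show ?thesis using left by blast
        qed
      next
        assume "copy_of_21 s (p (k + 6)) \<and> only_pin_slicing m p (k + 7) {p (k + 6), s}"
        then have c: "copy_of_21 s (p (k + 6))" and only: "\<And>l. 1 \<le> l \<Longrightarrow> l \<le> m \<Longrightarrow> l \<noteq> k + 7 \<Longrightarrow> \<not> slices (p l) {p (k + 6), s}"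
          by (auto simp: only_pin_slicing_def)
        have o1: "\<not> slices (p (k + 1)) {p (k + 6), s}" and o2: "\<not> slices (p (k + 2)) {p (k + 6), s}"
          using only[of "k + 1"] only[of "k + 2"] im by auto
        from V show ?thesis
        proof
          assume v: "fst a < fst s \<and> fst s < fst b"
          then have s6: "fst s < ?x (k + 6)" using sep by auto
          then have y6: "?y (k + 6) < snd s" using c by (auto simp: copy_of_21_def)
          have "snd s \<le> ?y (k + 1)" using o1 s6 y6 v NE[of "k + 1"] c8[of "k + 1"] by (auto simp: slices_pair)
          moreover have "snd s \<le> ?y (k + 2)" using o2 s6 y6 v NE[of "k + 2"] c8[of "k + 2"] by (auto simp: slices_pair)
          ultimately show ?thesis using low by blast
        next
          assume h: "snd b < snd s \<and> snd s < snd a"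
          then have y6: "?y (k + 6) < snd s" using NE[of "k + 3"] c8[of "k + 3"] by auto
          then have s6: "fst s < ?x (k + 6)" using c by (auto simp: copy_of_21_def)
          have "fst s \<le> ?x (k + 1)" using o1 s6 y6 h sep NE[of "k + 1"] c8[of "k + 1"] by (auto simp: slices_pair)
          moreover have "fst s \<le> ?x (k + 2)" using o2 s6 y6 h sep NE[of "k + 2"] c8[of "k + 2"] by (auto simp: slices_pair)
          ultimately show ?thesis using left by blast
        qed
      qed
    qed
    have o: "?x (k + 1) < fst a" "?y (k + 1) < snd b" "fst b < ?x (k + 9)" "snd a < ?y (k + 9)"
      using SW NE[of "k + 1"] c10 by auto
    have "a \<in> A" "b \<in> A" using abA by auto
    then show ?thesis using ab o close by (rule res)
  qed
qed

lemma pins_symmetry: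
  assumes "pins m p D" "turn_of \<mu>" "\<And>g z. sg (\<mu> g) (f z) = sg g z"
  shows "pins m (f \<circ> p) (\<lambda>l. \<mu> (D l))"
  using assms turn_ofD(2)[OF assms(2)] unfolding pins_def by simp

text \<open>In the bound, 16 counts pairs of directions and 10 keeps apart the boxes between the
  pins four steps before and after each chosen pin. The summand 16 discards at most eight pins at
  either end of the sequence, where the required neighbours may be missing.\<close>

lemma spiral_has_simple:
  assumes sp: "spiral_with_extensions K A" and gp: "gp A" and k: "0 < k"
    and K: "16 * (10 * (2 * k + 2)) + 16 < K"
  shows "has_simple (k div 2) A"
proof -
  obtain m p Ks X where s: "spiral m p" and Ks: "Ks \<subseteq> {4..m}" "card Ks = K"
    and A: "A = p ` {1..m} \<union> (\<Union>i\<in>Ks. X i)" and dj: "p ` {1..m} \<inter> (\<Union>i\<in>Ks. X i) = {}"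
    and ext': "\<forall>i\<in>Ks. extension_of A m p i (X i)"
    using sp unfolding spiral_with_extensions_def by (elim exE conjE)
  have ext: "\<And>i. i \<in> Ks \<Longrightarrow> extension_of A m p i (X i)" using ext' by blast
  have pA: "p ` {1..m} \<subseteq> A" using A by blast
  have gpp: "gp (p ` {1..m})" using gp_subset[OF gp pA] .
  obtain D where P: "pins m p D" using proper_pins[OF _ gpp] s unfolding spiral_def by blast
  have per: "D (j + 2) = opp (D j)" if "3 \<le> j" "j + 2 \<le> m" for j
  proof -
    have "perp (D j) (D (j + 1))" "perp (D (j + 1)) (D (j + 2))"
      using pinsD(1)[OF P, of "j + 1"] pinsD(1)[OF P, of "j + 2"] that perp_sym by auto
    then have "D (j + 2) = D j \<or> D (j + 2) = opp (D j)" using perp_perp by blast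
    moreover have "D (j + 2) \<noteq> D j"
    proof
      assume "D (j + 2) = D j"
      then have "j + 2 \<in> turns m p" using pins_turns[OF P] that by simp
      then show False using s by (simp add: spiral_def)
    qed
    ultimately show ?thesis by blast
  qed
  define U where "U = {i\<in>Ks. 12 \<le> i \<and> i + 8 \<le> m}"
  have finKs: "finite Ks" using Ks(1) finite_subset by blast
  have "Ks \<subseteq> U \<union> {4..<12} \<union> {m - 7..m}" using Ks(1) by (auto simp: U_def)
  then have "card Ks \<le> card (U \<union> {4..<12} \<union> {m - 7..m})" using finKs by (intro card_mono) (auto simp: U_def)
  also have "\<dots> \<le> card (U \<union> {4..<12}) + card {m - 7..m}" by (rule card_Un_le)
  also have "\<dots> \<le> (card U + card {4..<12::nat}) + card {m - 7..m}" by (intro add_mono card_Un_le) simp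
  finally have cU: "16 * (10 * (2 * k + 2)) < card U" using Ks(2) K by auto
  have "\<exists>y\<in>UNIV. 10 * (2 * k + 2) < card {x\<in>U. (D (x - 1), D x) = y}"
  proof (rule pigeonhole_class)
    show "finite U" using finKs by (simp add: U_def)
    show "card (UNIV :: (direction \<times> direction) set) * (10 * (2 * k + 2)) < card U"
      using card_direction_pairs cU by (meson le_less_trans mult_le_mono1)
  qed (use card_direction_pairs in auto)
  then obtain e d where W: "10 * (2 * k + 2) < card {x\<in>U. D (x - 1) = e \<and> D x = d}" by (auto simp: prod_eq_iff)
  let ?W = "{x\<in>U. D (x - 1) = e \<and> D x = d}"
  have "finite ?W" using finKs by (simp add: U_def)
  then obtain t where t: "\<And>i. i < 2 * k + 2 \<Longrightarrow> t i \<in> ?W" "\<And>i j. i < j \<Longrightarrow> j < 2 * k + 2 \<Longrightarrow> t i + 10 \<le> t j"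
    using spaced_subsequence[of ?W 10 "2 * k + 2"] W by auto
  have t': "12 \<le> t i" "t i + 8 \<le> m" "D (t i) = d" "D (t i - 1) = e" "t i \<in> Ks" if "i < 2 * k + 2" for i
    using t(1)[OF that] unfolding U_def by auto
  have pde: "perp d e" using pinsD(1)[OF P, of "t 0"] t'[of 0] by simp
  define f where "f = tf d e"
  have fs: "f \<in> square_symmetries" using pde square_symmetries_iff f_def by blast
  obtain \<kappa> where \<kappa>: "sim \<kappa> f A (f ` A)" "\<And>g z. sg g (f z) = sg (\<kappa> g) z" using sim_symmetry[OF fs] by blast
  have turn: "turn_of \<kappa>" using \<kappa>(1) by (simp add: sim_def)
  obtain \<mu> where \<mu>: "turn_of \<mu>" "\<And>d. \<mu> (\<kappa> d) = d" "\<And>d. \<kappa> (\<mu> d) = d" using turn_of_inv[OF turn] by blast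
  have sgeq: "c = c'" if "\<And>z. sg c z = sg c' z" for c c'
    using that[of "(1, 2)"] by (cases c; cases c'; simp)
  have "\<kappa> Right = d" "\<kappa> Up = e"
    by (rule sgeq, use \<kappa>(2)[of Right] in \<open>simp add: f_def tf_def\<close>, rule sgeq, use \<kappa>(2)[of Up] in \<open>simp add: f_def tf_def\<close>)
  then have \<mu>d: "\<mu> d = Right" "\<mu> e = Up" using \<mu>(2) by metis+
  define D' where "D' l = \<mu> (D l)" for l
  have P': "pins m (f \<circ> p) D'" unfolding D'_def using pins_symmetry[OF P \<mu>(1)] \<kappa>(2) \<mu>(3) by simp
  have per': "D' (j + 2) = opp (D' j)" if "3 \<le> j" "j + 2 \<le> m" for j
    using per[OF that] turn_ofD(1)[OF \<mu>(1)] by (simp add: D'_def)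
  have gp': "gp (f ` A)" using sim_gp \<kappa>(1) gp by blast
  have injf: "inj_on f A" using \<kappa>(1) by (simp add: sim_def bij_betw_def)
  have pA': "(f \<circ> p) ` {1..m} \<subseteq> f ` A" using pA by (auto simp: image_comp[symmetric])
  have inj': "f q \<in> f ` A - (f \<circ> p) ` {1..m}" if "i \<in> Ks" "q \<in> X i" for i q
  proof -
    have q: "q \<in> A" "q \<notin> p ` {1..m}" using that A dj by blast+
    have "f q \<notin> f ` (p ` {1..m})" using inj_on_image_mem_iff[OF injf q(1) pA] q(2) by simp
    then show ?thesis using q(1) by (simp add: image_comp)
  qed
  \<comment> \<open>The directions of the two pins determine the symmetry in the definition of an
    extension, so all chosen sites are seen through the same \<open>f\<close>.\<close>
  have same: "g = f" if g: "g \<in> square_symmetries" "pin_direction (g \<circ> p) (i - 1) Up" "pin_direction (g \<circ> p) i Right"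
    and i: "4 \<le> i" "i \<le> m" "D i = d" "D (i - 1) = e" for g i
  proof -
    obtain d1 e1 where de: "perp d1 e1" "g = tf d1 e1" using g(1) square_symmetries_iff by blast
    have "pin_direction p i d1" "pin_direction p (i - 1) e1"
      using g(2,3) unfolding pin_direction_iff de(2) by (simp_all add: tf_def)
    then have "d1 = d" "e1 = e" using pins_direction[OF P] i by auto
    then show ?thesis using de by (simp add: f_def)
  qed
  have "\<exists>a\<in>f ` A. \<exists>b\<in>f ` A. fst a < fst b \<and> snd b < snd a \<and> fst ((f \<circ> p) (t i - 4)) < fst a \<and> snd ((f \<circ> p) (t i - 4)) < snd b \<and>
     fst b < fst ((f \<circ> p) (t i + 4)) \<and> snd a < snd ((f \<circ> p) (t i + 4)) \<and>
     (\<forall>I. ivl (f ` A) I \<longrightarrow> a \<in> I \<longrightarrow> b \<in> I \<longrightarrow> (\<forall>j\<in>{3..m}. (f \<circ> p) j \<in> I))" if i: "i < 2 * k + 2" for i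
  proof (rule spiral_extension_closed[OF gp' P' pA' per' t'(1,2)[OF i]])
    show "D' (t i) = Right" "D' (t i - 1) = Up" using t'(3,4)[OF i] \<mu>d by (simp_all add: D'_def)
    have i4: "4 \<le> t i" "t i \<le> m" using t'(1,2)[OF i] by auto
    have mem: "\<And>q. q \<in> X (t i) \<Longrightarrow> f q \<in> f ` A - (f \<circ> p) ` {1..m}" using inj'[OF t'(5)[OF i]] .
    from ext[OF t'(5)[OF i]] consider
      (1) q where "X (t i) = {q}" "type1_extension A m p (t i) q" |
      (2) q r s where "X (t i) = {q, r, s}" "type2_extension A m p (t i) q r s"
      unfolding extension_of_def by blast
    then show "(\<exists>q. q \<in> f ` A - (f \<circ> p) ` {1..m} \<and> type1_ext_up_right (f ` A) m (f \<circ> p) (t i) q) \<or>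
      (\<exists>q r s. {q, r, s} \<subseteq> f ` A - (f \<circ> p) ` {1..m} \<and> type2_ext_up_right (f ` A) m (f \<circ> p) (t i) q r s)"
    proof cases
      case 1
      then obtain g where g: "g \<in> square_symmetries" "pin_direction (g \<circ> p) (t i - 1) Up" "pin_direction (g \<circ> p) (t i) Right"
        "type1_ext_up_right (g ` A) m (g \<circ> p) (t i) (g q)" unfolding type1_extension_def by blast
      have "g = f" using same[OF g(1-3) i4 t'(3,4)[OF i]] .
      moreover have "f q \<in> f ` A - (f \<circ> p) ` {1..m}" by (rule mem) (simp add: 1(1))
      ultimately show ?thesis using g(4) by (intro disjI1 exI[of _ "f q"]) simp
    next
      case 2
      then obtain g where g: "g \<in> square_symmetries" "pin_direction (g \<circ> p) (t i - 1) Up" "pin_direction (g \<circ> p) (t i) Right"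
        "type2_ext_up_right (g ` A) m (g \<circ> p) (t i) (g q) (g r) (g s)" unfolding type2_extension_def by blast
      have "g = f" using same[OF g(1-3) i4 t'(3,4)[OF i]] .
      moreover have "{f q, f r, f s} \<subseteq> f ` A - (f \<circ> p) ` {1..m}" using mem[of q] mem[of r] mem[of s] 2(1) by simp
      ultimately show ?thesis using g(4) by (intro disjI2 exI[of _ "f q"] exI[of _ "f r"] exI[of _ "f s"]) simp
    qed
  qed
  then have "\<forall>i. \<exists>a b. i < 2 * k + 2 \<longrightarrow> a \<in> f ` A \<and> b \<in> f ` A \<and> fst a < fst b \<and> snd b < snd a \<and> fst ((f \<circ> p) (t i - 4)) < fst a \<and> snd ((f \<circ> p) (t i - 4)) < snd b \<and>
     fst b < fst ((f \<circ> p) (t i + 4)) \<and> snd a < snd ((f \<circ> p) (t i + 4)) \<and>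
     (\<forall>I. ivl (f ` A) I \<longrightarrow> a \<in> I \<longrightarrow> b \<in> I \<longrightarrow> (\<forall>j\<in>{3..m}. (f \<circ> p) j \<in> I))" by meson
  then obtain a b where ab0: "\<forall>i. i < 2 * k + 2 \<longrightarrow> a i \<in> f ` A \<and> b i \<in> f ` A \<and> fst (a i) < fst (b i) \<and> snd (b i) < snd (a i) \<and>
     fst ((f \<circ> p) (t i - 4)) < fst (a i) \<and> snd ((f \<circ> p) (t i - 4)) < snd (b i) \<and>
     fst (b i) < fst ((f \<circ> p) (t i + 4)) \<and> snd (a i) < snd ((f \<circ> p) (t i + 4)) \<and>
     (\<forall>I. ivl (f ` A) I \<longrightarrow> a i \<in> I \<longrightarrow> b i \<in> I \<longrightarrow> (\<forall>j\<in>{3..m}. (f \<circ> p) j \<in> I))" by metis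
  let ?p = "f \<circ> p"
  have ab: "a i \<in> f ` A \<and> b i \<in> f ` A \<and> fst (a i) < fst (b i) \<and> snd (b i) < snd (a i)"
     "fst (?p (t i - 4)) < fst (a i) \<and> snd (?p (t i - 4)) < snd (b i)"
     "fst (b i) < fst (?p (t i + 4)) \<and> snd (a i) < snd (?p (t i + 4))"
     "\<And>I j. ivl (f ` A) I \<Longrightarrow> a i \<in> I \<Longrightarrow> b i \<in> I \<Longrightarrow> 3 \<le> j \<Longrightarrow> j \<le> m \<Longrightarrow> ?p j \<in> I" if "i < 2 * k + 2" for i
    using ab0 that by simp_all
  have "has_simple (k div 2) (f ` A)"
    unfolding has_simple_def
  proof (rule simple_of_sum21[OF gp' k, of a b])
    show "a i \<in> f ` A \<and> b i \<in> f ` A \<and> fst (a i) < fst (b i) \<and> snd (b i) < snd (a i)" if "i < 2 * k + 2" for i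
      using ab(1)[OF that] .
  next
    fix i j assume ij: "i < j" "j < 2 * k + 2"
    have i: "i < 2 * k + 2" using ij by simp
    have tt: "t i + 10 \<le> t j" using t(2)[OF ij] .
    have D4: "D' (t j - 4) = Right" "D' (t j - 4 - 1) = Up"
    proof -
      have "D' (t j) = Right" "D' (t j - 1) = Up" using t'(3,4)[OF ij(2)] \<mu>d by (simp_all add: D'_def)
      moreover have P2: "D' x = opp (D' y)" if "x = y + 2" "3 \<le> y" "x \<le> m" for x y using per'[of y] that by simp
      moreover have "D' (t j) = opp (D' (t j - 2))" "D' (t j - 2) = opp (D' (t j - 4))" "D' (t j - 1) = opp (D' (t j - 3))" "D' (t j - 3) = opp (D' (t j - 4 - 1))"
        by (rule P2, use t'(1,2)[OF ij(2)] in linarith, use t'(1,2)[OF ij(2)] in linarith, use t'(1,2)[OF ij(2)] in linarith)+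
      ultimately show "D' (t j - 4) = Right" "D' (t j - 4 - 1) = Up" by simp_all
    qed
    have j3: "3 \<le> t j - 4" "t j - 4 \<le> m" using t'(1,2)[OF ij(2)] by auto
    have "fst (?p (t i + 4)) \<le> fst (?p (t j - 4)) \<and> snd (?p (t i + 4)) \<le> snd (?p (t j - 4))"
    proof -
      have "t i + 4 < t j - 4 - 1" "t i + 4 < t j - 4" "1 \<le> t i + 4" using tt t'(1)[OF i] by arith+
      then show ?thesis
        using pinsD(2)[OF P' j3, of "t i + 4"] pinsD(3)[OF P' j3, of "t i + 4"] D4 by auto
    qed
    then show "fst (b i) < fst (a j) \<and> snd (a i) < snd (b j)" using ab(3)[OF i] ab(2)[OF ij(2)] by auto
  next
    fix I i j assume I: "ivl (f ` A) I" and i: "i < 2 * k + 2" and j: "j < 2 * k + 2" and m: "a i \<in> I" "b i \<in> I"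
    have pI: "?p l \<in> I" if "3 \<le> l" "l \<le> m" for l using ab(4)[OF i I m that] .
    have l: "?p (t j - 4) \<in> I" "?p (t j + 4) \<in> I" using pI t'(1,2)[OF j] by auto
    have o: "fst (?p (t j - 4)) < fst (a j)" "fst (a j) < fst (b j)" "fst (b j) < fst (?p (t j + 4))"
      using ab(1-3)[OF j] by auto
    have A: "a j \<in> f ` A" "b j \<in> f ` A" using ab(1)[OF j] by auto
    show "a j \<in> I \<and> b j \<in> I"
      using ivlR[OF I l A(1) o(1)] ivlR[OF I l A(2) _ o(3)] o by simp
  qed
  then show ?thesis using has_simple_sim \<kappa>(1) by blast
qed

definition bad_structure :: "nat \<Rightarrow> point set \<Rightarrow> bool" where
  "bad_structure N A \<longleftrightarrow> (\<exists>n\<ge>N. A = parallel_sawtooth n) \<or>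
     (\<exists>n\<ge>N. A = sliced_wedge1 n \<or> A = sliced_wedge2 n \<or> A = sliced_wedge3 n) \<or>
     (\<exists>k\<ge>N. pin_sequence_with_turns k A) \<or> (\<exists>k\<ge>N. spiral_with_extensions k A)"

text \<open>The constant is generous. With \<open>K = 2 * k + 1\<close> the spirals are the most
  demanding, needing more than \<open>640 * (k + 1) + 16\<close> extensions.\<close>

lemma bad_structure_has_simple:
  assumes S: "bad_structure (1000 * (k + 1)) A" and gp: "gp A"
  shows "has_simple k A"
proof -
  define K where "K = 2 * k + 1"
  have K: "0 < K" "K div 2 = k" by (simp_all add: K_def)
  consider (1) n where "1000 * (k + 1) \<le> n" "A = parallel_sawtooth n" |
    (2) n where "1000 * (k + 1) \<le> n" "A = sliced_wedge1 n \<or> A = sliced_wedge2 n \<or> A = sliced_wedge3 n" |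
    (3) j where "1000 * (k + 1) \<le> j" "pin_sequence_with_turns j A" |
    (4) j where "1000 * (k + 1) \<le> j" "spiral_with_extensions j A"
    using S unfolding bad_structure_def by blast
  then show ?thesis
  proof cases
    case 1
    then show ?thesis using parallel_has_simple[of n K] gp K by (simp add: K_def)
  next
    case 2
    then show ?thesis using sliced_wedge_has_simple[OF gp 2(2) K(1)] K by (simp add: K_def)
  next
    case 3
    then obtain m p where "A = p ` {1..m}" "proper_pin_sequence A m p" "card (turns m p) = j"
      unfolding pin_sequence_with_turns_def by blast
    then show ?thesis using turns_has_simple[of A m p K] gp K 3(1) by (simp add: K_def)
  next
    case 4
    then show ?thesis using spiral_has_simple[OF 4(2) gp K(1)] K by (simp add: K_def)
  qed
qed

section \<open>Sliced sums of copies of 21\<close>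

definition inversions :: "point set \<Rightarrow> (point \<times> point) set" where
  "inversions Z = {(u, v). u \<in> Z \<and> v \<in> Z \<and> copy_of_21 u v}"

definition box :: "point set \<Rightarrow> point \<Rightarrow> point \<Rightarrow> point set" where
  "box P v w = {z\<in>P. fst v < fst z \<and> fst z < fst w \<and> snd v < snd z \<and> snd z < snd w}"

lemma copy_of_21_sym: "copy_of_21 u v \<Longrightarrow> copy_of_21 v u"
  unfolding copy_of_21_def by blast

lemma inversions_sym: "(u, v) \<in> (inversions Z)\<^sup>* \<Longrightarrow> (v, u) \<in> (inversions Z)\<^sup>*"
proof -
  have "sym (inversions Z)" by (auto simp: sym_def inversions_def copy_of_21_sym)
  then have "sym ((inversions Z)\<^sup>*)" by (rule sym_rtrancl)
  then show "(u, v) \<in> (inversions Z)\<^sup>* \<Longrightarrow> (v, u) \<in> (inversions Z)\<^sup>*" by (rule symD)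
qed

lemma inversions_in: "(u, v) \<in> (inversions Z)\<^sup>* \<Longrightarrow> u \<in> Z \<Longrightarrow> v \<in> Z"
  by (induction rule: rtrancl_induct) (auto simp: inversions_def)

lemma rtrancl_crossing:
  assumes "(u, v) \<in> r\<^sup>*" "Q u" "\<not> Q v"
  shows "\<exists>x y. (u, x) \<in> r\<^sup>* \<and> (x, y) \<in> r \<and> Q x \<and> \<not> Q y"
  using assms
proof (induction rule: rtrancl_induct)
  case (step y z)
  then show ?case by (cases "Q y") blast+
qed simp

lemma not_ballE: "\<not> (\<forall>x\<in>A. Q x) \<Longrightarrow> (\<And>x. x \<in> A \<Longrightarrow> \<not> Q x \<Longrightarrow> thesis) \<Longrightarrow> thesis"
  by blast

text \<open>\<open>u\<close> and \<open>v\<close> are adjacent in the inversion graph of the box and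
  belong to the component of \<open>wc\<close>. The point \<open>e\<close> leaves the box on the
  side \<delta> and lies between them along the other axis, so it slices a copy of 21 from
  outside.\<close>

definition exits :: "point set \<Rightarrow> direction \<Rightarrow> point \<Rightarrow> point \<Rightarrow> point \<Rightarrow> bool" where
  "exits P \<delta> wa wc wb \<longleftrightarrow> (\<exists>u v e g. (wc, u) \<in> (inversions (box P wa wb))\<^sup>* \<and> (wc, v) \<in> (inversions (box P wa wb))\<^sup>* \<and>
     e \<in> P \<and> copy_of_21 u v \<and> perp g \<delta> \<and> sg g u < sg g e \<and> sg g e < sg g v \<and> sg \<delta> wa < sg \<delta> e \<and> sg \<delta> wb < sg \<delta> e)"

text \<open>Otherwise the component of \<open>wc\<close> in the inversion graph of the box would be an interval.\<close>

lemma ex_exit: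
  assumes P: "simple_set P" and wa: "wa \<in> P" and wb: "wb \<in> P" and wc: "wc \<in> box P wa wb" and wd: "wd \<in> box P wa wb"
    and cd: "copy_of_21 wc wd"
  shows "\<exists>\<delta>. exits P \<delta> wa wc wb"
proof -
  let ?Z = "box P wa wb"
  let ?R = "(inversions ?Z)\<^sup>*"
  define K where "K = {z. (wc, z) \<in> ?R}"
  have gp: "gp P" using P by (simp add: simple_set_def)
  have KZ: "K \<subseteq> ?Z" using inversions_in wc unfolding K_def by blast
  have ZP: "?Z \<subseteq> P" by (auto simp: box_def)
  have "wc \<in> K" by (simp add: K_def)
  moreover have "wd \<in> K" using wc wd cd by (auto simp: K_def inversions_def)
  moreover have "wc \<noteq> wd" using cd by (auto simp: copy_of_21_def)
  moreover have "K \<noteq> P" using KZ wa by (auto simp: box_def)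
  ultimately have "\<not> ivl P K" using simple_setD[OF P] by blast
  moreover have "K \<subseteq> P" using KZ ZP by blast
  ultimately have "\<not> (\<forall>z\<in>P - K. \<forall>u\<in>K. \<forall>v\<in>K. \<forall>d. \<not> (sg d u < sg d z \<and> sg d z < sg d v))"
    unfolding ivl_def by blast
  then obtain e where e0: "e \<in> P - K" "\<not> (\<forall>u\<in>K. \<forall>v\<in>K. \<forall>d. \<not> (sg d u < sg d e \<and> sg d e < sg d v))"
    by (rule not_ballE)
  then have e: "e \<in> P" "e \<notin> K" by auto
  from e0(2) obtain u where u: "u \<in> K" "\<not> (\<forall>v\<in>K. \<forall>d. \<not> (sg d u < sg d e \<and> sg d e < sg d v))" by (rule not_ballE)
  from u(2) obtain v where v: "v \<in> K" "\<not> (\<forall>d. \<not> (sg d u < sg d e \<and> sg d e < sg d v))" by (rule not_ballE)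
  from v(2) have "\<exists>d. sg d u < sg d e \<and> sg d e < sg d v" by (simp only: not_all not_not)
  then obtain d where d: "sg d u < sg d e \<and> sg d e < sg d v" by (rule exE)
  have uv: "u \<in> K" "v \<in> K" "sg d u < sg d e" "sg d e < sg d v" using u(1) v(1) d by simp_all
  have "(wc, u) \<in> ?R" "(wc, v) \<in> ?R" using uv(1,2) by (simp_all add: K_def)
  then have "(u, v) \<in> ?R" using rtrancl_trans[OF inversions_sym] by blast
  \<comment> \<open>A path from one side of \<open>e\<close> to the other has an edge crossing over
    \<open>e\<close>, so the two points around \<open>e\<close> may be assumed inverted.\<close>
  then obtain x y where xy: "(u, x) \<in> ?R" "(x, y) \<in> inversions ?Z" "sg d x < sg d e" "\<not> sg d y < sg d e"
    using rtrancl_crossing[of u v "inversions ?Z" "\<lambda>z. sg d z < sg d e"] uv by auto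
  have xK: "x \<in> K" using uv(1) xy(1) unfolding K_def by auto
  then have yK: "y \<in> K" using xy(2) unfolding K_def by auto
  have xy21: "copy_of_21 x y" using xy(2) by (auto simp: inversions_def)
  have "sg d y \<noteq> sg d e" using gp_sg[OF gp, of y e d] yK KZ ZP e by auto
  then have yd: "sg d e < sg d y" using xy(4) by simp
  \<comment> \<open>Inside the box, a point between the ends of an inversion is inverted with at
    least one of them and would belong to the component.\<close>
  have eZ: "e \<notin> ?Z"
  proof
    assume eZ: "e \<in> ?Z"
    have "\<not> copy_of_21 x e" "\<not> copy_of_21 y e"
      using e(2) xK yK KZ eZ unfolding K_def inversions_def by (auto intro: rtrancl_into_rtrancl)
    then show False using xy(3) yd xy21 by (cases d) (auto simp: copy_of_21_def)
  qed
  have xb: "x \<in> ?Z" "y \<in> ?Z" using xK yK KZ by auto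
  obtain \<delta> where \<delta>: "perp d \<delta>" "sg \<delta> wa < sg \<delta> e" "sg \<delta> wb < sg \<delta> e"
  proof -
    have ww: "fst wa < fst wb" "snd wa < snd wb" using wc by (auto simp: box_def)
    show thesis
    proof (cases "vertical d")
      case True
      then have y: "snd wa < snd e" "snd e < snd wb" using xb xy(3) yd by (cases d; auto simp: box_def)+
      then have "e \<noteq> wa" "e \<noteq> wb" by auto
      then have ne: "fst e \<noteq> fst wa" "fst e \<noteq> fst wb" using gp_sg[OF gp e(1) wa, of Right] gp_sg[OF gp e(1) wb, of Right] by auto
      have "fst e < fst wa \<or> fst wb < fst e" using eZ e(1) y ne by (auto simp: box_def)
      then show thesis using that[of Left] that[of Right] True ww by (auto simp: perp_def)
    next
      case False
      then have y: "fst wa < fst e" "fst e < fst wb" using xb xy(3) yd by (cases d; auto simp: box_def)+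
      then have "e \<noteq> wa" "e \<noteq> wb" by auto
      then have ne: "snd e \<noteq> snd wa" "snd e \<noteq> snd wb" using gp_sg[OF gp e(1) wa, of Up] gp_sg[OF gp e(1) wb, of Up] by auto
      have "snd e < snd wa \<or> snd wb < snd e" using eZ e(1) y ne by (auto simp: box_def)
      then show thesis using that[of Down] that[of Up] False ww by (auto simp: perp_def)
    qed
  qed
  have "(wc, x) \<in> ?R" "(wc, y) \<in> ?R" using xK yK by (simp_all add: K_def)
  then have "exits P \<delta> wa wc wb" unfolding exits_def using e(1) xy21 \<delta> xy(3) yd by blast
  then show ?thesis by blast
qed

definition turning :: "nat \<Rightarrow> point set \<Rightarrow> bool" where
  "turning N P \<longleftrightarrow> (\<exists>m p D. pins m p D \<and> p 1 \<noteq> p 2 \<and> p ` {1..m} \<subseteq> P \<and> N \<le> card (turns m p))"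

text \<open>A sawtooth alternation with the slicing points below the teeth. Their vertical order is
  left open, to be made monotone by Ramsey's theorem.\<close>

definition saw :: "nat \<Rightarrow> point set \<Rightarrow> (nat \<Rightarrow> point) \<Rightarrow> (nat \<Rightarrow> point) \<Rightarrow> (nat \<Rightarrow> point) \<Rightarrow> bool" where
  "saw n P a b c \<longleftrightarrow>
     (\<forall>i<n. a i \<in> P \<and> b i \<in> P \<and> c i \<in> P \<and> fst (a i) < fst (c i) \<and> fst (c i) < fst (b i) \<and> snd (b i) < snd (a i)) \<and>
     (\<forall>i j. i < j \<longrightarrow> j < n \<longrightarrow> fst (b i) < fst (a j) \<and> snd (a i) < snd (b j)) \<and>
     (\<forall>i<n. \<forall>j<n. snd (c i) < snd (b j))"

definition has_parallel :: "nat \<Rightarrow> point set \<Rightarrow> bool" where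
  "has_parallel n P \<longleftrightarrow> (\<exists>a b c. saw n P a b c \<and> (\<forall>i j. i < j \<longrightarrow> j < n \<longrightarrow> snd (c i) < snd (c j)))"

definition has_wedge :: "nat \<Rightarrow> point set \<Rightarrow> bool" where
  "has_wedge n P \<longleftrightarrow> (\<exists>a b c. saw n P a b c \<and> (\<forall>i j. i < j \<longrightarrow> j < n \<longrightarrow> snd (c j) < snd (c i)))"

text \<open>An induced path in the inversion graph that runs from the lower left to the upper right is an
  increasing oscillation, whose pins alternate between up and right.\<close>

lemma oscillation_turning:
  assumes adj: "\<And>i. i < n \<Longrightarrow> copy_of_21 (f i) (f (Suc i))"
    and far: "\<And>i j. i + 2 \<le> j \<Longrightarrow> j \<le> n \<Longrightarrow> fst (f i) < fst (f j) \<and> snd (f i) < snd (f j)"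
    and fP: "\<And>i. i \<le> n \<Longrightarrow> f i \<in> P" and n: "N + 3 \<le> n"
  shows "turning N P"
proof -
  define p where "p i = f (i - 1)" for i
  \<comment> \<open>Consecutive points are inverted, so one that lies to the left of its predecessor
    lies above it.\<close>
  define D where "D i = (if fst (p i) < fst (p (i - 1)) then Up else Right)" for i
  have alt: "D i \<noteq> D (i - 1) \<and> (\<forall>j\<in>{1..<i}. sg (D i) (p j) < sg (D i) (p i)) \<and>
     (\<forall>j\<in>{1..<i - 1}. sg (D (i - 1)) (p j) < sg (D (i - 1)) (p i)) \<and>
     sg (D (i - 1)) (p i) < sg (D (i - 1)) (p (i - 1))" if i: "3 \<le> i" "i \<le> n + 1" for i
  proof -
    obtain k where k: "i = k + 3" using i(1) by (metis le_iff_add add.commute)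
    have p: "p i = f (k + 2)" "p (i - 1) = f (k + 1)" "p (i - 1 - 1) = f k" by (simp_all add: p_def k)
    have c1: "copy_of_21 (f (k + 1)) (f (k + 2))" and c0: "copy_of_21 (f k) (f (k + 1))"
      using adj[of "k + 1"] adj[of k] i k by auto
    have ne: "fst (f k) < fst (f (k + 2))" "snd (f k) < snd (f (k + 2))" using far[of k "k + 2"] i k by auto
    have far': "fst (p j) < fst (p i) \<and> snd (p j) < snd (p i)" if "1 \<le> j" "j < i - 1" for j
      using far[of "j - 1" "k + 2"] that i k by (auto simp: p_def)
    have last: "j = i - 1 \<or> j < i - 1" if "j < i" for j using that by auto
    show ?thesis
    proof (cases "fst (p i) < fst (p (i - 1))")
      case True
      then have "snd (p (i - 1)) < snd (p i)" using c1 p by (auto simp: copy_of_21_def)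
      moreover have "\<not> fst (p (i - 1)) < fst (p (i - 1 - 1))" using True ne p by auto
      ultimately show ?thesis using True far' last unfolding D_def by fastforce
    next
      case False
      then have l: "fst (p (i - 1)) < fst (p i)" "snd (p i) < snd (p (i - 1))" using c1 p by (auto simp: copy_of_21_def)
      then have "fst (p (i - 1)) < fst (p (i - 1 - 1))" using c0 ne p by (auto simp: copy_of_21_def)
      then show ?thesis using False l far' last unfolding D_def by fastforce
    qed
  qed
  have D2: "D i = Up \<or> D i = Right" for i by (auto simp: D_def)
  have P: "pins (n + 1) p D"
    unfolding pins_def
  proof (intro ballI conjI)
    fix i assume i: "i \<in> {3..n + 1}"
    then show "perp (D i) (D (i - 1))" using alt[of i] D2[of i] D2[of "i - 1"] by (auto simp: perp_def)
  qed (use alt in auto)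
  have "D i = D (i - 2)" if "i \<in> {5..n + 1}" for i
  proof -
    have "i - 1 - 1 = i - 2" "3 \<le> i - 1" "i - 1 \<le> n + 1" "3 \<le> i" "i \<le> n + 1" using that by auto
    then show ?thesis using alt[of i] alt[of "i - 1"] D2[of i] D2[of "i - 1"] D2[of "i - 2"] by metis
  qed
  then have "turns (n + 1) p = {5..n + 1}" using pins_turns[OF P] by blast
  then have "N \<le> card (turns (n + 1) p)" using n by simp
  moreover have "p 1 \<noteq> p 2" using adj[of 0] n by (auto simp: p_def copy_of_21_def)
  moreover have "p ` {1..n + 1} \<subseteq> P" using fP by (auto simp: p_def)
  ultimately show ?thesis unfolding turning_def using P by blast
qed

text \<open>A shortest path in the inversion graph from the leftmost to the rightmost point is
  induced, so points at least two steps apart on it are comparable; going backwards from the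
  rightmost point shows that they increase. An edge changes the level \<tau> by at most 2, which
  makes the path long.\<close>

lemma long_path_turning:
  fixes V :: "point set" and \<tau> :: "point \<Rightarrow> nat"
  assumes gp: "gp V" and ne: "V \<noteq> {}"
    and conn: "\<And>u v. u \<in> V \<Longrightarrow> v \<in> V \<Longrightarrow> (u, v) \<in> (inversions V)\<^sup>*"
    and level: "\<And>u v. u \<in> V \<Longrightarrow> v \<in> V \<Longrightarrow> copy_of_21 u v \<Longrightarrow> \<tau> v \<le> \<tau> u + 2"
    and left: "\<And>u. u \<in> V \<Longrightarrow> (\<forall>v\<in>V. fst u \<le> fst v) \<Longrightarrow> \<tau> u \<le> l0"
    and right: "\<And>u. u \<in> V \<Longrightarrow> (\<forall>v\<in>V. fst v \<le> fst u) \<Longrightarrow> l0 + 2 * N + 6 \<le> \<tau> u"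
  shows "turning N V"
proof -
  let ?R = "inversions V"
  have fin: "finite V" using gp by (simp add: gp_def)
  define z0 where "z0 = arg_min_on fst V"
  have z0: "z0 \<in> V" "\<And>v. v \<in> V \<Longrightarrow> fst z0 \<le> fst v"
    using arg_min_if_finite[OF fin ne, of fst] unfolding z0_def by (auto simp: linorder_not_less)
  define z1 where "z1 = arg_min_on (\<lambda>z. - fst z) V"
  have z1: "z1 \<in> V" "\<And>v. v \<in> V \<Longrightarrow> fst v \<le> fst z1"
    using arg_min_if_finite[OF fin ne, of "\<lambda>z. - fst z"] unfolding z1_def by (auto simp: linorder_not_less)
  have "\<exists>n. (z0, z1) \<in> ?R ^^ n" using conn[OF z0(1) z1(1)] by (rule rtrancl_imp_relpow)
  then obtain n where n: "(z0, z1) \<in> ?R ^^ n" "\<And>k. k < n \<Longrightarrow> (z0, z1) \<notin> ?R ^^ k"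
    using exists_least_iff[of "\<lambda>n. (z0, z1) \<in> ?R ^^ n"] by blast
  obtain f where f: "f 0 = z0" "f n = z1" "\<And>i. i < n \<Longrightarrow> (f i, f (Suc i)) \<in> ?R"
    using n(1) unfolding relpow_fun_conv by blast
  have fV: "f i \<in> V" if "i \<le> n" for i
  proof (cases "i = n")
    case True
    then show ?thesis using z1 f by simp
  next
    case False
    then show ?thesis using f(3)[of i] that by (auto simp: inversions_def)
  qed
  have adj: "copy_of_21 (f i) (f (Suc i))" if "i < n" for i using f(3)[OF that] by (auto simp: inversions_def)
  have init: "(z0, f i) \<in> ?R ^^ i" if "i \<le> n" for i
    unfolding relpow_fun_conv using f that by (intro exI[of _ f]) auto
  have rest: "(f j, z1) \<in> ?R ^^ (n - j)" if "j \<le> n" for j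
    unfolding relpow_fun_conv using f that by (intro exI[of _ "\<lambda>i. f (j + i)"]) auto
  have nonadj: "\<not> copy_of_21 (f i) (f j) \<and> f i \<noteq> f j" if ij: "i + 2 \<le> j" "j \<le> n" for i j
  proof
    show "\<not> copy_of_21 (f i) (f j)"
    proof
      assume "copy_of_21 (f i) (f j)"
      then have "(f i, f j) \<in> ?R" using fV ij by (auto simp: inversions_def)
      then have "(z0, f j) \<in> ?R ^^ (Suc i)" using init[of i] ij by auto
      then have "(z0, z1) \<in> ?R ^^ (Suc i + (n - j))" using rest[OF ij(2)] by (rule relpow_trans)
      moreover have "Suc i + (n - j) < n" using ij by auto
      ultimately show False using n(2) by blast
    qed
    show "f i \<noteq> f j"
    proof
      assume "f i = f j"
      then have "(z0, z1) \<in> ?R ^^ (i + (n - j))" using init[of i] rest[OF ij(2)] ij relpow_trans by force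
      moreover have "i + (n - j) < n" using ij by auto
      ultimately show False using n(2) by blast
    qed
  qed
  have far: "fst (f i) < fst (f (n - k)) \<and> snd (f i) < snd (f (n - k))" if "i + 2 \<le> n - k" for i k
    using that
  proof (induction k)
    case 0
    have V: "f i \<in> V" "f n \<in> V" and na: "\<not> copy_of_21 (f i) (f n)" "f i \<noteq> f n" using fV nonadj[of i n] 0 by auto
    have "fst (f i) \<noteq> fst (f n)" "snd (f i) \<noteq> snd (f n)" using gp_sg[OF gp V, of Right] gp_sg[OF gp V, of Up] na by auto
    moreover have "fst (f i) \<le> fst (f n)" using z1(2)[OF V(1)] f(2) by simp
    ultimately show ?case using na(1) by (auto simp: copy_of_21_def)
  next
    case (Suc k)
    \<comment> \<open>\<open>f i\<close> is below and left of the successor of \<open>f ?j\<close>,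
      and that successor is inverted with \<open>f ?j\<close>. Hence \<open>f ?j\<close> is not
      below and left of \<open>f i\<close>.\<close>
    let ?j = "n - Suc k"
    have j: "Suc ?j = n - k" using Suc.prems by auto
    have IH: "fst (f i) < fst (f (n - k)) \<and> snd (f i) < snd (f (n - k))" using Suc by auto
    have V: "f i \<in> V" "f ?j \<in> V" and na: "\<not> copy_of_21 (f i) (f ?j)" "f i \<noteq> f ?j" using fV nonadj[of i ?j] Suc.prems by auto
    have nq: "fst (f i) \<noteq> fst (f ?j)" "snd (f i) \<noteq> snd (f ?j)" using gp_sg[OF gp V, of Right] gp_sg[OF gp V, of Up] na by auto
    have "copy_of_21 (f ?j) (f (n - k))" using adj[of ?j] j Suc.prems by auto
    then show ?case using na(1) nq IH by (auto simp: copy_of_21_def)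
  qed
  have far': "fst (f i) < fst (f j) \<and> snd (f i) < snd (f j)" if "i + 2 \<le> j" "j \<le> n" for i j
    using far[of i "n - j"] that by auto
  have "\<tau> (f i) \<le> l0 + 2 * i" if "i \<le> n" for i
    using that
  proof (induction i)
    case 0
    then show ?case using left[OF z0(1)] z0(2) f(1) by auto
  next
    case (Suc i)
    then show ?case using level[of "f i" "f (Suc i)"] fV[of i] fV[of "Suc i"] adj[of i] by auto
  qed
  from this[of n] have "N + 3 \<le> n" using right[OF z1(1)] z1(2) f(2) by auto
  then show ?thesis using oscillation_turning[of n f V N] adj far' fV by blast
qed

lemma turning_mono: "turning N V \<Longrightarrow> V \<subseteq> P \<Longrightarrow> turning N P"
  unfolding turning_def by blast

text \<open>A downward exit with its witnesses kept: \<open>u\<close> is above and to the left of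
  \<open>v\<close>, and \<open>e\<close> is below the box between their abscissae. Keeping them
  allows the choice of one exit point per box.\<close>

definition exitD :: "point set \<Rightarrow> point \<Rightarrow> point \<Rightarrow> point \<Rightarrow> point \<times> point \<times> point \<Rightarrow> bool" where
  "exitD P wa wc wb = (\<lambda>(u, v, e). (wc, u) \<in> (inversions (box P wa wb))\<^sup>* \<and> (wc, v) \<in> (inversions (box P wa wb))\<^sup>* \<and>
     e \<in> P \<and> fst u < fst e \<and> fst e < fst v \<and> snd v < snd u \<and> snd e < snd wa)"

lemma exits_Down:
  assumes "exits P Down wa wc wb"
  shows "\<exists>s. exitD P wa wc wb s"
proof -
  obtain u v e g where *: "(wc, u) \<in> (inversions (box P wa wb))\<^sup>*" "(wc, v) \<in> (inversions (box P wa wb))\<^sup>*"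
     "e \<in> P" "copy_of_21 u v" "perp g Down" "sg g u < sg g e" "sg g e < sg g v" "snd e < snd wa"
    using assms unfolding exits_def by auto
  have "g = Right \<or> g = Left" using *(5) by (cases g) (auto simp: perp_def)
  then show ?thesis
  proof
    assume "g = Right"
    then have "exitD P wa wc wb (u, v, e)" using * by (auto simp: exitD_def copy_of_21_def)
    then show ?thesis by blast
  next
    assume "g = Left"
    then have "exitD P wa wc wb (v, u, e)" using * by (auto simp: exitD_def copy_of_21_def)
    then show ?thesis by blast
  qed
qed

text \<open>If the exit points stay near, the components of the boxes link up to a connected part of the
  inversion graph all of whose edges are short.\<close>

lemma near_turning:
  fixes w :: "nat \<Rightarrow> point"
  assumes gp: "gp P" and wP: "\<And>i. i < M \<Longrightarrow> w i \<in> P"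
    and inc: "\<And>i j. i < j \<Longrightarrow> j < M \<Longrightarrow> fst (w i) < fst (w j) \<and> snd (w i) < snd (w j)"
    and ex: "\<And>t. 2 \<le> t \<Longrightarrow> t + 1 < M \<Longrightarrow> exitD P (w (t - 1)) (w t) (w (t + 1)) (u t, v t, e t)"
    and near: "\<And>t. 2 \<le> t \<Longrightarrow> t + 1 < M \<Longrightarrow> snd (w (t - 2)) < snd (e t)"
    and M: "2 * N + 11 \<le> M"
  shows "turning N P"
proof -
  let ?B = "\<lambda>t. box P (w (t - 1)) (w (t + 1))"
  define G where "G t = {z. (w t, z) \<in> (inversions (?B t))\<^sup>*} \<union> {e t}" for t
  define V where "V = (\<Union>t\<in>{2..M - 2}. G t)"
  have le: "fst (w i) \<le> fst (w j) \<and> snd (w i) \<le> snd (w j)" if "i \<le> j" "j < M" for i j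
    using inc[of i j] that by (cases "i = j") auto
  have wB: "w t \<in> ?B t" if "2 \<le> t" "t + 1 < M" for t
    using inc[of "t - 1" t] inc[of t "t + 1"] wP[of t] that by (auto simp: box_def)
  have Bin: "z \<in> ?B t" if "(w t, z) \<in> (inversions (?B t))\<^sup>*" "2 \<le> t" "t + 1 < M" for z t
    using inversions_in that wB by blast
  have e: "e t \<in> P" "fst (u t) < fst (e t)" "fst (e t) < fst (v t)" "snd (e t) < snd (w (t - 1))"
    "(w t, u t) \<in> (inversions (?B t))\<^sup>*" "(w t, v t) \<in> (inversions (?B t))\<^sup>*" if "2 \<le> t" "t + 1 < M" for t
    using ex[OF that] by (auto simp: exitD_def)
  have Gin: "z \<in> P \<and> fst (w (t - 2)) < fst z \<and> fst z < fst (w (t + 1)) \<and> snd (w (t - 2)) < snd z \<and> snd z < snd (w (t + 1))"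
    if z: "z \<in> G t" and t: "2 \<le> t" "t + 1 < M" for z t
  proof -
    have l: "fst (w (t - 2)) < fst (w (t - 1))" "snd (w (t - 2)) < snd (w (t - 1))" "snd (w (t - 1)) < snd (w (t + 1))"
      using inc[of "t - 2" "t - 1"] inc[of "t - 1" "t + 1"] t by auto
    show ?thesis
    proof (cases "z = e t")
      case True
      then show ?thesis using e[OF t] near[OF t] Bin[OF e(5)[OF t] t] Bin[OF e(6)[OF t] t] l by (auto simp: box_def)
    next
      case False
      then show ?thesis using Bin[of t z] z t l by (auto simp: box_def G_def)
    qed
  qed
  have t2: "2 \<le> t \<and> t + 1 < M" if "t \<in> {2..M - 2}" for t using that M by auto
  have VP: "V \<subseteq> P" using Gin t2 unfolding V_def by blast
  have GV: "G t \<subseteq> V" if "2 \<le> t" "t + 1 < M" for t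
  proof -
    have "t \<in> {2..M - 2}" using that by auto
    then show ?thesis unfolding V_def by blast
  qed
  have wG: "w t \<in> G t" for t by (simp add: G_def)
  have lift: "(w t, z) \<in> (inversions V)\<^sup>*" if z: "(w t, z) \<in> (inversions (?B t))\<^sup>*" and t: "2 \<le> t" "t + 1 < M" for t z
    using z
  proof (induction rule: rtrancl_induct)
    case (step y z)
    have "(w t, z) \<in> (inversions (?B t))\<^sup>*" using step by auto
    then have "y \<in> V" "z \<in> V" using GV[OF t] step(1) by (auto simp: G_def)
    then have "(y, z) \<in> inversions V" using step(2) by (auto simp: inversions_def)
    then show ?case using step.IH by auto
  qed simp
  \<comment> \<open>The exit point is inverted with a point of its own component and also with
    \<open>w (t - 1)\<close>, which ties consecutive components together.\<close>
  have ue: "copy_of_21 (u t) (e t)" "copy_of_21 (w (t - 1)) (e t)" if t: "2 \<le> t" "t + 1 < M" for t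
    using e[OF t] Bin[OF e(5)[OF t] t] by (auto simp: copy_of_21_def box_def)
  have liftG: "(w t, z) \<in> (inversions V)\<^sup>*" if z: "z \<in> G t" and t: "2 \<le> t" "t + 1 < M" for t z
  proof (cases "z = e t")
    case True
    have "u t \<in> V" "e t \<in> V" using GV[OF t] e(5)[OF t] by (auto simp: G_def)
    then have "(u t, e t) \<in> inversions V" using ue(1)[OF t] by (simp add: inversions_def)
    then show ?thesis using lift[OF e(5)[OF t] t] True by auto
  next
    case False
    then show ?thesis using lift[OF _ t] z by (auto simp: G_def)
  qed
  have back1: "(w 2, w t) \<in> (inversions V)\<^sup>*" if "2 \<le> t" "t + 1 < M" for t
    using that
  proof (induction t rule: less_induct)
    case (less t)
    show ?case
    proof (cases "t = 2")
      case False
      then have t: "2 \<le> t - 1" "t - 1 + 1 < M" using less.prems by auto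
      have "w (t - 1) \<in> V" using GV[OF t] wG[of "t - 1"] by blast
      moreover have "e t \<in> V" using GV[OF less.prems] by (auto simp: G_def)
      ultimately have "(w (t - 1), e t) \<in> inversions V" using ue(2)[OF less.prems] by (simp add: inversions_def)
      moreover have "(e t, w t) \<in> (inversions V)\<^sup>*"
        using liftG[OF _ less.prems, of "e t"] inversions_sym by (simp add: G_def)
      ultimately have "(w (t - 1), w t) \<in> (inversions V)\<^sup>*" by simp
      then show ?thesis using less.IH[of "t - 1"] t less.prems by (meson diff_less less_le_trans rtrancl_trans zero_less_numeral zero_less_one)
    qed simp
  qed
  have conn: "(x, y) \<in> (inversions V)\<^sup>*" if xy: "x \<in> V" "y \<in> V" for x y
  proof -
    have *: "(w 2, z) \<in> (inversions V)\<^sup>*" if zV: "z \<in> V" for z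
    proof -
      obtain t where t: "t \<in> {2..M - 2}" "z \<in> G t" using zV unfolding V_def by blast
      then show ?thesis using back1[of t] liftG[of z t] t2[OF t(1)] by (meson rtrancl_trans)
    qed
    show ?thesis using *[OF xy(1)] *[OF xy(2)] inversions_sym by (meson rtrancl_trans)
  qed
  \<comment> \<open>The level of a point is the index of some \<open>G t\<close> containing it. As
    \<open>G t\<close> lies between \<open>w (t - 2)\<close> and \<open>w (t + 1)\<close>, inverted
    points have levels differing by at most 2.\<close>
  have "\<exists>\<tau>. \<forall>z\<in>V. \<tau> z \<in> {2..M - 2} \<and> z \<in> G (\<tau> z)"
    by (rule bchoice) (auto simp: V_def)
  then obtain \<tau> where \<tau>: "\<And>z. z \<in> V \<Longrightarrow> \<tau> z \<in> {2..M - 2} \<and> z \<in> G (\<tau> z)" by blast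
  have \<tau>': "fst (w (\<tau> z - 2)) < fst z \<and> fst z < fst (w (\<tau> z + 1)) \<and> snd (w (\<tau> z - 2)) < snd z \<and> snd z < snd (w (\<tau> z + 1))"
    if "z \<in> V" for z using Gin t2 \<tau>[OF that] by blast
  \<comment> \<open>Since \<open>w 2\<close> and \<open>w (M - 2)\<close> belong to
    \<open>V\<close>, the leftmost point has level at most 3 and the rightmost at least
    \<open>2 * N + 9\<close>; the latter uses \<open>2 * N + 11 \<le> M\<close>.\<close>
  have "turning N V"
  proof (rule long_path_turning[where \<tau> = \<tau> and ?l0.0 = 3])
    show "gp V" using gp gp_subset VP by blast
    show "V \<noteq> {}" using GV[of 2] wG[of 2] M by auto
    show "(x, y) \<in> (inversions V)\<^sup>*" if "x \<in> V" "y \<in> V" for x y using conn that .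
    show "\<tau> y \<le> \<tau> x + 2" if xy: "x \<in> V" "y \<in> V" "copy_of_21 x y" for x y
    proof (rule ccontr)
      assume "\<not> \<tau> y \<le> \<tau> x + 2"
      then have "\<tau> x + 1 \<le> \<tau> y - 2" "\<tau> y - 2 < M" using \<tau>[OF xy(2)] by auto
      then have "fst x < fst y \<and> snd x < snd y" using le \<tau>'[OF xy(1)] \<tau>'[OF xy(2)] by (meson less_le_trans order.strict_trans)
      then show False using xy(3) by (auto simp: copy_of_21_def)
    qed
    show "\<tau> x \<le> 3" if x: "x \<in> V" "\<forall>y\<in>V. fst x \<le> fst y" for x
    proof (rule ccontr)
      assume "\<not> \<tau> x \<le> 3"
      then have "2 \<le> \<tau> x - 2" "\<tau> x - 2 < M" using \<tau>[OF x(1)] by auto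
      then have "fst (w 2) < fst x" using le \<tau>'[OF x(1)] by (meson le_less_trans)
      moreover have "w 2 \<in> V" using GV[of 2] wG[of 2] M by auto
      ultimately show False using x(2) by force
    qed
    show "3 + 2 * N + 6 \<le> \<tau> x" if x: "x \<in> V" "\<forall>y\<in>V. fst y \<le> fst x" for x
    proof (rule ccontr)
      assume "\<not> 3 + 2 * N + 6 \<le> \<tau> x"
      then have "\<tau> x + 1 \<le> M - 2" "M - 2 < M" using M by auto
      then have "fst x < fst (w (M - 2))" using le[of "\<tau> x + 1" "M - 2"] \<tau>'[OF x(1)] by linarith
      moreover have "2 \<le> M - 2" "M - 2 + 1 < M" using M by auto
      then have "w (M - 2) \<in> V" using GV[of "M - 2"] wG[of "M - 2"] by auto
      ultimately show False using x(2) by force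
    qed
  qed
  then show ?thesis using turning_mono VP by blast
qed

lemma ramsey_saw:
  "\<exists>n. \<forall>P a b c. gp P \<longrightarrow> saw n P a b c \<longrightarrow> has_parallel N P \<or> has_wedge N P"
proof -
  obtain n where n: "\<And>c::nat \<Rightarrow> nat \<Rightarrow> nat. (\<forall>x y. c x y < 2) \<Longrightarrow> (\<exists>h i. (\<forall>x<N. \<forall>y<N. x < y \<longrightarrow> h x < h y) \<and>
     (\<forall>x<N. h x < n) \<and> (\<forall>x y. x < y \<longrightarrow> y < N \<longrightarrow> c (h x) (h y) = i))" using ramsey_pairs[of 2 N] by blast
  show ?thesis
  proof (intro exI[of _ n] allI impI)
    fix P a b c assume gp: "gp P" and s: "saw n P a b c"
    define col :: "nat \<Rightarrow> nat \<Rightarrow> nat" where "col i j = (if snd (c i) < snd (c j) then 0 else 1)" for i j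
    have "\<forall>x y. col x y < 2" by (simp add: col_def)
    from n[OF this] obtain h k where h: "\<forall>x<N. \<forall>y<N. x < y \<longrightarrow> h x < h y" "\<forall>x<N. h x < n"
      "\<forall>x y. x < y \<longrightarrow> y < N \<longrightarrow> col (h x) (h y) = k" by (elim exE conjE)
    have s': "saw N P (a \<circ> h) (b \<circ> h) (c \<circ> h)" using s h(1,2) unfolding saw_def by simp
    show "has_parallel N P \<or> has_wedge N P"
    proof (cases "k = 0")
      case True
      then have "snd (c (h i)) < snd (c (h j))" if "i < j" "j < N" for i j
        using h(3)[rule_format, OF that] by (auto simp: col_def split: if_splits)
      then show ?thesis unfolding has_parallel_def using s' by (intro disjI1 exI[of _ "a \<circ> h"] exI[of _ "b \<circ> h"] exI[of _ "c \<circ> h"]) simp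
    next
      case False
      have "snd (c (h j)) < snd (c (h i))" if ij: "i < j" "j < N" for i j
      proof -
        have n: "\<not> snd (c (h i)) < snd (c (h j))" using h(3)[rule_format, OF ij] False by (auto simp: col_def split: if_splits)
        have hh: "h i < h j" "h j < n" "h i < n" using h(1,2) ij by auto
        have P: "c (h i) \<in> P" "c (h j) \<in> P" using s hh unfolding saw_def by auto
        have "fst (c (h i)) < fst (b (h i))" "fst (b (h i)) < fst (a (h j))" "fst (a (h j)) < fst (c (h j))" using s hh unfolding saw_def by auto
        then have "c (h i) \<noteq> c (h j)" by auto
        then have "snd (c (h i)) \<noteq> snd (c (h j))" using gp_sg[OF gp P, of Up] by auto
        then show ?thesis using n by simp
      qed
      then show ?thesis unfolding has_wedge_def using s' by (intro disjI2 exI[of _ "a \<circ> h"] exI[of _ "b \<circ> h"] exI[of _ "c \<circ> h"]) simp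
    qed
  qed
qed

text \<open>Quadruples \<open>l < i < c < j\<close> are coloured by whether the exit point of the
  box from \<open>w i\<close> to \<open>w j\<close> lies below \<open>w l\<close>. If it always
  does, disjoint boxes have all their slicing points below \<open>w 0\<close> and form a sawtooth
  alternation. If it never does, the exit points stay near their boxes and a long oscillation
  arises.\<close>

lemma exits_Down_dichotomy:
  "\<exists>M::nat. \<forall>P. \<forall>w::nat \<Rightarrow> point. gp P \<longrightarrow> (\<forall>i<M. w i \<in> P) \<longrightarrow>
     (\<forall>i j. i < j \<longrightarrow> j < M \<longrightarrow> fst (w i) < fst (w j) \<and> snd (w i) < snd (w j)) \<longrightarrow>
     (\<forall>i c j. i < c \<longrightarrow> c < j \<longrightarrow> j < M \<longrightarrow> exits P Down (w i) (w c) (w j)) \<longrightarrow>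
     turning N P \<or> has_parallel L P \<or> has_wedge L P"
proof -
  obtain n2 where n2: "\<forall>P a b c. gp P \<longrightarrow> saw n2 P a b c \<longrightarrow> has_parallel L P \<or> has_wedge L P" using ramsey_saw by blast
  \<comment> \<open>Room for \<open>n2\<close> disjoint triples after the reference index 0, and for
    the path with \<open>N\<close> turns.\<close>
  define M1 where "M1 = 3 * n2 + 2 * N + 11"
  obtain M where M: "\<And>c::nat list \<Rightarrow> nat. (\<forall>xs. c xs < 2) \<Longrightarrow> (\<exists>h::nat \<Rightarrow> nat. \<exists>i. (\<forall>x<M1. \<forall>y<M1. x < y \<longrightarrow> h x < h y) \<and>
     (\<forall>x<M1. h x < M) \<and> (\<forall>xs. length xs = 4 \<and> sorted_wrt (<) xs \<and> set xs \<subseteq> {..<M1} \<longrightarrow> c (map h xs) = i))"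
    using ramsey_increasing[of 2 M1 4] by blast
  show ?thesis
  proof (intro exI[of _ M] allI impI)
    fix P and w :: "nat \<Rightarrow> point"
    assume gp: "gp P" and wP: "\<forall>i<M. w i \<in> P"
      and inc: "\<forall>i j. i < j \<longrightarrow> j < M \<longrightarrow> fst (w i) < fst (w j) \<and> snd (w i) < snd (w j)"
      and ex: "\<forall>i c j. i < c \<longrightarrow> c < j \<longrightarrow> j < M \<longrightarrow> exits P Down (w i) (w c) (w j)"
    have "\<forall>i c j. \<exists>s. i < c \<longrightarrow> c < j \<longrightarrow> j < M \<longrightarrow> exitD P (w i) (w c) (w j) s"
      using ex exits_Down by metis
    then obtain s where s: "\<And>i c j. i < c \<Longrightarrow> c < j \<Longrightarrow> j < M \<Longrightarrow> exitD P (w i) (w c) (w j) (s i c j)" by metis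
    define e where "e i c j = snd (snd (s i c j))" for i c j
    define col :: "nat list \<Rightarrow> nat" where "col xs = (if snd (e (xs ! 1) (xs ! 2) (xs ! 3)) < snd (w (xs ! 0)) then 0 else 1)" for xs
    have "\<forall>xs. col xs < 2" by (simp add: col_def)
    from M[OF this] obtain h k where h: "\<forall>x<M1. \<forall>y<M1. x < y \<longrightarrow> h x < h y" "\<forall>x<M1. h x < M"
      "\<forall>xs. length xs = 4 \<and> sorted_wrt (<) xs \<and> set xs \<subseteq> {..<M1} \<longrightarrow> col (map h xs) = k" by (elim exE conjE)
    define w' where "w' i = w (h i)" for i
    have w'P: "w' i \<in> P" if "i < M1" for i using h(2) wP that by (simp add: w'_def)
    have inc': "fst (w' i) < fst (w' j) \<and> snd (w' i) < snd (w' j)" if "i < j" "j < M1" for i j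
      using h(1,2) inc that by (simp add: w'_def)
    have le': "fst (w' i) \<le> fst (w' j) \<and> snd (w' i) \<le> snd (w' j)" if "i \<le> j" "j < M1" for i j
      using inc'[of i j] that by (cases "i = j") auto
    define s' where "s' i c j = s (h i) (h c) (h j)" for i c j
    have s': "exitD P (w' i) (w' c) (w' j) (s' i c j)" if "i < c" "c < j" "j < M1" for i c j
      using s[of "h i" "h c" "h j"] h(1,2) that by (simp add: s'_def w'_def)
    have k: "snd (snd (snd (s' i c j))) < snd (w' l) \<longleftrightarrow> k = 0" if "l < i" "i < c" "c < j" "j < M1" for l i c j
    proof -
      have "col (map h [l, i, c, j]) = k" using h(3)[rule_format, of "[l, i, c, j]"] that by auto
      then show ?thesis by (auto simp: col_def e_def s'_def w'_def split: if_splits)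
    qed
    have unpack: "(w' c, fst (s' i c j)) \<in> (inversions (box P (w' i) (w' j)))\<^sup>*" "(w' c, fst (snd (s' i c j))) \<in> (inversions (box P (w' i) (w' j)))\<^sup>*"
      "snd (snd (s' i c j)) \<in> P" "fst (fst (s' i c j)) < fst (snd (snd (s' i c j)))" "fst (snd (snd (s' i c j))) < fst (fst (snd (s' i c j)))"
      "snd (fst (snd (s' i c j))) < snd (fst (s' i c j))" if "i < c" "c < j" "j < M1" for i c j
      using s'[OF that] by (auto simp: exitD_def split: prod.splits)
    show "turning N P \<or> has_parallel L P \<or> has_wedge L P"
    proof (cases "k = 0")
      case True
      define a where "a i = fst (s' (3 * i + 1) (3 * i + 2) (3 * i + 3))" for i
      define b where "b i = fst (snd (s' (3 * i + 1) (3 * i + 2) (3 * i + 3)))" for i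
      define c where "c i = snd (snd (s' (3 * i + 1) (3 * i + 2) (3 * i + 3)))" for i
      have bd: "3 * i + 1 < 3 * i + 2" "3 * i + 2 < 3 * i + 3" "3 * i + 3 < M1" "0 < 3 * i + 1" if "i < n2" for i
        using that by (auto simp: M1_def)
      have ab: "a i \<in> box P (w' (3 * i + 1)) (w' (3 * i + 3)) \<and> b i \<in> box P (w' (3 * i + 1)) (w' (3 * i + 3))" if i: "i < n2" for i
      proof -
        have "w' (3 * i + 2) \<in> box P (w' (3 * i + 1)) (w' (3 * i + 3))"
          using inc'[of "3 * i + 1" "3 * i + 2"] inc'[of "3 * i + 2" "3 * i + 3"] w'P[of "3 * i + 2"] bd[OF i] by (auto simp: box_def)
        then show ?thesis using unpack(1,2)[OF bd(1-3)[OF i]] inversions_in unfolding a_def b_def by blast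
      qed
      have low: "snd (c i) < snd (w' 0)" if i: "i < n2" for i
        using k[OF bd(4)[OF i] bd(1-3)[OF i]] True by (simp add: c_def)
      have "saw n2 P a b c"
        unfolding saw_def
      proof (intro conjI allI impI)
        fix i assume i: "i < n2"
        show "a i \<in> P" "b i \<in> P" using ab[OF i] by (auto simp: box_def)
        show "c i \<in> P" "fst (a i) < fst (c i)" "fst (c i) < fst (b i)" "snd (b i) < snd (a i)"
          using unpack(3-6)[OF bd(1-3)[OF i]] by (simp_all add: a_def b_def c_def)
        show "snd (c i) < snd (b j)" if j: "j < n2" for j
          using low[OF i] ab[OF j] inc'[of 0 "3 * j + 1"] bd[OF j] by (auto simp: box_def)
      next
        fix i j assume ij: "i < j" "j < n2"
        have "fst (w' (3 * i + 3)) \<le> fst (w' (3 * j + 1)) \<and> snd (w' (3 * i + 3)) \<le> snd (w' (3 * j + 1))"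
          using le'[of "3 * i + 3" "3 * j + 1"] ij bd[OF ij(2)] by auto
        then show "fst (b i) < fst (a j)" "snd (a i) < snd (b j)"
          using ab[of i] ab[of j] ij by (auto simp: box_def)
      qed
      then show ?thesis using n2 gp by blast
    next
      case False
      have "turning N P"
      proof (rule near_turning[where M = M1 and w = w' and u = "\<lambda>t. fst (s' (t - 1) t (t + 1))" and
            v = "\<lambda>t. fst (snd (s' (t - 1) t (t + 1)))" and e = "\<lambda>t. snd (snd (s' (t - 1) t (t + 1)))"])
        show "gp P" by (rule gp)
        show "w' i \<in> P" if "i < M1" for i using w'P[OF that] .
        show "fst (w' i) < fst (w' j) \<and> snd (w' i) < snd (w' j)" if "i < j" "j < M1" for i j using inc'[OF that] .
      next
        fix t assume t: "2 \<le> t" "t + 1 < M1"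
        have lt: "t - 2 < t - 1" "t - 1 < t" "t < t + 1" using t by auto
        show "exitD P (w' (t - 1)) (w' t) (w' (t + 1)) (fst (s' (t - 1) t (t + 1)), fst (snd (s' (t - 1) t (t + 1))), snd (snd (s' (t - 1) t (t + 1))))"
          using s'[OF lt(2,3) t(2)] by simp
        let ?e = "snd (snd (s' (t - 1) t (t + 1)))"
        have ge: "\<not> snd ?e < snd (w' (t - 2))" using k[OF lt t(2)] False by simp
        have "w' t \<in> box P (w' (t - 1)) (w' (t + 1))" using inc'[of "t - 1" t] inc'[of t "t + 1"] w'P[of t] t by (auto simp: box_def)
        then have "fst (s' (t - 1) t (t + 1)) \<in> box P (w' (t - 1)) (w' (t + 1))"
          using unpack(1)[OF lt(2,3) t(2)] inversions_in by blast
        then have "fst (w' (t - 1)) < fst ?e" using unpack(4)[OF lt(2,3) t(2)] by (auto simp: box_def)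
        moreover have "fst (w' (t - 2)) < fst (w' (t - 1))" using inc'[OF lt(1)] t by simp
        ultimately have "?e \<noteq> w' (t - 2)" by auto
        moreover have "t - 2 < M1" using t by simp
        ultimately have "snd ?e \<noteq> snd (w' (t - 2))"
          using gp_sg[OF gp unpack(3)[OF lt(2,3) t(2)] w'P[of "t - 2"], of Up] by auto
        then show "snd (w' (t - 2)) < snd ?e" using ge by simp
      qed (auto simp: M1_def)
      then show ?thesis ..
    qed
  qed
qed

lemma inversions_image:
  assumes "(u, v) \<in> (inversions Z)\<^sup>*" and "\<And>x y. copy_of_21 x y \<Longrightarrow> copy_of_21 (f x) (f y)"
  shows "(f u, f v) \<in> (inversions (f ` Z))\<^sup>*"
  using assms(1)
proof (induction rule: rtrancl_induct)
  case (step y z)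
  then have "(f y, f z) \<in> inversions (f ` Z)" using assms(2) by (auto simp: inversions_def)
  then show ?case using step.IH by auto
qed simp

lemma inversions_mono: "Z \<subseteq> Z' \<Longrightarrow> (inversions Z)\<^sup>* \<subseteq> (inversions Z')\<^sup>*"
  by (rule rtrancl_mono) (auto simp: inversions_def)

text \<open>The symmetries that preserve the pattern 21 carry any direction to down.\<close>

lemma exits_rotate:
  "\<exists>f\<in>square_symmetries. \<exists>rev. (\<forall>u v. fst u < fst v \<and> snd u < snd v \<longrightarrow>
       (if rev then fst (f v) < fst (f u) \<and> snd (f v) < snd (f u) else fst (f u) < fst (f v) \<and> snd (f u) < snd (f v))) \<and>
     (\<forall>P wa wc wb. exits P \<delta> wa wc wb \<longrightarrow>
       exits (f ` P) Down (if rev then f wb else f wa) (f wc) (if rev then f wa else f wb))"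
proof -
  define d where "d = (case \<delta> of Down \<Rightarrow> Right | Left \<Rightarrow> Up | Up \<Rightarrow> Left | Right \<Rightarrow> Down)"
  \<comment> \<open>Up and right are brought down by the half turn and by a diagonal reflection that
    reverse increasing chains; for down and left the identity and the other diagonal reflection keep
    the order.\<close>
  define rev where "rev \<longleftrightarrow> \<delta> = Up \<or> \<delta> = Right"
  define f where "f = tf d (opp \<delta>)"
  have pd: "perp d (opp \<delta>)" by (cases \<delta>) (auto simp: d_def perp_def)
  then have fs: "f \<in> square_symmetries" using square_symmetries_iff f_def by blast
  have c: "copy_of_21 (f x) (f y)" if "copy_of_21 x y" for x y
    using that by (cases \<delta>) (auto simp: d_def f_def tf_def copy_of_21_def)
  obtain \<kappa> where \<kappa>: "turn_of \<kappa>" "\<And>g z. sg g (f z) = sg (\<kappa> g) z" using symmetry_turn[OF fs] by blast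
  have D: "sg Down (f z) = sg \<delta> z" for z by (cases \<delta>) (auto simp: f_def tf_def)
  have kD: "\<kappa> Down = \<delta>"
  proof -
    have "sg (\<kappa> Down) z = sg \<delta> z" for z using D \<kappa>(2) by metis
    from this[of "(1, 2)"] show ?thesis by (cases "\<kappa> Down"; cases \<delta>; simp)
  qed
  have ord: "if rev then fst (f v) < fst (f u) \<and> snd (f v) < snd (f u) else fst (f u) < fst (f v) \<and> snd (f u) < snd (f v)"
    if "fst u < fst v \<and> snd u < snd v" for u v
    using that by (cases \<delta>) (auto simp: d_def f_def tf_def rev_def)
  have bx: "f ` box P wa wb \<subseteq> box (f ` P) (if rev then f wb else f wa) (if rev then f wa else f wb)" for P wa wb
    by (cases \<delta>) (auto simp: d_def f_def tf_def box_def rev_def)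
  have ex: "exits (f ` P) Down (if rev then f wb else f wa) (f wc) (if rev then f wa else f wb)"
    if ex0: "exits P \<delta> wa wc wb" for P wa wc wb
  proof -
    obtain u v e g where *: "(wc, u) \<in> (inversions (box P wa wb))\<^sup>*" "(wc, v) \<in> (inversions (box P wa wb))\<^sup>*"
     "e \<in> P" "copy_of_21 u v" "perp g \<delta>" "sg g u < sg g e" "sg g e < sg g v" "sg \<delta> wa < sg \<delta> e" "sg \<delta> wb < sg \<delta> e"
      using ex0 unfolding exits_def by auto
    obtain g' where g': "\<kappa> g' = g" using turn_ofD(3)[OF \<kappa>(1)] by blast
    have "perp g' Down" using turn_ofD(2)[OF \<kappa>(1), of g' Down] *(5) g' kD by simp
    moreover have "(f wc, f u) \<in> (inversions (f ` box P wa wb))\<^sup>*" "(f wc, f v) \<in> (inversions (f ` box P wa wb))\<^sup>*"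
      using inversions_image[OF *(1)] inversions_image[OF *(2)] c by blast+
    moreover have "sg g' (f u) < sg g' (f e)" "sg g' (f e) < sg g' (f v)" using *(6,7) \<kappa>(2) g' by simp_all
    moreover have "sg Down (f wa) < sg Down (f e)" "sg Down (f wb) < sg Down (f e)" using *(8,9) D by simp_all
    ultimately have "(f wc, f u) \<in> (inversions (box (f ` P) (if rev then f wb else f wa) (if rev then f wa else f wb)))\<^sup>*"
      "(f wc, f v) \<in> (inversions (box (f ` P) (if rev then f wb else f wa) (if rev then f wa else f wb)))\<^sup>*"
      "perp g' Down" "sg g' (f u) < sg g' (f e)" "sg g' (f e) < sg g' (f v)"
      "sg Down (if rev then f wb else f wa) < sg Down (f e)" "sg Down (if rev then f wa else f wb) < sg Down (f e)"
      using inversions_mono[OF bx, of P wa wb] by auto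
    moreover have "f e \<in> f ` P" "copy_of_21 (f u) (f v)" using *(3) c[OF *(4)] by auto
    ultimately show ?thesis unfolding exits_def by blast
  qed
  show ?thesis using fs ord ex by blast
qed

fun direction_code :: "direction \<Rightarrow> nat" where
  "direction_code Left = 0" | "direction_code Right = 1" | "direction_code Up = 2" | "direction_code Down = 3"

text \<open>The upper left points of the copies cut out boxes. A triple \<open>i < c < j\<close> is
  coloured by a side on which the component of \<open>a c\<close> in the box from \<open>a i\<close>
  to \<open>a j\<close> is sliced from outside. On a homogeneous set this side is constant, and it
  is turned to face down.\<close>

lemma sum21_outcomes:
  "\<exists>n. \<forall>P. simple_set P \<longrightarrow> sum21 n P \<longrightarrow>
     (\<exists>f\<in>square_symmetries. turning N (f ` P) \<or> has_parallel L (f ` P) \<or> has_wedge L (f ` P))"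
proof -
  obtain M :: nat where M: "\<And>P. \<And>w::nat \<Rightarrow> point. gp P \<Longrightarrow> (\<forall>i<M. w i \<in> P) \<Longrightarrow>
     (\<forall>i j. i < j \<longrightarrow> j < M \<longrightarrow> fst (w i) < fst (w j) \<and> snd (w i) < snd (w j)) \<Longrightarrow>
     (\<forall>i c j. i < c \<longrightarrow> c < j \<longrightarrow> j < M \<longrightarrow> exits P Down (w i) (w c) (w j)) \<Longrightarrow>
     turning N P \<or> has_parallel L P \<or> has_wedge L P" using exits_Down_dichotomy[of N L] by blast
  obtain n where n: "\<And>c::nat list \<Rightarrow> nat. (\<forall>xs. c xs < 4) \<Longrightarrow> (\<exists>h::nat \<Rightarrow> nat. \<exists>i. (\<forall>x<M. \<forall>y<M. x < y \<longrightarrow> h x < h y) \<and>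
     (\<forall>x<M. h x < n) \<and> (\<forall>xs. length xs = 3 \<and> sorted_wrt (<) xs \<and> set xs \<subseteq> {..<M} \<longrightarrow> c (map h xs) = i))"
    using ramsey_increasing[of 4 M 3] by blast
  show ?thesis
  proof (intro exI[of _ n] allI impI)
    fix P assume P: "simple_set P" and "sum21 n P"
    then obtain a b where ab: "\<forall>i<n. a i \<in> P \<and> b i \<in> P \<and> fst (a i) < fst (b i) \<and> snd (b i) < snd (a i)"
       "\<forall>i j. i < j \<longrightarrow> j < n \<longrightarrow> fst (b i) < fst (a j) \<and> snd (a i) < snd (b j)"
      unfolding sum21_def by blast
    have gp: "gp P" using P by (simp add: simple_set_def)
    have ex: "\<exists>\<delta>. exits P \<delta> (a i) (a c) (a j)" if ij: "i < c" "c < j" "j < n" for i c j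
    proof (rule ex_exit[OF P])
      have A: "fst (a i) < fst (b i)" "snd (b i) < snd (a i)" "fst (a c) < fst (b c)" "snd (b c) < snd (a c)"
        "fst (a j) < fst (b j)" "snd (b j) < snd (a j)" "a c \<in> P" "b c \<in> P" "a i \<in> P" "a j \<in> P"
        using ab(1) ij by auto
      have B: "fst (b i) < fst (a c)" "snd (a i) < snd (b c)" "fst (b c) < fst (a j)" "snd (a c) < snd (b j)"
        using ab(2) ij by auto
      show "a i \<in> P" "a j \<in> P" using A by auto
      show "a c \<in> box P (a i) (a j)" "b c \<in> box P (a i) (a j)" using A B unfolding box_def by auto
      show "copy_of_21 (a c) (b c)" using A by (simp add: copy_of_21_def)
    qed
    define \<Delta> where "\<Delta> i c j = (SOME \<delta>. exits P \<delta> (a i) (a c) (a j))" for i c j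
    have \<Delta>: "exits P (\<Delta> i c j) (a i) (a c) (a j)" if "i < c" "c < j" "j < n" for i c j
      unfolding \<Delta>_def using ex[OF that] by (rule someI_ex)
    define col where "col xs = direction_code (\<Delta> (xs ! 0) (xs ! 1) (xs ! 2))" for xs
    have "direction_code d < 4" for d by (cases d) auto
    then have "\<forall>xs. col xs < 4" by (simp add: col_def)
    from n[OF this] obtain h k where h: "\<forall>x<M. \<forall>y<M. x < y \<longrightarrow> h x < h y" "\<forall>x<M. h x < n"
      "\<forall>xs. length xs = 3 \<and> sorted_wrt (<) xs \<and> set xs \<subseteq> {..<M} \<longrightarrow> col (map h xs) = k" by (elim exE conjE)
    have inj: "direction_code d = direction_code e \<Longrightarrow> d = e" for d e by (cases d; cases e; simp)
    have k: "direction_code (\<Delta> (h i) (h c) (h j)) = k" if "i < c" "c < j" "j < M" for i c j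
      using h(3)[rule_format, of "[i, c, j]"] that by (simp add: col_def)
    obtain \<delta> where \<delta>: "\<And>i c j. i < c \<Longrightarrow> c < j \<Longrightarrow> j < M \<Longrightarrow> \<Delta> (h i) (h c) (h j) = \<delta>"
    proof (cases "2 < M")
      case True
      then show ?thesis using that[of "\<Delta> (h 0) (h 1) (h 2)"] k[of 0 1 2] k inj by (metis zero_less_one one_less_numeral_iff semiring_norm(76))
    next
      case False
      then show ?thesis using that by auto
    qed
    from exits_rotate[of \<delta>] obtain f rev where f: "f \<in> square_symmetries"
      "\<forall>u v. fst u < fst v \<and> snd u < snd v \<longrightarrow>
       (if rev then fst (f v) < fst (f u) \<and> snd (f v) < snd (f u) else fst (f u) < fst (f v) \<and> snd (f u) < snd (f v))"
      "\<forall>P wa wc wb. exits P \<delta> wa wc wb \<longrightarrow>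
       exits (f ` P) Down (if rev then f wb else f wa) (f wc) (if rev then f wa else f wb)"
      by (elim bexE exE conjE)
    \<comment> \<open>A symmetry that reverses the chain requires numbering it from the other
      end.\<close>
    define r where "r i = (if rev then M - 1 - i else i)" for i
    define w where "w i = f (a (h (r i)))" for i
    have rM: "r i < M" if "i < M" for i using that by (simp add: r_def)
    have "turning N (f ` P) \<or> has_parallel L (f ` P) \<or> has_wedge L (f ` P)"
    proof (rule M)
      obtain \<kappa> where "sim \<kappa> f P (f ` P)" using sim_symmetry[OF f(1)] by blast
      then show "gp (f ` P)" using sim_gp gp by blast
      show "\<forall>i<M. w i \<in> f ` P" using ab(1) h(2) rM by (auto simp: w_def)
      have lt: "fst (a (h i)) < fst (a (h j)) \<and> snd (a (h i)) < snd (a (h j))" if "i < j" "j < M" for i j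
      proof -
        have "h i < h j" "h j < n" "h i < n" using h(1,2) that by auto
        then show ?thesis using ab by (meson order.strict_trans)
      qed
      show "\<forall>i j. i < j \<longrightarrow> j < M \<longrightarrow> fst (w i) < fst (w j) \<and> snd (w i) < snd (w j)"
      proof (intro allI impI)
        fix i j assume ij: "i < j" "j < M"
        show "fst (w i) < fst (w j) \<and> snd (w i) < snd (w j)"
        proof (cases rev)
          case True
          then have "r j < r i" "r i < M" using ij by (auto simp: r_def)
          then show ?thesis using f(2)[rule_format, OF lt] True by (simp add: w_def)
        next
          case False
          then have "r i < r j" "r j < M" using ij by (auto simp: r_def)
          then show ?thesis using f(2)[rule_format, OF lt] False by (simp add: w_def)
        qed
      qed
      show "\<forall>i c j. i < c \<longrightarrow> c < j \<longrightarrow> j < M \<longrightarrow> exits (f ` P) Down (w i) (w c) (w j)"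
      proof (intro allI impI)
        fix i c j assume ij: "i < c" "c < j" "j < M"
        have E: "exits P \<delta> (a (h x)) (a (h y)) (a (h z))" if xyz: "x < y" "y < z" "z < M" for x y z
        proof -
          have "h x < h y" "h y < h z" "h z < n" using h(1,2) xyz by auto
          then show ?thesis using \<Delta> \<delta>[OF xyz] by metis
        qed
        show "exits (f ` P) Down (w i) (w c) (w j)"
        proof (cases rev)
          case True
          then have "r j < r c" "r c < r i" "r i < M" using ij by (auto simp: r_def)
          then show ?thesis using f(3)[rule_format, OF E] True unfolding w_def by fastforce
        next
          case False
          then have "r i < r c" "r c < r j" "r j < M" using ij by (auto simp: r_def)
          then show ?thesis using f(3)[rule_format, OF E] False unfolding w_def by fastforce
        qed
      qed
    qed
    then show "\<exists>f\<in>square_symmetries. turning N (f ` P) \<or> has_parallel L (f ` P) \<or> has_wedge L (f ` P)"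
      using f(1) by blast
  qed
qed

section \<open>Recognising the unavoidable structures\<close>

text \<open>Allowing an arbitrary action \<kappa> makes the notion insensitive to replacing
  \<open>P\<close> by a symmetric image.\<close>

definition has_struct :: "nat \<Rightarrow> point set \<Rightarrow> bool" where
  "has_struct N P \<longleftrightarrow> (\<exists>A S \<kappa> g. bad_structure N A \<and> S \<subseteq> P \<and> sim \<kappa> g A S)"

lemma has_struct_symmetry:
  assumes "f \<in> square_symmetries" "has_struct N (f ` P)"
  shows "has_struct N P"
proof -
  obtain A S \<kappa> g where A: "bad_structure N A" "S \<subseteq> f ` P" "sim \<kappa> g A S" using assms(2) unfolding has_struct_def by blast
  obtain \<mu> where "sim \<mu> f P (f ` P)" using sim_symmetry[OF assms(1)] by blast
  then obtain \<nu> h where h: "sim \<nu> h (f ` P) P" using sim_inv by blast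
  show ?thesis unfolding has_struct_def
    using A(1) sim_image_subset[OF h A(2)] sim_trans[OF A(3) sim_subset[OF h A(2)]] by blast
qed

lemma has_structI: "bad_structure N A \<Longrightarrow> A \<subseteq> P \<Longrightarrow> has_struct N P"
  unfolding has_struct_def using sim_refl by blast

lemma turning_has_struct:
  assumes "turning N P"
  shows "has_struct N P"
proof -
  obtain m p D where p: "pins m p D" "p 1 \<noteq> p 2" "p ` {1..m} \<subseteq> P" "N \<le> card (turns m p)"
    using assms unfolding turning_def by blast
  have "pin_sequence_with_turns (card (turns m p)) (p ` {1..m})"
    unfolding pin_sequence_with_turns_def using pins_proper[OF p(1,2)] by blast
  then have "bad_structure N (p ` {1..m})" unfolding bad_structure_def using p(4) by blast
  then show ?thesis using has_structI p(3) by blast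
qed

lemma spiral_has_struct: "spiral_with_extensions n A \<Longrightarrow> A \<subseteq> P \<Longrightarrow> N \<le> n \<Longrightarrow> has_struct N P"
  by (rule has_structI[of N A]) (auto simp: bad_structure_def)

text \<open>Because the ranks are injective, comparisons have to be checked in one direction only;
  the converses follow by trichotomy.\<close>

lemma sim_ranks:
  fixes xs ys :: "'i \<Rightarrow> nat" and G :: "'i \<Rightarrow> point"
  assumes x: "inj_on xs I" "\<And>u v. u \<in> I \<Longrightarrow> v \<in> I \<Longrightarrow> xs u < xs v \<Longrightarrow> fst (G u) < fst (G v)"
    and y: "inj_on ys I" "\<And>u v. u \<in> I \<Longrightarrow> v \<in> I \<Longrightarrow> ys u < ys v \<Longrightarrow> snd (G u) < snd (G v)"
  shows "\<exists>g. sim (\<lambda>d. d) g ((\<lambda>u. (real (xs u), real (ys u))) ` I) (G ` I)"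
proof -
  let ?F = "\<lambda>u. (real (xs u), real (ys u))"
  define g where "g = G \<circ> inv_into I ?F"
  have injF: "inj_on ?F I" using x(1) by (auto simp: inj_on_def)
  have g: "g (?F u) = G u" if "u \<in> I" for u
  proof -
    have "inv_into I ?F (?F u) = u" using injF that by (rule inv_into_f_f)
    then show ?thesis by (simp add: g_def)
  qed
  have X: "xs u < xs v \<longleftrightarrow> fst (G u) < fst (G v)" if uv: "u \<in> I" "v \<in> I" for u v
    using x(2)[OF uv] x(2)[OF uv(2,1)] inj_onD[OF x(1) _ uv] by (cases "xs u" "xs v" rule: linorder_cases) auto
  have Y: "ys u < ys v \<longleftrightarrow> snd (G u) < snd (G v)" if uv: "u \<in> I" "v \<in> I" for u v
    using y(2)[OF uv] y(2)[OF uv(2,1)] inj_onD[OF y(1) _ uv] by (cases "ys u" "ys v" rule: linorder_cases) auto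
  have "sg d (G u) < sg d (G v) \<longleftrightarrow> sg d (?F u) < sg d (?F v)" if "u \<in> I" "v \<in> I" for u v d
    using X[OF that] X[OF that(2,1)] Y[OF that] Y[OF that(2,1)] by (cases d) auto
  moreover have "inj_on G I"
  proof (rule inj_onI)
    fix u v assume uv: "u \<in> I" "v \<in> I" "G u = G v"
    then have "xs u = xs v" using X[OF uv(1,2)] X[OF uv(2,1)] by auto
    then show "u = v" using x(1) uv by (auto dest: inj_onD)
  qed
  ultimately have "sim (\<lambda>d. d) g (?F ` I) (G ` I)"
    unfolding sim_def using turn_of_id g by (auto simp: bij_betw_def inj_on_def image_image cong: image_cong)
  then show ?thesis by blast
qed

text \<open>The points of a sawtooth alternation: the teeth have indices \<open>(0, j)\<close> and \<open>(1, j)\<close>,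
  the monotone sequence \<open>(2, j)\<close>.\<close>

definition ix :: "nat \<Rightarrow> (nat \<times> nat) set" where
  "ix n = {0, 1, 2} \<times> {..<n}"

definition xrank :: "nat \<times> nat \<Rightarrow> nat" where
  "xrank = (\<lambda>(k, j). if k = 0 then 3 * j + 1 else if k = 1 then 3 * j + 3 else 3 * j + 2)"

text \<open>\<open>h\<close> supplies the heights of the slicing points: values up to
  \<open>n\<close> are below all teeth, values above \<open>3 * n\<close> are above them. Varying
  \<open>h\<close> covers the parallel and the wedge alternation as well as the sliced wedges of
  types 1 and 3.\<close>

definition yrank :: "nat \<Rightarrow> (nat \<Rightarrow> nat) \<Rightarrow> nat \<times> nat \<Rightarrow> nat" where
  "yrank n h = (\<lambda>(k, j). if k = 0 then n + 2 * j + 2 else if k = 1 then n + 2 * j + 1 else h j)"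

definition triple :: "(nat \<Rightarrow> point) \<Rightarrow> (nat \<Rightarrow> point) \<Rightarrow> (nat \<Rightarrow> point) \<Rightarrow> nat \<times> nat \<Rightarrow> point" where
  "triple a b c = (\<lambda>(k, j). if k = 0 then a j else if k = 1 then b j else c j)"

lemma ix_cases: "u \<in> ix n \<Longrightarrow> (\<And>j. j < n \<Longrightarrow> u = (0, j) \<Longrightarrow> Q) \<Longrightarrow> (\<And>j. j < n \<Longrightarrow> u = (1, j) \<Longrightarrow> Q) \<Longrightarrow>
    (\<And>j. j < n \<Longrightarrow> u = (2, j) \<Longrightarrow> Q) \<Longrightarrow> Q"
  unfolding ix_def by fastforce

lemma xrank_inj: "inj_on xrank (ix n)"
proof (rule inj_onI)
  fix u v assume "u \<in> ix n" "v \<in> ix n" "xrank u = xrank v"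
  moreover have "3 * i + 1 \<noteq> 3 * j + (2::nat)" "3 * i + 2 \<noteq> 3 * j + (1::nat)" "3 * i + 1 \<noteq> 3 * j + (3::nat)" "3 * i + 3 \<noteq> 3 * j + (1::nat)"
    "3 * i + 3 \<noteq> 3 * j + (2::nat)" "3 * i + 2 \<noteq> 3 * j + (3::nat)" for i j by presburger+
  ultimately show "u = v" by (elim ix_cases; simp add: xrank_def)
qed

lemma yrank_inj:
  assumes "inj_on h {..<n}" "\<And>j. j < n \<Longrightarrow> h j \<le> n \<or> 3 * n < h j"
  shows "inj_on (yrank n h) (ix n)"
proof (rule inj_onI)
  fix u v assume uv: "u \<in> ix n" "v \<in> ix n" "yrank n h u = yrank n h v"
  have par: "2 * i + 2 \<noteq> 2 * j + (1::nat)" "2 * i + 1 \<noteq> 2 * j + (2::nat)" for i j by presburger+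
  have ne: "h i \<noteq> n + 2 * j + 2" "h i \<noteq> n + 2 * j + 1" if "i < n" "j < n" for i j using assms(2)[OF that(1)] that(2) by auto
  show "u = v"
    using uv(1)
  proof (rule ix_cases)
    fix i assume i: "i < n" "u = (0, i)"
    show ?thesis using uv(2) by (rule ix_cases) (use uv(3) i par[of i] ne[of _ i] in \<open>force simp: yrank_def\<close>)+
  next
    fix i assume i: "i < n" "u = (1, i)"
    show ?thesis using uv(2) by (rule ix_cases) (use uv(3) i par[of i] ne[of _ i] in \<open>force simp: yrank_def\<close>)+
  next
    fix i assume i: "i < n" "u = (2, i)"
    show ?thesis using uv(2)
    proof (rule ix_cases)
      fix j assume "j < n" "v = (2, j)"
      then show ?thesis using uv(3) i inj_onD[OF assms(1), of i j] by (simp add: yrank_def)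
    qed (use uv(3) i ne[of i] in \<open>force simp: yrank_def\<close>)+
  qed
qed

lemma wedge_sawtooth_ranks: "wedge_sawtooth n = (\<lambda>u. (real (xrank u), real (yrank n (\<lambda>j. n - j) u))) ` ix n" (is "_ = ?H ` _")
  and parallel_sawtooth_ranks: "parallel_sawtooth n = (\<lambda>u. (real (xrank u), real (yrank n (\<lambda>j. j + 1) u))) ` ix n" (is "_ = ?K ` _")
proof -
  have ix: "ix n = (\<lambda>j. (0, j)) ` {..<n} \<union> (\<lambda>j. (1, j)) ` {..<n} \<union> (\<lambda>j. (2, j)) ` {..<n}" unfolding ix_def by auto
  have im: "F ` ix n = (\<Union>j<n. {F (0, j), F (1, j)}) \<union> (\<lambda>j. F (2, j)) ` {..<n}" for F :: "nat \<times> nat \<Rightarrow> point"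
    unfolding ix by (simp add: image_Un image_image) blast
  have S: "{1..n} = Suc ` {..<n}" by (simp add: image_Suc_lessThan)
  have t: "teeth n = (\<Union>j<n. {F (0, j), F (1, j)})"
    if "\<And>j. j < n \<Longrightarrow> F (0, j) = (3 * real j + 1, real n + 2 * real j + 2) \<and> F (1, j) = (3 * real j + 3, real n + 2 * real j + 1)" for F :: "nat \<times> nat \<Rightarrow> point"
  proof -
    have "teeth n = (\<Union>j<n. {(3 * real (Suc j) - 2, real n + 2 * real (Suc j)), (3 * real (Suc j), real n + 2 * real (Suc j) - 1)})"
      unfolding teeth_def S by (simp only: image_image)
    also have "\<dots> = (\<Union>j<n. {F (0, j), F (1, j)})" by (rule SUP_cong) (simp_all add: that algebra_simps del: One_nat_def)
    finally show ?thesis .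
  qed
  show "wedge_sawtooth n = ?H ` ix n"
    unfolding wedge_sawtooth_def im
  proof (rule arg_cong2[where f = "(\<union>)"])
    show "teeth n = (\<Union>j<n. {?H (0, j), ?H (1, j)})" by (rule t) (simp add: xrank_def yrank_def)
    show "(\<lambda>j. (3 * real j - 1, real n + 1 - real j)) ` {1..n} = (\<lambda>j. ?H (2, j)) ` {..<n}"
      unfolding S image_image by (rule image_cong) (auto simp: xrank_def yrank_def)
  qed
  show "parallel_sawtooth n = ?K ` ix n"
    unfolding parallel_sawtooth_def im
  proof (rule arg_cong2[where f = "(\<union>)"])
    show "teeth n = (\<Union>j<n. {?K (0, j), ?K (1, j)})" by (rule t) (simp add: xrank_def yrank_def)
    show "(\<lambda>j. (3 * real j - 1, real j)) ` {1..n} = (\<lambda>j. ?K (2, j)) ` {..<n}"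
      unfolding S image_image by (rule image_cong) (auto simp: xrank_def yrank_def)
  qed
qed

definition xsaw :: "nat \<Rightarrow> (nat \<Rightarrow> point) \<Rightarrow> (nat \<Rightarrow> point) \<Rightarrow> (nat \<Rightarrow> point) \<Rightarrow> bool" where
  "xsaw n a b c \<longleftrightarrow> (\<forall>i<n. fst (a i) < fst (c i) \<and> fst (c i) < fst (b i)) \<and> (\<forall>i j. i < j \<longrightarrow> j < n \<longrightarrow> fst (b i) < fst (a j))"

definition ysaw :: "nat \<Rightarrow> (nat \<Rightarrow> point) \<Rightarrow> (nat \<Rightarrow> point) \<Rightarrow> bool" where
  "ysaw n a b \<longleftrightarrow> (\<forall>i<n. snd (b i) < snd (a i)) \<and> (\<forall>i j. i < j \<longrightarrow> j < n \<longrightarrow> snd (a i) < snd (b j))"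

lemma xsaw_less:
  assumes "xsaw n a b c" "i < j" "j < n" and that: "z \<in> {a i, b i, c i}" "w \<in> {a j, b j, c j}"
  shows "fst z < fst w"
proof -
  have "i < n" using assms by simp
  then have "fst z \<le> fst (b i)" using assms(1) that(1) unfolding xsaw_def by fastforce
  moreover have "fst (b i) < fst (a j)" using assms unfolding xsaw_def by blast
  moreover have "fst (a j) \<le> fst w" using assms(1,3) that(2) unfolding xsaw_def by fastforce
  ultimately show ?thesis by simp
qed

lemma triple_x:
  assumes s: "xsaw n a b c" and uv: "u \<in> ix n" "v \<in> ix n" "xrank u < xrank v"
  shows "fst (triple a b c u) < fst (triple a b c v)"
proof -
  obtain k i l j where u: "u = (k, i)" "k \<in> {0, 1, 2}" "i < n" and v: "v = (l, j)" "l \<in> {0, 1, 2}" "j < n" using uv(1,2) unfolding ix_def by auto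
  have "i \<le> j" using uv(3) u v by (auto simp: xrank_def split: if_splits)
  show ?thesis
  proof (cases "i = j")
    case True
    have "fst (a i) < fst (c i)" "fst (c i) < fst (b i)" using s u(3) unfolding xsaw_def by auto
    then show ?thesis using uv(3) u v True by (auto simp: xrank_def triple_def)
  next
    case False
    have "triple a b c u \<in> {a i, b i, c i}" "triple a b c v \<in> {a j, b j, c j}" using u v by (auto simp: triple_def)
    moreover have "i < j" using False \<open>i \<le> j\<close> by simp
    ultimately show ?thesis by (intro xsaw_less[OF s _ v(3)])
  qed
qed

lemma triple_y:
  assumes s: "ysaw n a b" and h: "\<And>j. j < n \<Longrightarrow> h j \<le> n \<and> (\<forall>i<n. snd (c j) < snd (b i)) \<or> 3 * n < h j \<and> (\<forall>i<n. snd (a i) < snd (c j))"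
    and c: "\<And>i j. i < n \<Longrightarrow> j < n \<Longrightarrow> h i < h j \<Longrightarrow> snd (c i) < snd (c j)"
    and uv: "u \<in> ix n" "v \<in> ix n" "yrank n h u < yrank n h v"
  shows "snd (triple a b c u) < snd (triple a b c v)"
proof -
  have ab: "snd (b i) < snd (a i)" if "i < n" for i using s that unfolding ysaw_def by blast
  have lt: "snd (a i) < snd (b j)" if "i < j" "j < n" for i j using s that unfolding ysaw_def by blast
  have lt': "snd (b i) < snd (b j)" "snd (a i) < snd (a j)" "snd (b i) < snd (a j)" if "i < j" "j < n" for i j
    using lt[OF that] ab[of i] ab[of j] that by auto
  have ac: "snd (c j) < snd (a i)" if "h j \<le> n" "i < n" "j < n" for i j using h[OF that(3)] ab[OF that(2)] that by fastforce
  have bc: "snd (c j) < snd (b i)" if "h j \<le> n" "i < n" "j < n" for i j using h[OF that(3)] that by fastforce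
  have ca: "snd (a i) < snd (c j) \<and> snd (b i) < snd (c j)" if "n < h j" "i < n" "j < n" for i j using h[OF that(3)] ab[OF that(2)] that by fastforce
  show ?thesis
    using uv(1)
  proof (rule ix_cases)
    fix i assume i: "i < n" "u = (0, i)"
    show ?thesis using uv(2)
    proof (rule ix_cases)
      fix j assume j: "j < n" "v = (0, j)"
      then show ?thesis using uv(3) i lt'(2)[of i j] by (simp add: yrank_def triple_def)
    next
      fix j assume j: "j < n" "v = (1, j)"
      then show ?thesis using uv(3) i lt[of i j] by (simp add: yrank_def triple_def)
    next
      fix j assume j: "j < n" "v = (2, j)"
      then show ?thesis using uv(3) i ca[of j i] by (simp add: yrank_def triple_def)
    qed
  next
    fix i assume i: "i < n" "u = (1, i)"
    show ?thesis using uv(2)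
    proof (rule ix_cases)
      fix j assume j: "j < n" "v = (0, j)"
      then have "i \<le> j" using uv(3) i by (simp add: yrank_def)
      then show ?thesis using i j lt'(3)[of i j] ab[of i] by (cases "i = j") (simp_all add: triple_def)
    next
      fix j assume j: "j < n" "v = (1, j)"
      then show ?thesis using uv(3) i lt'(1)[of i j] by (simp add: yrank_def triple_def)
    next
      fix j assume j: "j < n" "v = (2, j)"
      then show ?thesis using uv(3) i ca[of j i] by (simp add: yrank_def triple_def)
    qed
  next
    fix i assume i: "i < n" "u = (2, i)"
    show ?thesis using uv(2)
    proof (rule ix_cases)
      fix j assume j: "j < n" "v = (0, j)"
      then have "\<not> 3 * n < h i" using uv(3) i by (simp add: yrank_def)
      then show ?thesis using h[OF i(1)] i j ab[of j] by (fastforce simp: triple_def)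
    next
      fix j assume j: "j < n" "v = (1, j)"
      then have "\<not> 3 * n < h i" using uv(3) i by (simp add: yrank_def)
      then show ?thesis using h[OF i(1)] i j by (simp add: triple_def)
    next
      fix j assume j: "j < n" "v = (2, j)"
      then show ?thesis using uv(3) i c[of i j] by (simp add: yrank_def triple_def)
    qed
  qed
qed

lemma triple_subset: "(\<And>j. j < n \<Longrightarrow> a j \<in> P \<and> b j \<in> P \<and> c j \<in> P) \<Longrightarrow> triple a b c ` ix n \<subseteq> P"
  unfolding triple_def ix_def by auto

lemma sawtooth_has_struct:
  assumes P: "\<And>j. j < n \<Longrightarrow> a j \<in> P \<and> b j \<in> P \<and> c j \<in> P" and x: "xsaw n a b c" and y: "ysaw n a b"
    and inj: "inj_on h {..<n}" and h: "\<And>j. j < n \<Longrightarrow> h j \<le> n \<and> (\<forall>i<n. snd (c j) < snd (b i)) \<or> 3 * n < h j \<and> (\<forall>i<n. snd (a i) < snd (c j))"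
    and c: "\<And>i j. i < n \<Longrightarrow> j < n \<Longrightarrow> h i < h j \<Longrightarrow> snd (c i) < snd (c j)"
    and A: "bad_structure N ((\<lambda>u. (real (xrank u), real (yrank n h u))) ` ix n)"
  shows "has_struct N P"
proof -
  have "h j \<le> n \<or> 3 * n < h j" if "j < n" for j using h[OF that] by blast
  then have "\<exists>g. sim (\<lambda>d. d) g ((\<lambda>u. (real (xrank u), real (yrank n h u))) ` ix n) (triple a b c ` ix n)"
    by (intro sim_ranks xrank_inj yrank_inj inj triple_x[OF x] triple_y[OF y h c])
  then show ?thesis unfolding has_struct_def using A triple_subset[of n a P b c] P by blast
qed

lemma parallel_has_struct:
  assumes "has_parallel N P"
  shows "has_struct N P"
proof -
  obtain a b c where s: "saw N P a b c" and c: "\<And>i j. i < j \<Longrightarrow> j < N \<Longrightarrow> snd (c i) < snd (c j)" using assms unfolding has_parallel_def by blast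
  show ?thesis
  proof (rule sawtooth_has_struct)
    show "xsaw N a b c" "ysaw N a b" using s unfolding saw_def xsaw_def ysaw_def by blast+
    show "a j \<in> P \<and> b j \<in> P \<and> c j \<in> P" if "j < N" for j using s that unfolding saw_def by blast
    show "inj_on (\<lambda>j. j + 1) {..<N}" by simp
    show "j + 1 \<le> N \<and> (\<forall>i<N. snd (c j) < snd (b i)) \<or> 3 * N < j + 1 \<and> (\<forall>i<N. snd (a i) < snd (c j))" if "j < N" for j
      using s that unfolding saw_def by auto
    show "snd (c i) < snd (c j)" if "j < N" "i + 1 < j + 1" for i j using c that by simp
    show "bad_structure N ((\<lambda>u. (real (xrank u), real (yrank N (\<lambda>j. j + 1) u))) ` ix N)"
      unfolding bad_structure_def parallel_sawtooth_ranks[symmetric] by blast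
  qed
qed

lemma insert_image_fun_upd:
  assumes "inj_on F I" "u \<in> I"
  shows "insert z (F ` I - {F u}) = F(u := z) ` I"
  using assms by (auto simp: inj_on_def image_iff)

lemma wedge_inj: "inj_on (\<lambda>u. (real (xrank u), real (yrank n h u))) (ix n)"
  using xrank_inj[of n] by (auto simp: inj_on_def)

lemma yrank_upd:
  "(\<lambda>u. (real (xrank u), real (yrank n h u)))((2, j) := (3 * real j + 2, real w)) ` ix n = (\<lambda>u. (real (xrank u), real (yrank n (h(j := w)) u))) ` ix n"
  by (rule image_cong) (auto simp: xrank_def yrank_def ix_def split: if_splits)

lemma sliced_wedge1_has_struct:
  assumes P: "\<And>j. j < n \<Longrightarrow> a j \<in> P \<and> b j \<in> P \<and> c j \<in> P" and x: "xsaw n a b c" and y: "ysaw n a b"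
    and cb: "\<And>i j. i < n \<Longrightarrow> j < n \<Longrightarrow> snd (c j) < snd (b i)"
    and c: "\<And>i j. 0 < i \<Longrightarrow> i < j \<Longrightarrow> j < n \<Longrightarrow> snd (c j) < snd (c i)" "\<And>j. 0 < j \<Longrightarrow> j < n \<Longrightarrow> snd (c 0) < snd (c j)"
    and n: "N \<le> n" "0 < n"
  shows "has_struct N P"
proof -
  \<comment> \<open>Type 1: the first slicing point sinks below the heights \<open>1\<close> to
    \<open>n\<close> of the wedge.\<close>
  let ?h = "(\<lambda>j. n - j)(0 := 0::nat)"
  let ?H = "\<lambda>u. (real (xrank u), real (yrank n (\<lambda>j. n - j) u))"
  have H0: "?H (2, 0) = (2, real n)" by (simp add: xrank_def yrank_def)
  have "(2, 0) \<in> ix n" using n(2) by (simp add: ix_def)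
  note u = insert_image_fun_upd[OF wedge_inj[of n "\<lambda>j. n - j"] this, of "(3 * real 0 + 2, real (0::nat))"]
  have "sliced_wedge1 n = insert (3 * real 0 + 2, real (0::nat)) (?H ` ix n - {?H (2, 0)})"
    unfolding sliced_wedge1_def wedge_sawtooth_ranks H0 by (simp add: add.commute)
  also have "\<dots> = ?H((2, 0) := (3 * real 0 + 2, real (0::nat))) ` ix n" by (rule u)
  also have "\<dots> = (\<lambda>u. (real (xrank u), real (yrank n ?h u))) ` ix n" by (rule yrank_upd)
  finally have "sliced_wedge1 n = (\<lambda>u. (real (xrank u), real (yrank n ?h u))) ` ix n" .
  then have A: "bad_structure N ((\<lambda>u. (real (xrank u), real (yrank n ?h u))) ` ix n)"
    unfolding bad_structure_def using n(1) by metis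
  show ?thesis
  proof (rule sawtooth_has_struct[OF P x y _ _ _ A])
    show "inj_on ?h {..<n}" by (auto simp: inj_on_def)
    show "?h j \<le> n \<and> (\<forall>i<n. snd (c j) < snd (b i)) \<or> 3 * n < ?h j \<and> (\<forall>i<n. snd (a i) < snd (c j))" if "j < n" for j
      using cb that by simp
    show "snd (c i) < snd (c j)" if "i < n" "j < n" "?h i < ?h j" for i j
      using that c(1)[of j i] c(2)[of j] by (auto split: if_splits)
  qed
qed

lemma sliced_wedge3_has_struct:
  assumes P: "\<And>j. j < n \<Longrightarrow> a j \<in> P \<and> b j \<in> P \<and> c j \<in> P" and x: "xsaw n a b c" and y: "ysaw n a b"
    and cb: "\<And>i j. 0 < j \<Longrightarrow> i < n \<Longrightarrow> j < n \<Longrightarrow> snd (c j) < snd (b i)"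
    and c: "\<And>i j. 0 < i \<Longrightarrow> i < j \<Longrightarrow> j < n \<Longrightarrow> snd (c j) < snd (c i)" and ac: "\<And>i. i < n \<Longrightarrow> snd (a i) < snd (c 0)"
    and n: "N \<le> n" "0 < n"
  shows "has_struct N P"
proof -
  \<comment> \<open>Type 3: the first slicing point rises above the teeth, which end at height
    \<open>3 * n\<close>.\<close>
  let ?h = "(\<lambda>j. n - j)(0 := 3 * n + 1)"
  let ?H = "\<lambda>u. (real (xrank u), real (yrank n (\<lambda>j. n - j) u))"
  have H0: "?H (2, 0) = (2, real n)" by (simp add: xrank_def yrank_def)
  have "(2, 0) \<in> ix n" using n(2) by (simp add: ix_def)
  note u = insert_image_fun_upd[OF wedge_inj[of n "\<lambda>j. n - j"] this, of "(3 * real 0 + 2, real (3 * n + 1))"]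
  have "sliced_wedge3 n = insert (3 * real 0 + 2, real (3 * n + 1)) (?H ` ix n - {?H (2, 0)})"
    unfolding sliced_wedge3_def wedge_sawtooth_ranks H0 by (simp add: add.commute)
  also have "\<dots> = ?H((2, 0) := (3 * real 0 + 2, real (3 * n + 1))) ` ix n" by (rule u)
  also have "\<dots> = (\<lambda>u. (real (xrank u), real (yrank n ?h u))) ` ix n" by (rule yrank_upd)
  finally have "sliced_wedge3 n = (\<lambda>u. (real (xrank u), real (yrank n ?h u))) ` ix n" .
  then have A: "bad_structure N ((\<lambda>u. (real (xrank u), real (yrank n ?h u))) ` ix n)"
    unfolding bad_structure_def using n(1) by metis
  have c0: "snd (c j) < snd (c 0)" if "0 < j" "j < n" for j
    using cb[OF that(1) n(2) that(2)] ac[OF n(2)] y n(2) unfolding ysaw_def by fastforce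
  show ?thesis
  proof (rule sawtooth_has_struct[OF P x y _ _ _ A])
    show "inj_on ?h {..<n}" by (auto simp: inj_on_def)
    show "?h j \<le> n \<and> (\<forall>i<n. snd (c j) < snd (b i)) \<or> 3 * n < ?h j \<and> (\<forall>i<n. snd (a i) < snd (c j))" if "j < n" for j
      using cb[of j] ac that by (cases "j = 0") auto
    show "snd (c i) < snd (c j)" if "i < n" "j < n" "?h i < ?h j" for i j
      using that c[of j i] c0[of i] by (auto split: if_splits)
  qed
qed

text \<open>In type 2 the right point of the first tooth is the rightmost of all, so the horizontal
  order is not that of a sawtooth alternation. The moved point is compared separately; for the
  remaining points a stand-in next to \<open>c 0\<close> restores the sawtooth order.\<close>

lemma sliced_wedge2_has_struct:
  assumes P: "\<And>j. j < n \<Longrightarrow> a j \<in> P \<and> b j \<in> P \<and> c j \<in> P" and y: "ysaw n a b"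
    and x: "\<And>i. i < n \<Longrightarrow> fst (a i) < fst (c i)" "\<And>i. 0 < i \<Longrightarrow> i < n \<Longrightarrow> fst (c i) < fst (b i)"
      "\<And>i j. 0 < i \<Longrightarrow> i < j \<Longrightarrow> j < n \<Longrightarrow> fst (b i) < fst (a j)" "\<And>i. 0 < i \<Longrightarrow> i < n \<Longrightarrow> fst (c 0) < fst (a i)"
      "\<And>i. 0 < i \<Longrightarrow> i < n \<Longrightarrow> fst (b i) < fst (b 0)" "fst (c 0) < fst (b 0)"
    and cb: "\<And>i j. i < n \<Longrightarrow> j < n \<Longrightarrow> snd (c j) < snd (b i)"
    and c: "\<And>i j. i < j \<Longrightarrow> j < n \<Longrightarrow> snd (c j) < snd (c i)"
    and n: "N \<le> n" "0 < n"
  shows "has_struct N P"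
proof -
  let ?h = "\<lambda>j. n - j" and ?x = "xrank((1, 0) := 3 * n + 1)"
  let ?H = "\<lambda>u. (real (xrank u), real (yrank n ?h u))"
  have H0: "?H (1, 0) = (3, real n + 1)" by (simp add: xrank_def yrank_def)
  have "(1, 0) \<in> ix n" using n(2) by (simp add: ix_def)
  note u = insert_image_fun_upd[OF wedge_inj[of n "\<lambda>j. n - j"] this, of "(3 * real n + 1, real n + 1)"]
  have "sliced_wedge2 n = insert (3 * real n + 1, real n + 1) (?H ` ix n - {?H (1, 0)})"
    unfolding sliced_wedge2_def wedge_sawtooth_ranks H0 ..
  also have "\<dots> = ?H((1, 0) := (3 * real n + 1, real n + 1)) ` ix n" by (rule u)
  also have "?H((1, 0) := (3 * real n + 1, real n + 1)) = (\<lambda>u. (real (?x u), real (yrank n ?h u)))"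
    by (rule ext) (auto simp: yrank_def)
  finally have "sliced_wedge2 n = (\<lambda>u. (real (?x u), real (yrank n ?h u))) ` ix n" .
  then have A: "bad_structure N ((\<lambda>u. (real (?x u), real (yrank n ?h u))) ` ix n)"
    unfolding bad_structure_def using n(1) by metis
  \<comment> \<open>The stand-in has its abscissa halfway between \<open>c 0\<close> and the next
    tooth, or halfway to \<open>b 0\<close> if there is only one tooth.\<close>
  define b' where "b' = b(0 := (((fst (c 0) + (if 1 < n then fst (a 1) else fst (b 0))) / 2), 0))"
  have b'0: "fst (c 0) < fst (b' 0)" "1 < n \<Longrightarrow> fst (b' 0) < fst (a 1)" using x(4)[of 1] x(6) n by (auto simp: b'_def)
  have b0: "fst (b' 0) < fst (a j)" if "0 < j" "j < n" for j
  proof (cases "j = 1")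
    case True
    then show ?thesis using b'0 that by simp
  next
    case False
    then have "1 < j" using that by simp
    then show ?thesis using b'0(2) x(1)[of 1] x(2)[of 1] x(3)[of 1 j] that by simp
  qed
  have x': "xsaw n a b' c"
    unfolding xsaw_def
  proof (intro conjI allI impI)
    fix i assume i: "i < n"
    show "fst (a i) < fst (c i)" using x(1)[OF i] .
    show "fst (c i) < fst (b' i)" using x(2)[of i] i b'0(1) by (cases "i = 0") (auto simp: b'_def)
  next
    fix i j assume ij: "i < j" "j < n"
    show "fst (b' i) < fst (a j)" using x(3)[of i j] ij b0[of j] by (cases "i = 0") (auto simp: b'_def)
  qed
  have top: "fst (triple a b c u) < fst (b 0)" if "u \<in> ix n" "u \<noteq> (1, 0)" for u
    using that(1)
  proof (rule ix_cases)
    fix j assume j: "j < n" "u = (0, j)"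
    then show ?thesis using x(1)[of j] x(2)[of j] x(5)[of j] x(6) by (cases "j = 0") (auto simp: triple_def)
  next
    fix j assume j: "j < n" "u = (1, j)"
    then show ?thesis using x(5)[of j] that(2) by (cases "j = 0") (auto simp: triple_def)
  next
    fix j assume j: "j < n" "u = (2, j)"
    then show ?thesis using x(2)[of j] x(5)[of j] x(6) by (cases "j = 0") (auto simp: triple_def)
  qed
  have tr: "triple a b c u = triple a b' c u" if "u \<noteq> (1, 0)" "u \<in> ix n" for u
    using that by (auto simp: triple_def b'_def ix_def split: if_splits)
  have xr: "xrank u \<le> 3 * n" if "u \<in> ix n" for u using that by (elim ix_cases) (auto simp: xrank_def)
  have "\<exists>g. sim (\<lambda>d. d) g ((\<lambda>u. (real (?x u), real (yrank n ?h u))) ` ix n) (triple a b c ` ix n)"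
  proof (rule sim_ranks)
    show "inj_on ?x (ix n)"
    proof (rule inj_onI)
      fix u v assume uv: "u \<in> ix n" "v \<in> ix n" "?x u = ?x v"
      then show "u = v" using xr[of u] xr[of v] inj_onD[OF xrank_inj[of n], of u v] by (auto split: if_splits)
    qed
    show "inj_on (yrank n ?h) (ix n)" by (rule yrank_inj) (auto simp: inj_on_def)
    show "fst (triple a b c u) < fst (triple a b c v)" if uv: "u \<in> ix n" "v \<in> ix n" "?x u < ?x v" for u v
    proof -
      have u: "u \<noteq> (1, 0)" using uv xr[of v] by (auto split: if_splits)
      show ?thesis
      proof (cases "v = (1, 0)")
        case True
        then show ?thesis using top[OF uv(1) u] by (simp add: triple_def)
      next
        case False
        then show ?thesis using triple_x[OF x' uv(1,2)] uv(3) u tr[OF u uv(1)] tr[OF False uv(2)] by simp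
      qed
    qed
    show "snd (triple a b c u) < snd (triple a b c v)" if uv: "u \<in> ix n" "v \<in> ix n" "yrank n ?h u < yrank n ?h v" for u v
    proof (rule triple_y[OF y _ _ uv])
      show "n - j \<le> n \<and> (\<forall>i<n. snd (c j) < snd (b i)) \<or> 3 * n < n - j \<and> (\<forall>i<n. snd (a i) < snd (c j))" if "j < n" for j
        using cb that by simp
      show "snd (c i) < snd (c j)" if "i < n" "j < n" "n - i < n - j" for i j
        using that c[of j i] by simp
    qed
  qed
  then show ?thesis unfolding has_struct_def using A triple_subset[of n a P b c] P by blast
qed

section \<open>Extensions of layered spirals\<close>

lemma tf_simps [simp]: "fst (tf d e z) = sg d z" "snd (tf d e z) = sg e z"
  by (simp_all add: tf_def)

text \<open>\<open>B s d\<close> is the extent in direction \<open>d\<close> of the \<open>s\<close>-th layer, and \<open>p s\<close> a pin that reaches it in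
  direction \<open>dir s\<close>.\<close>

locale layered_spiral =
  fixes P :: "point set" and c0 :: point and p :: "nat \<Rightarrow> point" and dir :: "nat \<Rightarrow> direction"
    and B :: "nat \<Rightarrow> direction \<Rightarrow> real" and m :: nat
  assumes gpP: "gp P" and c0P: "c0 \<in> P" and p1: "p 1 = c0"
    and Bmono: "\<And>s t d. s \<le> t \<Longrightarrow> B s d \<le> B t d"
    and c0B: "\<And>d. sg d c0 \<le> B 0 d"
    and layer: "\<And>s d z. z \<in> P \<Longrightarrow> (\<And>e. perp d e \<Longrightarrow> sg e z \<le> B s e) \<Longrightarrow> sg d z \<le> B (Suc s) d"
    and pP: "\<And>s. 2 \<le> s \<Longrightarrow> s \<le> m \<Longrightarrow> p s \<in> P"
    and main: "\<And>s. 2 \<le> s \<Longrightarrow> s \<le> m \<Longrightarrow> sg (dir s) (p s) = B s (dir s) \<and> B (s - 1) (dir s) < B s (dir s)"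
    and cross: "\<And>s. 2 \<le> s \<Longrightarrow> s \<le> m \<Longrightarrow>
      B (s - 2) (dir (s - 1)) < sg (dir (s - 1)) (p s) \<and> sg (dir (s - 1)) (p s) < B (s - 1) (dir (s - 1))"
    and dir_opp: "\<And>s. dir (s + 2) = opp (dir s)"
    and dir_perp: "\<And>s. perp (dir s) (dir (s + 1))"
begin

declare One_nat_def [simp del]

lemma c0_le: "sg d c0 \<le> B s d"
  using c0B[of d] Bmono[of 0 s d] by simp

lemma dir4: "dir (s + 4) = dir s"
proof -
  have "dir (s + 4) = dir ((s + 2) + 2)" by (rule arg_cong[of _ _ dir]) simp
  also have "\<dots> = opp (opp (dir s))" by (simp only: dir_opp)
  finally show ?thesis by simp
qed

lemma mod4_gap: "a mod 4 = b mod 4 \<Longrightarrow> a < b \<Longrightarrow> a + 4 \<le> (b::nat)"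
  by presburger

lemma mod4_ge: "l mod 4 = a mod 4 \<Longrightarrow> a < l \<Longrightarrow> l \<noteq> a + 4 \<Longrightarrow> a + 8 \<le> (l::nat)"
proof -
  assume a: "l mod 4 = a mod 4" "a < l" "l \<noteq> a + 4"
  have "(a + 4) mod 4 = a mod 4" by (rule mod_add_self2)
  then have e: "(a + 4) mod 4 = l mod 4" by (rule trans[OF _ a(1)[symmetric]])
  have "a + 4 \<le> l" by (rule mod4_gap[OF a(1)[symmetric] a(2)])
  then have "a + 4 < l" using a(3) by linarith
  then have "a + 4 + 4 \<le> l" by (rule mod4_gap[OF e])
  then show "a + 8 \<le> l" by linarith
qed

lemma mod4_pred: "l mod 4 = (i + 1) mod 4 \<Longrightarrow> 1 \<le> l \<Longrightarrow> (l - 1) mod 4 = i mod (4::nat)"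
proof -
  have "k mod 4 = i mod 4" if h: "(k + 1) mod 4 = (i + 1) mod 4" for k :: nat
  proof -
    have "(k + 1 + 3) mod 4 = (i + 1 + 3) mod 4" by (rule mod_add_cong[OF h refl])
    moreover have "k + 1 + 3 = k + 4" "i + 1 + 3 = i + 4" by linarith+
    ultimately have "(k + 4) mod 4 = (i + 4) mod 4" by (simp only:)
    then show ?thesis by (simp only: mod_add_self2)
  qed
  then show "l mod 4 = (i + 1) mod 4 \<Longrightarrow> 1 \<le> l \<Longrightarrow> (l - 1) mod 4 = i mod (4::nat)" by (metis le_add_diff_inverse2)
qed

lemma mod4_cases: "l mod 4 = i mod 4 \<or> l mod 4 = (i + 1) mod 4 \<or> l mod 4 = (i + 2) mod 4 \<or> l mod 4 = (i + 3) mod (4::nat)"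
proof -
  have i: "i mod 4 = 0 \<or> i mod 4 = 1 \<or> i mod 4 = 2 \<or> i mod 4 = 3" using mod_less_divisor[of 4 i] by linarith
  have l: "l mod 4 = 0 \<or> l mod 4 = 1 \<or> l mod 4 = 2 \<or> l mod 4 = 3" using mod_less_divisor[of 4 l] by linarith
  have m: "(i + k) mod 4 = (i mod 4 + k) mod 4" for k by (rule mod_add_left_eq[symmetric])
  show ?thesis using i l unfolding m[of 1] m[of 2] m[of 3] by (elim disjE) simp_all
qed

lemma dir4k: "dir (s + 4 * k) = dir s"
proof (induction k)
  case (Suc k)
  have "s + 4 * Suc k = (s + 4 * k) + 4" by simp
  then show ?case using dir4[of "s + 4 * k"] Suc by metis
qed simp

lemma dir_mod: "s mod 4 = t mod 4 \<Longrightarrow> dir s = dir t"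
proof -
  assume st: "s mod 4 = t mod 4"
  have "dir s = dir (s mod 4)" using dir4k[of "s mod 4" "s div 4"] by simp
  moreover have "dir t = dir (t mod 4)" using dir4k[of "t mod 4" "t div 4"] by simp
  ultimately show ?thesis using st by simp
qed

lemma dir_near:
  assumes "7 \<le> i"
  shows "dir (i - 2) = opp (dir i)" "dir (i - 4) = dir i" "dir (i - 3) = opp (dir (i - 1))" "dir (i - 5) = dir (i - 1)"
    "dir (i - 6) = opp (dir i)" "dir (i - 7) = opp (dir (i - 1))"
    "dir (i + 1) = opp (dir (i - 1))" "dir (i + 2) = opp (dir i)" "dir (i + 3) = dir (i - 1)" "dir (i + 4) = dir i" "dir (i + 5) = opp (dir (i - 1))"
    "perp (dir i) (dir (i - 1))" "perp (dir (i - 1)) (dir i)"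
proof -
  obtain k where k: "i = k + 7" using assms by (metis le_iff_add add.commute)
  have e: "i - 1 = k + 6" "i - 2 = k + 5" "i - 3 = k + 4" "i - 4 = k + 3" "i - 5 = k + 2" "i - 6 = k + 1" "i - 7 = k" using k by simp_all
  have d: "dir a = opp (dir b)" if "a = b + 2" for a b using dir_opp[of b] that by simp
  have f: "dir a = dir b" if "a = b + 4" for a b using dir4[of b] that by simp
  have o: "dir b = opp (dir a)" if "a = b + 2" for a b using d[OF that] by simp
  show "dir (i - 2) = opp (dir i)" using o[of i "i - 2"] e k by simp
  show "dir (i - 4) = dir i" using f[of i "i - 4"] e k by simp
  show "dir (i - 3) = opp (dir (i - 1))" using o[of "i - 1" "i - 3"] e k by simp
  show "dir (i - 5) = dir (i - 1)" using f[of "i - 1" "i - 5"] e k by simp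
  show "dir (i - 6) = opp (dir i)" using f[of "i - 2" "i - 6"] o[of i "i - 2"] e k by simp
  show "dir (i - 7) = opp (dir (i - 1))" using f[of "i - 3" "i - 7"] o[of "i - 1" "i - 3"] e k by simp
  show "dir (i + 1) = opp (dir (i - 1))" using d[of "i + 1" "i - 1"] e k by simp
  show "dir (i + 2) = opp (dir i)" using d[of "i + 2" i] by simp
  show "dir (i + 3) = dir (i - 1)" using f[of "i + 3" "i - 1"] e k by simp
  show "dir (i + 4) = dir i" using f[of "i + 4" i] by simp
  show "dir (i + 5) = opp (dir (i - 1))" using f[of "i + 5" "i + 1"] d[of "i + 1" "i - 1"] e k by simp
  have "perp (dir (i - 1)) (dir (i - 1 + 1))" by (rule dir_perp)
  moreover have "i - 1 + 1 = i" using assms by simp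
  ultimately show "perp (dir (i - 1)) (dir i)" by metis
  then show "perp (dir i) (dir (i - 1))" by (rule perp_sym)
qed

text \<open>Beyond \<open>c0\<close> in direction \<open>d\<close>, a point cannot leave a layer on
  the opposite side, because \<open>c0\<close> is in every layer. So it lies in a strip through
  layer \<open>s\<close>, and the next layer takes it in.\<close>

lemma layer_arm:
  assumes "z \<in> P" "perp d e" "sg d c0 \<le> sg d z" "sg d z \<le> B s d"
  shows "sg e z \<le> B (Suc s) e"
proof (rule layer[OF assms(1)])
  fix g assume "perp e g"
  then have "g = d \<or> g = opp d" using perp_perp[OF assms(2)] by blast
  then show "sg g z \<le> B s g"
  proof
    assume "g = opp d"
    then have "sg g z \<le> sg g c0" using assms(3) by simp
    then show ?thesis using c0_le[of g s] by simp
  qed (use assms(4) in simp)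
qed

lemma layer_arm':
  assumes "z \<in> P" "perp d e" "sg d c0 \<le> sg d z" "B (Suc s) e < sg e z"
  shows "B s d < sg d z"
  using layer_arm[OF assms(1-3), of s] assms(4) by force

text \<open>The local modifications of the spiral stay within these bounds.\<close>

definition adm :: "(nat \<Rightarrow> point) \<Rightarrow> bool" where
  "adm r \<longleftrightarrow> r 1 = c0 \<and> (\<forall>s\<in>{2..m}. r s \<in> P \<and>
      B (s - 4) (dir s) < sg (dir s) (r s) \<and> sg (dir s) (r s) \<le> B s (dir s) \<and>
      B (s - 5) (dir (s - 1)) < sg (dir (s - 1)) (r s) \<and> sg (dir (s - 1)) (r s) < B (s - 1) (dir (s - 1)) \<and>
      (3 \<le> s \<longrightarrow> sg (dir (s - 1)) (r s) < sg (dir (s - 1)) (r (s - 1))))"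

lemma adm_p: "adm p"
  unfolding adm_def
proof (intro conjI ballI impI)
  show "p 1 = c0" by (rule p1)
  fix s assume s: "s \<in> {2..m}"
  have mn: "sg (dir s) (p s) = B s (dir s)" "B (s - 1) (dir s) < B s (dir s)" using main[of s] s by auto
  have cr: "B (s - 2) (dir (s - 1)) < sg (dir (s - 1)) (p s)" "sg (dir (s - 1)) (p s) < B (s - 1) (dir (s - 1))" using cross[of s] s by auto
  show "p s \<in> P" using pP s by auto
  show "B (s - 4) (dir s) < sg (dir s) (p s)" using mn Bmono[of "s - 4" "s - 1" "dir s", OF diff_le_mono2] by simp
  show "sg (dir s) (p s) \<le> B s (dir s)" using mn by simp
  show "B (s - 5) (dir (s - 1)) < sg (dir (s - 1)) (p s)" using cr Bmono[of "s - 5" "s - 2" "dir (s - 1)", OF diff_le_mono2] by simp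
  show "sg (dir (s - 1)) (p s) < B (s - 1) (dir (s - 1))" by (rule cr)
  assume "3 \<le> s"
  then show "sg (dir (s - 1)) (p s) < sg (dir (s - 1)) (p (s - 1))" using main[of "s - 1"] s cr by auto
qed

lemma admD:
  assumes "adm r" "2 \<le> s" "s \<le> m"
  shows "r s \<in> P" "B (s - 4) (dir s) < sg (dir s) (r s)" "sg (dir s) (r s) \<le> B s (dir s)"
    "B (s - 5) (dir (s - 1)) < sg (dir (s - 1)) (r s)" "sg (dir (s - 1)) (r s) < B (s - 1) (dir (s - 1))"
    "3 \<le> s \<Longrightarrow> sg (dir (s - 1)) (r s) < sg (dir (s - 1)) (r (s - 1))"
    "sg (dir s) c0 < sg (dir s) (r s)" "sg (dir (s - 1)) c0 < sg (dir (s - 1)) (r s)"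
proof -
  show a: "r s \<in> P" "B (s - 4) (dir s) < sg (dir s) (r s)" "sg (dir s) (r s) \<le> B s (dir s)"
    "B (s - 5) (dir (s - 1)) < sg (dir (s - 1)) (r s)" "sg (dir (s - 1)) (r s) < B (s - 1) (dir (s - 1))"
    "3 \<le> s \<Longrightarrow> sg (dir (s - 1)) (r s) < sg (dir (s - 1)) (r (s - 1))"
    using assms unfolding adm_def by auto
  show "sg (dir s) c0 < sg (dir s) (r s)" using a(2) c0_le[of "dir s" "s - 4"] by simp
  show "sg (dir (s - 1)) c0 < sg (dir (s - 1)) (r s)" using a(4) c0_le[of "dir (s - 1)" "s - 5"] by simp
qed

text \<open>The directions have period 4. Beyond \<open>c0\<close> in direction \<open>dir i\<close>
  lie at most the pins heading there and the pins that follow them; the pins of the other two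
  residues are on the far side of \<open>c0\<close>.\<close>

lemma adm_coord:
  assumes r: "adm r" and l: "1 \<le> l" "l \<le> m"
  shows "sg (dir i) (r l) \<le> sg (dir i) c0 \<or>
    (2 \<le> l \<and> l mod 4 = i mod 4 \<and> B (l - 4) (dir i) < sg (dir i) (r l) \<and> sg (dir i) (r l) \<le> B l (dir i)) \<or>
    (2 \<le> l \<and> l mod 4 = (i + 1) mod 4 \<and> B (l - 5) (dir i) < sg (dir i) (r l) \<and> sg (dir i) (r l) < B (l - 1) (dir i))"
proof (cases "l = 1")
  case True
  then show ?thesis using r by (simp add: adm_def)
next
  case False
  then have l2: "2 \<le> l" using l by simp
  note A = admD[OF r l2 l(2)]
  have l1: "l = Suc (l - 1)" using l2 by simp
  consider "l mod 4 = i mod 4" | "l mod 4 = (i + 1) mod 4" | "l mod 4 = (i + 2) mod 4" | "l mod 4 = (i + 3) mod 4" using mod4_cases[of l i] by blast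
  then show ?thesis
  proof cases
    case 1
    then have "dir l = dir i" by (rule dir_mod)
    then show ?thesis using A(2,3) 1 l2 by auto
  next
    case 2
    have "(l - 1) mod 4 = i mod 4" using mod4_pred[OF 2] l2 by linarith
    then have "dir (l - 1) = dir i" by (rule dir_mod)
    then show ?thesis using A(4,5) 2 l2 by auto
  next
    case 3
    then have "dir l = opp (dir i)" using dir_mod[of l "i + 2"] dir_opp by simp
    then show ?thesis using A(7) by simp
  next
    case 4
    have "i + 3 = i + 2 + 1" by simp
    then have "l mod 4 = (i + 2 + 1) mod 4" using 4 by (simp only:)
    then have "(l - 1) mod 4 = (i + 2) mod 4" by (rule mod4_pred) (use l2 in linarith)
    then have "dir (l - 1) = opp (dir i)" using dir_mod[of "l - 1" "i + 2"] dir_opp by simp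
    then show ?thesis using A(8) by simp
  qed
qed

text \<open>All comparisons go through layers: the previous pin with the same direction is four
  steps earlier and stays within layer \<open>i - 4\<close>, and pin \<open>i\<close> is beyond that
  layer in its own direction. Similarly layer \<open>i - 5\<close> decides along the direction of
  pin \<open>i - 1\<close>.\<close>

lemma adm_pins:
  assumes r: "adm r"
  shows "pins m r dir"
  unfolding pins_def
proof (intro ballI conjI)
  fix i assume i: "i \<in> {3..m}"
  have i2: "2 \<le> i" "i \<le> m" "3 \<le> i" using i by auto
  note A = admD[OF r i2(1,2)]
  have "perp (dir (i - 1)) (dir (i - 1 + 1))" by (rule dir_perp)
  then show "perp (dir i) (dir (i - 1))" using i2 perp_sym by simp
  show "sg (dir (i - 1)) (r i) < sg (dir (i - 1)) (r (i - 1))" using A(6) i2 by simp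
  show "sg (dir i) (r j) < sg (dir i) (r i)" if j: "j \<in> {1..<i}" for j
  proof -
    have jm: "1 \<le> j" "j \<le> m" using i j by auto
    from adm_coord[OF r jm, of i] show ?thesis
    proof (elim disjE conjE)
      assume "sg (dir i) (r j) \<le> sg (dir i) c0"
      then show ?thesis using A(7) by simp
    next
      assume a: "j mod 4 = i mod 4" "sg (dir i) (r j) \<le> B j (dir i)"
      have "j < i" using j by auto
      then have "j \<le> i - 4" using mod4_gap[OF a(1)] by linarith
      then show ?thesis using Bmono[of j "i - 4" "dir i"] a(2) A(2) by simp
    next
      assume a: "j mod 4 = (i + 1) mod 4" "sg (dir i) (r j) < B (j - 1) (dir i)"
      have "j < i + 1" using j by auto
      then have "j - 1 \<le> i - 4" using mod4_gap[OF a(1)] by linarith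
      then show ?thesis using Bmono[of "j - 1" "i - 4" "dir i"] a(2) A(2) by simp
    qed
  qed
  show "sg (dir (i - 1)) (r j) < sg (dir (i - 1)) (r i)" if j: "j \<in> {1..<i - 1}" for j
  proof -
    have jm: "1 \<le> j" "j \<le> m" using i j by auto
    from adm_coord[OF r jm, of "i - 1"] show ?thesis
    proof (elim disjE conjE)
      assume "sg (dir (i - 1)) (r j) \<le> sg (dir (i - 1)) c0"
      then show ?thesis using A(8) by simp
    next
      assume a: "j mod 4 = (i - 1) mod 4" "sg (dir (i - 1)) (r j) \<le> B j (dir (i - 1))"
      have "j < i - 1" using j by auto
      then have "j \<le> i - 5" using mod4_gap[OF a(1)] by linarith
      then show ?thesis using Bmono[of j "i - 5" "dir (i - 1)"] a(2) A(4) by simp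
    next
      assume a: "j mod 4 = (i - 1 + 1) mod 4" "sg (dir (i - 1)) (r j) < B (j - 1) (dir (i - 1))"
      have "j < i - 1 + 1" using j by auto
      then have "j - 1 \<le> i - 5" using mod4_gap[OF a(1)] by linarith
      then show ?thesis using Bmono[of "j - 1" "i - 5" "dir (i - 1)"] a(2) A(4) by simp
    qed
  qed
qed

lemma adm_spiral:
  assumes r: "adm r" and m: "2 \<le> m"
  shows "spiral m r"
proof -
  have P: "pins m r dir" using adm_pins[OF r] .
  have "r 1 \<noteq> r 2" using admD(7)[OF r, of 2] m r by (auto simp: adm_def)
  then have "proper_pin_sequence (r ` {1..m}) m r" using pins_proper[OF P] by blast
  moreover have "dir i \<noteq> dir (i - 2)" if "i \<in> {5..m}" for i
  proof -
    have "i = (i - 2) + 2" using that by auto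
    then show ?thesis using dir_opp[of "i - 2"] by (metis opp_neq(1))
  qed
  then have "turns m r = {}" using pins_turns[OF P] by auto
  ultimately show ?thesis by (simp add: spiral_def)
qed

text \<open>Coordinates in the corner between the directions of the pins \<open>i - 1\<close> and \<open>i\<close>.\<close>

abbreviation X :: "nat \<Rightarrow> point \<Rightarrow> real" where "X i \<equiv> sg (dir i)"
abbreviation Y :: "nat \<Rightarrow> point \<Rightarrow> real" where "Y i \<equiv> sg (dir (i - 1))"

text \<open>Points that do not interfere with an extension of pin \<open>i\<close> are of two sorts.
  Inner ones are below and left of the place of the extension, seen in the frame of that corner;
  outer ones avoid, in each coordinate, the window from \<open>c0\<close> to layer
  \<open>i + 3\<close>.\<close>

definition inner :: "nat \<Rightarrow> point \<Rightarrow> bool" where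
  "inner i z \<longleftrightarrow> X i z \<le> B (i - 4) (dir i) \<and> Y i z \<le> B (i - 5) (dir (i - 1))"

definition outer :: "nat \<Rightarrow> point \<Rightarrow> bool" where
  "outer i z \<longleftrightarrow> (X i z \<le> X i c0 \<or> B (i + 3) (dir i) < X i z) \<and> (Y i z \<le> Y i c0 \<or> B (i + 3) (dir (i - 1)) < Y i z)"

text \<open>The region that an extension of pin \<open>i\<close> may occupy. Being beyond layer
  \<open>i - 7\<close> in two perpendicular directions, each coordinate of the point is beyond that
  layer on one side or short of \<open>c0\<close>. So extensions of pins at least 11 apart are inner
  or outer for each other.\<close>

definition near :: "nat \<Rightarrow> point \<Rightarrow> bool" where
  "near i z \<longleftrightarrow> (\<forall>d. sg d z \<le> B (i + 3) d) \<and> (\<exists>d e. perp d e \<and> B (i - 7) d < sg d z \<and> B (i - 7) e < sg e z)"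

lemma near_inner: "near i z \<Longrightarrow> i + 11 \<le> j \<Longrightarrow> inner j z"
proof -
  assume n: "near i z" and ij: "i + 11 \<le> j"
  have "i + 3 \<le> j - 4" "i + 3 \<le> j - 5" using ij by auto
  then have "B (i + 3) d \<le> B (j - 4) d" "B (i + 3) d \<le> B (j - 5) d" for d using Bmono by auto
  moreover have "sg d z \<le> B (i + 3) d" for d using n by (simp add: near_def)
  ultimately show "inner j z" unfolding inner_def by (meson order_trans)
qed

lemma near_outer:
  assumes n: "near i z" and j: "7 \<le> j" "j + 11 \<le> i"
  shows "outer j z"
proof -
  obtain d e where de: "perp d e" "B (i - 7) d < sg d z" "B (i - 7) e < sg e z" using n unfolding near_def by blast
  have *: "sg g z \<le> sg g c0 \<or> B (j + 3) g < sg g z" for g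
  proof -
    have l: "B (j + 3) c \<le> B (i - 7) c" "sg c c0 \<le> B (i - 7) c" for c using Bmono[of "j + 3" "i - 7" c] j c0_le by auto
    have "g = d \<or> g = opp d \<or> g = e \<or> g = opp e" using direction_cases_perp[OF de(1)] .
    then show ?thesis using de(2,3) l[of d] l[of e] by auto
  qed
  show ?thesis unfolding outer_def using * by blast
qed

lemma adm_inner:
  assumes r: "adm r" and i: "10 \<le> i" "i + 6 \<le> m" and l: "1 \<le> l" "l \<le> i - 2"
  shows "inner i (r l)"
proof -
  have lm: "l \<le> m" using l i by simp
  have X: "X i (r l) \<le> B (i - 4) (dir i)"
    using adm_coord[OF r l(1) lm, of i]
  proof (elim disjE conjE)
    assume "X i (r l) \<le> X i c0"
    then show ?thesis using c0_le[of "dir i" "i - 4"] by simp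
  next
    assume a: "l mod 4 = i mod 4" "X i (r l) \<le> B l (dir i)"
    have "l < i" using l i by simp
    then have "l \<le> i - 4" using mod4_gap[OF a(1)] by linarith
    then show ?thesis using a(2) Bmono[of l "i - 4" "dir i"] by simp
  next
    assume a: "l mod 4 = (i + 1) mod 4" "X i (r l) < B (l - 1) (dir i)"
    have "l < i + 1" using l i by simp
    then have "l - 1 \<le> i - 4" using mod4_gap[OF a(1)] by linarith
    then show ?thesis using a(2) Bmono[of "l - 1" "i - 4" "dir i"] by simp
  qed
  have Y: "Y i (r l) \<le> B (i - 5) (dir (i - 1))"
    using adm_coord[OF r l(1) lm, of "i - 1"]
  proof (elim disjE conjE)
    assume "Y i (r l) \<le> Y i c0"
    then show ?thesis using c0_le[of "dir (i - 1)" "i - 5"] by simp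
  next
    assume a: "l mod 4 = (i - 1) mod 4" "Y i (r l) \<le> B l (dir (i - 1))"
    have "l < i - 1" using l i by simp
    then have "l \<le> i - 5" using mod4_gap[OF a(1)] by linarith
    then show ?thesis using a(2) Bmono[of l "i - 5" "dir (i - 1)"] by simp
  next
    assume a: "l mod 4 = (i - 1 + 1) mod 4" "Y i (r l) < B (l - 1) (dir (i - 1))"
    have "l < i - 1 + 1" using l i by simp
    then have "l - 1 \<le> i - 5" using mod4_gap[OF a(1)] by linarith
    then show ?thesis using a(2) Bmono[of "l - 1" "i - 5" "dir (i - 1)"] by simp
  qed
  show ?thesis using X Y by (simp add: inner_def)
qed

lemma adm_outer:
  assumes r: "adm r" and i: "10 \<le> i" and l: "l \<le> m" and hi: "l = i + 2 \<or> i + 6 \<le> l"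
  shows "outer i (r l)"
proof -
  have l': "1 \<le> l" using hi by auto
  have "X i (r l) \<le> X i c0 \<or> B (i + 3) (dir i) < X i (r l)"
    using adm_coord[OF r l' l, of i]
  proof (elim disjE conjE)
    assume a: "l mod 4 = i mod 4" "B (l - 4) (dir i) < X i (r l)"
    have "i < l" "l \<noteq> i + 4" using hi i by auto
    then have "i + 3 \<le> l - 4" using mod4_ge[OF a(1)] i by auto
    then show ?thesis using a(2) Bmono[of "i + 3" "l - 4" "dir i"] by simp
  next
    assume a: "l mod 4 = (i + 1) mod 4" "B (l - 5) (dir i) < X i (r l)"
    have "(i + 1) < l" "l \<noteq> (i + 1) + 4" using hi i by auto
    then have "i + 3 \<le> l - 5" using mod4_ge[OF a(1)] i by auto
    then show ?thesis using a(2) Bmono[of "i + 3" "l - 5" "dir i"] by simp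
  qed simp
  moreover have "Y i (r l) \<le> Y i c0 \<or> B (i + 3) (dir (i - 1)) < Y i (r l)"
    using adm_coord[OF r l' l, of "i - 1"]
  proof (elim disjE conjE)
    assume a: "l mod 4 = (i - 1) mod 4" "B (l - 4) (dir (i - 1)) < Y i (r l)"
    have "(i - 1) < l" "l \<noteq> (i - 1) + 4" using hi i by auto
    then have "i + 3 \<le> l - 4" using mod4_ge[OF a(1)] i by auto
    then show ?thesis using a(2) Bmono[of "i + 3" "l - 4" "dir (i - 1)"] by simp
  next
    assume a: "l mod 4 = (i - 1 + 1) mod 4" "B (l - 5) (dir (i - 1)) < Y i (r l)"
    have "(i - 1 + 1) < l" "l \<noteq> (i - 1 + 1) + 4" using hi i by auto
    then have "i + 3 \<le> l - 5" using mod4_ge[OF a(1)] i by auto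
    then show ?thesis using a(2) Bmono[of "i + 3" "l - 5" "dir (i - 1)"] by simp
  qed simp
  ultimately show ?thesis by (simp add: outer_def)
qed

text \<open>This leaves six pins to be compared individually with an extension of pin
  \<open>i\<close>.\<close>

lemma adm_positions:
  assumes r: "adm r" and i: "10 \<le> i" "i + 6 \<le> m" and l: "1 \<le> l" "l \<le> m"
  shows "inner i (r l) \<or> outer i (r l) \<or> l \<in> {i - 1, i, i + 1, i + 3, i + 4, i + 5}"
proof -
  have "l \<le> i - 2 \<or> (l = i + 2 \<or> i + 6 \<le> l) \<or> (l = i - 1 \<or> l = i \<or> l = i + 1 \<or> l = i + 3 \<or> l = i + 4 \<or> l = i + 5)" using i by linarith
  then show ?thesis using adm_inner[OF r i l(1)] adm_outer[OF r i(1) l(2)] by blast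
qed

lemma adm_special:
  assumes r: "adm r" and i: "10 \<le> i" "i + 6 \<le> m"
  shows "X i (r (i - 1)) < X i c0" "Y i (r (i - 1)) \<le> B (i - 1) (dir (i - 1))"
    "B (i - 4) (dir i) < X i (r i)" "X i (r i) \<le> B i (dir i)" "B (i - 5) (dir (i - 1)) < Y i (r i)" "Y i (r i) < Y i (r (i - 1))"
    "B (i - 4) (dir i) < X i (r (i + 1))" "X i (r (i + 1)) < X i (r i)" "Y i (r (i + 1)) < Y i c0"
    "X i (r (i + 3)) < X i c0" "Y i (r (i + 4)) < Y i (r (i + 3))" "Y i (r (i + 3)) \<le> B (i + 3) (dir (i - 1))"
    "B i (dir i) < X i (r (i + 4))" "B (i - 1) (dir (i - 1)) < Y i (r (i + 4))"
    "B i (dir i) < X i (r (i + 5))" "Y i (r (i + 5)) < Y i c0"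
proof -
  have dn: "dir (i - 2) = opp (dir i)" "dir (i + 1) = opp (dir (i - 1))" "dir (i + 2) = opp (dir i)" "dir (i + 3) = dir (i - 1)"
    "dir (i + 4) = dir i" "dir (i + 5) = opp (dir (i - 1))" by (rule dir_near, use i in linarith)+
  have s: "i - 1 - 1 = i - 2" "i + 1 - 1 = i" "i + 1 - 4 = i - 3" "i + 1 - 5 = i - 4" "i + 3 - 1 = i + 2" "i + 4 - 1 = i + 3"
    "i + 4 - 4 = i" "i + 4 - 5 = i - 1" "i + 5 - 1 = i + 4" "i + 5 - 5 = i" using i by auto
  show "X i (r (i - 1)) < X i c0" "Y i (r (i - 1)) \<le> B (i - 1) (dir (i - 1))"
    using admD(8)[OF r, of "i - 1"] admD(3)[OF r, of "i - 1"] dn s i by auto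
  show "B (i - 4) (dir i) < X i (r i)" "X i (r i) \<le> B i (dir i)" "B (i - 5) (dir (i - 1)) < Y i (r i)" "Y i (r i) < Y i (r (i - 1))"
    using admD[OF r, of i] i by auto
  show "B (i - 4) (dir i) < X i (r (i + 1))" "X i (r (i + 1)) < X i (r i)" "Y i (r (i + 1)) < Y i c0"
    using admD(4,6,7)[OF r, of "i + 1"] dn s i by auto
  show "X i (r (i + 3)) < X i c0" "Y i (r (i + 3)) \<le> B (i + 3) (dir (i - 1))"
    using admD(8)[OF r, of "i + 3", unfolded dn s] admD(3)[OF r, of "i + 3", unfolded dn s] i by auto
  show "Y i (r (i + 4)) < Y i (r (i + 3))" "B i (dir i) < X i (r (i + 4))" "B (i - 1) (dir (i - 1)) < Y i (r (i + 4))"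
    using admD(2,4,6)[OF r, of "i + 4", unfolded dn s] i by auto
  show "B i (dir i) < X i (r (i + 5))" "Y i (r (i + 5)) < Y i c0"
    using admD(4,7)[OF r, of "i + 5", unfolded dn s] i by auto
qed

section \<open>The two kinds of extension in coordinates\<close>

definition ext1 :: "(nat \<Rightarrow> point) \<Rightarrow> nat \<Rightarrow> point \<Rightarrow> bool" where
  "ext1 r i q \<longleftrightarrow> q \<in> P \<and> X i q < X i (r i) \<and> Y i (r i) < Y i q \<and> B (i - 4) (dir i) < X i q \<and> Y i q < Y i (r (i + 4)) \<and>
     (Y i (r (i - 1)) < Y i q \<or> X i q < X i (r (i + 1)))"

text \<open>In the first alternative \<open>s\<close> slices the copy of 21 from the side of pin
  \<open>i + 1\<close>, at a depth between pins \<open>i - 3\<close> and \<open>i + 2\<close>. In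
  the second it slices from the side of pin \<open>i - 2\<close>, short of pin \<open>i - 1\<close>.
  They lead to the condition on \<open>s\<close> with pin \<open>i + 1\<close> and to the one with
  pin \<open>i - 1\<close>, respectively.\<close>

definition ext2 :: "(nat \<Rightarrow> point) \<Rightarrow> nat \<Rightarrow> point \<Rightarrow> point \<Rightarrow> point \<Rightarrow> bool" where
  "ext2 r i u v s \<longleftrightarrow> u \<in> P \<and> v \<in> P \<and> s \<in> P \<and>
     B (i - 4) (dir i) < X i u \<and> X i u < X i v \<and> X i v < X i (r (i + 1)) \<and>
     B (i - 5) (dir (i - 1)) < Y i v \<and> Y i v < Y i u \<and> Y i u < Y i (r i) \<and>
     (X i u < X i s \<and> X i s < X i v \<and> X (i + 1) (r (i - 3)) < X (i + 1) s \<and> X (i + 1) s < X (i + 1) (r (i + 2)) \<or>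
      Y i v < Y i s \<and> Y i s < Y i u \<and> B (i - 6) (dir (i - 2)) < X (i - 2) s \<and> X (i - 2) s < X (i - 2) (r (i - 1)))"

lemma corner_symmetry:
  assumes "10 \<le> i"
  shows "tf (dir i) (dir (i - 1)) \<in> square_symmetries"
  using dir_near(12)[of i] assms square_symmetries_iff by auto

lemma corner_directions:
  assumes r: "adm r" and i: "10 \<le> i" "i \<le> m"
  shows "pin_direction (tf (dir i) (dir (i - 1)) \<circ> r) (i - 1) Up" "pin_direction (tf (dir i) (dir (i - 1)) \<circ> r) i Right"
  using pins_direction[OF adm_pins[OF r], of i "dir i"] pins_direction[OF adm_pins[OF r], of "i - 1" "dir (i - 1)"] i
  unfolding pin_direction_iff by (simp_all add: tf_def)

text \<open>The ambient set may hold further points provided they are inner or outer, which is what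
  allows several extensions on one spiral.\<close>

lemma ext1_extension:
  assumes r: "adm r" and i: "10 \<le> i" "i + 6 \<le> m" and q: "ext1 r i q"
    and A: "\<And>z. z \<in> A \<Longrightarrow> z \<in> r ` {1..m} \<or> z = q \<or> inner i z \<or> outer i z"
  shows "extension_of A m r i {q}" and "q \<notin> r ` {1..m}" and "near i q"
proof -
  let ?f = "tf (dir i) (dir (i - 1))"
  note S = adm_special[OF r i]
  have q': "q \<in> P" "X i q < X i (r i)" "Y i (r i) < Y i q" "B (i - 4) (dir i) < X i q" "Y i q < Y i (r (i + 4))"
     "Y i (r (i - 1)) < Y i q \<or> X i q < X i (r (i + 1))" using q unfolding ext1_def by auto
  have c0: "X i c0 < X i q" "Y i c0 < Y i (r i)" using q'(4) S(5) c0_le[of "dir i" "i - 4"] c0_le[of "dir (i - 1)" "i - 5"] by simp_all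
  have hi: "X i (r i) \<le> B (i + 3) (dir i)" "Y i q < B (i + 3) (dir (i - 1))"
    using S(4,11,12) q'(5) Bmono[of i "i + 3" "dir i"] by simp_all
  have inn: "\<not> slices (?f z) {?f (r i), ?f q}" "z \<noteq> q" if "inner i z" for z
    using that S(3,5) q'(2,3,4) unfolding slices_pair inner_def by auto
  have out: "\<not> slices (?f z) {?f (r i), ?f q}" "z \<noteq> q" if "outer i z" for z
    using that q'(2,3) c0 hi unfolding slices_pair outer_def by auto
  have pin: "(slices (?f (r l)) {?f (r i), ?f q} \<longrightarrow> l = i - 1 \<or> l = i + 1) \<and> r l \<noteq> q" if l: "1 \<le> l" "l \<le> m" for l
  proof -
    consider "inner i (r l)" | "outer i (r l)" | "l \<in> {i - 1, i, i + 1, i + 3, i + 4, i + 5}"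
      using adm_positions[OF r i l] by blast
    then show ?thesis
    proof cases
      case 1
      then show ?thesis using inn by blast
    next
      case 2
      then show ?thesis using out by blast
    next
      case 3
      then consider "l = i - 1" | "l = i" | "l = i + 1" | "l = i + 3" | "l = i + 4" | "l = i + 5" by blast
      then show ?thesis
      proof cases
        case 1
        then show ?thesis using S(1) c0 by auto
      next
        case 2
        then show ?thesis using q' by (auto simp: slices_pair)
      next
        case 3
        then show ?thesis using S(9) c0 q'(3) by auto
      next
        case 4
        then show ?thesis using S(3,10,11) c0(1) q'(2,3,5) by (auto simp: slices_pair)
      next
        case 5
        then show ?thesis using S(4,13) q'(2,3,5) by (auto simp: slices_pair)
      next
        case 6
        then show ?thesis using S(4,15,16) q'(2,3) c0 by (auto simp: slices_pair)
      qed
    qed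
  qed
  show nr: "q \<notin> r ` {1..m}"
  proof
    assume "q \<in> r ` {1..m}"
    then obtain l where "1 \<le> l" "l \<le> m" "q = r l" by auto
    then show False using pin[of l] by simp
  qed
  have t1: "type1_ext_up_right (?f ` A) m (?f \<circ> r) i (?f q)"
    unfolding type1_ext_up_right_def
  proof (intro conjI ballI impI)
    show "copy_of_21 ((?f \<circ> r) i) (?f q)" using q' by (simp add: copy_of_21_def)
    show "slices ((?f \<circ> r) (i - 1)) {(?f \<circ> r) i, ?f q} \<or> i + 1 \<le> m \<and> slices ((?f \<circ> r) (i + 1)) {(?f \<circ> r) i, ?f q}"
      using q'(6)
    proof
      assume "Y i (r (i - 1)) < Y i q"
      then have "slices ((?f \<circ> r) (i - 1)) {(?f \<circ> r) i, ?f q}" using S(1,6) c0 q' by (auto simp: slices_pair)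
      then show ?thesis ..
    next
      assume "X i q < X i (r (i + 1))"
      then have "slices ((?f \<circ> r) (i + 1)) {(?f \<circ> r) i, ?f q}" using S(8,9) c0 q' by (auto simp: slices_pair)
      then show ?thesis using i by simp
    qed
    fix x assume x: "x \<in> ?f ` A" "slices x {(?f \<circ> r) i, ?f q}"
    then obtain z where z: "z \<in> A" "x = ?f z" by blast
    have sl: "slices (?f z) {?f (r i), ?f q}" using x z by simp
    have "z \<noteq> q" using sl by (auto simp: slices_pair)
    then obtain l where "1 \<le> l" "l \<le> m" "z = r l" using A[OF z(1)] inn[of z] out[of z] sl by auto
    then have "z = r l \<and> (l = i - 1 \<or> l = i + 1)" using pin[of l] sl by auto
    then show "x = (?f \<circ> r) (i - 1) \<or> i + 1 \<le> m \<and> x = (?f \<circ> r) (i + 1)" using z(2) i by auto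
  qed
  have "type1_extension A m r i q"
    unfolding type1_extension_def using t1 corner_symmetry[OF i(1)] corner_directions[OF r i(1)] i by auto
  then show "extension_of A m r i {q}" unfolding extension_of_def by blast
  show "near i q"
    unfolding near_def
  proof (intro conjI allI)
    have pp: "perp (dir i) (dir (i - 1))" using dir_near(12)[of i] i by simp
    fix d
    have "d = dir i \<or> d = opp (dir i) \<or> d = dir (i - 1) \<or> d = opp (dir (i - 1))" using direction_cases_perp[OF pp] .
    then show "sg d q \<le> B (i + 3) d"
      using hi q' c0 c0_le[of "opp (dir i)" "i + 3"] c0_le[of "opp (dir (i - 1))" "i + 3"] by auto
    have "B (i - 7) (dir i) < X i q" "B (i - 7) (dir (i - 1)) < Y i q"
      using q'(3,4) S(5) Bmono[of "i - 7" "i - 4" "dir i", OF diff_le_mono2] Bmono[of "i - 7" "i - 5" "dir (i - 1)", OF diff_le_mono2] by auto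
    then show "\<exists>d e. perp d e \<and> B (i - 7) d < sg d q \<and> B (i - 7) e < sg e q" using pp by blast
  qed
qed

end

context layered_spiral
begin

declare One_nat_def [simp del]

text \<open>In the frame of the corner, the pins up to \<open>i - 1\<close> are left of
  \<open>s\<close> and above it, as none of them is deeper than pin \<open>i - 3\<close>. Pin
  \<open>i + 2\<close> passes between \<open>s\<close> and pin \<open>i + 1\<close>. Pin
  \<open>i\<close> and all pins from \<open>i + 3\<close> on are clear of the rectangle in both
  coordinates.\<close>

lemma south_only_pin:
  assumes r: "adm r" and i: "13 \<le> i" "i + 8 \<le> m" and l: "1 \<le> l" "l \<le> m"
    and s: "B (i - 4) (dir i) < X i s" "X i s < X i (r (i + 1))" "X (i + 1) (r (i - 3)) < X (i + 1) s" "X (i + 1) s < X (i + 1) (r (i + 2))"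
  shows "slices (tf (dir i) (dir (i - 1)) (r l)) {tf (dir i) (dir (i - 1)) (r (i + 1)), tf (dir i) (dir (i - 1)) s} \<longleftrightarrow> l = i + 2"
proof -
  let ?f = "tf (dir i) (dir (i - 1))"
  have d: "dir (i + 1) = opp (dir (i - 1))" "dir (i - 3) = opp (dir (i - 1))" by (rule dir_near, use i in linarith)+
  have Z: "X (i + 1) z = - Y i z" for z by (simp add: d)
  have e: "i + 1 - 1 = i" "i + 1 + 1 = i + 2" "i + 1 + 3 = i + 4" "i + 1 + 4 = i + 5" "i + 1 + 5 = i + 6" "i - 3 - 1 = i - 4" by auto
  have s': "Y i s < Y i (r (i - 3))" "Y i (r (i + 2)) < Y i s" using s(3,4) unfolding Z by simp_all
  have i': "10 \<le> i" "i + 6 \<le> m" using i by auto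
  note Sp = adm_special[OF r i']
  have S: "X i (r i) \<le> B i (dir i)" "X i (r (i + 1)) < X i (r i)" "X i (r (i - 1)) < X i c0" "Y i c0 < Y i (r i)" "Y i (r (i + 1)) < Y i c0"
    using Sp(1,4,5,8,9) c0_le[of "dir (i - 1)" "i - 5"] by simp_all
  have T: "Y i (r (i + 1)) < Y i (r (i + 2))" "X i (r (i + 2)) < X i c0" 
  proof -
    have dd: "i + 2 - 1 = i + 1" "dir (i + 2) = opp (dir i)" using dir_opp by simp_all
    have "2 \<le> i + 2" "i + 2 \<le> m" "3 \<le> i + 2" using i by auto
    note a = admD(6,7)[OF r this(1,2), unfolded dd]
    show "Y i (r (i + 1)) < Y i (r (i + 2))" using a(1) i unfolding Z by simp
    show "X i (r (i + 2)) < X i c0" using a(2) by simp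
  qed
  have c3: "Y i (r (i - 3)) < Y i c0" using admD(7)[OF r, of "i - 3"] i d by simp
  have Xc: "X i c0 < X i s" using s(1) c0_le[of "dir i" "i - 4"] by simp
  have Zb: "- Y i (r (i + 1)) \<le> B (i + 1) (dir (i + 1))" using admD(3)[OF r, of "i + 1"] i unfolding Z by simp
  consider (1) "l \<le> i - 1" | (2) "l = i" | (3) "l = i + 1" | (4) "l = i + 2" | (5) "i + 3 \<le> l" using i by linarith
  then show ?thesis
  proof cases
    case 1
    have "Y i (r (i - 3)) \<le> Y i (r l)"
    proof -
      consider "l < i - 3" | "l = i - 3" | "l = i - 2" | "l = i - 1" using 1 by linarith
      then show ?thesis
      proof cases
        assume "l < i - 3"
        moreover have "3 \<le> i - 3" "i - 3 \<le> m" using i by arith+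
        ultimately show ?thesis using pinsD(2)[OF adm_pins[OF r], of "i - 3" l] l d by simp
      next
        assume l: "l = i - 2"
        have e2: "i - 2 - 1 = i - 3" by simp
        have "2 \<le> i - 2" "i - 2 \<le> m" "3 \<le> i - 2" using i by arith+
        then show ?thesis using admD(6)[OF r, of "i - 2", unfolded e2] d l by simp
      next
        assume "l = i - 1"
        moreover have "2 \<le> i - 1" "i - 1 \<le> m" using i by arith+
        ultimately show ?thesis using admD(7)[OF r, of "i - 1"] c3 by simp
      qed simp
    qed
    moreover have "X i (r l) < X i s"
    proof (cases "l = i - 1")
      case True
      then show ?thesis using S(3) Xc by simp
    next
      case False
      then have "inner i (r l)" using adm_inner[OF r, of i l] i l 1 by simp
      then show ?thesis using s(1) by (simp add: inner_def)
    qed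
    ultimately show ?thesis using 1 i s(2) s' S(5) T(1) unfolding slices_pair by auto
  next
    case 2
    then show ?thesis using S s' s(2) c3 T(1) unfolding slices_pair by auto
  next
    case 3
    then show ?thesis unfolding slices_pair by auto
  next
    case 4
    then show ?thesis using T s' s(2) Xc unfolding slices_pair by auto
  next
    case 5
    have "10 \<le> i + 1" "i + 1 + 6 \<le> m" using i by auto
    note U = adm_special[OF r this, unfolded e]
    have "l \<in> {i + 4, i + 5, i + 6} \<or> l = i + 1 + 2 \<or> i + 1 + 6 \<le> l" using 5 by auto
    then consider "outer (i + 1) (r l)" | "l = i + 4" | "l = i + 5" | "l = i + 6"
      using adm_outer[OF r _ l(2), of "i + 1"] i by auto
    then show ?thesis
    proof cases
      assume o: "outer (i + 1) (r l)"
      have "- Y i (r l) \<le> - Y i c0 \<or> B (i + 1) (dir (i + 1)) < - Y i (r l)"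
        using o Bmono[of "i + 1" "i + 1 + 3" "dir (i + 1)"] unfolding outer_def Z by auto
      moreover have "X i (r l) \<le> X i c0 \<or> B i (dir i) < X i (r l)"
        using o Bmono[of i "i + 1 + 3" "dir i"] unfolding outer_def e by auto
      ultimately show ?thesis using 5 Zb S(1,2) s(2) Xc s' c3 T(1) unfolding slices_pair by auto
    next
      assume "l = i + 4"
      then show ?thesis using U(10) Sp(13) S(1,2) s(2) s' c3 T(1) unfolding Z slices_pair by auto
    next
      assume "l = i + 5"
      then show ?thesis using U(13,14) Zb S(1,2) s(2) s' c3 T(1) unfolding Z slices_pair by auto
    next
      assume "l = i + 6"
      then show ?thesis using U(15,16) Zb S(1,2) s(2) s' c3 T(1) Xc unfolding Z slices_pair by auto
    qed
  qed
qed

text \<open>The pins up to \<open>i - 2\<close> are lower than \<open>s\<close>, and none of them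
  has its abscissa between pin \<open>i - 1\<close> and \<open>s\<close>. Pin \<open>i\<close>
  passes between these two in height, and the later pins are clear of the rectangle in both
  coordinates.\<close>

lemma west_only_pin:
  assumes r: "adm r" and i: "13 \<le> i" "i + 8 \<le> m" and l: "1 \<le> l" "l \<le> m"
    and s: "B (i - 5) (dir (i - 1)) < Y i s" "Y i s < Y i (r i)" "B (i - 6) (dir (i - 2)) < X (i - 2) s" "X (i - 2) s < X (i - 2) (r (i - 1))"
  shows "slices (tf (dir i) (dir (i - 1)) (r l)) {tf (dir i) (dir (i - 1)) (r (i - 1)), tf (dir i) (dir (i - 1)) s} \<longleftrightarrow> l = i"
proof -
  have d: "dir (i + 1) = opp (dir (i - 1))" "dir (i - 3) = opp (dir (i - 1))" "dir (i - 4) = dir i" "dir (i - 2) = opp (dir i)" "dir (i + 2) = opp (dir i)" "dir (i + 3) = dir (i - 1)"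
    by (rule dir_near, use i in linarith)+
  have W: "X (i - 2) z = - X i z" for z by (simp add: d)
  have e: "i - 1 - 1 = i - 2" "i - 2 - 1 = i - 3" "i - 1 + 5 = i + 4" "i - 3 - 1 = i - 4" "i - 1 + 1 = i" "i - 1 + 3 = i + 2" "i - 1 + 4 = i + 3" "i - 1 - 4 = i - 5" "i - 1 - 5 = i - 6"
    using i by auto
  have s': "B (i - 6) (dir (i - 2)) < - X i s" "X i (r (i - 1)) < X i s" using s(3,4) unfolding W by simp_all
  have Xc: "X i s < X i c0" using s'(1) c0_le[of "dir (i - 2)" "i - 6"] unfolding W by simp
  have Yc: "Y i c0 < Y i s" using s(1) c0_le[of "dir (i - 1)" "i - 5"] by simp
  have i': "10 \<le> i" "i + 6 \<le> m" using i by auto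
  note Sp = adm_special[OF r i']
  have S: "X i c0 < X i (r i)" "X i c0 < X i (r (i + 1))" "Y i (r i) < Y i (r (i - 1))" "Y i (r (i + 1)) < Y i c0" "Y i (r (i - 1)) \<le> B (i - 1) (dir (i - 1))"
    using Sp(3,6,7,9,2) c0_le[of "dir i" "i - 4"] by simp_all
  have m1: "10 \<le> i - 1" "i - 1 + 6 \<le> m" using i by auto
  note U = adm_special[OF r m1, unfolded e]
  have Wb: "- X i (r (i - 1)) < B (i - 2) (dir (i - 2))" using admD(5)[OF r, of "i - 1", unfolded e] i unfolding W by simp
  consider (1) "l \<le> i - 2" | (2) "l = i - 1" | (3) "l = i" | (4) "l = i + 1" | (5) "i + 2 \<le> l" using i by linarith
  then show ?thesis
  proof cases
    case 1
    have "10 \<le> i" "i + 6 \<le> m" using i by auto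
    then have "Y i (r l) < Y i s" using adm_inner[OF r _ _ l(1) 1] s(1) by (auto simp: inner_def)
    moreover have "X i s < X i (r l) \<or> X i (r l) < X i (r (i - 1))"
    proof (cases "l = i - 2")
      case True
      then show ?thesis using admD(6)[OF r, of "i - 1", unfolded e] i unfolding W by simp
    next
      case False
      have "- X i (r l) \<le> B (i - 6) (dir (i - 2))"
        using adm_coord[OF r l, of "i - 2"] unfolding W
      proof (elim disjE conjE)
        assume "- X i (r l) \<le> - X i c0"
        then show ?thesis using c0_le[of "dir (i - 2)" "i - 6"] unfolding W by simp
      next
        assume a: "l mod 4 = (i - 2) mod 4" "- X i (r l) \<le> B l (dir (i - 2))"
        have "l < i - 2" using 1 False by simp
        then have "l \<le> i - 6" using mod4_gap[OF a(1)] by linarith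
        then show ?thesis using a(2) Bmono[of l "i - 6" "dir (i - 2)"] by simp
      next
        assume a: "l mod 4 = (i - 2 + 1) mod 4" "- X i (r l) < B (l - 1) (dir (i - 2))"
        have "l < i - 2 + 1" using 1 False by simp
        then have "l - 1 \<le> i - 6" using mod4_gap[OF a(1)] by linarith
        then show ?thesis using a(2) Bmono[of "l - 1" "i - 6" "dir (i - 2)"] by simp
      qed
      then show ?thesis using s'(1) by simp
    qed
    ultimately show ?thesis using 1 i S(3) s(2) s'(2) unfolding slices_pair by auto
  next
    case 2
    then show ?thesis using i unfolding slices_pair by auto
  next
    case 3
    then show ?thesis using S(1,3) s(2) Xc s'(2) unfolding slices_pair by auto
  next
    case 4
    then show ?thesis using S(2,3,4) s(2) Xc Yc s'(2) unfolding slices_pair by auto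
  next
    case 5
    have "l \<in> {i + 2, i + 3, i + 4} \<or> l = i - 1 + 2 \<or> i - 1 + 6 \<le> l" using 5 i by auto
    then consider "outer (i - 1) (r l)" | "l = i + 2" | "l = i + 3" | "l = i + 4"
      using adm_outer[OF r m1(1) l(2)] i 5 by auto
    then show ?thesis
    proof cases
      assume o: "outer (i - 1) (r l)"
      have "Y i (r l) \<le> Y i c0 \<or> B (i - 1) (dir (i - 1)) < Y i (r l)"
        using o Bmono[of "i - 1" "i - 1 + 3" "dir (i - 1)"] unfolding outer_def by auto
      moreover have "- X i (r l) \<le> - X i c0 \<or> B (i - 2) (dir (i - 2)) < - X i (r l)"
      proof -
        have "i - 2 \<le> i - 1 + 3" by arith
        then have "B (i - 2) (dir (i - 2)) \<le> B (i - 1 + 3) (dir (i - 2))" by (rule Bmono)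
        then show ?thesis using o unfolding outer_def e W by linarith
      qed
      ultimately show ?thesis using 5 S(3,5) s(2) Xc s'(2) Yc Wb unfolding slices_pair by auto
    next
      assume "l = i + 2"
      then show ?thesis using U(10) Wb U(14) U(11) admD(2)[OF r, of "i + 2"] d S(3) s(2) s'(2) Xc Yc i unfolding W slices_pair by auto
    next
      assume "l = i + 3"
      then show ?thesis using U(13,14) S(3,5) s(2) s'(2) Xc Yc Wb unfolding W slices_pair by auto
    next
      assume "l = i + 4"
      then show ?thesis using U(15,16) S(3,5) s(2) s'(2) Xc Yc unfolding W slices_pair by auto
    qed
  qed
qed

lemma near_corner:
  assumes i: "13 \<le> i" and "B (i - 7) (dir i) < X i z" "X i z \<le> B (i + 3) (dir i)"
    and "B (i - 7) (dir (i - 1)) < Y i z" "Y i z \<le> B (i + 3) (dir (i - 1))"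
  shows "near i z"
  unfolding near_def
proof (intro conjI allI)
  have pp: "perp (dir i) (dir (i - 1))" using dir_near(12)[of i] i by simp
  show "\<exists>d e. perp d e \<and> B (i - 7) d < sg d z \<and> B (i - 7) e < sg e z" using pp assms(2,4) by blast
  fix d
  have "d = dir i \<or> d = opp (dir i) \<or> d = dir (i - 1) \<or> d = opp (dir (i - 1))" using direction_cases_perp[OF pp] .
  then show "sg d z \<le> B (i + 3) d"
    using assms(2-) c0_le[of "opp (dir i)" "i + 3"] c0_le[of "opp (dir (i - 1))" "i + 3"]
      c0_le[of "dir i" "i - 7"] c0_le[of "dir (i - 1)" "i - 7"] by auto
qed

lemma ext2_near:
  assumes r: "adm r" and i: "13 \<le> i" "i + 8 \<le> m" and q: "ext2 r i u v s" and z: "z \<in> {u, v, s}"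
  shows "near i z" and "z \<notin> r ` {1..m}"
proof -
  have d: "dir (i + 1) = opp (dir (i - 1))" "dir (i - 3) = opp (dir (i - 1))" "dir (i - 4) = dir i" "dir (i - 2) = opp (dir i)" "dir (i + 2) = opp (dir i)" "dir (i + 3) = dir (i - 1)"
    by (rule dir_near, use i in linarith)+
  have W: "X (i - 2) z = - X i z" "X (i + 1) z = - Y i z" for z by (simp_all add: d)
  have i': "10 \<le> i" "i + 6 \<le> m" using i by auto
  note S = adm_special[OF r i']
  have q': "B (i - 4) (dir i) < X i u" "X i u < X i v" "X i v < X i (r (i + 1))"
     "B (i - 5) (dir (i - 1)) < Y i v" "Y i v < Y i u" "Y i u < Y i (r i)"
    and qs: "X i u < X i s \<and> X i s < X i v \<and> X (i + 1) (r (i - 3)) < X (i + 1) s \<and> X (i + 1) s < X (i + 1) (r (i + 2)) \<or>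
      Y i v < Y i s \<and> Y i s < Y i u \<and> B (i - 6) (dir (i - 2)) < X (i - 2) s \<and> X (i - 2) s < X (i - 2) (r (i - 1))" using q unfolding ext2_def by auto
  have mono: "B (i - 7) g \<le> B (i - 4) g" "B (i - 7) g \<le> B (i - 5) g" "B (i - 7) g \<le> B (i - 6) g" "B i g \<le> B (i + 3) g" "B (i - 1) g \<le> B (i + 3) g" "B (i + 1) g \<le> B (i + 3) g" "B (i - 2) g \<le> B (i + 3) g" for g
    by (rule Bmono, simp)+
  have c: "X i c0 < X i u" "Y i c0 < Y i v" using q' c0_le[of "dir i" "i - 4"] c0_le[of "dir (i - 1)" "i - 5"] by simp_all
  have "near i u"
    by (rule near_corner[OF i(1)]) (use q' mono[of "dir i"] mono[of "dir (i - 1)"] S(2,4,6,8) in linarith)+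
  moreover have "near i v"
    by (rule near_corner[OF i(1)]) (use q' mono[of "dir i"] mono[of "dir (i - 1)"] S(2,4,6,8) in linarith)+
  ultimately have uv: "near i u" "near i v" by simp_all
  have c3: "Y i (r (i - 3)) < Y i c0" using admD(7)[OF r, of "i - 3"] i d by simp
  have s1: "near i s \<and> (Y i s < Y i c0 \<and> X i u < X i s \<and> X i s < X i v \<or> X i s < X i c0 \<and> Y i v < Y i s \<and> Y i s < Y i u)"
    using qs
  proof
    assume a: "X i u < X i s \<and> X i s < X i v \<and> X (i + 1) (r (i - 3)) < X (i + 1) s \<and> X (i + 1) s < X (i + 1) (r (i + 2))"
    have b3: "B (i - 7) (dir (i + 1)) < X (i + 1) (r (i - 3))" 
    proof -
      have "i - 3 - 4 = i - 7" "dir (i - 3) = dir (i + 1)" using d by simp_all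
      then show ?thesis using admD(2)[OF r, of "i - 3"] i by simp
    qed
    have b2: "X (i + 1) (r (i + 2)) < B (i + 1) (dir (i + 1))"
    proof -
      have e2: "i + 2 - 1 = i + 1" by simp
      show ?thesis using admD(5)[OF r, of "i + 2", unfolded e2] i by simp
    qed
    have "near i s"
      unfolding near_def
    proof (intro conjI allI)
      have pp: "perp (dir i) (dir (i + 1))" by (rule dir_perp)
      have lo: "B (i - 7) (dir i) < X i s" "B (i - 7) (dir (i + 1)) < X (i + 1) s" using a b3 q'(1) mono[of "dir i"] by linarith+
      then show "\<exists>d e. perp d e \<and> B (i - 7) d < sg d s \<and> B (i - 7) e < sg e s" using pp by blast
      have hi: "X i s \<le> B (i + 3) (dir i)" "X (i + 1) s \<le> B (i + 3) (dir (i + 1))"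
        using a q'(3) S(4,8) b2 mono[of "dir i"] mono[of "dir (i + 1)"] by linarith+
      fix g
      have "g = dir i \<or> g = opp (dir i) \<or> g = dir (i + 1) \<or> g = opp (dir (i + 1))" using direction_cases_perp[OF pp] .
      then show "sg g s \<le> B (i + 3) g"
      proof (elim disjE)
        assume "g = opp (dir i)"
        then show ?thesis using lo(1) c0_le[of g "i + 3"] c0_le[of "dir i" "i - 7"] by simp
      next
        assume "g = opp (dir (i + 1))"
        then show ?thesis using lo(2) c0_le[of g "i + 3"] c0_le[of "dir (i + 1)" "i - 7"] by simp
      qed (use hi in simp_all)
    qed
    moreover have "Y i s < Y i c0" using a c3 unfolding W by simp
    ultimately show ?thesis using a by blast
  next
    assume a: "Y i v < Y i s \<and> Y i s < Y i u \<and> B (i - 6) (dir (i - 2)) < X (i - 2) s \<and> X (i - 2) s < X (i - 2) (r (i - 1))"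
    have b2: "X (i - 2) (r (i - 1)) < B (i - 2) (dir (i - 2))"
    proof -
      have e2: "i - 1 - 1 = i - 2" by simp
      have "2 \<le> i - 1" "i - 1 \<le> m" using i by arith+
      then show ?thesis using admD(5)[OF r, of "i - 1", unfolded e2] by simp
    qed
    have "near i s"
      unfolding near_def
    proof (intro conjI allI)
      have "perp (dir (i - 2)) (dir (i - 2 + 1))" by (rule dir_perp)
      moreover have "i - 2 + 1 = i - 1" using i by simp
      ultimately have pp: "perp (dir (i - 2)) (dir (i - 1))" by metis
      have lo: "B (i - 7) (dir (i - 1)) < Y i s" "B (i - 7) (dir (i - 2)) < X (i - 2) s"
        using a q'(4) mono[of "dir (i - 1)"] mono[of "dir (i - 2)"] by linarith+
      then show "\<exists>d e. perp d e \<and> B (i - 7) d < sg d s \<and> B (i - 7) e < sg e s" using pp by blast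
      have hi: "Y i s \<le> B (i + 3) (dir (i - 1))" "X (i - 2) s \<le> B (i + 3) (dir (i - 2))"
        using a q'(6) S(2,6) b2 mono[of "dir (i - 1)"] mono[of "dir (i - 2)"] by linarith+
      fix g
      have "g = dir (i - 2) \<or> g = opp (dir (i - 2)) \<or> g = dir (i - 1) \<or> g = opp (dir (i - 1))" using direction_cases_perp[OF pp] .
      then show "sg g s \<le> B (i + 3) g"
      proof (elim disjE)
        assume "g = opp (dir (i - 2))"
        then show ?thesis using lo(2) c0_le[of g "i + 3"] c0_le[of "dir (i - 2)" "i - 7"] by simp
      next
        assume "g = opp (dir (i - 1))"
        then show ?thesis using lo(1) c0_le[of g "i + 3"] c0_le[of "dir (i - 1)" "i - 7"] by simp
      qed (use hi in simp_all)
    qed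
    moreover have "X i s < X i c0" using a c0_le[of "dir (i - 2)" "i - 6"] unfolding W by simp
    ultimately show ?thesis using a by blast
  qed
  then show "near i z" using uv z by blast
  show "z \<notin> r ` {1..m}"
  proof
    assume "z \<in> r ` {1..m}"
    then obtain l where l: "1 \<le> l" "l \<le> m" "z = r l" by auto
    have zc: "B (i - 4) (dir i) < X i z \<and> X i z < X i (r (i + 1)) \<and> Y i z < Y i (r i) \<and> (B (i - 5) (dir (i - 1)) < Y i z \<or> Y i z < Y i c0) \<or>
        X i z < X i c0 \<and> B (i - 5) (dir (i - 1)) < Y i z \<and> Y i z < Y i (r i)"
      using z s1 q' c S(5) c0_le[of "dir (i - 1)" "i - 5"] by auto
    have nin: "\<not> inner i z" using zc unfolding inner_def by linarith
    have nout: "\<not> outer i z"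
      using zc S(2,4,6,8) mono[of "dir i"] mono[of "dir (i - 1)"] c0_le[of "dir i" "i - 4"] c0_le[of "dir (i - 1)" "i - 5"] unfolding outer_def by linarith
    have "l \<in> {i - 1, i, i + 1, i + 3, i + 4, i + 5}" using adm_positions[OF r i' l(1,2)] nin nout l(3) by simp
    then consider "l = i - 1" | "l = i" | "l = i + 1" | "l = i + 3" | "l = i + 4" | "l = i + 5" by blast
    then show False
    proof cases
      assume "l = i + 1"
      then show ?thesis using zc l(3) S(9) c0_le[of "dir (i - 1)" "i - 5"] by auto
    next
      assume "l = i + 5"
      then show ?thesis using zc l(3) S(4,8,15) S(16) c0_le[of "dir (i - 1)" "i - 5"] by auto
    next
      assume "l = i + 3"
      then show ?thesis using zc l(3) S(2,6,11,14) by auto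
    next
      assume "l = i + 4"
      then show ?thesis using zc l(3) S(4,8,13) S(14) S(2,6) by auto
    qed (use zc l(3) S in auto)
  qed
qed

lemma ext2_extension:
  assumes r: "adm r" and i: "13 \<le> i" "i + 8 \<le> m" and q: "ext2 r i u v s"
    and A: "\<And>z. z \<in> A \<Longrightarrow> z \<in> r ` {1..m} \<or> z \<in> {u, v, s} \<or> inner i z \<or> outer i z" and sA: "s \<in> A"
  shows "extension_of A m r i {u, v, s}"
proof -
  let ?f = "tf (dir i) (dir (i - 1))"
  have d: "dir (i + 1) = opp (dir (i - 1))" "dir (i - 3) = opp (dir (i - 1))" "dir (i - 2) = opp (dir i)"
    by (rule dir_near, use i in linarith)+
  have W: "X (i - 2) z = - X i z" "X (i + 1) z = - Y i z" for z by (simp_all add: d)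
  have i': "10 \<le> i" "i + 6 \<le> m" using i by auto
  note S = adm_special[OF r i']
  have q': "B (i - 4) (dir i) < X i u" "X i u < X i v" "X i v < X i (r (i + 1))"
     "B (i - 5) (dir (i - 1)) < Y i v" "Y i v < Y i u" "Y i u < Y i (r i)"
    and qs: "X i u < X i s \<and> X i s < X i v \<and> X (i + 1) (r (i - 3)) < X (i + 1) s \<and> X (i + 1) s < X (i + 1) (r (i + 2)) \<or>
      Y i v < Y i s \<and> Y i s < Y i u \<and> B (i - 6) (dir (i - 2)) < X (i - 2) s \<and> X (i - 2) s < X (i - 2) (r (i - 1))" using q unfolding ext2_def by auto
  have mono: "B i g \<le> B (i + 3) g" "B (i - 1) g \<le> B (i + 3) g" for g by (rule Bmono, simp)+
  have c: "X i c0 < X i u" "Y i c0 < Y i v" using q' c0_le[of "dir i" "i - 4"] c0_le[of "dir (i - 1)" "i - 5"] by simp_all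
  have c3: "Y i (r (i - 3)) < Y i c0" using admD(7)[OF r, of "i - 3"] i d by simp
  have sl_s: "slices (?f s) {?f u, ?f v}"
    using qs
  proof
    assume a: "X i u < X i s \<and> X i s < X i v \<and> X (i + 1) (r (i - 3)) < X (i + 1) s \<and> X (i + 1) s < X (i + 1) (r (i + 2))"
    then have "Y i s < Y i c0" using c3 unfolding W by simp
    then show ?thesis using a c q'(5) unfolding slices_pair by auto
  next
    assume a: "Y i v < Y i s \<and> Y i s < Y i u \<and> B (i - 6) (dir (i - 2)) < X (i - 2) s \<and> X (i - 2) s < X (i - 2) (r (i - 1))"
    then have "X i s < X i c0" using c0_le[of "dir (i - 2)" "i - 6"] unfolding W by simp
    then show ?thesis using a c q'(2) unfolding slices_pair by auto
  qed
  have noin: "\<not> (\<exists>d. \<exists>a\<in>{?f (r i), ?f u, ?f v}. \<exists>b\<in>{?f (r i), ?f u, ?f v}. sg d a < sg d (?f z) \<and> sg d (?f z) < sg d b)"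
    if "(X i z \<le> X i u \<or> X i (r i) \<le> X i z) \<and> (Y i z \<le> Y i v \<or> Y i (r i) \<le> Y i z)" for z
  proof
    assume "\<exists>d. \<exists>a\<in>{?f (r i), ?f u, ?f v}. \<exists>b\<in>{?f (r i), ?f u, ?f v}. sg d a < sg d (?f z) \<and> sg d (?f z) < sg d b"
    then obtain d a b where ab: "a \<in> {?f (r i), ?f u, ?f v}" "b \<in> {?f (r i), ?f u, ?f v}" "sg d a < sg d (?f z)" "sg d (?f z) < sg d b" by blast
    have "X i u \<le> fst a \<and> fst a \<le> X i (r i) \<and> Y i v \<le> snd a \<and> snd a \<le> Y i (r i)" if "a \<in> {?f (r i), ?f u, ?f v}" for a
      using that q' S(8) by auto
    from this[OF ab(1)] this[OF ab(2)] show False using ab(3,4) that by (cases d) auto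
  qed
  have far: "(X i z \<le> X i u \<or> X i (r i) \<le> X i z) \<and> (Y i z \<le> Y i v \<or> Y i (r i) \<le> Y i z)" if "inner i z \<or> outer i z" for z
    using that
  proof
    assume "inner i z"
    then show ?thesis using q' unfolding inner_def by auto
  next
    assume "outer i z"
    then show ?thesis using q' c S(2,4,6) mono[of "dir i"] mono[of "dir (i - 1)"] unfolding outer_def by auto
  qed
  \<comment> \<open>Every pin other than \<open>i + 1\<close> misses the rectangle of pin
    \<open>i\<close> and the copy of 21 in both coordinates, so it slices neither that rectangle nor
    the smaller one.\<close>
  have far_pin: "(X i (r l) \<le> X i u \<or> X i (r i) \<le> X i (r l)) \<and> (Y i (r l) \<le> Y i v \<or> Y i (r i) \<le> Y i (r l))"
    if l: "1 \<le> l" "l \<le> m" "l \<noteq> i + 1" for l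
  proof -
    consider "inner i (r l) \<or> outer i (r l)" | "l = i - 1" | "l = i" | "l = i + 3" | "l = i + 4" | "l = i + 5"
      using adm_positions[OF r i' l(1,2)] l(3) by blast
    then show ?thesis
    proof cases
      assume "inner i (r l) \<or> outer i (r l)"
      then show ?thesis by (rule far)
    qed (use S c q' in auto)
  qed
  have sl_pair: "\<not> slices (?f z) {?f u, ?f v}" if "(X i z \<le> X i u \<or> X i (r i) \<le> X i z) \<and> (Y i z \<le> Y i v \<or> Y i (r i) \<le> Y i z)" for z
    using that q' S(8) unfolding slices_pair by auto
  have sl_next: "\<not> slices (?f (r (i + 1))) {?f u, ?f v}" using q' S(9) c unfolding slices_pair by auto
  have t2: "type2_ext_up_right (?f ` A) m (?f \<circ> r) i (?f u) (?f v) (?f s)"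
    unfolding type2_ext_up_right_def
  proof (intro conjI ballI impI)
    show "copy_of_21 ((?f \<circ> r) (i - 1)) (?f s) \<and> only_pin_slicing m (?f \<circ> r) i {(?f \<circ> r) (i - 1), ?f s} \<or>
      i + 2 \<le> m \<and> copy_of_21 (?f s) ((?f \<circ> r) (i + 1)) \<and> only_pin_slicing m (?f \<circ> r) (i + 2) {(?f \<circ> r) (i + 1), ?f s}"
      using qs
    proof
      assume a: "X i u < X i s \<and> X i s < X i v \<and> X (i + 1) (r (i - 3)) < X (i + 1) s \<and> X (i + 1) s < X (i + 1) (r (i + 2))"
      have b: "B (i - 4) (dir i) < X i s" "X i s < X i (r (i + 1))" using a q' by auto
      have "only_pin_slicing m (?f \<circ> r) (i + 2) {(?f \<circ> r) (i + 1), ?f s}"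
        unfolding only_pin_slicing_def comp_def using south_only_pin[OF r i _ _ b] a by simp
      moreover have "Y i (r (i + 1)) < Y i s"
      proof -
        have e2: "i + 2 - 1 = i + 1" by simp
        have "X (i + 1) (r (i + 2)) < X (i + 1) (r (i + 1))" using admD(6)[OF r, of "i + 2", unfolded e2] i by simp
        then show ?thesis using a unfolding W by simp
      qed
      then have "copy_of_21 (?f s) ((?f \<circ> r) (i + 1))" using b(2) by (simp add: copy_of_21_def)
      ultimately show ?thesis using i by simp
    next
      assume a: "Y i v < Y i s \<and> Y i s < Y i u \<and> B (i - 6) (dir (i - 2)) < X (i - 2) s \<and> X (i - 2) s < X (i - 2) (r (i - 1))"
      have b: "B (i - 5) (dir (i - 1)) < Y i s" "Y i s < Y i (r i)" using a q' by auto
      have "only_pin_slicing m (?f \<circ> r) i {(?f \<circ> r) (i - 1), ?f s}"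
        unfolding only_pin_slicing_def comp_def using west_only_pin[OF r i _ _ b] a by simp
      moreover have "copy_of_21 ((?f \<circ> r) (i - 1)) (?f s)"
        using a b(2) S(6) unfolding W copy_of_21_def by simp
      ultimately show ?thesis by simp
    qed
    show "copy_of_21 (?f u) (?f v)" using q' by (simp add: copy_of_21_def)
    show "SW_of (?f u) {(?f \<circ> r) i}" "SW_of (?f v) {(?f \<circ> r) i}" using q' S(8) by (auto simp: SW_of_def)
    have inn: "inner i (r l)" if "l \<in> {1..i - 2}" for l using adm_inner[OF r i', of l] that by simp
    show "NE_of (?f u) ((?f \<circ> r) ` {1..i - 2})" "NE_of (?f v) ((?f \<circ> r) ` {1..i - 2})"
      unfolding NE_of_def using inn q' unfolding inner_def by fastforce+
    show "i + 1 \<le> m" using i by simp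
    show "separates ((?f \<circ> r) (i + 1)) {?f u, ?f v} ((?f \<circ> r) i)"
      unfolding separates_iff using q' S(8) by (intro exI[of _ Right]) auto
  next
    fix x assume x: "x \<in> ?f ` A"
    show "slices x {?f u, ?f v} \<longleftrightarrow> x = ?f s"
    proof
      assume sl: "slices x {?f u, ?f v}"
      obtain z where z: "z \<in> A" "x = ?f z" using x by blast
      have "\<not> (inner i z \<or> outer i z)" using sl_pair[OF far] sl z(2) by blast
      moreover have "z \<notin> r ` {1..m}"
      proof
        assume "z \<in> r ` {1..m}"
        then obtain l where l: "1 \<le> l" "l \<le> m" "z = r l" by auto
        show False
        proof (cases "l = i + 1")
          case True
          then show False using sl_next sl z(2) l(3) by simp
        next
          case False
          then show False using sl_pair[OF far_pin[OF l(1,2)]] sl z(2) l(3) by simp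
        qed
      qed
      ultimately have "z = u \<or> z = v \<or> z = s" using A[OF z(1)] by blast
      then show "x = ?f s" using sl z(2) by (auto simp: slices_pair)
    next
      assume "x = ?f s"
      then show "slices x {?f u, ?f v}" using sl_s by simp
    qed
  next
    fix l assume l: "l \<in> {1..m}" "slices ((?f \<circ> r) l) {(?f \<circ> r) i, ?f u, ?f v}"
    show "l = i + 1"
    proof (rule ccontr)
      assume n: "l \<noteq> i + 1"
      have "\<exists>d. \<exists>a\<in>{?f (r i), ?f u, ?f v}. \<exists>b\<in>{?f (r i), ?f u, ?f v}. sg d a < sg d (?f (r l)) \<and> sg d (?f (r l)) < sg d b"
        using slices_between[of "{?f (r i), ?f u, ?f v}" "?f (r l)"] l(2) by simp
      then show False using noin[OF far_pin[of l]] l(1) n by simp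
    qed
  qed
  have "type2_extension A m r i u v s"
    unfolding type2_extension_def using t2 corner_symmetry[OF i'(1)] corner_directions[OF r i'(1)] i by auto
  then show ?thesis unfolding extension_of_def by blast
qed

section \<open>Several extensions on one spiral\<close>

definition extn :: "(nat \<Rightarrow> point) \<Rightarrow> nat \<Rightarrow> point set \<Rightarrow> bool" where
  "extn r j E \<longleftrightarrow> (\<exists>q. E = {q} \<and> ext1 r j q) \<or> (\<exists>u v s. E = {u, v, s} \<and> ext2 r j u v s)"

lemma extn_subset: "extn r j E \<Longrightarrow> E \<subseteq> P"
  unfolding extn_def ext1_def ext2_def by auto

lemma extn_near:
  assumes r: "adm r" and i: "13 \<le> i" "i + 8 \<le> m" and E: "extn r i E" and z: "z \<in> E"
  shows "near i z" and "z \<notin> r ` {1..m}"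
proof -
  have i': "10 \<le> i" "i + 6 \<le> m" using i by auto
  have "near i z \<and> z \<notin> r ` {1..m}"
    using E unfolding extn_def
  proof (elim disjE exE conjE)
    fix q assume q: "E = {q}" "ext1 r i q"
    show ?thesis using ext1_extension(2,3)[OF r i' q(2), of "{}"] z q(1) by simp
  next
    fix u v s assume q: "E = {u, v, s}" "ext2 r i u v s"
    show ?thesis using ext2_near[OF r i q(2), of z] z q(1) by simp
  qed
  then show "near i z" "z \<notin> r ` {1..m}" by simp_all
qed

lemma extn_extension:
  assumes r: "adm r" and i: "13 \<le> i" "i + 8 \<le> m" and E: "extn r i E" and EA: "E \<subseteq> A"
    and A: "\<And>z. z \<in> A \<Longrightarrow> z \<in> r ` {1..m} \<or> z \<in> E \<or> inner i z \<or> outer i z"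
  shows "extension_of A m r i E"
  using E unfolding extn_def
proof (elim disjE exE conjE)
  have i': "10 \<le> i" "i + 6 \<le> m" using i by auto
  fix q assume q: "E = {q}" "ext1 r i q"
  show ?thesis using ext1_extension(1)[OF r i' q(2), of A] A q(1) by simp
next
  fix u v s assume q: "E = {u, v, s}" "ext2 r i u v s"
  have "s \<in> A" using EA q(1) by simp
  then show ?thesis using ext2_extension[OF r i q(2), of A] A q(1) by simp
qed

lemma extn_cong:
  assumes "extn r j E" and "\<And>l. j \<le> l + 3 \<Longrightarrow> l \<le> j + 4 \<Longrightarrow> r' l = r l" and "3 \<le> j"
  shows "extn r' j E"
proof -
  have e: "r' j = r j" "r' (j - 1) = r (j - 1)" "r' (j + 1) = r (j + 1)" "r' (j + 4) = r (j + 4)" "r' (j + 2) = r (j + 2)" "r' (j - 3) = r (j - 3)"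
    by (rule assms(2), use assms(3) in simp, simp)+
  show ?thesis using assms(1) unfolding extn_def ext1_def ext2_def e .
qed

text \<open>A site alters only the pins \<open>i t - 1\<close>, \<open>i t\<close> and
  \<open>i t + 1\<close>, and admissibility relates a pin to its predecessor only, so the local
  sequences can be glued. With sites 30 apart the extended pins are at least 26 apart, and the added
  points of one are inner or outer for the others.\<close>

lemma spiral_combine:
  fixes i \<kappa> :: "nat \<Rightarrow> nat" and R :: "nat \<Rightarrow> nat \<Rightarrow> point" and E :: "nat \<Rightarrow> point set"
  assumes m: "2 \<le> m" and i: "\<And>t. t < n \<Longrightarrow> 20 \<le> i t \<and> i t + 20 \<le> m" "\<And>t t'. t < t' \<Longrightarrow> t' < n \<Longrightarrow> i t + 30 \<le> i t'"
    and R: "\<And>t. t < n \<Longrightarrow> adm (R t)" "\<And>t l. t < n \<Longrightarrow> l + 1 < i t \<or> i t + 1 < l \<Longrightarrow> R t l = p l"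
    and \<kappa>: "\<And>t. t < n \<Longrightarrow> i t \<le> \<kappa> t + 3 \<and> \<kappa> t \<le> i t + 1" and E: "\<And>t. t < n \<Longrightarrow> extn (R t) (\<kappa> t) (E t)"
  shows "\<exists>A\<subseteq>P. spiral_with_extensions n A"
proof -
  define r where "r l = (if \<exists>t<n. i t \<le> l + 10 \<and> l \<le> i t + 10 then R (THE t. t < n \<and> i t \<le> l + 10 \<and> l \<le> i t + 10) l else p l)" for l
  have uniq: "t = t'" if "t < n" "t' < n" "i t \<le> l + 14" "l \<le> i t + 10" "i t' \<le> l + 14" "l \<le> i t' + 10" for t t' l
    using i(2)[of t t'] i(2)[of t' t] that by (cases t t' rule: linorder_cases) auto
  have r_in: "r l = R t l" if t: "t < n" "i t \<le> l + 10" "l \<le> i t + 10" for t l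
  proof -
    have "(THE t. t < n \<and> i t \<le> l + 10 \<and> l \<le> i t + 10) = t"
    proof (rule the_equality)
      show "t < n \<and> i t \<le> l + 10 \<and> l \<le> i t + 10" using t by simp
      fix x assume x: "x < n \<and> i x \<le> l + 10 \<and> l \<le> i x + 10"
      show "x = t" by (rule uniq[of x t l]) (use t x in simp_all)
    qed
    moreover have "\<exists>t<n. i t \<le> l + 10 \<and> l \<le> i t + 10" using t by blast
    ultimately show ?thesis by (simp add: r_def)
  qed
  have r_out: "r l = p l" if "\<forall>t<n. l + 1 < i t \<or> i t + 1 < l" for l
  proof (cases "\<exists>t<n. i t \<le> l + 10 \<and> l \<le> i t + 10")
    case True
    then obtain t where t: "t < n" "i t \<le> l + 10" "l \<le> i t + 10" by blast
    then show ?thesis using r_in[OF t] R(2)[OF t(1), of l] that by simp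
  next
    case False
    then show ?thesis unfolding r_def by (rule if_not_P)
  qed
  \<comment> \<open>Any two consecutive pins of the glued sequence come from a single admissible
    sequence.\<close>
  have loc: "\<exists>g. adm g \<and> r s = g s \<and> r (s - 1) = g (s - 1)" if s: "2 \<le> s" for s
  proof (cases "\<exists>t<n. i t \<le> s + 5 \<and> s \<le> i t + 5")
    case True
    then obtain t where t: "t < n" "i t \<le> s + 5" "s \<le> i t + 5" by blast
    then show ?thesis using r_in[of t s] r_in[of t "s - 1"] R(1)[OF t(1)] by (intro exI[of _ "R t"]) auto
  next
    case False
    then have *: "s + 5 < i t \<or> i t + 5 < s" if "t < n" for t using that by (meson not_le)
    have "r s = p s" by (rule r_out) (use * in fastforce)
    moreover have "r (s - 1) = p (s - 1)" by (rule r_out) (use * in fastforce)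
    ultimately show ?thesis using adm_p by blast
  qed
  have ra: "adm r"
    unfolding adm_def
  proof (intro conjI ballI)
    show "r 1 = c0"
    proof -
      have "r 1 = p 1" by (rule r_out) (use i(1) in fastforce)
      then show ?thesis using p1 by simp
    qed
    fix s assume s: "s \<in> {2..m}"
    then obtain g where g: "adm g" "r s = g s" "r (s - 1) = g (s - 1)" using loc[of s] by auto
    have sm: "2 \<le> s" "s \<le> m" using s by auto
    note a = admD[OF g(1) sm]
    show "r s \<in> P" "B (s - 4) (dir s) < sg (dir s) (r s)" "sg (dir s) (r s) \<le> B s (dir s)"
      "B (s - 5) (dir (s - 1)) < sg (dir (s - 1)) (r s)" "sg (dir (s - 1)) (r s) < B (s - 1) (dir (s - 1))"
      "3 \<le> s \<longrightarrow> sg (dir (s - 1)) (r s) < sg (dir (s - 1)) (r (s - 1))" unfolding g(2,3) using a by blast+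
  qed
  have \<kappa>': "13 \<le> \<kappa> t" "\<kappa> t + 8 \<le> m" if "t < n" for t using \<kappa>[OF that] i(1)[OF that] by auto
  have Er: "extn r (\<kappa> t) (E t)" if t: "t < n" for t
  proof (rule extn_cong[OF E[OF t]])
    fix l assume "\<kappa> t \<le> l + 3" "l \<le> \<kappa> t + 4"
    then show "r l = R t l" using r_in[OF t, of l] \<kappa>[OF t] by simp
  qed (use \<kappa>'[OF t] in simp)
  have sp: "\<kappa> t + 11 \<le> \<kappa> t'" if "t < t'" "t' < n" for t t' using i(2)[OF that] \<kappa>[of t] \<kappa>[of t'] that by simp
  have inj: "inj_on \<kappa> {..<n}"
  proof (rule inj_onI)
    fix t t' assume "t \<in> {..<n}" "t' \<in> {..<n}" "\<kappa> t = \<kappa> t'"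
    then show "t = t'" using sp[of t t'] sp[of t' t] by (cases t t' rule: linorder_cases) auto
  qed
  \<comment> \<open>The added points are reindexed from sites to extended pins.\<close>
  define X where "X j = (\<Union>t\<in>{t. t < n \<and> \<kappa> t = j}. E t)" for j
  have X: "X (\<kappa> t) = E t" if "t < n" for t
  proof -
    have "{t'. t' < n \<and> \<kappa> t' = \<kappa> t} = {t}" using inj that by (auto dest: inj_onD)
    then show ?thesis by (simp add: X_def)
  qed
  define A where "A = r ` {1..m} \<union> (\<Union>j\<in>\<kappa> ` {..<n}. X j)"
  have UX: "(\<Union>j\<in>\<kappa> ` {..<n}. X j) = (\<Union>t<n. E t)" using X by auto
  have AP: "A \<subseteq> P"
  proof -
    have "r l \<in> P" if "l \<in> {1..m}" for l
      using admD(1)[OF ra, of l] ra c0P that by (cases "l = 1") (auto simp: adm_def)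
    then show ?thesis unfolding A_def UX using extn_subset[OF Er] by blast
  qed
  have "spiral_with_extensions n A"
    unfolding spiral_with_extensions_def
  proof (intro exI conjI ballI)
    show "spiral m r" using adm_spiral[OF ra m] .
    show "\<kappa> ` {..<n} \<subseteq> {4..m}" using \<kappa>' by fastforce
    show "card (\<kappa> ` {..<n}) = n" using card_image[OF inj] by simp
    show "A = r ` {1..m} \<union> (\<Union>j\<in>\<kappa> ` {..<n}. X j)" by (rule A_def)
    show "r ` {1..m} \<inter> (\<Union>j\<in>\<kappa> ` {..<n}. X j) = {}" unfolding UX using extn_near(2)[OF ra \<kappa>' Er] by blast
    fix j assume "j \<in> \<kappa> ` {..<n}"
    then obtain t where t: "t < n" "j = \<kappa> t" by blast
    show "extension_of A m r j (X j)"
      unfolding t(2) X[OF t(1)]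
    proof (rule extn_extension[OF ra \<kappa>'[OF t(1)] Er[OF t(1)]])
      show "E t \<subseteq> A" unfolding A_def UX using t(1) by blast
      fix z assume "z \<in> A"
      then consider "z \<in> r ` {1..m}" | t' where "t' < n" "z \<in> E t'" unfolding A_def UX by blast
      then show "z \<in> r ` {1..m} \<or> z \<in> E t \<or> inner (\<kappa> t) z \<or> outer (\<kappa> t) z"
      proof cases
        case (2 t')
        have n: "near (\<kappa> t') z" using extn_near(1)[OF ra \<kappa>'[OF 2(1)] Er[OF 2(1)] 2(2)] .
        show ?thesis
        proof (cases t' t rule: linorder_cases)
          case less
          then show ?thesis using near_inner[OF n sp] t(1) by blast
        next
          case equal
          then show ?thesis using 2 by simp
        next
          case greater
          have "7 \<le> \<kappa> t" using \<kappa>'[OF t(1)] by simp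
          then show ?thesis using near_outer[OF n _ sp[OF greater 2(1)]] by blast
        qed
      qed simp
    qed
  qed
  then show ?thesis using AP by blast
qed

end

context layered_spiral
begin

declare One_nat_def [simp del]

text \<open>Exchanging pins \<open>j\<close> and \<open>j + 1\<close> affects the comparison of each
  with its predecessor and that of pin \<open>j + 2\<close> with pin \<open>j + 1\<close>; all
  others are inherited.\<close>

lemma adm_update:
  assumes g: "adm g" and j: "4 \<le> j" "j + 2 \<le> m" and ab: "a \<in> P" "b \<in> P"
    and a: "B (j - 4) (dir j) < sg (dir j) a" "sg (dir j) a \<le> B j (dir j)"
      "B (j - 5) (dir (j - 1)) < sg (dir (j - 1)) a" "sg (dir (j - 1)) a < B (j - 1) (dir (j - 1))"
      "sg (dir (j - 1)) a < sg (dir (j - 1)) (g (j - 1))"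
    and b: "B (j - 3) (dir (j + 1)) < sg (dir (j + 1)) b" "sg (dir (j + 1)) b \<le> B (j + 1) (dir (j + 1))"
      "B (j - 4) (dir j) < sg (dir j) b" "sg (dir j) b < B j (dir j)" "sg (dir j) b < sg (dir j) a"
    and n: "sg (dir (j + 1)) (g (j + 2)) < sg (dir (j + 1)) b"
  shows "adm (g(j := a, j + 1 := b))"
  unfolding adm_def
proof (intro conjI ballI)
  show "(g(j := a, j + 1 := b)) 1 = c0" using g j by (simp add: adm_def)
  fix s assume s: "s \<in> {2..m}"
  have e: "j + 1 - 1 = j" "j + 1 - 4 = j - 3" "j + 1 - 5 = j - 4" "j + 2 - 1 = j + 1" by simp_all
  have sm: "2 \<le> s" "s \<le> m" using s by auto
  note G = admD[OF g sm]
  let ?r = "g(j := a, j + 1 := b)"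
  consider "s = j" | "s = j + 1" | "s = j + 2" | "s \<noteq> j" "s \<noteq> j + 1" "s - 1 \<noteq> j" "s - 1 \<noteq> j + 1" by linarith
  then have "?r s \<in> P \<and> B (s - 4) (dir s) < sg (dir s) (?r s) \<and> sg (dir s) (?r s) \<le> B s (dir s) \<and>
      B (s - 5) (dir (s - 1)) < sg (dir (s - 1)) (?r s) \<and> sg (dir (s - 1)) (?r s) < B (s - 1) (dir (s - 1)) \<and>
      (3 \<le> s \<longrightarrow> sg (dir (s - 1)) (?r s) < sg (dir (s - 1)) (?r (s - 1)))"
  proof cases
    assume sj: "s = j"
    have "?r j = a" "?r (j - 1) = g (j - 1)" using j by auto
    then show ?thesis unfolding sj using a ab by simp
  next
    assume sj: "s = j + 1"
    have "?r (j + 1) = b" "?r j = a" by auto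
    then show ?thesis unfolding sj e using b ab by (simp del: fun_upd_apply)
  next
    assume sj: "s = j + 2"
    have r: "?r (j + 2) = g (j + 2)" "?r (j + 1) = b" by auto
    show ?thesis unfolding sj e r using G(1-5)[unfolded sj e] n by simp
  next
    assume "s \<noteq> j" "s \<noteq> j + 1" "s - 1 \<noteq> j" "s - 1 \<noteq> j + 1"
    then have r: "?r s = g s" "?r (s - 1) = g (s - 1)" by auto
    show ?thesis unfolding r using G(1-6) by blast
  qed
  then show "?r s \<in> P" "B (s - 4) (dir s) < sg (dir s) (?r s)" "sg (dir s) (?r s) \<le> B s (dir s)"
      "B (s - 5) (dir (s - 1)) < sg (dir (s - 1)) (?r s)" "sg (dir (s - 1)) (?r s) < B (s - 1) (dir (s - 1))"
      "3 \<le> s \<longrightarrow> sg (dir (s - 1)) (?r s) < sg (dir (s - 1)) (?r (s - 1))" by (simp_all del: fun_upd_apply)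
qed

text \<open>The pin \<open>\<kappa>\<close> that is extended need not be \<open>i\<close>, and pins next to \<open>i\<close> may be exchanged first.\<close>

definition extendable :: "nat \<Rightarrow> bool" where
  "extendable i \<longleftrightarrow> (\<exists>R \<kappa> E. adm R \<and> (\<forall>l. l + 1 < i \<or> i + 1 < l \<longrightarrow> R l = p l) \<and> i \<le> \<kappa> + 3 \<and> \<kappa> \<le> i + 1 \<and> extn R \<kappa> E)"

lemma extendableI:
  assumes "extn R \<kappa> E" "adm R" "\<And>l. l + 1 < i \<or> i + 1 < l \<Longrightarrow> R l = p l" "i \<le> \<kappa> + 3" "\<kappa> \<le> i + 1"
  shows "extendable i"
  unfolding extendable_def using assms by (intro exI[of _ R] exI[of _ \<kappa>] exI[of _ E]) simp

lemma extendableI1: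
  assumes "ext1 R \<kappa> q" "adm R" "\<And>l. l + 1 < i \<or> i + 1 < l \<Longrightarrow> R l = p l" "i \<le> \<kappa> + 3" "\<kappa> \<le> i + 1"
  shows "extendable i"
proof (rule extendableI[OF _ assms(2-5)])
  show "extn R \<kappa> {q}" unfolding extn_def using assms(1) by (intro disjI1 exI[of _ q]) simp
qed

lemma extendableI2:
  assumes "ext2 R \<kappa> u v s" "adm R" "\<And>l. l + 1 < i \<or> i + 1 < l \<Longrightarrow> R l = p l" "i \<le> \<kappa> + 3" "\<kappa> \<le> i + 1"
  shows "extendable i"
proof (rule extendableI[OF _ assms(2-5)])
  show "extn R \<kappa> {u, v, s}" unfolding extn_def using assms(1) by (intro disjI2 exI[of _ u] exI[of _ v] exI[of _ s]) simp
qed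

text \<open>The copy of 21 formed by \<open>u\<close> and \<open>v\<close> is reached by layer
  \<open>i\<close> at pin \<open>i\<close>, and \<open>s\<close> slices it from the far side of
  \<open>c0\<close>. If \<open>u\<close> rises far enough above pin \<open>i\<close>, it extends
  that pin at once. Otherwise \<open>s\<close> decides: if it reaches far, or if a pin already
  crosses the copy, two consecutive pins can be exchanged so that \<open>v\<close> becomes a pin
  extended by \<open>u\<close>, or \<open>s\<close> itself extends a nearby pin. If nothing of this
  happens, the coordinates left over are those of a type 2 extension.\<close>

lemma extendable_site:
  assumes i: "20 \<le> i" "i + 20 \<le> m" and P: "u \<in> P" "v \<in> P" "s \<in> P"
    and uv: "X i u < X i v" "Y i v < Y i u" "Y i c0 < Y i v"
    and X: "B (i - 4) (dir i) < X i u" "X i u \<le> B i (dir i)"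
    and s: "X i u < X i s \<and> X i s < X i v \<and> Y i s < Y i c0 \<or> Y i v < Y i s \<and> Y i s < Y i u \<and> X i s < X i c0"
  shows "extendable i"
proof -
  have d: "dir (i + 1) = opp (dir (i - 1))" "dir (i - 3) = opp (dir (i - 1))" "dir (i - 2) = opp (dir i)" "dir (i - 4) = dir i"
    "dir (i + 2) = opp (dir i)" "dir (i + 3) = dir (i - 1)" "dir (i + 4) = dir i"
    by (rule dir_near, use i in linarith)+
  have Z: "sg (dir (i + 1)) z = - Y i z" "sg (dir (i - 3)) z = - Y i z" "sg (dir (i - 2)) z = - X i z" "sg (dir (i + 2)) z = - X i z" for z
    unfolding d by simp_all
  have pp: "perp (dir i) (dir (i - 1))" "perp (dir (i - 1)) (dir i)" using dir_near(12,13)[of i] i by simp_all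
  have pz: "perp (dir (i + 1)) (dir i)" "perp (dir i) (dir (i + 1))" using pp unfolding d by simp_all
  have pw: "perp (dir (i - 1)) (dir (i - 2))" "perp (dir (i - 2)) (dir (i - 1))" using pp unfolding d by simp_all
  have e: "i + 1 - 1 = i" "i + 2 - 1 = i + 1" "i + 3 - 1 = i + 2" "i + 4 - 1 = i + 3" "i + 5 - 1 = i + 4" "i - 1 - 1 = i - 2" "i - 3 - 1 = i - 4" "i - 2 - 1 = i - 3"
    "i + 1 - 2 = i - 1" "i + 2 - 2 = i" "i + 3 - 2 = i + 1" "i + 4 - 2 = i + 2" "i + 5 - 2 = i + 3" "i - 1 - 2 = i - 3" "i - 3 - 2 = i - 5"
    "i - 3 - 4 = i - 7" "i - 3 + 4 = i + 1" "i - 3 + 1 = i - 2" "i + 1 - 4 = i - 3" "i + 1 + 4 = i + 5" "i + 1 + 1 = i + 2" "i - 1 - 4 = i - 5" "i - 1 + 4 = i + 3" "i - 1 + 1 = i"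
    "i - 1 - 5 = i - 6" "i - 1 - 3 = i - 4" "i - 1 + 2 = i + 1"
    using i by arith+
  have idx: "2 \<le> i - 1" "i - 1 \<le> m" "2 \<le> i - 3" "i - 3 \<le> m" "2 \<le> i - 2" "i - 2 \<le> m" "2 \<le> i - 4" "i - 4 \<le> m" "2 \<le> i" "i \<le> m"
    "2 \<le> i + 1" "i + 1 \<le> m" "2 \<le> i + 2" "i + 2 \<le> m" "2 \<le> i + 3" "i + 3 \<le> m" "2 \<le> i + 4" "i + 4 \<le> m" "2 \<le> i + 5" "i + 5 \<le> m" using i by arith+
  have PP: "p i \<in> P" "p (i - 1) \<in> P" "p (i - 2) \<in> P" "p (i - 3) \<in> P" "p (i + 1) \<in> P" "p (i + 2) \<in> P"
    using pP[OF idx(9,10)] pP[OF idx(1,2)] pP[OF idx(5,6)] pP[OF idx(3,4)] pP[OF idx(11,12)] pP[OF idx(13,14)] by simp_all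
  have M: "X i (p i) = B i (dir i)" "Y i (p (i - 1)) = B (i - 1) (dir (i - 1))" "X i (p (i - 4)) = B (i - 4) (dir i)"
    "- Y i (p (i + 1)) = B (i + 1) (dir (i + 1))" "- Y i (p (i - 3)) = B (i - 3) (dir (i - 3))" "- X i (p (i - 2)) = B (i - 2) (dir (i - 2))"
    using main[OF idx(9,10)] main[OF idx(1,2)] main[OF idx(7,8)] main[OF idx(11,12)] main[OF idx(3,4)] main[OF idx(5,6)] unfolding Z d(4) by simp_all
  have C: "B (i - 2) (dir (i - 1)) < Y i (p i)" "Y i (p i) < Y i (p (i - 1))"
    "B (i - 1) (dir i) < X i (p (i + 1))" "X i (p (i + 1)) < X i (p i)"
    "B i (dir (i + 1)) < - Y i (p (i + 2))" "- Y i (p (i + 2)) < - Y i (p (i + 1))"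
    "B (i + 1) (dir (i + 2)) < - X i (p (i + 3))" 
    "B (i + 2) (dir (i - 1)) < Y i (p (i + 4))"
    "B (i + 3) (dir i) < X i (p (i + 5))"
    "B (i - 3) (dir (i - 2)) < - X i (p (i - 1))" "- X i (p (i - 1)) < - X i (p (i - 2))"
    "X i (p (i - 3)) < B (i - 4) (dir i)"
    using cross[OF idx(9,10), unfolded e] cross[OF idx(11,12), unfolded e] cross[OF idx(13,14), unfolded e] cross[OF idx(15,16), unfolded e] cross[OF idx(17,18), unfolded e]
      cross[OF idx(19,20), unfolded e] cross[OF idx(1,2), unfolded e] cross[OF idx(3,4), unfolded e] M unfolding Z d(4,6,7) by simp_all
  have c1: "Y i (p (i + 1)) < Y i c0" using C(5,6) c0_le[of "dir (i + 1)" i] unfolding Z by simp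
  have c2: "X i (p (i + 2)) < X i c0" using admD(7)[OF adm_p idx(13,14)] unfolding Z by simp
  have c3: "Y i (p (i - 3)) < Y i c0" using admD(7)[OF adm_p idx(3,4)] unfolding Z by simp
  have c4: "Y i (p (i - 2)) < Y i c0" using admD(8)[OF adm_p idx(5,6), unfolded e] unfolding Z by simp
  have c5: "X i (p (i - 1)) < X i c0" using admD(8)[OF adm_p idx(1,2), unfolded e] unfolding Z by simp
  have mono: "B a g \<le> B b g" if "a \<le> b" for a b g using Bmono[OF that] .
  have Xc: "X i c0 < X i u" using X(1) c0_le[of "dir i" "i - 4"] by simp
  have Sk: "Suc (i - 5) = i - 4" "Suc (i - 1) = i" "Suc i = i + 1" "Suc (i - 7) = i - 6" "Suc (i - 3) = i - 2" "Suc (i - 2) = i - 1" "Suc (i - 6) = i - 5" using i by arith+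
  have Yu_hi: "Y i u < Y i (p (i + 4))"
  proof -
    have "Y i u \<le> B (i + 1) (dir (i - 1))" using layer_arm[OF P(1) pp(1) _ X(2)] Xc Sk by simp
    then show ?thesis using mono[of "i + 1" "i + 2" "dir (i - 1)"] C(8) by simp
  qed
  have gpE: "a = b" if "a \<in> P" "b \<in> P" "sg g a = sg g b" for a b g using gp_sg[OF gpP that] .
  have up: "u \<noteq> p i" if "Y i u \<noteq> Y i (p i)" using that by blast
  show ?thesis
  proof (cases "Y i (p i) < Y i u \<and> (Y i (p (i - 1)) < Y i u \<or> X i u < X i (p (i + 1)))")
    case True
    have "u \<noteq> p i" using True by auto
    then have "X i u \<noteq> X i (p i)" using gpE[OF P(1) PP(1)] by auto
    then have "ext1 p i u" unfolding ext1_def using P(1) X M(1) True Yu_hi by auto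
    then show ?thesis by (rule extendableI1) (use adm_p i in auto)
  next
    case not1: False
    have Yu: "Y i u \<le> B (i - 1) (dir (i - 1))" using not1 C(2) M(2) by auto
    have Xv: "X i v \<le> B i (dir i)"
    proof -
      have "Y i v \<le> B (i - 1) (dir (i - 1))" "Y i c0 \<le> Y i v" using Yu uv by auto
      then show ?thesis using layer_arm[OF P(2) pp(2), of "i - 1"] Sk by simp
    qed
    have Yv: "B (i - 5) (dir (i - 1)) < Y i v"
    proof (rule layer_arm'[OF P(2) pp(2)])
      show "B (Suc (i - 5)) (dir i) < X i v" using X(1) uv(1) Sk by simp
    qed (use uv in simp)
    from s show ?thesis
    proof
      assume s: "X i u < X i s \<and> X i s < X i v \<and> Y i s < Y i c0"
      \<comment> \<open>Pins \<open>i\<close> and \<open>i + 1\<close> are exchanged for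
        \<open>v\<close> and a deep point \<open>w\<close> between \<open>u\<close> and
        \<open>v\<close>. Then \<open>u\<close> is a type 1 extension of the new pin
        \<open>v\<close>, sliced by \<open>w\<close>.\<close>
      have upd: "extendable i" if ed: "w \<in> P" "X i u < X i w" "X i w < X i v" "- Y i (p (i + 2)) < - Y i w" for w
      proof (rule extendableI1)
        let ?r = "p(i := v, i + 1 := w)"
        have Zw: "- Y i w \<le> B (i + 1) (dir (i + 1))"
        proof -
          have "X i c0 \<le> X i w" "X i w \<le> B i (dir i)" using ed Xc Xv by auto
          then show ?thesis using layer_arm[OF ed(1) pz(2), of i, unfolded Sk] unfolding Z by simp
        qed
        show "adm ?r"
        proof (rule adm_update[OF adm_p])
          show "4 \<le> i" "i + 2 \<le> m" using i by simp_all
          show "v \<in> P" "w \<in> P" using P ed by simp_all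
          show "X i v \<le> B i (dir i)" "B (i - 5) (dir (i - 1)) < Y i v" by (fact Xv, fact Yv)
          show "B (i - 4) (dir i) < X i v" using X(1) uv(1) by linarith
          show "Y i v < B (i - 1) (dir (i - 1))" using uv(2) Yu by linarith
          show "Y i v < Y i (p (i - 1))" using uv(2) Yu M(2) by linarith
          show "B (i - 3) (dir (i + 1)) < sg (dir (i + 1)) w"
          proof -
            have "B (i - 3) (dir (i + 1)) \<le> B i (dir (i + 1))" by (rule mono) simp
            then show ?thesis unfolding Z using C(5) ed(4) by linarith
          qed
          show "sg (dir (i + 1)) w \<le> B (i + 1) (dir (i + 1))" unfolding Z by (fact Zw)
          show "B (i - 4) (dir i) < X i w" using X(1) ed(2) by linarith
          show "X i w < B i (dir i)" using ed(3) Xv by linarith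
          show "X i w < X i v" by (fact ed(3))
          show "sg (dir (i + 1)) (p (i + 2)) < sg (dir (i + 1)) w" unfolding Z by (fact ed(4))
        qed
        have r: "?r i = v" "?r (i + 1) = w" "?r (i + 4) = p (i + 4)" "?r (i - 1) = p (i - 1)" using i by auto
        show "ext1 ?r i u" unfolding ext1_def r using P uv X Yu_hi ed by blast
      qed auto
      show ?thesis
      proof (cases "- Y i (p (i + 2)) < - Y i s \<or> X i u < X i (p (i + 1)) \<and> X i (p (i + 1)) < X i v")
        case True
        then show ?thesis using upd[OF P(3)] upd[OF PP(5)] s C(6) by auto
      next
        \<comment> \<open>Now \<open>s\<close> is shallower than pin \<open>i + 2\<close>, and pin
          \<open>i + 1\<close> does not pass between \<open>u\<close> and \<open>v\<close>. If
          \<open>s\<close> is also shallower than pin \<open>i - 3\<close> it extends that pin; if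
          it is beyond pin \<open>i + 1\<close> it extends pin \<open>i + 1\<close>; in between, a
          type 2 extension of pin \<open>i\<close> results.\<close>
        case not2: False
        have Zs: "- Y i s < - Y i (p (i + 2))"
        proof -
          have "s \<noteq> p (i + 2)" using s c2 Xc by auto
          then have "Y i s \<noteq> Y i (p (i + 2))" using gpE[OF P(3) PP(6)] by auto
          then show ?thesis using not2 by auto
        qed
        have Zc: "sg (dir (i + 1)) c0 \<le> sg (dir (i + 1)) s" unfolding Z using s by simp
        have Zlo: "B k (dir (i + 1)) < - Y i s" if "B (Suc k) (dir i) < X i s" for k
          using layer_arm'[OF P(3) pz(1) Zc that] unfolding Z .
        have s3: "s \<noteq> p (i - 3)" using s X(1) C(12) by auto
        then have ns3: "Y i s \<noteq> Y i (p (i - 3))" using gpE[OF P(3) PP(4)] by auto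
        show ?thesis
        proof (cases "- Y i s < - Y i (p (i - 3))")
          case True
          have lo: "B (i - 7) (dir (i + 1)) < - Y i s"
            by (rule Zlo) (unfold Sk, use X(1) s mono[of "i - 6" "i - 4" "dir i", OF diff_le_mono2] i in simp)
          have "sg (dir (i - 3)) s \<le> B (i - 3) (dir (i - 3))" using True M(5) unfolding Z by simp
          then have "X i s \<le> B (Suc (i - 3)) (dir i)"
            using layer_arm[OF P(3), of "dir (i - 3)" "dir i" "i - 3"] Zc pz(1) d(1,2) by simp
          then have "X i s < X i (p (i + 1))" using mono[of "i - 2" "i - 1" "dir i", OF diff_le_mono2] C(3) Sk by simp
          then have "ext1 p (i - 3) s" unfolding ext1_def e d(4) Z using P(3) True X(1) C(12) M(3) lo s d(1,2) by simp
          then show ?thesis by (rule extendableI1) (use adm_p i in auto)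
        next
          case False
          then have Z3: "- Y i (p (i - 3)) < - Y i s" using ns3 by simp
          show ?thesis
          proof (cases "X i (p (i + 1)) < X i s")
            case True
            have lo: "B (i - 3) (dir (i + 1)) < - Y i s"
              by (rule Zlo) (unfold Sk, use True C(3) mono[of "i - 2" "i - 1" "dir i", OF diff_le_mono2] i in simp)
            have "X i s < X i (p (i + 5))" using s Xv C(9) mono[of i "i + 3" "dir i"] by simp
            then have "ext1 p (i + 1) s" unfolding ext1_def e Z using P(3) True lo Zs C(6) by simp
            then show ?thesis by (rule extendableI1) (use adm_p i in auto)
          next
            case False
            have "s \<noteq> p (i + 1)" using Zs C(6) by auto
            then have Xs: "X i s < X i (p (i + 1))" using gpE[OF P(3) PP(5), of "dir i"] False by force
            have "v \<noteq> p (i + 1)" using uv c1 by auto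
            then have "X i v \<noteq> X i (p (i + 1))" using gpE[OF P(2) PP(5)] by auto
            then have Xv': "X i v < X i (p (i + 1))" using not2 Xs s by auto
            have "u \<noteq> p i" using uv(1) Xv' C(4) by auto
            then have "Y i u \<noteq> Y i (p i)" using gpE[OF P(1) PP(1)] by auto
            then have "Y i u < Y i (p i)" using not1 s Xs by auto
            then have "ext2 p i u v s" unfolding ext2_def Z using P X uv Xv' Yv s Z3 Zs by blast
            then show ?thesis by (rule extendableI2) (use adm_p i in auto)
          qed
        qed
      qed
    next
      assume s: "Y i v < Y i s \<and> Y i s < Y i u \<and> X i s < X i c0"
      have Yc: "Y i c0 \<le> Y i s" "Y i s \<le> B (i - 1) (dir (i - 1))" using s uv Yu by auto
      have Wlo: "B (i - 6) (dir (i - 2)) < - X i s"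
      proof -
        have "sg (dir (i - 2)) c0 \<le> sg (dir (i - 2)) s" unfolding Z using s by simp
        then have "B (i - 6) (dir (i - 2)) < sg (dir (i - 2)) s"
          by (rule layer_arm'[OF P(3) pw(2)]) (unfold Sk, use Yv s in simp)
        then show ?thesis unfolding Z .
      qed
      have s1: "s \<noteq> p (i - 1)" using s Yu M(2) by auto
      then have ns1: "X i s \<noteq> X i (p (i - 1))" using gpE[OF P(3) PP(2)] by auto
      have s2: "s \<noteq> p (i - 2)" using s uv c4 by auto
      then have ns2: "X i s \<noteq> X i (p (i - 2))" using gpE[OF P(3) PP(3)] by auto
      show ?thesis
      proof (cases "- X i (p (i - 1)) < - X i s \<and> (- X i (p (i - 2)) < - X i s \<or> Y i s < Y i (p i))")
        \<comment> \<open>\<open>s\<close> reaches further out than pin \<open>i - 1\<close> and is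
          sliced off from it by pin \<open>i - 2\<close> or pin \<open>i\<close>.\<close>
        case True
        have "- X i s \<le> B i (dir (i - 2))"
          using layer_arm[OF P(3) pw(1) Yc] Sk unfolding Z by simp
        then have "- X i s < - X i (p (i + 3))" using mono[of i "i + 1" "dir (i - 2)"] C(7) d(3,5) by simp
        then have "ext1 p (i - 1) s" unfolding ext1_def e Z using P(3) True s Yu M(2) Yv by auto
        then show ?thesis by (rule extendableI1) (use adm_p i in auto)
      next
        case notW1: False
        have Ws: "- X i s < - X i (p (i - 2))" using notW1 ns1 ns2 C(11) by auto
        show ?thesis
        proof (cases "X i (p (i + 1)) < X i v")
          case True
          show ?thesis
          proof (rule extendableI1)
            \<comment> \<open>Pins \<open>i - 1\<close> and \<open>i\<close> are exchanged for
              \<open>s\<close> and \<open>v\<close>; again \<open>u\<close> extends the new pin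
              \<open>v\<close>, and \<open>s\<close> slices.\<close>
            let ?r = "p(i - 1 := s, i - 1 + 1 := v)"
            show "adm ?r"
            proof (rule adm_update[OF adm_p], unfold e Z)
              show "4 \<le> i - 1" "i + 1 \<le> m" using i by arith+
              show "s \<in> P" "v \<in> P" using P by simp_all
              show "B (i - 5) (dir (i - 1)) < Y i s" using Yv s by linarith
              show "Y i s \<le> B (i - 1) (dir (i - 1))" by (fact Yc(2))
              show "B (i - 6) (dir (i - 2)) < - X i s" by (fact Wlo)
              show "- X i s < B (i - 2) (dir (i - 2))" using Ws M(6) by linarith
              show "- X i s < - X i (p (i - 2))" by (fact Ws)
              show "B (i - 4) (dir i) < X i v" using X(1) uv(1) by linarith
              show "X i v \<le> B i (dir i)" "B (i - 5) (dir (i - 1)) < Y i v" by (fact Xv, fact Yv)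
              show "Y i v < B (i - 1) (dir (i - 1))" using uv(2) Yu by linarith
              show "Y i v < Y i s" using s by blast
              show "X i (p (i + 1)) < X i v" by (fact True)
            qed
            have r: "?r i = v" "?r (i + 4) = p (i + 4)" "?r (i - 1) = s" using i by auto
            show "ext1 ?r i u" unfolding ext1_def r using P uv X Yu_hi s by blast
          qed (use i in auto)
        next
          case False
          have "v \<noteq> p (i + 1)" using uv c1 by auto
          then have Xv': "X i v < X i (p (i + 1))" using gpE[OF P(2) PP(5), of "dir i"] False by force
          have "u \<noteq> p i" using uv(1) Xv' C(4) by auto
          then have "Y i u \<noteq> Y i (p i)" using gpE[OF P(1) PP(1)] by auto
          then have Yu': "Y i u < Y i (p i)" using not1 uv(1) Xv' by auto
          have "- X i s < - X i (p (i - 1))" using notW1 ns1 Yu' s by auto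
          then have "ext2 p i u v s" unfolding ext2_def Z using P X uv Xv' Yv s Yu' Wlo by blast
          then show ?thesis by (rule extendableI2) (use adm_p i in auto)
        qed
      qed
    qed
  qed
qed

lemma spiral_sites:
  fixes i :: "nat \<Rightarrow> nat"
  assumes m: "2 \<le> m" and i: "\<And>t. t < n \<Longrightarrow> 20 \<le> i t \<and> i t + 20 \<le> m" "\<And>t t'. t < t' \<Longrightarrow> t' < n \<Longrightarrow> i t + 30 \<le> i t'"
    and ext: "\<And>t. t < n \<Longrightarrow> extendable (i t)"
  shows "\<exists>A\<subseteq>P. spiral_with_extensions n A"
proof -
  have "\<forall>t. \<exists>R \<kappa> E. t < n \<longrightarrow> adm R \<and> (\<forall>l. l + 1 < i t \<or> i t + 1 < l \<longrightarrow> R l = p l) \<and> i t \<le> \<kappa> + 3 \<and> \<kappa> \<le> i t + 1 \<and> extn R \<kappa> E"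
    using ext unfolding extendable_def by meson
  then obtain R \<kappa> E where *: "\<forall>t. t < n \<longrightarrow> adm (R t) \<and> (\<forall>l. l + 1 < i t \<or> i t + 1 < l \<longrightarrow> R t l = p l) \<and> i t \<le> \<kappa> t + 3 \<and> \<kappa> t \<le> i t + 1 \<and> extn (R t) (\<kappa> t) (E t)"
    by metis
  show ?thesis by (rule spiral_combine[OF m i, where R = R and \<kappa> = \<kappa> and E = E]) (use * in blast)+
qed

end

section \<open>Layers\<close>

locale layers =
  fixes P :: "point set" and a0 c0 :: point
  assumes simple: "simple_set P" and a0: "a0 \<in> P" and c0: "c0 \<in> P" and ac: "a0 \<noteq> c0"
begin

text \<open>A layer is a box stored by its four extents. Its next extent in direction
  \<open>d\<close> is that of the points whose other coordinate lies within the box; keeping the old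
  extent in the maximum makes the boxes increase.\<close>

fun \<beta> :: "nat \<Rightarrow> direction \<Rightarrow> real" where
  "\<beta> 0 d = max (sg d a0) (sg d c0)"
| "\<beta> (Suc i) d = Max (insert (\<beta> i d) (sg d ` {z \<in> P. \<forall>e. perp d e \<longrightarrow> sg e z \<le> \<beta> i e}))"

lemma gpP: "gp P"
  using simple by (simp add: simple_set_def)

lemma finP: "finite P"
  using gpP by (simp add: gp_def)

lemma \<beta>_layer: "z \<in> P \<Longrightarrow> (\<And>e. perp d e \<Longrightarrow> sg e z \<le> \<beta> i e) \<Longrightarrow> sg d z \<le> \<beta> (Suc i) d"
  using finP by (auto intro!: Max_ge)

lemma \<beta>_Suc: "\<beta> i d \<le> \<beta> (Suc i) d"
  using finP by (auto intro!: Max_ge)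

lemma \<beta>_mono: "i \<le> j \<Longrightarrow> \<beta> i d \<le> \<beta> j d"
  by (induction rule: dec_induct) (use \<beta>_Suc order_trans in blast)+

lemma c0_\<beta>: "sg d c0 \<le> \<beta> i d"
  using \<beta>_mono[of 0 i d] by simp

lemma a0_\<beta>: "sg d a0 \<le> \<beta> i d"
  using \<beta>_mono[of 0 i d] by simp

lemma \<beta>_attained:
  assumes "\<beta> i d < \<beta> (Suc i) d"
  shows "\<exists>z\<in>P. sg d z = \<beta> (Suc i) d \<and> (\<forall>e. perp d e \<longrightarrow> sg e z \<le> \<beta> i e)"
proof -
  let ?S = "{z \<in> P. \<forall>e. perp d e \<longrightarrow> sg e z \<le> \<beta> i e}"
  have "Max (insert (\<beta> i d) (sg d ` ?S)) \<in> insert (\<beta> i d) (sg d ` ?S)" by (rule Max_in) (use finP in auto)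
  then have "\<beta> (Suc i) d \<in> sg d ` ?S" using assms by auto
  then show ?thesis by auto
qed

lemma \<beta>_opp: "sg d z = \<beta> (Suc i) d \<Longrightarrow> sg (opp d) z \<le> \<beta> j (opp d)"
  using c0_\<beta>[of d "Suc i"] c0_\<beta>[of "opp d" j] by (simp del: \<beta>.simps)

text \<open>Each side of a box is touched by a point of \<open>P\<close> inside the box. A side that
  has not moved inherits the point from the previous layer.\<close>

lemma \<beta>_extreme: "\<exists>z\<in>P. sg d z = \<beta> i d \<and> (\<forall>e. sg e z \<le> \<beta> i e)"
proof (induction i)
  case 0
  show ?case
  proof (cases "sg d a0 \<le> sg d c0")
    case True
    then show ?thesis using c0 by (intro bexI[of _ c0]) auto
  next
    case False
    then show ?thesis using a0 by (intro bexI[of _ a0]) auto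
  qed
next
  case (Suc i)
  show ?case
  proof (cases "\<beta> i d < \<beta> (Suc i) d")
    case True
    obtain z where z: "z \<in> P" "sg d z = \<beta> (Suc i) d" "\<And>e. perp d e \<Longrightarrow> sg e z \<le> \<beta> i e" using \<beta>_attained[OF True] by blast
    have "sg e z \<le> \<beta> (Suc i) e" for e
    proof (cases "perp d e")
      case True
      then show ?thesis using z(3) \<beta>_Suc order_trans by blast
    next
      case False
      then have "e = d \<or> e = opp d" by (rule not_perp)
      then show ?thesis using z(2) \<beta>_opp[OF z(2)] by (auto simp del: \<beta>.simps)
    qed
    then show ?thesis using z by blast
  next
    case False
    then have "\<beta> (Suc i) d = \<beta> i d" using \<beta>_Suc[of i d] by linarith
    then show ?thesis using Suc \<beta>_Suc order_trans by (metis (no_types))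
  qed
qed

text \<open>A point between two points of the box in one coordinate lies in a strip through the box.
  If no side grows, it is inside, so the points of the box form an interval with \<open>a0\<close>
  and \<open>c0\<close>, and by simplicity this is all of \<open>P\<close>.\<close>

lemma \<beta>_grows:
  assumes "z \<in> P" "\<beta> i d < sg d z"
  shows "\<exists>g. \<beta> i g < \<beta> (Suc i) g"
proof (rule ccontr)
  assume no: "\<not> (\<exists>g. \<beta> i g < \<beta> (Suc i) g)"
  define I where "I = {z \<in> P. \<forall>d. sg d z \<le> \<beta> i d}"
  have "ivl P I"
    unfolding ivl_def
  proof (intro conjI ballI allI notI)
    show "I \<subseteq> P" by (auto simp: I_def)
    fix z u v d
    assume z: "z \<in> P - I" and uv: "u \<in> I" "v \<in> I" and l: "sg d u < sg d z \<and> sg d z < sg d v"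
    obtain g where g: "\<beta> i g < sg g z" using z by (auto simp: I_def not_le)
    have "sg d v \<le> \<beta> i d" "sg (opp d) u \<le> \<beta> i (opp d)" using uv unfolding I_def by blast+
    then have dz: "sg d z \<le> \<beta> i d" "sg (opp d) z \<le> \<beta> i (opp d)" using l by auto
    have "sg g z \<le> \<beta> (Suc i) g"
    proof (rule \<beta>_layer)
      show "z \<in> P" using z by simp
      fix e assume e: "perp g e"
      have "g \<noteq> d" "g \<noteq> opp d" using g dz by auto
      then have "perp d g" using not_perp by blast
      then show "sg e z \<le> \<beta> i e" using perp_perp[OF _ e] dz by blast
    qed
    then show False using no g by (meson less_le_trans)
  qed
  moreover have "a0 \<in> I" "c0 \<in> I" using a0 c0 a0_\<beta> c0_\<beta> by (auto simp: I_def)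
  ultimately have "I = P" using simple_setD[OF simple _ _ _ ac] by blast
  then have "sg d z \<le> \<beta> i d" using assms(1) unfolding I_def by blast
  then show False using assms(2) by simp
qed

text \<open>While a point is left outside, every layer takes in a new point of the finite set
  \<open>P\<close>.\<close>

lemma \<beta>_exhausts:
  assumes "z \<in> P"
  shows "\<exists>i. sg d z \<le> \<beta> i d"
proof (rule ccontr)
  assume "\<not> (\<exists>i. sg d z \<le> \<beta> i d)"
  then have out: "\<beta> i d < sg d z" for i by (meson not_le)
  define I where "I i = {z \<in> P. \<forall>d. sg d z \<le> \<beta> i d}" for i
  have fin: "finite (I i)" for i using finP by (simp add: I_def)
  have "i \<le> card (I i)" for i
  proof (induction i)
    case (Suc i)
    obtain g where g: "\<beta> i g < \<beta> (Suc i) g" using \<beta>_grows[OF assms out] by blast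
    obtain x where x: "x \<in> P" "sg g x = \<beta> (Suc i) g" "\<forall>e. sg e x \<le> \<beta> (Suc i) e" using \<beta>_extreme by blast
    have "\<not> sg g x \<le> \<beta> i g" using g x(2) by linarith
    then have "x \<in> I (Suc i)" "x \<notin> I i" using x(1,3) unfolding I_def by blast+
    moreover have "I i \<subseteq> I (Suc i)" unfolding I_def using \<beta>_Suc order_trans by blast
    ultimately have "card (I i) < card (I (Suc i))" using fin by (intro psubset_card_mono) auto
    then show ?case using Suc by simp
  qed simp
  moreover have "card (I i) \<le> card P" for i using finP by (intro card_mono) (auto simp: I_def)
  ultimately show False by (meson not_less_eq_eq order_trans)
qed

section \<open>Chains with one pin per layer\<close>

text \<open>\<open>q\<close> is responsible for the growth of layer \<open>i\<close> in direction
  \<open>d\<close>: it lies in the strip through the layer before and reaches furthest.\<close>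

definition att :: "nat \<Rightarrow> direction \<Rightarrow> point \<Rightarrow> bool" where
  "att i d q \<longleftrightarrow> 1 \<le> i \<and> q \<in> P \<and> sg d q = \<beta> i d \<and> \<beta> (i - 1) d < \<beta> i d \<and> (\<forall>e. perp d e \<longrightarrow> sg e q \<le> \<beta> (i - 1) e)"

lemma att_exists: "\<beta> i d < \<beta> (Suc i) d \<Longrightarrow> \<exists>q. att (Suc i) d q"
  using \<beta>_attained[of i d] unfolding att_def by (auto simp del: \<beta>.simps)

lemma att_inside: "att i d q \<Longrightarrow> i \<le> j \<Longrightarrow> sg e q \<le> \<beta> j e"
proof -
  assume a: "att i d q" and ij: "i \<le> j"
  obtain k where k: "i = Suc k" using a by (cases i) (auto simp: att_def)
  have "sg e q \<le> \<beta> i e"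
  proof (cases "perp d e")
    case True
    then have "sg e q \<le> \<beta> (i - 1) e" using a unfolding att_def by blast
    then show ?thesis using \<beta>_mono[of "i - 1" i e] by simp
  next
    case False
    then have "e = d \<or> e = opp d" by (rule not_perp)
    then show ?thesis using a \<beta>_opp[of d q k i] unfolding att_def k by (auto simp del: \<beta>.simps)
  qed
  then show ?thesis using \<beta>_mono[OF ij, of e] by simp
qed

text \<open>A point taken in only by layer \<open>i + 2\<close> was not in the strip through layer
  \<open>i\<close>, so it exceeds that layer in a perpendicular direction \<open>e\<close>. Hence
  layer \<open>i + 1\<close> grew in direction \<open>e\<close>, and the point responsible for this
  growth is the predecessor.\<close>

lemma att_pred:
  assumes a: "att (Suc (Suc i)) d q"
  shows "\<exists>e q'. perp d e \<and> att (Suc i) e q' \<and> \<beta> i e < sg e q \<and> sg e q < \<beta> (Suc i) e"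
proof -
  have q: "q \<in> P" "sg d q = \<beta> (Suc (Suc i)) d" "\<beta> (Suc i) d < \<beta> (Suc (Suc i)) d" "\<And>e. perp d e \<Longrightarrow> sg e q \<le> \<beta> (Suc i) e"
    using a unfolding att_def by (auto simp del: \<beta>.simps)
  have "\<not> sg d q \<le> \<beta> (Suc i) d" using q(2,3) by linarith
  then obtain e where e: "perp d e" "\<not> sg e q \<le> \<beta> i e" using \<beta>_layer[OF q(1), of d i] by blast
  have lt: "\<beta> i e < \<beta> (Suc i) e" using e q(4)[OF e(1)] by linarith
  obtain q' where q': "att (Suc i) e q'" using att_exists[OF lt] by blast
  have "q \<noteq> q'" using att_inside[OF q', of "Suc i" d] q(2,3) by auto
  then have "sg e q \<noteq> sg e q'" using gp_sg[OF gpP q(1)] q' unfolding att_def by blast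
  then have "sg e q < \<beta> (Suc i) e" using q(4)[OF e(1)] q' unfolding att_def by simp
  then show ?thesis using e q' by (meson not_le)
qed

definition chain :: "nat \<Rightarrow> (nat \<Rightarrow> point) \<Rightarrow> (nat \<Rightarrow> direction) \<Rightarrow> bool" where
  "chain L q d \<longleftrightarrow> (\<forall>i\<in>{1..L}. att i (d i) (q i)) \<and>
     (\<forall>i\<in>{2..L}. perp (d i) (d (i - 1)) \<and> \<beta> (i - 2) (d (i - 1)) < sg (d (i - 1)) (q i) \<and> sg (d (i - 1)) (q i) < \<beta> (i - 1) (d (i - 1)))"

lemma ex_chain: "att L g x \<Longrightarrow> \<exists>q d. chain L q d \<and> d L = g \<and> q L = x"
proof (induction L arbitrary: g x)
  case 0
  then show ?case by (simp add: att_def)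
next
  case (Suc L)
  show ?case
  proof (cases L)
    case 0
    then have "chain (Suc L) (\<lambda>_. x) (\<lambda>_. g)" using Suc.prems by (auto simp: chain_def)
    then show ?thesis by (intro exI[of _ "\<lambda>_. x"] exI[of _ "\<lambda>_. g"]) simp
  next
    case (Suc i)
    obtain e x' where e: "perp g e" "att L e x'" "\<beta> i e < sg e x" "sg e x < \<beta> L e" using att_pred[of i g x] Suc.prems Suc by auto
    obtain q d where qd: "chain L q d" "d L = e" "q L = x'" using Suc.IH[OF e(2)] by blast
    let ?q = "q(Suc L := x)" and ?d = "d(Suc L := g)"
    have "chain (Suc L) ?q ?d"
      unfolding chain_def
    proof (intro conjI ballI)
      fix l assume "l \<in> {1..Suc L}"
      then show "att l (?d l) (?q l)" using qd(1) Suc.prems unfolding chain_def by (cases "l = Suc L") auto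
    next
      fix l assume l: "l \<in> {2..Suc L}"
      have "perp (?d l) (?d (l - 1)) \<and> \<beta> (l - 2) (?d (l - 1)) < sg (?d (l - 1)) (?q l) \<and> sg (?d (l - 1)) (?q l) < \<beta> (l - 1) (?d (l - 1))"
      proof (cases "l = Suc L")
        case True
        have "l - 1 = L" "l - 2 = i" using True Suc by simp_all
        then show ?thesis using e qd(2) True by simp
      next
        case False
        then have "l \<in> {2..L}" "l \<noteq> Suc L" "l - 1 \<noteq> Suc L" using l by auto
        then show ?thesis using qd(1) unfolding chain_def by simp
      qed
      then show "perp (?d l) (?d (l - 1))" "\<beta> (l - 2) (?d (l - 1)) < sg (?d (l - 1)) (?q l)" "sg (?d (l - 1)) (?q l) < \<beta> (l - 1) (?d (l - 1))"
        by blast+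
    qed
    moreover have "?d (Suc L) = g" "?q (Suc L) = x" by simp_all
    ultimately show ?thesis by blast
  qed
qed

text \<open>The points up to stage \<open>k\<close> lie in layer \<open>k\<close>, while the next
  one exceeds that layer in its own direction and the layer before in the direction of its
  predecessor. Putting \<open>c0\<close> in front shifts the indices by one.\<close>

lemma chain_pins:
  assumes ch: "chain L q d"
  shows "pins (Suc L) (\<lambda>i. if i = 1 then c0 else q (i - 1)) (\<lambda>i. d (i - 1))" (is "pins _ ?p _")
proof -
  have A: "att i (d i) (q i)" if "1 \<le> i" "i \<le> L" for i using ch that unfolding chain_def by simp
  have C: "perp (d i) (d (i - 1))" "\<beta> (i - 2) (d (i - 1)) < sg (d (i - 1)) (q i)" "sg (d (i - 1)) (q i) < \<beta> (i - 1) (d (i - 1))"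
    if "2 \<le> i" "i \<le> L" for i using ch that unfolding chain_def by simp_all
  have ins: "sg g (?p j) \<le> \<beta> k g" if "1 \<le> j" "j \<le> Suc k" "j \<le> Suc L" for j k g
    using that att_inside[OF A[of "j - 1"], of k g] c0_\<beta>[of g k] by auto
  show ?thesis
    unfolding pins_def
  proof (intro ballI conjI)
    fix i assume "i \<in> {3..Suc L}"
    then have i: "2 \<le> i - 1" "i - 1 \<le> L" "i \<noteq> 1" "i - 1 \<noteq> 1" by auto
    note c = C[OF i(1,2)]
    have a: "sg (d (i - 1)) (q (i - 1)) = \<beta> (i - 1) (d (i - 1))" "\<beta> (i - 1 - 1) (d (i - 1)) < \<beta> (i - 1) (d (i - 1))"
      using A[of "i - 1"] i unfolding att_def by auto
    have a': "sg (d (i - 1 - 1)) (q (i - 1 - 1)) = \<beta> (i - 1 - 1) (d (i - 1 - 1))" using A[of "i - 1 - 1"] i unfolding att_def by auto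
    show "perp (d (i - 1)) (d (i - 1 - 1))" using c(1) .
    show "sg (d (i - 1)) (?p j) < sg (d (i - 1)) (?p i)" if "j \<in> {1..<i}" for j
    proof -
      have "sg (d (i - 1)) (?p j) \<le> \<beta> (i - 1 - 1) (d (i - 1))" by (rule ins) (use that i in auto)
      then show ?thesis using a i by simp
    qed
    show "sg (d (i - 1 - 1)) (?p j) < sg (d (i - 1 - 1)) (?p i)" if "j \<in> {1..<i - 1}" for j
    proof -
      have "sg (d (i - 1 - 1)) (?p j) \<le> \<beta> (i - 1 - 2) (d (i - 1 - 1))" by (rule ins) (use that i in auto)
      then show ?thesis using c(2) i by simp
    qed
    show "sg (d (i - 1 - 1)) (?p i) < sg (d (i - 1 - 1)) (?p (i - 1))" using c(3) a' i by simp
  qed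
qed

lemma chain_turning:
  assumes ch: "chain L q d" and L: "1 \<le> L" and T: "finite T" "\<And>l. l \<in> T \<Longrightarrow> 4 \<le> l \<and> l \<le> L \<and> d l = d (l - 2)" "N \<le> card T"
  shows "turning N P"
proof -
  let ?p = "\<lambda>i. if i = 1 then c0 else q (i - 1)" and ?D = "\<lambda>i. d (i - 1)"
  have A: "att i (d i) (q i)" if "1 \<le> i" "i \<le> L" for i using ch that unfolding chain_def by simp
  have P: "pins (Suc L) ?p ?D" using chain_pins[OF ch] .
  have "Suc ` T \<subseteq> turns (Suc L) ?p"
  proof
    fix i assume "i \<in> Suc ` T"
    then obtain l where l: "l \<in> T" "i = Suc l" by blast
    have "i - 2 - 1 = l - 2" using l by simp
    then show "i \<in> turns (Suc L) ?p" unfolding pins_turns[OF P] using T(2)[OF l(1)] l(2) by simp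
  qed
  moreover have "finite (turns (Suc L) ?p)" by (simp add: turns_def)
  ultimately have "card T \<le> card (turns (Suc L) ?p)" by (metis card_image card_mono inj_Suc)
  then have N: "N \<le> card (turns (Suc L) ?p)" using T(3) by simp
  have "sg (d 1) c0 < sg (d 1) (q 1)" using A[of 1] L c0_\<beta>[of "d 1" 0] unfolding att_def by (simp del: \<beta>.simps)
  then have "?p 1 \<noteq> ?p 2" by auto
  moreover have "?p ` {1..Suc L} \<subseteq> P" using A c0 unfolding att_def by auto
  ultimately show ?thesis unfolding turning_def using P N by blast
qed

end

section \<open>Layers of a wedge sawtooth alternation\<close>

fun spin :: "direction \<Rightarrow> direction \<Rightarrow> nat \<Rightarrow> direction" where
  "spin x y 0 = x" | "spin x y (Suc 0) = y" | "spin x y (Suc (Suc n)) = opp (spin x y n)"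

lemma spin_perp: "perp x y \<Longrightarrow> perp (spin x y n) (spin x y (Suc n))"
proof (induction n rule: induct_nat_012)
  case 1
  then show ?case by (simp add: perp_sym)
qed simp_all

text \<open>Among four consecutive steps a spiral passes the upper right corner, towards which the
  teeth extend; the two alternatives are the two senses of rotation.\<close>

lemma spin_corner:
  assumes "perp x y"
  shows "\<exists>r. 1 \<le> r \<and> r \<le> 4 \<and> (spin x y r = Right \<and> spin x y (r - 1) = Up \<or> spin x y r = Up \<and> spin x y (r - 1) = Right)"
proof -
  have s: "spin x y 1 = y" "spin x y 2 = opp x" "spin x y 3 = opp y" "spin x y 4 = x" for x y by (simp_all add: eval_nat_numeral)
  have "(y = Right \<and> x = Up \<or> y = Up \<and> x = Right) \<or> (opp x = Right \<and> y = Up \<or> opp x = Up \<and> y = Right) \<or>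
    (opp y = Right \<and> opp x = Up \<or> opp y = Up \<and> opp x = Right) \<or> (x = Right \<and> opp y = Up \<or> x = Up \<and> opp y = Right)"
    using assms by (cases x; cases y; simp add: perp_def)
  then show ?thesis
  proof (elim disjE)
    assume "x = Right \<and> opp y = Up"
    then show ?thesis by (intro exI[of _ 4]) (simp add: s)
  next
    assume "x = Up \<and> opp y = Right"
    then show ?thesis by (intro exI[of _ 4]) (simp add: s)
  next
    assume "opp y = Right \<and> opp x = Up"
    then show ?thesis by (intro exI[of _ 3]) (simp add: s)
  next
    assume "opp y = Up \<and> opp x = Right"
    then show ?thesis by (intro exI[of _ 3]) (simp add: s)
  next
    assume "opp x = Right \<and> y = Up"
    then show ?thesis by (intro exI[of _ 2]) (simp add: s)
  next
    assume "opp x = Up \<and> y = Right"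
    then show ?thesis by (intro exI[of _ 2]) (simp add: s)
  qed (intro exI[of _ 1], simp)+
qed

locale wedge_layers = layers P "a 0" "c 0" for P :: "point set" and a b c :: "nat \<Rightarrow> point" +
  fixes n N :: nat
  assumes saw: "saw n P a b c" and dec: "\<And>i j. i < j \<Longrightarrow> j < n \<Longrightarrow> snd (c j) < snd (c i)"
    and noS: "\<not> has_struct N P"
begin

lemma abc: "i < n \<Longrightarrow> a i \<in> P \<and> b i \<in> P \<and> c i \<in> P"
  and in_block: "i < n \<Longrightarrow> fst (a i) < fst (c i) \<and> fst (c i) < fst (b i) \<and> snd (b i) < snd (a i)"
  and blocks: "i < j \<Longrightarrow> j < n \<Longrightarrow> fst (b i) < fst (a j) \<and> snd (a i) < snd (b j)"
  and below: "i < n \<Longrightarrow> j < n \<Longrightarrow> snd (c i) < snd (b j)"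
  using saw unfolding saw_def by blast+

text \<open>Later teeth lie further right and further up and their slicing points further down.
  These are the three sides on which a box can touch them.\<close>

definition misses :: "nat \<Rightarrow> (direction \<Rightarrow> real) \<Rightarrow> bool" where
  "misses t f \<longleftrightarrow> f Right < fst (a t) \<and> f Up < snd (b t) \<and> f Down < - snd (c t)"

lemma misses_mono: "misses t f \<Longrightarrow> t \<le> t' \<Longrightarrow> t' < n \<Longrightarrow> misses t' f"
  using in_block[of t] blocks[of t t'] dec[of t t'] unfolding misses_def
  by (cases "t = t'") (auto simp: not_less intro: less_trans)

lemma misses_anti: "misses t (\<beta> j) \<Longrightarrow> i \<le> j \<Longrightarrow> misses t (\<beta> i)"
  using \<beta>_mono[of i j Right] \<beta>_mono[of i j Up] \<beta>_mono[of i j Down] unfolding misses_def by linarith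

text \<open>A point \<open>x\<close> on the left side of the box and \<open>c t\<close> form a copy
  of 21 that serves as a new first tooth, sliced by \<open>z\<close> from above or below; the teeth
  after \<open>t\<close> follow it.\<close>

lemma sawtooth_pair:
  assumes m: "misses t (\<beta> i)" and T: "t + N + 1 < n" and x: "x \<in> P" "sg Left x = \<beta> i Left" "\<forall>e. sg e x \<le> \<beta> i e"
    and z: "fst x < fst z" "fst z < fst (a t)"
  shows "xsaw (N + 1) ((\<lambda>j. a (t + j))(0 := x)) ((\<lambda>j. b (t + j))(0 := c t)) ((\<lambda>j. c (t + j))(0 := z))"
    and "ysaw (N + 1) ((\<lambda>j. a (t + j))(0 := x)) ((\<lambda>j. b (t + j))(0 := c t))"
proof -
  have x': "snd x < snd (b t)" "snd (c t) < snd x"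
    using x(3)[rule_format, of Up] x(3)[rule_format, of Down] m by (auto simp: misses_def)
  show "xsaw (N + 1) ((\<lambda>j. a (t + j))(0 := x)) ((\<lambda>j. b (t + j))(0 := c t)) ((\<lambda>j. c (t + j))(0 := z))"
    unfolding xsaw_def
  proof (intro conjI allI impI)
    fix i assume "i < N + 1"
    then have i: "t + i < n" "t < n" using T by auto
    show "fst (((\<lambda>j. a (t + j))(0 := x)) i) < fst (((\<lambda>j. c (t + j))(0 := z)) i)" "fst (((\<lambda>j. c (t + j))(0 := z)) i) < fst (((\<lambda>j. b (t + j))(0 := c t)) i)"
      using in_block[OF i(1)] in_block[OF i(2)] z by auto
  next
    fix i j assume ij: "i < j" "j < N + 1"
    then have j: "t + i < t + j" "t < t + j" "t + j < n" using T by auto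
    show "fst (((\<lambda>j. b (t + j))(0 := c t)) i) < fst (((\<lambda>j. a (t + j))(0 := x)) j)"
      using blocks[OF j(1,3)] blocks[OF j(2,3)] in_block[of t] ij j by auto
  qed
  show "ysaw (N + 1) ((\<lambda>j. a (t + j))(0 := x)) ((\<lambda>j. b (t + j))(0 := c t))"
    unfolding ysaw_def
  proof (intro conjI allI impI)
    fix i assume "i < N + 1"
    then have i: "t + i < n" using T by auto
    show "snd (((\<lambda>j. b (t + j))(0 := c t)) i) < snd (((\<lambda>j. a (t + j))(0 := x)) i)" using in_block[OF i] x' by auto
  next
    fix i j assume ij: "i < j" "j < N + 1"
    then have j: "t + i < t + j" "t < t + j" "t + j < n" using T by auto
    show "snd (((\<lambda>j. a (t + j))(0 := x)) i) < snd (((\<lambda>j. b (t + j))(0 := c t)) j)"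
      using blocks[OF j(1,3)] blocks[OF j(2,3)] in_block[of t] ij j x' by auto
  qed
qed

text \<open>A layer that reaches over many teeth yields a point slicing a wedge sawtooth alternation.\<close>

lemma misses_jump:
  assumes m: "misses t (\<beta> i)" and T: "t + N + 1 < n"
  shows "misses (t + N + 1) (\<beta> (Suc i))"
proof (rule ccontr)
  assume "\<not> misses (t + N + 1) (\<beta> (Suc i))"
  then consider (R) "fst (a (t + N + 1)) \<le> \<beta> (Suc i) Right" | (U) "snd (b (t + N + 1)) \<le> \<beta> (Suc i) Up" | (D) "- snd (c (t + N + 1)) \<le> \<beta> (Suc i) Down"
    unfolding misses_def by (auto simp del: \<beta>.simps)
  then have "has_struct N P"
  proof cases
    \<comment> \<open>\<open>z\<close> is to the right of the teeth, at a height between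
      \<open>c t\<close> and \<open>b t\<close>. In place of \<open>b t\<close> it produces type
      2.\<close>
    case R
    have "\<beta> i Right < \<beta> (Suc i) Right" using R m blocks[of t "t + N + 1"] in_block[of t] T unfolding misses_def by (auto simp del: \<beta>.simps)
    then obtain z where z: "z \<in> P" "sg Right z = \<beta> (Suc i) Right" "\<forall>e. perp Right e \<longrightarrow> sg e z \<le> \<beta> i e" using \<beta>_attained by blast
    have "snd z \<le> \<beta> i Up" "- snd z \<le> \<beta> i Down"
      using z(3)[rule_format, of Up] z(3)[rule_format, of Down] by (simp_all add: perp_def)
    then have z': "fst (a (t + N + 1)) \<le> fst z" "snd z < snd (b t)" "snd (c t) < snd z"
      using z(2) R m unfolding misses_def by (simp_all del: \<beta>.simps)
    let ?a = "\<lambda>j. a (t + j)" and ?b = "(\<lambda>j. b (t + j))(0 := z)" and ?c = "\<lambda>j. c (t + j)"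
    have tn: "t < n" using T by simp
    show ?thesis
    proof (rule sliced_wedge2_has_struct[where n = "N + 1" and a = ?a and b = ?b and c = ?c])
      show "?a j \<in> P \<and> ?b j \<in> P \<and> ?c j \<in> P" if "j < N + 1" for j using abc[of "t + j"] that T z(1) by auto
      show "ysaw (N + 1) ?a ?b"
        unfolding ysaw_def
      proof (intro conjI allI impI)
        fix i assume "i < N + 1"
        then show "snd (?b i) < snd (?a i)" using in_block[of "t + i"] T z'(2) by auto
      next
        fix i j assume "i < j" "j < N + 1"
        then show "snd (?a i) < snd (?b j)" using blocks[of "t + i" "t + j"] T by auto
      qed
      show "fst (?a i) < fst (?c i)" if "i < N + 1" for i using in_block[of "t + i"] that T by simp
      show "fst (?c i) < fst (?b i)" if "0 < i" "i < N + 1" for i using in_block[of "t + i"] that T by simp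
      show "fst (?b i) < fst (?a j)" if "0 < i" "i < j" "j < N + 1" for i j using blocks[of "t + i" "t + j"] that T by simp
      show "fst (?c 0) < fst (?a i)" if "0 < i" "i < N + 1" for i using blocks[of t "t + i"] in_block[OF tn] that T by simp
      show "fst (?b i) < fst (?b 0)" if "0 < i" "i < N + 1" for i using blocks[of "t + i" "t + N + 1"] z'(1) that T by simp
      show "fst (?c 0) < fst (?b 0)" using blocks[of t "t + N + 1"] in_block[OF tn] z'(1) T by simp
      show "snd (?c j) < snd (?b i)" if "i < N + 1" "j < N + 1" for i j
        using below[of "t + j" "t + i"] dec[of t "t + j"] z'(3) that T by (cases "j = 0") auto
      show "snd (?c j) < snd (?c i)" if "i < j" "j < N + 1" for i j using dec[of "t + i" "t + j"] that T by simp
    qed simp_all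
  next
    \<comment> \<open>\<open>z\<close> is above the teeth used and slices the tooth of
      \<open>x\<close> and \<open>c t\<close>, which produces type 3.\<close>
    case U
    obtain x where x: "x \<in> P" "sg Left x = \<beta> i Left" "\<forall>e. sg e x \<le> \<beta> i e" using \<beta>_extreme by blast
    have bt: "snd (b t) < snd (b (t + N + 1))" using blocks[of t "t + N + 1"] in_block[of t] T by simp
    have "\<beta> i Up < \<beta> (Suc i) Up" using U m bt unfolding misses_def by (auto simp del: \<beta>.simps)
    then obtain z where z: "z \<in> P" "sg Up z = \<beta> (Suc i) Up" "\<forall>e. perp Up e \<longrightarrow> sg e z \<le> \<beta> i e" using \<beta>_attained by blast
    have zx: "fst z \<le> \<beta> i Right" "- fst z \<le> \<beta> i Left"
      using z(3)[rule_format, of Right] z(3)[rule_format, of Left] by (simp_all add: perp_def)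
    have xU: "snd x \<le> \<beta> i Up" using x(3)[rule_format, of Up] by simp
    have zU: "snd (b (t + N + 1)) \<le> snd z" "snd x < snd z" using z(2) U m xU bt unfolding misses_def by (auto simp del: \<beta>.simps)
    then have "x \<noteq> z" by auto
    then have "fst x \<noteq> fst z" using gp_sg[OF gpP x(1) z(1), of Right] by auto
    then have xz: "fst x < fst z" "fst z < fst (a t)" using zx x(2) m unfolding misses_def by auto
    note saw2 = sawtooth_pair[OF m T x xz]
    show ?thesis
    proof (rule sliced_wedge3_has_struct[OF _ saw2])
      show "((\<lambda>j. a (t + j))(0 := x)) j \<in> P \<and> ((\<lambda>j. b (t + j))(0 := c t)) j \<in> P \<and> ((\<lambda>j. c (t + j))(0 := z)) j \<in> P" if "j < N + 1" for j
        using abc[of "t + j"] abc[of t] that T z(1) x(1) by auto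
      show "snd (((\<lambda>j. c (t + j))(0 := z)) j) < snd (((\<lambda>j. b (t + j))(0 := c t)) i)" if "0 < j" "i < N + 1" "j < N + 1" for i j
        using below[of "t + j" "t + i"] dec[of t "t + j"] that T by auto
      show "snd (((\<lambda>j. c (t + j))(0 := z)) j) < snd (((\<lambda>j. c (t + j))(0 := z)) i)" if "0 < i" "i < j" "j < N + 1" for i j
        using dec[of "t + i" "t + j"] that T by auto
      show "snd (((\<lambda>j. a (t + j))(0 := x)) i) < snd (((\<lambda>j. c (t + j))(0 := z)) 0)" if "i < N + 1" for i
        using blocks[of "t + i" "t + N + 1"] zU that T by auto
    qed simp_all
  next
    \<comment> \<open>\<open>z\<close> is below the slicing points used and slices the tooth of
      \<open>x\<close> and \<open>c t\<close>, which produces type 1.\<close>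
    case D
    obtain x where x: "x \<in> P" "sg Left x = \<beta> i Left" "\<forall>e. sg e x \<le> \<beta> i e" using \<beta>_extreme by blast
    have ct: "snd (c (t + N + 1)) < snd (c t)" using dec[of t "t + N + 1"] T by simp
    have "\<beta> i Down < \<beta> (Suc i) Down" using D m ct unfolding misses_def by (auto simp del: \<beta>.simps)
    then obtain z where z: "z \<in> P" "sg Down z = \<beta> (Suc i) Down" "\<forall>e. perp Down e \<longrightarrow> sg e z \<le> \<beta> i e" using \<beta>_attained by blast
    have zx: "fst z \<le> \<beta> i Right" "- fst z \<le> \<beta> i Left"
      using z(3)[rule_format, of Right] z(3)[rule_format, of Left] by (simp_all add: perp_def)
    have xD: "- snd x \<le> \<beta> i Down" using x(3)[rule_format, of Down] by simp
    have zD: "snd z \<le> snd (c (t + N + 1))" "snd z < snd x" using z(2) D m xD ct unfolding misses_def by (auto simp del: \<beta>.simps)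
    then have "x \<noteq> z" by auto
    then have "fst x \<noteq> fst z" using gp_sg[OF gpP x(1) z(1), of Right] by auto
    then have xz: "fst x < fst z" "fst z < fst (a t)" using zx x(2) m unfolding misses_def by auto
    note saw2 = sawtooth_pair[OF m T x xz]
    show ?thesis
    proof (rule sliced_wedge1_has_struct[OF _ saw2])
      show "((\<lambda>j. a (t + j))(0 := x)) j \<in> P \<and> ((\<lambda>j. b (t + j))(0 := c t)) j \<in> P \<and> ((\<lambda>j. c (t + j))(0 := z)) j \<in> P" if "j < N + 1" for j
        using abc[of "t + j"] abc[of t] that T z(1) x(1) by auto
      show "snd (((\<lambda>j. c (t + j))(0 := z)) j) < snd (((\<lambda>j. b (t + j))(0 := c t)) i)" if "i < N + 1" "j < N + 1" for i j
        using below[of "t + j" "t + i"] below[of "t + N + 1" "t + i"] dec[of t "t + j"] zD ct that T by auto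
      show "snd (((\<lambda>j. c (t + j))(0 := z)) j) < snd (((\<lambda>j. c (t + j))(0 := z)) i)" if "0 < i" "i < j" "j < N + 1" for i j
        using dec[of "t + i" "t + j"] that T by auto
      show "snd (((\<lambda>j. c (t + j))(0 := z)) 0) < snd (((\<lambda>j. c (t + j))(0 := z)) j)" if "0 < j" "j < N + 1" for j
        using dec[of "t + j" "t + N + 1"] zD that T by auto
    qed simp_all
  qed
  then show False using noS by simp
qed

section \<open>The first layer that touches a tooth\<close>

definition \<iota> :: "nat \<Rightarrow> nat" where
  "\<iota> t = (LEAST i. \<not> misses t (\<beta> i))"

lemma \<iota>_hits: "t < n \<Longrightarrow> \<not> misses t (\<beta> (\<iota> t))"
proof -
  assume "t < n"
  then have "a t \<in> P" using abc by blast
  then obtain i where "fst (a t) \<le> \<beta> i Right" using \<beta>_exhausts[of "a t" Right] by auto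
  then have "\<not> misses t (\<beta> i)" unfolding misses_def by linarith
  then show ?thesis unfolding \<iota>_def by (rule LeastI)
qed

lemma \<iota>_misses: "i < \<iota> t \<Longrightarrow> misses t (\<beta> i)"
  unfolding \<iota>_def using not_less_Least by blast

lemma \<iota>_le: "\<not> misses t (\<beta> i) \<Longrightarrow> \<iota> t \<le> i"
  unfolding \<iota>_def by (rule Least_le)

lemma \<iota>_mono: "t \<le> t' \<Longrightarrow> t' < n \<Longrightarrow> \<iota> t \<le> \<iota> t'"
  using \<iota>_le \<iota>_hits misses_mono by blast

lemma \<iota>_pos: "1 \<le> t \<Longrightarrow> t < n \<Longrightarrow> 1 \<le> \<iota> t"
proof -
  assume t: "1 \<le> t" "t < n"
  then have "fst (a 0) < fst (c 0)" "fst (c 0) < fst (b 0)" "snd (b 0) < snd (a 0)" "fst (b 0) < fst (a t)" "snd (a 0) < snd (b t)"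
     "snd (c 0) < snd (b 0)" "snd (c t) < snd (c 0)"
    using in_block[of 0] blocks[of 0 t] below[of 0 0] dec[of 0 t] by auto
  then have "misses t (\<beta> 0)" unfolding misses_def by simp
  then have "\<iota> t \<noteq> 0" using \<iota>_hits[OF t(2)] by metis
  then show ?thesis by simp
qed

text \<open>By \<open>misses_jump\<close> teeth that are \<open>N + 1\<close> apart are not first
  touched by the same layer.\<close>

lemma \<iota>_jump: "1 \<le> t \<Longrightarrow> t + k * (N + 1) < n \<Longrightarrow> \<iota> t + k \<le> \<iota> (t + k * (N + 1))"
proof (induction k)
  case (Suc k)
  let ?t = "t + k * (N + 1)"
  have e: "t + Suc k * (N + 1) = ?t + N + 1" by simp
  have tn: "?t < n" "?t + N + 1 < n" "1 \<le> ?t" using Suc.prems unfolding e by simp_all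
  have "\<iota> ?t - 1 < \<iota> ?t" using \<iota>_pos[OF tn(3,1)] by simp
  then have "misses (?t + N + 1) (\<beta> (Suc (\<iota> ?t - 1)))" by (intro misses_jump \<iota>_misses tn(2))
  moreover have "Suc (\<iota> ?t - 1) = \<iota> ?t" using \<iota>_pos[OF tn(3,1)] by simp
  ultimately have "misses (?t + N + 1) (\<beta> (\<iota> ?t))" by simp
  then have "\<iota> ?t < \<iota> (?t + N + 1)" using misses_anti \<iota>_hits[OF tn(2)] by (meson not_le)
  then show ?case unfolding e using Suc.IH Suc.prems(1) tn(1) by simp
qed simp

lemma \<beta>_arm:
  assumes "z \<in> P" "perp d e" "sg d (c 0) \<le> sg d z" "sg d z \<le> \<beta> s d"
  shows "sg e z \<le> \<beta> (Suc s) e"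
proof (rule \<beta>_layer[OF assms(1)])
  fix g assume "perp e g"
  then have "g = d \<or> g = opp d" using perp_perp[OF assms(2)] by blast
  then show "sg g z \<le> \<beta> s g"
  proof
    assume "g = opp d"
    then have "sg g z \<le> sg g (c 0)" using assms(3) by simp
    then show ?thesis using c0_\<beta>[of g s] by simp
  qed (use assms(4) in simp)
qed

text \<open>A layer touching tooth \<open>T + 1\<close> has passed tooth \<open>T\<close> on the
  right or above, or \<open>c T\<close> below. One strip leads from right to up and from up to
  right; from below it takes two, the first of them to the abscissa of \<open>c T\<close>. Hence the
  summand 2.\<close>

lemma \<iota>_reach:
  assumes T: "1 \<le> T" "T + 1 < n"
  shows "fst (a T) \<le> \<beta> (\<iota> (T + 1) + 2) Right" "snd (b T) \<le> \<beta> (\<iota> (T + 1) + 2) Up"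
proof -
  let ?l = "\<iota> (T + 1)"
  have up: "\<beta> ?l g \<le> \<beta> (?l + 2) g" "\<beta> (Suc ?l) g \<le> \<beta> (?l + 2) g" "\<beta> (Suc (Suc ?l)) g \<le> \<beta> (?l + 2) g" for g by (rule \<beta>_mono, simp)+
  have B: "fst (b T) < fst (a (T + 1))" "snd (a T) < snd (b (T + 1))" using blocks[of T "T + 1"] T by simp_all
  have I: "fst (a T) < fst (c T)" "fst (c T) < fst (b T)" "snd (b T) < snd (a T)" using in_block[of T] T by simp_all
  have O: "fst (c 0) < fst (a T)" "snd (c 0) < snd (b T)" "snd (c T) < snd (c 0)" "snd (c (T + 1)) < snd (c T)"
    using blocks[of 0 T] in_block[of 0] below[of 0 T] dec[of 0 T] dec[of T "T + 1"] T by simp_all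
  have TP: "a T \<in> P" "b T \<in> P" "c T \<in> P" using abc[of T] T by simp_all
  from \<iota>_hits[OF T(2)] consider (R) "fst (a (T + 1)) \<le> \<beta> ?l Right" | (U) "snd (b (T + 1)) \<le> \<beta> ?l Up" | (D) "- snd (c (T + 1)) \<le> \<beta> ?l Down"
    unfolding misses_def by linarith
  then have "fst (a T) \<le> \<beta> (?l + 2) Right \<and> snd (b T) \<le> \<beta> (?l + 2) Up"
  proof cases
    case R
    have "snd (b T) \<le> \<beta> (Suc ?l) Up" using \<beta>_arm[OF TP(2), of Right Up ?l] R O B I by (simp add: perp_def del: \<beta>.simps)
    then show ?thesis using up[of Right] up[of Up] R B I by linarith
  next
    case U
    have "fst (a T) \<le> \<beta> (Suc ?l) Right" using \<beta>_arm[OF TP(1), of Up Right ?l] U O B I by (simp add: perp_def del: \<beta>.simps)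
    then show ?thesis using up[of Right] up[of Up] U B I by linarith
  next
    case D
    have r: "fst (c T) \<le> \<beta> (Suc ?l) Right" using \<beta>_arm[OF TP(3), of Down Right ?l] D O by (simp add: perp_def del: \<beta>.simps)
    have "snd (a T) \<le> \<beta> (Suc (Suc ?l)) Up" using \<beta>_arm[OF TP(1), of Right Up "Suc ?l"] r O I by (simp add: perp_def del: \<beta>.simps)
    then show ?thesis using up[of Right] up[of Up] r I by linarith
  qed
  then show "fst (a T) \<le> \<beta> (\<iota> (T + 1) + 2) Right" "snd (b T) \<le> \<beta> (\<iota> (T + 1) + 2) Up" by simp_all
qed

end

section \<open>The characterisation\<close>

lemma bad_structure_mono:
  assumes "bad_structure L A" "N \<le> L"
  shows "bad_structure N A"
proof -
  have "N \<le> n" if "L \<le> n" for n using assms(2) that by simp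
  then show ?thesis using assms(1) unfolding bad_structure_def by blast
qed

lemma has_struct_mono: "has_struct L P \<Longrightarrow> N \<le> L \<Longrightarrow> has_struct N P"
  unfolding has_struct_def using bad_structure_mono by blast

context wedge_layers
begin

text \<open>On a stretch of the chain without turns the pins form a layered spiral.\<close>

lemma spiral_segment:
  assumes ch: "chain L q d" and e: "1 \<le> e" "e + m \<le> L" and m: "4 \<le> m"
    and free: "\<And>l. e + 3 \<le> l \<Longrightarrow> l \<le> e + m \<Longrightarrow> d l = opp (d (l - 2))" 
    and t: "1 \<le> t" "\<iota> t + 4 = e" and t': "t' < n" "\<iota> t' = e + m" "t + (40 * N + 100) * (N + 1) \<le> t'"
  shows "\<exists>A\<subseteq>P. spiral_with_extensions N A"
proof -
  \<comment> \<open>The directions are continued periodically over all indices. The two starting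
    values make \<open>dir 1\<close> and \<open>dir 2\<close> the directions of the chain at
    \<open>e + 1\<close> and \<open>e + 2\<close>.\<close>
  define dir where "dir = spin (opp (d (e + 2))) (d (e + 1))"
  define p where "p l = (if l = 1 then c 0 else q (e + l))" for l
  define B where "B s = \<beta> (e + s)" for s
  have A: "att i (d i) (q i)" if "1 \<le> i" "i \<le> L" for i using ch that unfolding chain_def by simp
  have C: "perp (d i) (d (i - 1))" "\<beta> (i - 2) (d (i - 1)) < sg (d (i - 1)) (q i)" "sg (d (i - 1)) (q i) < \<beta> (i - 1) (d (i - 1))"
    if "2 \<le> i" "i \<le> L" for i using ch that unfolding chain_def by simp_all
  have pd: "perp (opp (d (e + 2))) (d (e + 1))" 
  proof -
    have "perp (d (e + 2)) (d (e + 2 - 1))" by (rule C(1)) (use e m in simp_all)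
    moreover have "e + 2 - 1 = e + 1" by simp
    ultimately show ?thesis by (metis perp_opp(1))
  qed
  have dd: "1 \<le> s \<Longrightarrow> s \<le> m \<Longrightarrow> d (e + s) = dir s" for s
  proof (induction s rule: less_induct)
    case (less s)
    show ?case
    proof (cases "s \<le> 2")
      case True
      then have "s = 1 \<or> s = 2" using less.prems by auto
      then show ?thesis by (auto simp: dir_def eval_nat_numeral)
    next
      case False
      then obtain k where k: "s = Suc (Suc k)" "1 \<le> k" by (metis Suc_1 Suc_le_D less_Suc_eq_le linorder_not_less not_less_eq_eq One_nat_def)
      have "d (e + s) = opp (d (e + s - 2))" by (rule free) (use less.prems k in simp_all)
      moreover have "e + s - 2 = e + k" using k by simp
      ultimately show ?thesis using less.IH[of k] k less.prems(2) by (simp add: dir_def)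
    qed
  qed
  interpret LS: layered_spiral P "c 0" p dir B m
  proof
    show "gp P" by (rule gpP)
    show "c 0 \<in> P" by (rule c0)
    show "p 1 = c 0" by (simp add: p_def)
    show "B s d \<le> B t d" if "s \<le> t" for s t d unfolding B_def by (rule \<beta>_mono) (use that in simp)
    show "sg d (c 0) \<le> B 0 d" for d unfolding B_def by (rule c0_\<beta>)
    show "sg d z \<le> B (Suc s) d" if "z \<in> P" "\<And>e. perp d e \<Longrightarrow> sg e z \<le> B s e" for s d z
      using \<beta>_layer[of z d "e + s"] that unfolding B_def by (simp del: \<beta>.simps)
    show "dir (s + 2) = opp (dir s)" for s unfolding dir_def by (simp add: eval_nat_numeral)
    show "perp (dir s) (dir (s + 1))" for s unfolding dir_def using spin_perp[OF pd, of s] by simp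
    fix s assume s: "2 \<le> s" "s \<le> m"
    have es: "1 \<le> e + s" "2 \<le> e + s" "e + s \<le> L" "p s = q (e + s)" "d (e + s) = dir s" "e + s - 1 = e + (s - 1)" "e + s - 2 = e + (s - 2)"
      "d (e + s - 1) = dir (s - 1)"
      using s e m dd[of s] dd[of "s - 1"] by (auto simp: p_def)
    note a = A[OF es(1,3)] and c = C[OF es(2,3)]
    show "p s \<in> P" using a unfolding es(4) att_def by blast
    show "sg (dir s) (p s) = B s (dir s) \<and> B (s - 1) (dir s) < B s (dir s)"
      using a unfolding es(4) att_def es(5,6) B_def by blast
    show "B (s - 2) (dir (s - 1)) < sg (dir (s - 1)) (p s) \<and> sg (dir (s - 1)) (p s) < B (s - 1) (dir (s - 1))"
      using c(2,3) unfolding es(4,8) unfolding es(6,7) B_def by blast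
  qed
  obtain r where r: "1 \<le> r" "r \<le> 4" "dir r = Right \<and> dir (r - 1) = Up \<or> dir r = Up \<and> dir (r - 1) = Right"
    using spin_corner[OF pd] unfolding dir_def by blast
  have site: "\<exists>i. LS.extendable i \<and> \<iota> T \<le> e + i \<and> e + i \<le> \<iota> (T + 1) + 5"
    if T: "t + 31 * (N + 1) \<le> T" "T + 1 + 25 * (N + 1) \<le> t'" for T
  proof -
    have T1: "1 \<le> T" "T < n" "T + 1 < n" "t + 31 * (N + 1) < n" "T + 1 + 25 * (N + 1) < n" using T t t' by auto
    have lo: "\<iota> t + 31 \<le> \<iota> T" using \<iota>_jump[OF t(1) T1(4)] \<iota>_mono[OF T(1) T1(2)] by linarith
    have hi: "\<iota> (T + 1) + 25 \<le> e + m" using \<iota>_jump[OF _ T1(5)] \<iota>_mono[OF T(2) t'(1)] t'(2) by simp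
    have TT: "\<iota> T \<le> \<iota> (T + 1)" by (rule \<iota>_mono) (use T1 in simp_all)
    \<comment> \<open>If the spiral rotates the other way, the two axes and hence the two points of
      the tooth exchange roles.\<close>
    define u where "u = (if dir r = Right then a T else b T)"
    define v where "v = (if dir r = Right then b T else a T)"
    have uv: "sg (dir r) u < sg (dir r) v" "sg (dir (r - 1)) v < sg (dir (r - 1)) u" "sg (dir (r - 1)) (c 0) < sg (dir (r - 1)) v"
      "u \<in> P" "v \<in> P" "c T \<in> P"
      using r(3) in_block[OF T1(2)] blocks[of 0 T] in_block[of 0] below[of 0 T] abc[OF T1(2)] T1(1,2) unfolding u_def v_def by auto
    have S: "sg (dir r) u < sg (dir r) (c T) \<and> sg (dir r) (c T) < sg (dir r) v \<and> sg (dir (r - 1)) (c T) < sg (dir (r - 1)) (c 0) \<or>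
        sg (dir (r - 1)) v < sg (dir (r - 1)) (c T) \<and> sg (dir (r - 1)) (c T) < sg (dir (r - 1)) u \<and> sg (dir r) (c T) < sg (dir r) (c 0)"
      using r(3) in_block[OF T1(2)] dec[of 0 T] T1(1,2) unfolding u_def v_def by auto
    have out: "\<beta> l (dir r) < sg (dir r) u" if "misses T (\<beta> l)" for l
      using that r(3) unfolding misses_def u_def by auto
    have inn: "sg (dir r) u \<le> \<beta> l (dir r)" if "\<iota> (T + 1) + 2 \<le> l" for l
      using \<iota>_reach[OF T1(1,3)] \<beta>_mono[OF that, of "dir r"] r(3) unfolding u_def by auto
    \<comment> \<open>The last corner pin of this direction up to layer
      \<open>\<iota> (T + 1) + 5\<close>. Such pins come every four layers, so it belongs to layer
      \<open>\<iota> (T + 1) + 2\<close> or a later one, which covers \<open>u\<close>.\<close>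
    define k1 where "k1 = (\<iota> (T + 1) + 5 - (e + r)) div 4"
    have k1: "e + (r + 4 * k1) \<le> \<iota> (T + 1) + 5" "\<iota> (T + 1) + 2 \<le> e + (r + 4 * k1)"
    proof -
      have "e + r \<le> \<iota> (T + 1) + 5" using lo TT t(2) r(2) by linarith
      moreover have "4 * k1 \<le> \<iota> (T + 1) + 5 - (e + r)" "\<iota> (T + 1) + 5 - (e + r) \<le> 4 * k1 + 3" unfolding k1_def by presburger+
      ultimately show "e + (r + 4 * k1) \<le> \<iota> (T + 1) + 5" "\<iota> (T + 1) + 2 \<le> e + (r + 4 * k1)" by linarith+
    qed
    \<comment> \<open>The first revolution that reaches \<open>u\<close>; the previous one leaves
      \<open>u\<close> outside, as an extendable site requires.\<close>
    define k where "k = (LEAST k. sg (dir r) u \<le> B (r + 4 * k) (dir r))"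
    have ex: "sg (dir r) u \<le> B (r + 4 * k1) (dir r)" unfolding B_def using inn k1(2) by blast
    have kk: "sg (dir r) u \<le> B (r + 4 * k) (dir r)" unfolding k_def by (rule LeastI[where P = "\<lambda>k. sg (dir r) u \<le> B (r + 4 * k) (dir r)", OF ex])
    have kmin: "B (r + 4 * j) (dir r) < sg (dir r) u" if "j < k" for j using not_less_Least[where P = "\<lambda>k. sg (dir r) u \<le> B (r + 4 * k) (dir r)", OF that[unfolded k_def]] by simp
    have "k \<le> k1" unfolding k_def by (rule Least_le[where P = "\<lambda>k. sg (dir r) u \<le> B (r + 4 * k) (dir r)", OF ex])
    then have up: "e + (r + 4 * k) \<le> \<iota> (T + 1) + 5" using k1(1) by linarith
    have dn: "\<iota> T \<le> e + (r + 4 * k)"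
    proof (rule ccontr)
      assume "\<not> \<iota> T \<le> e + (r + 4 * k)"
      then have "B (r + 4 * k) (dir r) < sg (dir r) u" unfolding B_def by (intro out \<iota>_misses) simp
      then show False using kk by simp
    qed
    have k0: "20 \<le> r + 4 * k" "1 \<le> k" using dn lo t(2) r(2) by linarith+
    have di: "dir (r + 4 * k) = dir r" "dir (r + 4 * k - 1) = dir (r - 1)"
    proof -
      show "dir (r + 4 * k) = dir r" by (rule LS.dir4k)
      have "r + 4 * k - 1 = (r - 1) + 4 * k" using r(1) by simp
      then show "dir (r + 4 * k - 1) = dir (r - 1)" using LS.dir4k[of "r - 1" k] by simp
    qed
    have "LS.extendable (r + 4 * k)"
    proof (rule LS.extendable_site[of _ u v "c T"], unfold di)
      show "20 \<le> r + 4 * k" by (rule k0(1))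
      show "r + 4 * k + 20 \<le> m" using up hi by linarith
      have "r + 4 * k - 4 = r + 4 * (k - 1)" using k0(2) by (simp add: algebra_simps)
      then show "B (r + 4 * k - 4) (dir r) < sg (dir r) u" using kmin[of "k - 1"] k0(2) by simp
      show "sg (dir r) u \<le> B (r + 4 * k) (dir r)" by (rule kk)
    qed (fact uv S)+
    then show ?thesis using dn up by blast
  qed
  \<comment> \<open>Each step of \<open>N + 1\<close> teeth is worth at least one layer. The 31
    steps at the start and at least 25 at the end keep sites 20 pins away from both ends; the 40
    steps in between keep them 30 pins apart.\<close>
  define T where "T j = t + (31 + 40 * j) * (N + 1)" for j
  have T: "t + 31 * (N + 1) \<le> T j" "T j + 1 + 25 * (N + 1) \<le> t'" if "j < N" for j
  proof -
    show "t + 31 * (N + 1) \<le> T j" unfolding T_def by (simp add: algebra_simps)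
    have "T j + 1 + 25 * (N + 1) \<le> t + (31 + 40 * j + 26) * (N + 1)" unfolding T_def by (simp add: algebra_simps)
    also have "\<dots> \<le> t + (40 * N + 100) * (N + 1)" by (intro add_left_mono mult_right_mono) (use that in simp_all)
    finally show "T j + 1 + 25 * (N + 1) \<le> t'" using t'(3) by linarith
  qed
  have "\<forall>j. \<exists>i. j < N \<longrightarrow> LS.extendable i \<and> \<iota> (T j) \<le> e + i \<and> e + i \<le> \<iota> (T j + 1) + 5"
    using site[OF T] by blast
  then obtain i where i: "\<And>j. j < N \<Longrightarrow> LS.extendable (i j) \<and> \<iota> (T j) \<le> e + i j \<and> e + i j \<le> \<iota> (T j + 1) + 5" by metis
  show ?thesis
  proof (rule LS.spiral_sites)
    show "2 \<le> m" using m by simp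
    show "LS.extendable (i j)" if "j < N" for j using i[OF that] by blast
    show "20 \<le> i j \<and> i j + 20 \<le> m" if j: "j < N" for j
    proof
      have n: "t + 31 * (N + 1) < n" "T j < n" "T j + 1 + 25 * (N + 1) < n" using T[OF j] t'(1) by linarith+
      have "\<iota> t + 31 \<le> \<iota> (T j)" using \<iota>_jump[OF t(1) n(1)] \<iota>_mono[OF T(1)[OF j] n(2)] by linarith
      then show "20 \<le> i j" using i[OF j] t(2) by linarith
      have "\<iota> (T j + 1) + 25 \<le> e + m" using \<iota>_jump[OF _ n(3)] \<iota>_mono[OF T(2)[OF j] t'(1)] t'(2) by simp
      then show "i j + 20 \<le> m" using i[OF j] by linarith
    qed
    show "i j + 30 \<le> i j'" if j: "j < j'" "j' < N" for j j'
    proof -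
      have "T j + 1 + 35 * (N + 1) \<le> t + (31 + 40 * j + 36) * (N + 1)" unfolding T_def by (simp add: algebra_simps)
      also have "\<dots> \<le> T j'" unfolding T_def by (intro add_left_mono mult_right_mono) (use j in simp_all)
      finally have le: "T j + 1 + 35 * (N + 1) \<le> T j'" .
      have n: "T j' < n" using T(2)[OF j(2)] t'(1) by linarith
      have n': "T j + 1 + 35 * (N + 1) < n" using le n by linarith
      have "\<iota> (T j + 1) + 35 \<le> \<iota> (T j')" using \<iota>_jump[OF _ n'] \<iota>_mono[OF le n] by simp
      then show ?thesis using i[of j] i[of j'] j by simp
    qed
  qed
qed

text \<open>The teeth are cut into \<open>N\<close> stretches. If the layers of every stretch
  contain a turn of the chain there are \<open>N\<close> turns; otherwise some stretch is free of
  turns and long enough for \<open>N\<close> extensions.\<close>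

lemma too_long: "N * ((40 * N + 100) * (N + 1)) + 2 \<le> n \<Longrightarrow> False"
proof -
  assume n: "N * ((40 * N + 100) * (N + 1)) + 2 \<le> n"
  define M where "M = (40 * N + 100) * (N + 1)"
  define t where "t s = 1 + s * M" for s
  have tn: "t s < n" "1 \<le> t s" if "s \<le> N" for s
  proof -
    have "s * M \<le> N * M" using that by (rule mult_right_mono) simp
    then show "t s < n" using n unfolding t_def M_def by linarith
  qed (simp add: t_def)
  have tm: "t s \<le> t s'" if "s \<le> s'" for s s' using that unfolding t_def by (simp add: mult_right_mono)
  define L where "L = \<iota> (t N)"
  have L: "1 \<le> L" unfolding L_def by (rule \<iota>_pos[OF tn(2,1)]) simp_all
  have m0: "misses (t N) (\<beta> (L - 1))" using \<iota>_misses[of "L - 1" "t N"] L unfolding L_def by simp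
  have h0: "\<not> misses (t N) (\<beta> L)" unfolding L_def by (rule \<iota>_hits[OF tn(1)]) simp
  \<comment> \<open>Layer \<open>L\<close> is the first to touch tooth \<open>t N\<close>, so it
    differs from the one before. A point responsible for its growth is where the chain is traced
    back from.\<close>
  have "\<exists>g. \<beta> (L - 1) g < \<beta> L g"
  proof (rule ccontr)
    assume "\<not> (\<exists>g. \<beta> (L - 1) g < \<beta> L g)"
    then have "\<beta> L g \<le> \<beta> (L - 1) g" for g by (meson not_le)
    then have "misses (t N) (\<beta> L)" using m0 unfolding misses_def by (meson le_less_trans)
    then show False using h0 by simp
  qed
  then obtain g where g: "\<beta> (L - 1) g < \<beta> L g" by blast
  have SL: "Suc (L - 1) = L" using L by simp
  obtain x where "att L g x" using att_exists[of "L - 1" g] g SL by auto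
  then obtain q d where ch: "chain L q d" using ex_chain by blast
  have Ls: "\<iota> (t s) \<le> L" if "s \<le> N" for s unfolding L_def by (rule \<iota>_mono[OF tm[OF that] tn(1)]) simp
  have C: "perp (d i) (d (i - 1))" if "2 \<le> i" "i \<le> L" for i using ch that unfolding chain_def by simp
  show False
  proof (cases "\<exists>s<N. \<forall>l. \<iota> (t s) + 4 \<le> l \<longrightarrow> l \<le> \<iota> (t (Suc s)) \<longrightarrow> d l \<noteq> d (l - 2)")
    case True
    then obtain s where s: "s < N" and fr: "\<And>l. \<iota> (t s) + 4 \<le> l \<Longrightarrow> l \<le> \<iota> (t (Suc s)) \<Longrightarrow> d l \<noteq> d (l - 2)" by blast
    let ?e = "\<iota> (t s) + 4" and ?m = "\<iota> (t (Suc s)) - (\<iota> (t s) + 4)"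
    have ss: "s \<le> N" "Suc s \<le> N" using s by simp_all
    have tM: "t s + M = t (Suc s)" unfolding t_def by simp
    have "t s + (40 * N + 100) * (N + 1) < n" using tn(1)[OF ss(2)] tM unfolding M_def by simp
    from \<iota>_jump[OF tn(2)[OF ss(1)] this] have j: "\<iota> (t s) + (40 * N + 100) \<le> \<iota> (t (Suc s))" using tM unfolding M_def by simp
    then have em: "?e + ?m = \<iota> (t (Suc s))" "4 \<le> ?m" by linarith+
    have "\<exists>A\<subseteq>P. spiral_with_extensions N A"
    proof (rule spiral_segment[OF ch])
      show "1 \<le> ?e" "4 \<le> ?m" using em by simp_all
      show "?e + ?m \<le> L" unfolding em(1) by (rule Ls[OF ss(2)])
      show "1 \<le> t s" "\<iota> (t s) + 4 = ?e" "t (Suc s) < n" "\<iota> (t (Suc s)) = ?e + ?m" "t s + (40 * N + 100) * (N + 1) \<le> t (Suc s)"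
        using tn[OF ss(1)] tn[OF ss(2)] em tM unfolding M_def by simp_all
      fix l assume l: "?e + 3 \<le> l" "l \<le> ?e + ?m"
      have lL: "l \<le> L" using l(2) Ls[OF ss(2)] unfolding em(1) by simp
      have "perp (d l) (d (l - 1))" "perp (d (l - 1)) (d (l - 1 - 1))" using C[of l] C[of "l - 1"] l(1) lL by auto
      moreover have "l - 1 - 1 = l - 2" by simp
      ultimately have "d (l - 2) = d l \<or> d (l - 2) = opp (d l)" using perp_perp by metis
      then show "d l = opp (d (l - 2))" using fr[of l] l unfolding em(1) by auto
    qed
    then show False using spiral_has_struct noS by blast
  next
    case False
    then have "\<forall>s. \<exists>l. s < N \<longrightarrow> \<iota> (t s) + 4 \<le> l \<and> l \<le> \<iota> (t (Suc s)) \<and> d l = d (l - 2)" by blast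
    then obtain \<tau> where \<tau>: "\<And>s. s < N \<Longrightarrow> \<iota> (t s) + 4 \<le> \<tau> s \<and> \<tau> s \<le> \<iota> (t (Suc s)) \<and> d (\<tau> s) = d (\<tau> s - 2)" by metis
    have lt: "\<tau> s < \<tau> s'" if "s < s'" "s' < N" for s s'
    proof -
      have "\<iota> (t (Suc s)) \<le> \<iota> (t s')" by (rule \<iota>_mono[OF tm tn(1)]) (use that in simp_all)
      then show ?thesis using \<tau>[of s] \<tau>[of s'] that by simp
    qed
    have "inj_on \<tau> {..<N}"
    proof (rule inj_onI)
      fix s s' assume "s \<in> {..<N}" "s' \<in> {..<N}" "\<tau> s = \<tau> s'"
      then show "s = s'" using lt[of s s'] lt[of s' s] by (cases s s' rule: linorder_cases) auto
    qed
    then have "card (\<tau> ` {..<N}) = N" by (simp add: card_image)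
    moreover have "4 \<le> l \<and> l \<le> L \<and> d l = d (l - 2)" if lT: "l \<in> \<tau> ` {..<N}" for l
    proof -
      obtain s where s: "s < N" "l = \<tau> s" using lT by blast
      show ?thesis using \<tau>[OF s(1)] Ls[of "Suc s"] s by simp
    qed
    ultimately have "turning N P" by (intro chain_turning[OF ch L, of "\<tau> ` {..<N}"]) simp_all
    then show False using turning_has_struct noS by blast
  qed
qed

end

lemma wedge_has_struct:
  assumes P: "simple_set P" and w: "has_wedge n P" and n: "N * ((40 * N + 100) * (N + 1)) + 2 \<le> n"
  shows "has_struct N P"
proof (rule ccontr)
  assume noS: "\<not> has_struct N P"
  obtain a b c where s: "saw n P a b c" and d: "\<And>i j. i < j \<Longrightarrow> j < n \<Longrightarrow> snd (c j) < snd (c i)"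
    using w unfolding has_wedge_def by blast
  have 0: "0 < n" using n by simp
  have "a 0 \<in> P" "c 0 \<in> P" "fst (a 0) < fst (c 0)" using s 0 unfolding saw_def by blast+
  then interpret wedge_layers P a b c n N
    by unfold_locales (use P s d noS in auto)
  show False using too_long[OF n] .
qed

lemma sum21_has_struct: "\<exists>n. \<forall>P. simple_set P \<longrightarrow> sum21 n P \<longrightarrow> has_struct N P"
proof -
  \<comment> \<open>The product plus 2 is the length needed for a wedge; the last summand makes
    \<open>N \<le> L\<close> evident for the parallel case.\<close>
  define L where "L = N * ((40 * N + 100) * (N + 1)) + 2 + N"
  obtain n where n: "\<And>P. simple_set P \<Longrightarrow> sum21 n P \<Longrightarrow> \<exists>f\<in>square_symmetries. turning N (f ` P) \<or> has_parallel L (f ` P) \<or> has_wedge L (f ` P)"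
    using sum21_outcomes[of N L] by blast
  have "has_struct N P" if P: "simple_set P" "sum21 n P" for P
  proof -
    obtain f where f: "f \<in> square_symmetries" "turning N (f ` P) \<or> has_parallel L (f ` P) \<or> has_wedge L (f ` P)" using n[OF P] by blast
    have "simple_set (f ` P)" using sim_symmetry[OF f(1), of P] sim_simple_set P(1) by blast
    then have "has_struct N (f ` P)"
      using f(2) turning_has_struct wedge_has_struct[of "f ` P" L N] parallel_has_struct[of L "f ` P"] has_struct_mono[of L "f ` P" N]
      unfolding L_def by auto
    then show ?thesis by (rule has_struct_symmetry[OF f(1)])
  qed
  then show ?thesis by blast
qed

lemma not_scattered_of_no_struct:
  "\<exists>n. \<forall>P. simple_set P \<longrightarrow> \<not> has_struct N P \<longrightarrow> \<not> scattered (Suc n) P"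
proof -
  obtain m where m: "\<And>P. simple_set P \<Longrightarrow> sum21 m P \<Longrightarrow> has_struct N P" using sum21_has_struct by blast
  obtain n where n: "\<And>A. scattered n A \<Longrightarrow> sum21 m A \<or> sum21 m (tf Right Down ` A)" using sum21_of_scattered by blast
  have "has_struct N P" if P: "simple_set P" "scattered (Suc n) P" for P
  proof -
    have "perp Right Down" by (simp add: perp_def)
    then have f: "tf Right Down \<in> square_symmetries" unfolding square_symmetries_iff by blast
    have "scattered n P" using P(2) unfolding scattered_def by (meson less_SucI)
    then consider "sum21 m P" | "sum21 m (tf Right Down ` P)" using n by blast
    then show ?thesis
    proof cases
      case 1
      then show ?thesis using m P(1) by blast
    next
      case 2
      have "simple_set (tf Right Down ` P)" using sim_symmetry[OF f, of P] sim_simple_set P(1) by blast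
      then have "has_struct N (tf Right Down ` P)" using m 2 by blast
      then show ?thesis by (rule has_struct_symmetry[OF f])
    qed
  qed
  then show ?thesis by blast
qed

lemma plot_gridding:
  assumes "simple \<pi>" "\<not> scattered (Suc m) (plot \<pi>)"
  shows "\<exists>H V. gridding H V (plot \<pi>) \<and> card H \<le> 2 * m * Suc m \<and> card V \<le> 2 * Suc m"
proof (rule gridding_of_not_scattered)
  show gp: "gp (plot \<pi>)" using simple_imp_simple_set[OF assms(1)] by (simp add: simple_set_def)
  show "finite (plot \<pi>)" using gp by (simp add: gp_def)
  show "sg d z \<in> \<int>" if "z \<in> plot \<pi>" for z d using that by (cases d) (auto simp: plot_def)
  show "0 \<le> fst z" if "z \<in> plot \<pi>" for z using that by (auto simp: plot_def)
  show "\<not> scattered (Suc m) (plot \<pi>)" by (rule assms(2))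
qed

lemma bad_structure_iff:
  "(\<exists>A. bad_structure N A \<and> is_up_to_symmetry \<pi> A) \<longleftrightarrow>
      (\<exists>n\<ge>N. is_up_to_symmetry \<pi> (parallel_sawtooth n)) \<or>
       (\<exists>n\<ge>N. is_up_to_symmetry \<pi> (sliced_wedge1 n) \<or>
              is_up_to_symmetry \<pi> (sliced_wedge2 n) \<or>
              is_up_to_symmetry \<pi> (sliced_wedge3 n)) \<or>
       (\<exists>k\<ge>N. \<exists>A. pin_sequence_with_turns k A \<and> is_up_to_symmetry \<pi> A) \<or>
       (\<exists>k\<ge>N. \<exists>A. spiral_with_extensions k A \<and> is_up_to_symmetry \<pi> A)"
  unfolding bad_structure_def by blast

lemma no_bad_structure_griddable:
  assumes C: "permutation_class C" and no: "\<And>\<pi> A. \<pi> \<in> C \<Longrightarrow> bad_structure N A \<Longrightarrow> \<not> is_up_to_symmetry \<pi> A"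
  shows "monotone_griddable {\<pi>\<in>C. simple \<pi>}"
proof -
  obtain m where m: "\<And>P. simple_set P \<Longrightarrow> \<not> has_struct N P \<Longrightarrow> \<not> scattered (Suc m) P" using not_scattered_of_no_struct by blast
  have "\<exists>H V. gridding H V (plot \<pi>) \<and> card H \<le> 2 * m * Suc m \<and> card V \<le> 2 * Suc m" if p: "\<pi> \<in> C" "simple \<pi>" for \<pi>
  proof (rule plot_gridding[OF p(2) m])
    show "simple_set (plot \<pi>)" by (rule simple_imp_simple_set[OF p(2)])
    show "\<not> has_struct N (plot \<pi>)"
    proof
      assume "has_struct N (plot \<pi>)"
      then obtain A S \<kappa> g where A: "bad_structure N A" "S \<subseteq> plot \<pi>" "sim \<kappa> g A S" unfolding has_struct_def by blast
      show False using class_symmetry[OF C p(1) A(3,2)] no A(1) by blast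
    qed
  qed
  then show ?thesis unfolding monotone_griddable_def by blast
qed

text \<open>A structure for \<open>k = h + v + 1\<close> would put into \<open>C\<close> a simple
  permutation with \<open>k\<close> scattered sets, one more than \<open>h\<close> horizontal and
  \<open>v\<close> vertical lines can split.\<close>

lemma griddable_no_bad_structure:
  assumes C: "permutation_class C" and g: "monotone_griddable {\<pi>\<in>C. simple \<pi>}"
  shows "\<exists>N>0. \<forall>\<pi>\<in>C. \<forall>A. bad_structure N A \<longrightarrow> \<not> is_up_to_symmetry \<pi> A"
proof -
  obtain h v where hv: "\<And>\<pi>. \<pi> \<in> C \<Longrightarrow> simple \<pi> \<Longrightarrow> \<exists>H V. gridding H V (plot \<pi>) \<and> card H \<le> h \<and> card V \<le> v"
    using g unfolding monotone_griddable_def by blast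
  define k where "k = h + v + 1"
  have "\<not> is_up_to_symmetry \<pi> A" if p: "\<pi> \<in> C" and A: "bad_structure (1000 * (k + 1)) A" for \<pi> A
  proof
    assume "is_up_to_symmetry \<pi> A"
    then obtain \<kappa> f where f: "sim \<kappa> f A (plot \<pi>)" using is_up_to_symmetry_sim by blast
    have "permutation \<pi>" using C p by (simp add: permutation_class_def)
    then have "gp A" using sim_inv[OF f] sim_gp plot_gp by blast
    then obtain B where B: "B \<subseteq> A" "simple_set B" "scattered k B" using bad_structure_has_simple[OF A] unfolding has_simple_def by blast
    have s: "sim \<kappa> f B (f ` B)" by (rule sim_subset[OF f B(1)])
    obtain \<sigma> where \<sigma>: "\<sigma> \<in> C" "order_isomorphic (plot \<sigma>) (f ` B)"
      using class_subset[OF C p sim_image_subset[OF f B(1)]] by blast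
    obtain g where "sim (\<lambda>d. d) g (plot \<sigma>) (f ` B)" using \<sigma>(2) order_isomorphic_sg by blast
    then obtain \<mu> g' where g': "sim \<mu> g' (f ` B) (plot \<sigma>)" using sim_inv by blast
    have S: "simple_set (plot \<sigma>)" "scattered k (plot \<sigma>)"
      using sim_simple_set[OF g' sim_simple_set[OF s B(2)]] sim_scattered[OF g' sim_scattered[OF s B(3)]] by blast+
    have "permutation \<sigma>" using C \<sigma>(1) by (simp add: permutation_class_def)
    then have "simple \<sigma>" using simple_set_imp_simple S(1) by blast
    then obtain H V where "gridding H V (plot \<sigma>)" "card H \<le> h" "card V \<le> v" using hv[OF \<sigma>(1)] by blast
    then show False using gridding_scattered[OF _ S(2)] by (fastforce simp: k_def)
  qed
  moreover have "0 < 1000 * (k + 1)" by simp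
  ultimately show ?thesis by blast
qed

theorem theorem1p1:
  fixes C :: "nat list set"
  assumes "permutation_class C"
  shows "monotone_griddable {\<pi>\<in>C. simple \<pi>} \<longleftrightarrow>
    (\<exists>N::nat. 0 < N \<and> (\<forall>\<pi>\<in>C. \<not>
      ((\<exists>n\<ge>N. is_up_to_symmetry \<pi> (parallel_sawtooth n)) \<or>
       (\<exists>n\<ge>N. is_up_to_symmetry \<pi> (sliced_wedge1 n) \<or>
              is_up_to_symmetry \<pi> (sliced_wedge2 n) \<or>
              is_up_to_symmetry \<pi> (sliced_wedge3 n)) \<or>
       (\<exists>k\<ge>N. \<exists>A. pin_sequence_with_turns k A \<and> is_up_to_symmetry \<pi> A) \<or>
       (\<exists>k\<ge>N. \<exists>A. spiral_with_extensions k A \<and> is_up_to_symmetry \<pi> A))))"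
  unfolding bad_structure_iff[symmetric]
  using griddable_no_bad_structure[OF assms] no_bad_structure_griddable[OF assms] by blast

end
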